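(* Let $\mathcal V$ be a braided closed monoidal category and let $\mathcal C$ be a tensored closed $\mathcal V$-monoidal category. The following are equivalent: (1) Every $\mathcal V$-representable functor $\mathcal R^a=\mathcal C(a\to-):\mathcal C\to\widehat{\mathcal V}$ is tensored. (2) The $\mathcal V$-functor $\mathcal I:\mathcal C\to\overline{\mathcal C}$ is tensored. (3) The $\mathcal V$-monoidal functor $\mathcal I:\mathcal C\to\overline{\mathcal C}$ witnesses a $\mathcal V$-monoidal equivalence.
   Context: Conventions: composition is written left to right; tensor products in $\mathcal V$ are juxtaposition; associators and unitors are suppressed; "mate" means the morphism corresponding under the indicated adjunction; $\beta_{u,v}:uv\to vu$ is the braiding. A $\mathcal V$-category $\mathcal C$ has hom objects $\mathcal C(a\to b)\in\mathcal V$, identities $j_a:1_{\mathcal V}\to\mathcal C(a\to a)$ and composition $-\circ_{\mathcal C}-:\mathcal C(a\to b)\mathcal C(b\to c)\to\mathcal C(a\to c)$, associative and unital. A $\mathcal V$-functor $F$ has morphisms $F_{a\to b}:\mathcal C(a\to b)\to\mathcal D(F(a)\to F(b))$ compatible with composition and identities. The underlying category $\mathcal C^{\mathcal V}$ has $\mathcal C^{\mathcal V}(a\to b)=\mathcal V(1_{\mathcal V}\to\mathcal C(a\to b))$. $\mathcal V$ closed: internal homs $\widehat{\mathcal V}(u\to v)$ satisfy $\mathcal V(uw\to v)\cong\mathcal V(w\to\widehat{\mathcal V}(u\to v))$, with $\varepsilon^{\widehat{\mathcal V}}_{u\to v}:u\widehat{\mathcal V}(u\to v)\to v$ the mate of the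 identity. $\widehat{\mathcal V}$ is the self-enriched $\mathcal V$-category; its underlying category is identified with $\mathcal V$. $\mathcal R^a:\mathcal C\to\widehat{\mathcal V}$ is $b\mapsto\mathcal C(a\to b)$, with action $\mathcal C(b\to c)\to\widehat{\mathcal V}(\mathcal C(a\to b)\to\mathcal C(a\to c))$ the mate of $-\circ_{\mathcal C}-$. $\mathcal C$ is tensored if every $\mathcal R^a$ has a left $\mathcal V$-adjoint $\mathcal L^a$, i.e. a $\mathcal V$-functor with isomorphisms $\mathcal C(\mathcal L^a(v)\to b)\cong\widehat{\mathcal V}(v\to\mathcal C(a\to b))$ in $\mathcal V$ that are $\mathcal V$-natural in both variables. Write $a\vartriangleleft v=\mathcal L^a(v)$; then $\mathcal C^{\mathcal V}(a\vartriangleleft v\to b)\cong\mathcal V(v\to\mathcal C(a\to b))$, with unit $\eta^{\mathcal C}_{a,v}:v\to\mathcal C(a\to a\vartriangleleft v)$. For $\widehat{\mathcal V}$ itself, $u\vartriangleleft v=uv$. A $\mathcal V$-functor $F:\mathcal C\to\mathcal D$ of tensored $\mathcal V$-categories is tensored if for all $c,v$ the morphism $\mu^F_{c,v}\in\mathcal D^{\mathcal V}(F(c)\vartriangleleft v\to F(c\vartriangleleft v))$, the mate of $\eta^{\mathcal C}_{c,v}\circ F_{c\to c\vartriangleleft v}\in\mathcal V(v\to\mathcal D(F(c)\to F(c\vartriangleleft v)))$, is an isomorphism. A (strict) $\mathcal V$-monoidal category is a $\mathcal V$-category $\mathcal C$ with a unit object $1_{\mathcal C}$, a strictly associative and unital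 product $ab$ of objects, and morphisms $-\otimes_{\mathcal C}-:\mathcal C(a\to b)\mathcal C(c\to d)\to\mathcal C(ac\to bd)$ that are associative, unital ($j_{1_{\mathcal C}}$ is a two-sided unit and $(j_aj_b)\circ(-\otimes_{\mathcal C}-)=j_{ab}$), and satisfy braided interchange: on $\mathcal C(a\to b)\mathcal C(d\to e)\mathcal C(b\to c)\mathcal C(e\to f)$, $((-\otimes_{\mathcal C}-)(-\otimes_{\mathcal C}-))\circ(-\circ_{\mathcal C}-)=(\mathrm{id}\,\beta_{\mathcal C(d\to e),\mathcal C(b\to c)}\,\mathrm{id})\circ((-\circ_{\mathcal C}-)(-\circ_{\mathcal C}-))\circ(-\otimes_{\mathcal C}-)$. It is closed if each $\mathcal V$-functor $a\otimes-:b\mapsto ab$, $(a\otimes-)_{b\to c}=(j_a\mathrm{id})\circ(-\otimes_{\mathcal C}-)$, has a right $\mathcal V$-adjoint. A $\mathcal V$-monoidal functor $(F,\nu):\mathcal C\to\mathcal D$ is a $\mathcal V$-functor with $F(1_{\mathcal C})=1_{\mathcal D}$ and isomorphisms $\nu_{a,b}\in\mathcal D^{\mathcal V}(F(ab)\to F(a)F(b))$ which are unital ($\nu_{a,1}=\mathrm{id}=\nu_{1,a}$), associative, and natural: as morphisms $\mathcal C(a\to c)\mathcal C(b\to d)\to\mathcal D(F(ab)\to F(c)F(d))$, $(-\otimes_{\mathcal C}-)\circ F_{ab\to cd}$ post-composed with $\nu_{c,d}$ equals $(F_{a\to c}F_{b\to d})\circ(-\otimes_{\mathcal D}-)$ pre-composed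 with $\nu_{a,b}$. A $\mathcal V$-natural transformation $\sigma$ is monoidal if $\sigma_{1}=j_1$ and $\sigma_{ab}\circ\nu^G_{a,b}=\nu^F_{a,b}\circ(\sigma_a\sigma_b)$. A $\mathcal V$-monoidal equivalence is a $\mathcal V$-monoidal functor with a $\mathcal V$-monoidal inverse up to monoidal $\mathcal V$-natural isomorphism. Completion: $\overline{\mathcal C}$ has objects formal symbols $a\blacktriangleleft u$ ($a\in\mathcal C$, $u\in\mathcal V$), hom objects $\overline{\mathcal C}(a\blacktriangleleft u\to b\blacktriangleleft v)=\widehat{\mathcal V}(u\to\mathcal C(a\to b)v)$, identity $j_{a\blacktriangleleft u}$ the mate of $j_a\mathrm{id}_u$, composition the mate of $(\varepsilon^{\widehat{\mathcal V}}_{u\to\mathcal C(a\to b)v}\mathrm{id})\circ(\mathrm{id}_{\mathcal C(a\to b)}\varepsilon^{\widehat{\mathcal V}}_{v\to\mathcal C(b\to c)w})\circ((-\circ_{\mathcal C}-)\mathrm{id}_w)$; it is tensored with $(a\blacktriangleleft u)\vartriangleleft v=a\blacktriangleleft uv$. Its $\mathcal V$-monoidal structure: $1_{\overline{\mathcal C}}=1_{\mathcal C}\blacktriangleleft1_{\mathcal V}$, $(a\blacktriangleleft u)(b\blacktriangleleft v)=ab\blacktriangleleft uv$, and $-\otimes_{\overline{\mathcal C}}-:\widehat{\mathcal V}(u\to\mathcal C(a\to b)v)\widehat{\mathcal V}(w\to\mathcal C(c\to d)x)\to\widehat{\mathcal V}(uw\to\mathcal C(ac\to bd)vx)$ is the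 mate of $(\mathrm{id}_u\beta_{w,\widehat{\mathcal V}(u\to\mathcal C(a\to b)v)}\mathrm{id})\circ(\varepsilon^{\widehat{\mathcal V}}\varepsilon^{\widehat{\mathcal V}})\circ(\mathrm{id}_{\mathcal C(a\to b)}\,(\beta_{\mathcal C(c\to d),v})^{-1}\,\mathrm{id}_x)\circ((-\otimes_{\mathcal C}-)\mathrm{id}_{vx})$. The $\mathcal V$-monoidal functor $\mathcal I:\mathcal C\to\overline{\mathcal C}$ is $a\mapsto a\blacktriangleleft1_{\mathcal V}$ with $\mathcal I_{a\to b}$ the mate of $\mathrm{id}_{\mathcal C(a\to b)}$ and $\nu^{\mathcal I}_{a,b}=j_{ab\blacktriangleleft1_{\mathcal V}}$. *)

theory Defs
  imports Main
begin

text \<open>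
  Composition is written in diagrammatic order throughout.  The base category \<open>V\<close> is not assumed
  strict, so the associators and unitors that are usually suppressed appear explicitly.
\<close>

section \<open>Braided closed monoidal categories\<close>

text \<open>
  For \<open>f : u \<otimes> w \<rightarrow> v\<close>, the arrow \<open>mate V u w f : w \<rightarrow> ihom V u v\<close> corresponds to \<open>f\<close> under
  \<open>V(u \<otimes> w \<rightarrow> v) \<cong> V(w \<rightarrow> ihom V u v)\<close>.
\<close>

record ('o, 'm) bcm =
  obj :: "'o set"
  arr :: "'m set"
  src :: "'m \<Rightarrow> 'o"
  trg :: "'m \<Rightarrow> 'o"
  idm :: "'o \<Rightarrow> 'm" ("\<i>\<index>")
  cmp :: "'m \<Rightarrow> 'm \<Rightarrow> 'm" (infixl "\<Zsemi>\<index>" 55)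
  unit_obj :: "'o" ("\<one>\<index>")
  ten_obj :: "'o \<Rightarrow> 'o \<Rightarrow> 'o" (infixr "\<otimes>\<index>" 70)
  ten_arr :: "'m \<Rightarrow> 'm \<Rightarrow> 'm" (infixr "\<odot>\<index>" 70)
  assoc :: "'o \<Rightarrow> 'o \<Rightarrow> 'o \<Rightarrow> 'm" ("\<alpha>\<index>")
  lunit :: "'o \<Rightarrow> 'm" ("\<l>\<index>")
  runit :: "'o \<Rightarrow> 'm" ("\<r>\<index>")
  braid :: "'o \<Rightarrow> 'o \<Rightarrow> 'm" ("\<beta>\<index>")
  ihom :: "'o \<Rightarrow> 'o \<Rightarrow> 'o"
  mate :: "'o \<Rightarrow> 'o \<Rightarrow> 'm \<Rightarrow> 'm"

context
  fixes V :: "('o, 'm, 'z) bcm_scheme" (structure)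
begin

definition hom :: "'o \<Rightarrow> 'o \<Rightarrow> 'm set" where
  "hom u v = {f \<in> arr V. src V f = u \<and> trg V f = v}"

definition is_inverse :: "'m \<Rightarrow> 'm \<Rightarrow> bool" where
  "is_inverse f g \<longleftrightarrow> f \<in> arr V \<and> g \<in> hom (trg V f) (src V f)
     \<and> f \<Zsemi> g = \<i> (src V f) \<and> g \<Zsemi> f = \<i> (trg V f)"

definition isos :: "'o \<Rightarrow> 'o \<Rightarrow> 'm set" where
  "isos u v = {f \<in> hom u v. \<exists>g. is_inverse f g}"

definition inverse_arr :: "'m \<Rightarrow> 'm" where
  "inverse_arr f = (THE g. is_inverse f g)"

end

notation inverse_arr ("\<inverse>\<index> _" [90] 90)

locale category =
  fixes V :: "('o, 'm, 'z) bcm_scheme" (structure)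
  assumes src_obj: "f \<in> arr V \<Longrightarrow> src V f \<in> obj V"
    and trg_obj: "f \<in> arr V \<Longrightarrow> trg V f \<in> obj V"
    and id_hom: "u \<in> obj V \<Longrightarrow> \<i> u \<in> hom V u u"
    and cmp_hom: "\<lbrakk>f \<in> hom V u v; g \<in> hom V v w\<rbrakk> \<Longrightarrow> f \<Zsemi> g \<in> hom V u w"
    and id_left: "f \<in> hom V u v \<Longrightarrow> \<i> u \<Zsemi> f = f"
    and id_right: "f \<in> hom V u v \<Longrightarrow> f \<Zsemi> \<i> v = f"
    and cmp_assoc: "\<lbrakk>f \<in> hom V u v; g \<in> hom V v w; h \<in> hom V w x\<rbrakk>
          \<Longrightarrow> (f \<Zsemi> g) \<Zsemi> h = f \<Zsemi> (g \<Zsemi> h)"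

locale monoidal_category = category V
  for V :: "('o, 'm, 'z) bcm_scheme" (structure) +
  assumes unit_obj: "\<one> \<in> obj V"
    and ten_obj: "\<lbrakk>u \<in> obj V; v \<in> obj V\<rbrakk> \<Longrightarrow> u \<otimes> v \<in> obj V"
    and ten_hom: "\<lbrakk>f \<in> hom V u u'; g \<in> hom V v v'\<rbrakk> \<Longrightarrow> f \<odot> g \<in> hom V (u \<otimes> v) (u' \<otimes> v')"
    and ten_id: "\<lbrakk>u \<in> obj V; v \<in> obj V\<rbrakk> \<Longrightarrow> \<i> u \<odot> \<i> v = \<i> (u \<otimes> v)"
    and ten_cmp: "\<lbrakk>f \<in> hom V u u'; f' \<in> hom V u' u''; g \<in> hom V v v'; g' \<in> hom V v' v''\<rbrakk>
          \<Longrightarrow> (f \<Zsemi> f') \<odot> (g \<Zsemi> g') = (f \<odot> g) \<Zsemi> (f' \<odot> g')"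
    and assoc_iso: "\<lbrakk>u \<in> obj V; v \<in> obj V; w \<in> obj V\<rbrakk>
          \<Longrightarrow> \<alpha> u v w \<in> isos V ((u \<otimes> v) \<otimes> w) (u \<otimes> (v \<otimes> w))"
    and assoc_nat: "\<lbrakk>f \<in> hom V u u'; g \<in> hom V v v'; h \<in> hom V w w'\<rbrakk>
          \<Longrightarrow> ((f \<odot> g) \<odot> h) \<Zsemi> \<alpha> u' v' w' = \<alpha> u v w \<Zsemi> (f \<odot> (g \<odot> h))"
    and lunit_iso: "u \<in> obj V \<Longrightarrow> \<l> u \<in> isos V (\<one> \<otimes> u) u"
    and lunit_nat: "f \<in> hom V u v \<Longrightarrow> (\<i> \<one> \<odot> f) \<Zsemi> \<l> v = \<l> u \<Zsemi> f"
    and runit_iso: "u \<in> obj V \<Longrightarrow> \<r> u \<in> isos V (u \<otimes> \<one>) u"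
    and runit_nat: "f \<in> hom V u v \<Longrightarrow> (f \<odot> \<i> \<one>) \<Zsemi> \<r> v = \<r> u \<Zsemi> f"
    and pentagon: "\<lbrakk>u \<in> obj V; v \<in> obj V; w \<in> obj V; x \<in> obj V\<rbrakk>
          \<Longrightarrow> \<alpha> (u \<otimes> v) w x \<Zsemi> \<alpha> u v (w \<otimes> x)
            = (\<alpha> u v w \<odot> \<i> x) \<Zsemi> \<alpha> u (v \<otimes> w) x \<Zsemi> (\<i> u \<odot> \<alpha> v w x)"
    and triangle: "\<lbrakk>u \<in> obj V; v \<in> obj V\<rbrakk> \<Longrightarrow> \<alpha> u \<one> v \<Zsemi> (\<i> u \<odot> \<l> v) = \<r> u \<odot> \<i> v"

locale braided_monoidal_category = monoidal_category V
  for V :: "('o, 'm, 'z) bcm_scheme" (structure) +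
  assumes braid_iso: "\<lbrakk>u \<in> obj V; v \<in> obj V\<rbrakk> \<Longrightarrow> \<beta> u v \<in> isos V (u \<otimes> v) (v \<otimes> u)"
    and braid_nat: "\<lbrakk>f \<in> hom V u u'; g \<in> hom V v v'\<rbrakk>
          \<Longrightarrow> (f \<odot> g) \<Zsemi> \<beta> u' v' = \<beta> u v \<Zsemi> (g \<odot> f)"
    and hexagon1: "\<lbrakk>u \<in> obj V; v \<in> obj V; w \<in> obj V\<rbrakk>
          \<Longrightarrow> \<alpha> u v w \<Zsemi> \<beta> u (v \<otimes> w) \<Zsemi> \<alpha> v w u
            = (\<beta> u v \<odot> \<i> w) \<Zsemi> \<alpha> v u w \<Zsemi> (\<i> v \<odot> \<beta> u w)"
    and hexagon2: "\<lbrakk>u \<in> obj V; v \<in> obj V; w \<in> obj V\<rbrakk>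
          \<Longrightarrow> \<inverse> (\<alpha> u v w) \<Zsemi> \<beta> (u \<otimes> v) w \<Zsemi> \<inverse> (\<alpha> w u v)
            = (\<i> u \<odot> \<beta> v w) \<Zsemi> \<inverse> (\<alpha> u w v) \<Zsemi> (\<beta> u w \<odot> \<i> v)"

locale braided_closed_monoidal_category = braided_monoidal_category V
  for V :: "('o, 'm, 'z) bcm_scheme" (structure) +
  assumes ihom_obj: "\<lbrakk>u \<in> obj V; v \<in> obj V\<rbrakk> \<Longrightarrow> ihom V u v \<in> obj V"
    and mate_bij: "\<lbrakk>u \<in> obj V; v \<in> obj V; w \<in> obj V\<rbrakk>
          \<Longrightarrow> bij_betw (mate V u w) (hom V (u \<otimes> w) v) (hom V w (ihom V u v))"
    and mate_nat: "\<lbrakk>u \<in> obj V; f \<in> hom V (u \<otimes> w) v; h \<in> hom V w' w\<rbrakk>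
          \<Longrightarrow> mate V u w' ((\<i> u \<odot> h) \<Zsemi> f) = h \<Zsemi> mate V u w f"

context
  fixes V :: "('o, 'm, 'z) bcm_scheme" (structure)
begin

definition unmate :: "'o \<Rightarrow> 'o \<Rightarrow> 'o \<Rightarrow> 'm \<Rightarrow> 'm" where
  "unmate u w v = the_inv_into (hom V (u \<otimes> w) v) (mate V u w)"

definition ev :: "'o \<Rightarrow> 'o \<Rightarrow> 'm" where
  "ev u v = unmate u (ihom V u v) v (\<i> (ihom V u v))"

text \<open>The identification \<open>V(v \<rightarrow> w) \<cong> V(1 \<rightarrow> ihom V v w)\<close> and its inverse.\<close>

definition name :: "'o \<Rightarrow> 'm \<Rightarrow> 'm" where
  "name v f = mate V v \<one> (\<r> v \<Zsemi> f)"

definition unname :: "'o \<Rightarrow> 'o \<Rightarrow> 'm \<Rightarrow> 'm" where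
  "unname v w g = \<inverse> (\<r> v) \<Zsemi> unmate v \<one> w g"

text \<open>
  For \<open>p : x \<otimes> y \<rightarrow> y \<otimes> x\<close>, the arrow \<open>exch p w x y z : (w \<otimes> x) \<otimes> (y \<otimes> z) \<rightarrow> (w \<otimes> y) \<otimes> (x \<otimes> z)\<close>
  is \<open>id p id\<close> up to associators.
\<close>

definition exch :: "'m \<Rightarrow> 'o \<Rightarrow> 'o \<Rightarrow> 'o \<Rightarrow> 'o \<Rightarrow> 'm" where
  "exch p w x y z =
     \<alpha> w x (y \<otimes> z) \<Zsemi>
     (\<i> w \<odot> (\<inverse> (\<alpha> x y z) \<Zsemi> (p \<odot> \<i> z) \<Zsemi> \<alpha> y x z)) \<Zsemi>
     \<inverse> (\<alpha> w y (x \<otimes> z))"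

end

notation ev ("\<epsilon>\<index>")

section \<open>Enriched categories, functors and adjunctions\<close>

record ('a, 'o, 'm) vcat =
  vobj :: "'a set"
  vhom :: "'a \<Rightarrow> 'a \<Rightarrow> 'o"
  vid :: "'a \<Rightarrow> 'm"
  vcmp :: "'a \<Rightarrow> 'a \<Rightarrow> 'a \<Rightarrow> 'm"

record ('a, 'b, 'm) vfun =
  fobj :: "'a \<Rightarrow> 'b"
  fmap :: "'a \<Rightarrow> 'a \<Rightarrow> 'm"

locale V_category =
  fixes V :: "('o, 'm, 'z) bcm_scheme" (structure)
    and C :: "('a, 'o, 'm, 'y) vcat_scheme"
  assumes vhom_obj: "\<lbrakk>a \<in> vobj C; b \<in> vobj C\<rbrakk> \<Longrightarrow> vhom C a b \<in> obj V"
    and vid_hom: "a \<in> vobj C \<Longrightarrow> vid C a \<in> hom V \<one> (vhom C a a)"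
    and vcmp_hom: "\<lbrakk>a \<in> vobj C; b \<in> vobj C; c \<in> vobj C\<rbrakk>
          \<Longrightarrow> vcmp C a b c \<in> hom V (vhom C a b \<otimes> vhom C b c) (vhom C a c)"
    and vid_left: "\<lbrakk>a \<in> vobj C; b \<in> vobj C\<rbrakk>
          \<Longrightarrow> (vid C a \<odot> \<i> (vhom C a b)) \<Zsemi> vcmp C a a b = \<l> (vhom C a b)"
    and vid_right: "\<lbrakk>a \<in> vobj C; b \<in> vobj C\<rbrakk>
          \<Longrightarrow> (\<i> (vhom C a b) \<odot> vid C b) \<Zsemi> vcmp C a b b = \<r> (vhom C a b)"
    and vcmp_assoc: "\<lbrakk>a \<in> vobj C; b \<in> vobj C; c \<in> vobj C; d \<in> vobj C\<rbrakk>
          \<Longrightarrow> (vcmp C a b c \<odot> \<i> (vhom C c d)) \<Zsemi> vcmp C a c d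
            = \<alpha> (vhom C a b) (vhom C b c) (vhom C c d) \<Zsemi>
              (\<i> (vhom C a b) \<odot> vcmp C b c d) \<Zsemi> vcmp C a b d"

context
  fixes V :: "('o, 'm, 'z) bcm_scheme" (structure)
begin

text \<open>The underlying category of \<open>C\<close>: an arrow from \<open>a\<close> to \<open>b\<close> is an element of \<open>uhom C a b\<close>.\<close>

definition uhom :: "('a, 'o, 'm, 'y) vcat_scheme \<Rightarrow> 'a \<Rightarrow> 'a \<Rightarrow> 'm set" where
  "uhom C a b = hom V \<one> (vhom C a b)"

definition ucmp :: "('a, 'o, 'm, 'y) vcat_scheme \<Rightarrow> 'a \<Rightarrow> 'a \<Rightarrow> 'a \<Rightarrow> 'm \<Rightarrow> 'm \<Rightarrow> 'm" where
  "ucmp C a b c f g = \<inverse> (\<l> \<one>) \<Zsemi> (f \<odot> g) \<Zsemi> vcmp C a b c"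

definition uisos :: "('a, 'o, 'm, 'y) vcat_scheme \<Rightarrow> 'a \<Rightarrow> 'a \<Rightarrow> 'm set" where
  "uisos C a b = {f \<in> uhom C a b.
     \<exists>g \<in> uhom C b a. ucmp C a b a f g = vid C a \<and> ucmp C b a b g f = vid C b}"

text \<open>
  Post-composition \<open>vhom C a b \<rightarrow> vhom C a c\<close> with \<open>g \<in> uhom C b c\<close> and pre-composition
  \<open>vhom C b c \<rightarrow> vhom C a c\<close> with \<open>f \<in> uhom C a b\<close>.
\<close>

definition postcmp :: "('a, 'o, 'm, 'y) vcat_scheme \<Rightarrow> 'a \<Rightarrow> 'a \<Rightarrow> 'a \<Rightarrow> 'm \<Rightarrow> 'm" where
  "postcmp C a b c g =
     \<inverse> (\<r> (vhom C a b)) \<Zsemi> (\<i> (vhom C a b) \<odot> g) \<Zsemi> vcmp C a b c"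

definition precmp :: "('a, 'o, 'm, 'y) vcat_scheme \<Rightarrow> 'a \<Rightarrow> 'a \<Rightarrow> 'a \<Rightarrow> 'm \<Rightarrow> 'm" where
  "precmp C a b c f =
     \<inverse> (\<l> (vhom C b c)) \<Zsemi> (f \<odot> \<i> (vhom C b c)) \<Zsemi> vcmp C a b c"

definition V_functor ::
  "('a, 'o, 'm, 'y) vcat_scheme \<Rightarrow> ('b, 'o, 'm, 'x) vcat_scheme \<Rightarrow> ('a, 'b, 'm, 'w) vfun_scheme \<Rightarrow> bool"
where
  "V_functor C D F \<longleftrightarrow>
     (\<forall>a \<in> vobj C. fobj F a \<in> vobj D) \<and>
     (\<forall>a \<in> vobj C. \<forall>b \<in> vobj C.
        fmap F a b \<in> hom V (vhom C a b) (vhom D (fobj F a) (fobj F b))) \<and>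
     (\<forall>a \<in> vobj C. vid C a \<Zsemi> fmap F a a = vid D (fobj F a)) \<and>
     (\<forall>a \<in> vobj C. \<forall>b \<in> vobj C. \<forall>c \<in> vobj C.
        vcmp C a b c \<Zsemi> fmap F a c
        = (fmap F a b \<odot> fmap F b c) \<Zsemi> vcmp D (fobj F a) (fobj F b) (fobj F c))"

definition V_natural_iso ::
  "('a, 'o, 'm, 'y) vcat_scheme \<Rightarrow> ('b, 'o, 'm, 'x) vcat_scheme \<Rightarrow>
   ('a, 'b, 'm, 'w) vfun_scheme \<Rightarrow> ('a, 'b, 'm, 'v) vfun_scheme \<Rightarrow> ('a \<Rightarrow> 'm) \<Rightarrow> bool"
where
  "V_natural_iso C D F G \<sigma> \<longleftrightarrow>
     (\<forall>a \<in> vobj C. \<sigma> a \<in> uisos D (fobj F a) (fobj G a)) \<and>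
     (\<forall>a \<in> vobj C. \<forall>b \<in> vobj C.
        fmap F a b \<Zsemi> postcmp D (fobj F a) (fobj F b) (fobj G b) (\<sigma> b)
        = fmap G a b \<Zsemi> precmp D (fobj F a) (fobj G a) (fobj G b) (\<sigma> a))"

text \<open>
  \<open>F : C \<rightarrow> D\<close> is left \<open>V\<close>-adjoint to \<open>G : D \<rightarrow> C\<close> via isomorphisms
  \<open>\<phi> c d : D(F c \<rightarrow> d) \<rightarrow> C(c \<rightarrow> G d)\<close> in \<open>V\<close>.  The last two clauses are \<open>V\<close>-naturality in \<open>d\<close>
  and in \<open>c\<close>, with the actions of the hom objects of \<open>D\<close> and \<open>C\<close> in uncurried form.
\<close>

definition V_adjunction ::
  "('a, 'o, 'm, 'y) vcat_scheme \<Rightarrow> ('b, 'o, 'm, 'x) vcat_scheme \<Rightarrow>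
   ('a, 'b, 'm, 'w) vfun_scheme \<Rightarrow> ('b, 'a, 'm, 'v) vfun_scheme \<Rightarrow> ('a \<Rightarrow> 'b \<Rightarrow> 'm) \<Rightarrow> bool"
where
  "V_adjunction C D F G \<phi> \<longleftrightarrow>
     V_functor C D F \<and> V_functor D C G \<and>
     (\<forall>c \<in> vobj C. \<forall>d \<in> vobj D.
        \<phi> c d \<in> isos V (vhom D (fobj F c) d) (vhom C c (fobj G d))) \<and>
     (\<forall>c \<in> vobj C. \<forall>d \<in> vobj D. \<forall>d' \<in> vobj D.
        vcmp D (fobj F c) d d' \<Zsemi> \<phi> c d'
        = (\<phi> c d \<odot> fmap G d d') \<Zsemi> vcmp C c (fobj G d) (fobj G d')) \<and>
     (\<forall>c' \<in> vobj C. \<forall>c \<in> vobj C. \<forall>d \<in> vobj D.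
        (fmap F c' c \<odot> \<i> (vhom D (fobj F c) d)) \<Zsemi> vcmp D (fobj F c') (fobj F c) d \<Zsemi> \<phi> c' d
        = (\<i> (vhom C c' c) \<odot> \<phi> c d) \<Zsemi> vcmp C c' c (fobj G d))"

section \<open>The self-enrichment and tensored categories\<close>

definition self :: "('o, 'o, 'm) vcat" where
  "self = \<lparr>
     vobj = obj V,
     vhom = ihom V,
     vid = (\<lambda>u. name V u (\<i> u)),
     vcmp = (\<lambda>u v w. mate V u (ihom V u v \<otimes> ihom V v w)
       (\<inverse> (\<alpha> u (ihom V u v) (ihom V v w)) \<Zsemi>
        (\<epsilon> u v \<odot> \<i> (ihom V v w)) \<Zsemi> \<epsilon> v w)) \<rparr>"

definition representable :: "('a, 'o, 'm, 'y) vcat_scheme \<Rightarrow> 'a \<Rightarrow> ('a, 'o, 'm) vfun" where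
  "representable C a = \<lparr>
     fobj = (\<lambda>b. vhom C a b),
     fmap = (\<lambda>b c. mate V (vhom C a b) (vhom C b c) (vcmp C a b c)) \<rparr>"

end

text \<open>
  A choice, for each \<open>a\<close>, of a left \<open>V\<close>-adjoint \<open>tfun T a\<close> of the representable functor of \<open>a\<close>, with
  the isomorphisms \<open>tiso T a v b : C(tfun T a v \<rightarrow> b) \<rightarrow> ihom V v (C(a \<rightarrow> b))\<close>.
\<close>

record ('a, 'o, 'm) tensoring =
  tfun :: "'a \<Rightarrow> ('o, 'a, 'm) vfun"
  tiso :: "'a \<Rightarrow> 'o \<Rightarrow> 'a \<Rightarrow> 'm"

context
  fixes V :: "('o, 'm, 'z) bcm_scheme" (structure)
begin

definition is_tensoring :: "('a, 'o, 'm, 'y) vcat_scheme \<Rightarrow> ('a, 'o, 'm) tensoring \<Rightarrow> bool" where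
  "is_tensoring C T \<longleftrightarrow>
     (\<forall>a \<in> vobj C. V_adjunction V (self V) C (tfun T a) (representable V C a) (tiso T a))"

definition tobj :: "('a, 'o, 'm) tensoring \<Rightarrow> 'a \<Rightarrow> 'o \<Rightarrow> 'a" where
  "tobj T a v = fobj (tfun T a) v"

text \<open>
  The unit \<open>\<eta> : v \<rightarrow> C(a \<rightarrow> tobj T a v)\<close>, and the mate in \<open>uhom V C (tobj T a v) b\<close> of an arrow
  \<open>f : v \<rightarrow> C(a \<rightarrow> b)\<close>.
\<close>

definition tunit ::
  "('a, 'o, 'm, 'y) vcat_scheme \<Rightarrow> ('a, 'o, 'm) tensoring \<Rightarrow> 'a \<Rightarrow> 'o \<Rightarrow> 'm"
where
  "tunit C T a v =
     unname V v (vhom C a (tobj T a v)) (vid C (tobj T a v) \<Zsemi> tiso T a v (tobj T a v))"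

definition tmate :: "('a, 'o, 'm) tensoring \<Rightarrow> 'a \<Rightarrow> 'o \<Rightarrow> 'a \<Rightarrow> 'm \<Rightarrow> 'm" where
  "tmate T a v b f = name V v f \<Zsemi> \<inverse> (tiso T a v b)"

definition tensored_mu ::
  "('a, 'o, 'm, 'y) vcat_scheme \<Rightarrow> ('a, 'o, 'm) tensoring \<Rightarrow> ('b, 'o, 'm) tensoring \<Rightarrow>
   ('a, 'b, 'm, 'w) vfun_scheme \<Rightarrow> 'a \<Rightarrow> 'o \<Rightarrow> 'm"
where
  "tensored_mu C S T F c v =
     tmate T (fobj F c) v (fobj F (tobj S c v)) (tunit C S c v \<Zsemi> fmap F c (tobj S c v))"

definition tensored_functor ::
  "('a, 'o, 'm, 'y) vcat_scheme \<Rightarrow> ('a, 'o, 'm) tensoring \<Rightarrow>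
   ('b, 'o, 'm, 'x) vcat_scheme \<Rightarrow> ('b, 'o, 'm) tensoring \<Rightarrow> ('a, 'b, 'm, 'w) vfun_scheme \<Rightarrow> bool"
where
  "tensored_functor C S D T F \<longleftrightarrow>
     V_functor V C D F \<and>
     (\<forall>c \<in> vobj C. \<forall>v \<in> obj V.
        tensored_mu C S T F c v \<in> uisos V D (tobj T (fobj F c) v) (fobj F (tobj S c v)))"

definition self_tensoring :: "('o, 'o, 'm) tensoring" where
  "self_tensoring = \<lparr>
     tfun = (\<lambda>u. \<lparr>
       fobj = (\<lambda>v. u \<otimes> v),
       fmap = (\<lambda>v w. mate V (u \<otimes> v) (ihom V v w) (\<alpha> u v (ihom V v w) \<Zsemi> (\<i> u \<odot> \<epsilon> v w))) \<rparr>),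
     tiso = (\<lambda>u v w.
       mate V v (ihom V (u \<otimes> v) w)
         (mate V u (v \<otimes> ihom V (u \<otimes> v) w)
           (\<inverse> (\<alpha> u v (ihom V (u \<otimes> v) w)) \<Zsemi> \<epsilon> (u \<otimes> v) w))) \<rparr>"

end

section \<open>Enriched monoidal categories and functors\<close>

text \<open>
  The arrow \<open>mtenm C a b c d : C(a \<rightarrow> b) \<otimes> C(c \<rightarrow> d) \<rightarrow> C(a c \<rightarrow> b d)\<close> is the tensor product of
  morphisms.  The coherence data \<open>massoc\<close>, \<open>mlunit\<close>, \<open>mrunit\<close> are identities in a strict
  \<open>V\<close>-monoidal category; they are carried along because the completion is strict only if \<open>V\<close> is.
\<close>

record ('a, 'o, 'm) vmoncat = "('a, 'o, 'm) vcat" +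
  munit :: "'a"
  mten :: "'a \<Rightarrow> 'a \<Rightarrow> 'a"
  mtenm :: "'a \<Rightarrow> 'a \<Rightarrow> 'a \<Rightarrow> 'a \<Rightarrow> 'm"
  massoc :: "'a \<Rightarrow> 'a \<Rightarrow> 'a \<Rightarrow> 'm"
  mlunit :: "'a \<Rightarrow> 'm"
  mrunit :: "'a \<Rightarrow> 'm"

record ('a, 'b, 'm) vmonfun = "('a, 'b, 'm) vfun" +
  nu :: "'a \<Rightarrow> 'a \<Rightarrow> 'm"

locale strict_V_monoidal_category = V_category V C
  for V :: "('o, 'm, 'z) bcm_scheme" (structure)
    and C :: "('a, 'o, 'm, 'y) vmoncat_scheme" +
  assumes munit_obj: "munit C \<in> vobj C"
    and mten_obj: "\<lbrakk>a \<in> vobj C; b \<in> vobj C\<rbrakk> \<Longrightarrow> mten C a b \<in> vobj C"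
    and mten_assoc: "\<lbrakk>a \<in> vobj C; b \<in> vobj C; c \<in> vobj C\<rbrakk>
          \<Longrightarrow> mten C (mten C a b) c = mten C a (mten C b c)"
    and mten_unit_left: "a \<in> vobj C \<Longrightarrow> mten C (munit C) a = a"
    and mten_unit_right: "a \<in> vobj C \<Longrightarrow> mten C a (munit C) = a"
    and massoc_strict: "\<lbrakk>a \<in> vobj C; b \<in> vobj C; c \<in> vobj C\<rbrakk>
          \<Longrightarrow> massoc C a b c = vid C (mten C a (mten C b c))"
    and mlunit_strict: "a \<in> vobj C \<Longrightarrow> mlunit C a = vid C a"
    and mrunit_strict: "a \<in> vobj C \<Longrightarrow> mrunit C a = vid C a"
    and mtenm_hom: "\<lbrakk>a \<in> vobj C; b \<in> vobj C; c \<in> vobj C; d \<in> vobj C\<rbrakk>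
          \<Longrightarrow> mtenm C a b c d \<in> hom V (vhom C a b \<otimes> vhom C c d) (vhom C (mten C a c) (mten C b d))"
    and mtenm_assoc: "\<lbrakk>a \<in> vobj C; b \<in> vobj C; c \<in> vobj C; d \<in> vobj C; e \<in> vobj C; f \<in> vobj C\<rbrakk>
          \<Longrightarrow> (mtenm C a b c d \<odot> \<i> (vhom C e f)) \<Zsemi> mtenm C (mten C a c) (mten C b d) e f
            = \<alpha> (vhom C a b) (vhom C c d) (vhom C e f) \<Zsemi>
              (\<i> (vhom C a b) \<odot> mtenm C c d e f) \<Zsemi> mtenm C a b (mten C c e) (mten C d f)"
    and mtenm_unit_left: "\<lbrakk>a \<in> vobj C; b \<in> vobj C\<rbrakk>
          \<Longrightarrow> (vid C (munit C) \<odot> \<i> (vhom C a b)) \<Zsemi> mtenm C (munit C) (munit C) a b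
            = \<l> (vhom C a b)"
    and mtenm_unit_right: "\<lbrakk>a \<in> vobj C; b \<in> vobj C\<rbrakk>
          \<Longrightarrow> (\<i> (vhom C a b) \<odot> vid C (munit C)) \<Zsemi> mtenm C a b (munit C) (munit C)
            = \<r> (vhom C a b)"
    and mtenm_vid: "\<lbrakk>a \<in> vobj C; b \<in> vobj C\<rbrakk>
          \<Longrightarrow> \<inverse> (\<l> \<one>) \<Zsemi> (vid C a \<odot> vid C b) \<Zsemi> mtenm C a a b b = vid C (mten C a b)"
    and interchange: "\<lbrakk>a \<in> vobj C; b \<in> vobj C; c \<in> vobj C; d \<in> vobj C; e \<in> vobj C; f \<in> vobj C\<rbrakk>
          \<Longrightarrow> (mtenm C a b d e \<odot> mtenm C b c e f) \<Zsemi> vcmp C (mten C a d) (mten C b e) (mten C c f)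
            = exch V (\<beta> (vhom C d e) (vhom C b c))
                (vhom C a b) (vhom C d e) (vhom C b c) (vhom C e f) \<Zsemi>
              (vcmp C a b c \<odot> vcmp C d e f) \<Zsemi> mtenm C a c d f"

context
  fixes V :: "('o, 'm, 'z) bcm_scheme" (structure)
begin

definition left_tensor :: "('a, 'o, 'm, 'y) vmoncat_scheme \<Rightarrow> 'a \<Rightarrow> ('a, 'a, 'm) vfun" where
  "left_tensor C a = \<lparr>
     fobj = (\<lambda>b. mten C a b),
     fmap = (\<lambda>b c. \<inverse> (\<l> (vhom C b c)) \<Zsemi> (vid C a \<odot> \<i> (vhom C b c)) \<Zsemi> mtenm C a a b c) \<rparr>"

definition closed_V_monoidal :: "('a, 'o, 'm, 'y) vmoncat_scheme \<Rightarrow> bool" where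
  "closed_V_monoidal C \<longleftrightarrow>
     (\<forall>a \<in> vobj C. \<exists>(G :: ('a, 'a, 'm) vfun) \<phi>. V_adjunction V C C (left_tensor C a) G \<phi>)"

definition uten ::
  "('a, 'o, 'm, 'y) vmoncat_scheme \<Rightarrow> 'a \<Rightarrow> 'a \<Rightarrow> 'a \<Rightarrow> 'a \<Rightarrow> 'm \<Rightarrow> 'm \<Rightarrow> 'm"
where
  "uten C a b c d f g = \<inverse> (\<l> \<one>) \<Zsemi> (f \<odot> g) \<Zsemi> mtenm C a b c d"

text \<open>
  In the clauses for naturality, unitality and associativity of \<open>\<nu> a b : F(a b) \<rightarrow> F a F b\<close>, the
  coherence morphisms of \<open>C\<close> and \<open>D\<close> are identities in the strict case, where unitality becomes
  \<open>\<nu> a 1 = id = \<nu> 1 a\<close>.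
\<close>

definition V_monoidal_functor ::
  "('a, 'o, 'm, 'y) vmoncat_scheme \<Rightarrow> ('b, 'o, 'm, 'x) vmoncat_scheme \<Rightarrow>
   ('a, 'b, 'm, 'w) vmonfun_scheme \<Rightarrow> bool"
where
  "V_monoidal_functor C D F \<longleftrightarrow>
     V_functor V C D F \<and>
     fobj F (munit C) = munit D \<and>
     (\<forall>a \<in> vobj C. \<forall>b \<in> vobj C.
        nu F a b \<in> uisos V D (fobj F (mten C a b)) (mten D (fobj F a) (fobj F b))) \<and>
     (\<forall>a \<in> vobj C. \<forall>b \<in> vobj C. \<forall>c \<in> vobj C. \<forall>d \<in> vobj C.
        mtenm C a c b d \<Zsemi> fmap F (mten C a b) (mten C c d) \<Zsemi>
          postcmp V D (fobj F (mten C a b)) (fobj F (mten C c d))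
            (mten D (fobj F c) (fobj F d)) (nu F c d)
        = (fmap F a c \<odot> fmap F b d) \<Zsemi> mtenm D (fobj F a) (fobj F c) (fobj F b) (fobj F d) \<Zsemi>
          precmp V D (fobj F (mten C a b)) (mten D (fobj F a) (fobj F b))
            (mten D (fobj F c) (fobj F d)) (nu F a b)) \<and>
     (\<forall>a \<in> vobj C.
        ucmp V D (fobj F (mten C a (munit C))) (mten D (fobj F a) (munit D)) (fobj F a)
          (nu F a (munit C)) (mrunit D (fobj F a))
        = mrunit C a \<Zsemi> fmap F (mten C a (munit C)) a) \<and>
     (\<forall>a \<in> vobj C.
        ucmp V D (fobj F (mten C (munit C) a)) (mten D (munit D) (fobj F a)) (fobj F a)
          (nu F (munit C) a) (mlunit D (fobj F a))
        = mlunit C a \<Zsemi> fmap F (mten C (munit C) a) a) \<and>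
     (\<forall>a \<in> vobj C. \<forall>b \<in> vobj C. \<forall>c \<in> vobj C.
        (let Fa = fobj F a; Fb = fobj F b; Fc = fobj F c;
             Fab = fobj F (mten C a b); Fbc = fobj F (mten C b c);
             ab_c = mten C (mten C a b) c; a_bc = mten C a (mten C b c)
         in
           ucmp V D (fobj F ab_c) (mten D (mten D Fa Fb) Fc) (mten D Fa (mten D Fb Fc))
             (ucmp V D (fobj F ab_c) (mten D Fab Fc) (mten D (mten D Fa Fb) Fc)
               (nu F (mten C a b) c)
               (uten D Fab (mten D Fa Fb) Fc Fc (nu F a b) (vid D Fc)))
             (massoc D Fa Fb Fc)
           = ucmp V D (fobj F ab_c) (fobj F a_bc) (mten D Fa (mten D Fb Fc))
               (massoc C a b c \<Zsemi> fmap F ab_c a_bc)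
               (ucmp V D (fobj F a_bc) (mten D Fa Fbc) (mten D Fa (mten D Fb Fc))
                 (nu F a (mten C b c))
                 (uten D Fa Fa Fbc (mten D Fb Fc) (vid D Fa) (nu F b c)))))"

definition monoidal_V_natural_iso ::
  "('a, 'o, 'm, 'y) vmoncat_scheme \<Rightarrow> ('b, 'o, 'm, 'x) vmoncat_scheme \<Rightarrow>
   ('a, 'b, 'm, 'w) vmonfun_scheme \<Rightarrow> ('a, 'b, 'm, 'v) vmonfun_scheme \<Rightarrow> ('a \<Rightarrow> 'm) \<Rightarrow> bool"
where
  "monoidal_V_natural_iso C D F G \<sigma> \<longleftrightarrow>
     V_natural_iso V C D F G \<sigma> \<and>
     \<sigma> (munit C) = vid D (munit D) \<and>
     (\<forall>a \<in> vobj C. \<forall>b \<in> vobj C.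
        ucmp V D (fobj F (mten C a b)) (fobj G (mten C a b)) (mten D (fobj G a) (fobj G b))
          (\<sigma> (mten C a b)) (nu G a b)
        = ucmp V D (fobj F (mten C a b)) (mten D (fobj F a) (fobj F b)) (mten D (fobj G a) (fobj G b))
            (nu F a b) (uten D (fobj F a) (fobj G a) (fobj F b) (fobj G b) (\<sigma> a) (\<sigma> b)))"

definition vmonfun_id :: "('a, 'o, 'm, 'y) vmoncat_scheme \<Rightarrow> ('a, 'a, 'm) vmonfun" where
  "vmonfun_id C = \<lparr>
     fobj = (\<lambda>a. a),
     fmap = (\<lambda>a b. \<i> (vhom C a b)),
     nu = (\<lambda>a b. vid C (mten C a b)) \<rparr>"

text \<open>The composite of \<open>F : C \<rightarrow> D\<close> followed by \<open>G : D \<rightarrow> E\<close>.\<close>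

definition vmonfun_cmp ::
  "('a, 'o, 'm, 'y) vmoncat_scheme \<Rightarrow> ('b, 'o, 'm, 'x) vmoncat_scheme \<Rightarrow>
   ('c, 'o, 'm, 'w) vmoncat_scheme \<Rightarrow>
   ('a, 'b, 'm, 'v) vmonfun_scheme \<Rightarrow> ('b, 'c, 'm, 'u) vmonfun_scheme \<Rightarrow> ('a, 'c, 'm) vmonfun"
where
  "vmonfun_cmp C D E F G = \<lparr>
     fobj = (\<lambda>a. fobj G (fobj F a)),
     fmap = (\<lambda>a b. fmap F a b \<Zsemi> fmap G (fobj F a) (fobj F b)),
     nu = (\<lambda>a b.
       ucmp V E (fobj G (fobj F (mten C a b)))
         (fobj G (mten D (fobj F a) (fobj F b)))
         (mten E (fobj G (fobj F a)) (fobj G (fobj F b)))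
         (nu F a b \<Zsemi> fmap G (fobj F (mten C a b)) (mten D (fobj F a) (fobj F b)))
         (nu G (fobj F a) (fobj F b))) \<rparr>"

definition V_monoidal_equivalence ::
  "('a, 'o, 'm, 'y) vmoncat_scheme \<Rightarrow> ('b, 'o, 'm, 'x) vmoncat_scheme \<Rightarrow>
   ('a, 'b, 'm, 'w) vmonfun_scheme \<Rightarrow> bool"
where
  "V_monoidal_equivalence C D F \<longleftrightarrow>
     V_monoidal_functor C D F \<and>
     (\<exists>(G :: ('b, 'a, 'm) vmonfun) \<sigma> \<tau>.
        V_monoidal_functor D C G \<and>
        monoidal_V_natural_iso C C (vmonfun_cmp C D C F G) (vmonfun_id C) \<sigma> \<and>
        monoidal_V_natural_iso D D (vmonfun_cmp D C D G F) (vmonfun_id D) \<tau>)"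

section \<open>The completion\<close>

text \<open>The pair \<open>(a, u)\<close> stands for the formal symbol of \<open>a \<in> C\<close> and \<open>u \<in> V\<close>.\<close>

definition completion :: "('a, 'o, 'm, 'y) vmoncat_scheme \<Rightarrow> ('a \<times> 'o, 'o, 'm) vmoncat" where
  "completion C = \<lparr>
     vobj = vobj C \<times> obj V,
     vhom = (\<lambda>(a, u) (b, v). ihom V u (vhom C a b \<otimes> v)),
     vid = (\<lambda>(a, u). name V u (\<inverse> (\<l> u) \<Zsemi> (vid C a \<odot> \<i> u))),
     vcmp = (\<lambda>(a, u) (b, v) (c, w).
       let ab = vhom C a b; bc = vhom C b c; h = ihom V u (ab \<otimes> v); k = ihom V v (bc \<otimes> w)
       in mate V u (h \<otimes> k)
            (\<inverse> (\<alpha> u h k) \<Zsemi> (\<epsilon> u (ab \<otimes> v) \<odot> \<i> k) \<Zsemi>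
             \<alpha> ab v k \<Zsemi> (\<i> ab \<odot> \<epsilon> v (bc \<otimes> w)) \<Zsemi>
             \<inverse> (\<alpha> ab bc w) \<Zsemi> (vcmp C a b c \<odot> \<i> w))),
     munit = (munit C, \<one>),
     mten = (\<lambda>(a, u) (b, v). (mten C a b, u \<otimes> v)),
     mtenm = (\<lambda>(a, u) (b, v) (c, w) (d, x).
       let ab = vhom C a b; cd = vhom C c d; h = ihom V u (ab \<otimes> v); k = ihom V w (cd \<otimes> x)
       in mate V (u \<otimes> w) (h \<otimes> k)
            (exch V (\<beta> w h) u w h k \<Zsemi>
             (\<epsilon> u (ab \<otimes> v) \<odot> \<epsilon> w (cd \<otimes> x)) \<Zsemi>
             exch V (\<inverse> (\<beta> cd v)) ab v cd x \<Zsemi>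
             (mtenm C a b c d \<odot> \<i> (v \<otimes> x)))),
     massoc = (\<lambda>(a, u) (b, v) (c, w).
       name V ((u \<otimes> v) \<otimes> w)
         (\<alpha> u v w \<Zsemi> \<inverse> (\<l> (u \<otimes> (v \<otimes> w))) \<Zsemi> (massoc C a b c \<odot> \<i> (u \<otimes> (v \<otimes> w))))),
     mlunit = (\<lambda>(a, u). name V (\<one> \<otimes> u) (\<l> u \<Zsemi> \<inverse> (\<l> u) \<Zsemi> (mlunit C a \<odot> \<i> u))),
     mrunit = (\<lambda>(a, u). name V (u \<otimes> \<one>) (\<r> u \<Zsemi> \<inverse> (\<l> u) \<Zsemi> (mrunit C a \<odot> \<i> u))) \<rparr>"

text \<open>
  The hom objects out of \<open>(a, u \<otimes> v)\<close> are internal homs out of \<open>u \<otimes> v\<close>, so the adjunction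
  isomorphisms are those of the self-enrichment.
\<close>

definition completion_tensoring ::
  "('a, 'o, 'm, 'y) vmoncat_scheme \<Rightarrow> ('a \<times> 'o, 'o, 'm) tensoring"
where
  "completion_tensoring C = \<lparr>
     tfun = (\<lambda>(a, u). \<lparr>
       fobj = (\<lambda>v. (a, u \<otimes> v)),
       fmap = (\<lambda>v w. mate V (u \<otimes> v) (ihom V v w)
         (\<alpha> u v (ihom V v w) \<Zsemi> (\<i> u \<odot> \<epsilon> v w) \<Zsemi>
          \<inverse> (\<l> (u \<otimes> w)) \<Zsemi> (vid C a \<odot> \<i> (u \<otimes> w)))) \<rparr>),
     tiso = (\<lambda>(a, u) v (b, w). tiso (self_tensoring V) u v (vhom C a b \<otimes> w)) \<rparr>"

text \<open>
  If \<open>V\<close> is strict then \<open>fmap\<close> is the mate of the identity of \<open>C(a \<rightarrow> b)\<close> and \<open>nu\<close> consists of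
  identities.
\<close>

definition completion_embedding :: "('a, 'o, 'm, 'y) vmoncat_scheme \<Rightarrow> ('a, 'a \<times> 'o, 'm) vmonfun" where
  "completion_embedding C = \<lparr>
     fobj = (\<lambda>a. (a, \<one>)),
     fmap = (\<lambda>a b. mate V \<one> (vhom C a b) (\<l> (vhom C a b) \<Zsemi> \<inverse> (\<r> (vhom C a b)))),
     nu = (\<lambda>a b. name V \<one>
       (\<inverse> (\<l> \<one>) \<Zsemi> \<inverse> (\<l> (\<one> \<otimes> \<one>)) \<Zsemi> (vid C (mten C a b) \<odot> \<i> (\<one> \<otimes> \<one>)))) \<rparr>"

end

end

theory Submission
  imports Defs
begin

text \<open>
  Each of the three conditions says that for all \<open>c\<close> and \<open>v\<close> the unit \<open>\<eta> : v \<rightarrow> C(c \<rightarrow> c \<lhd> v)\<close>, read as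
  an arrow \<open>(c, v) \<rightarrow> (c \<lhd> v, 1)\<close> of the completion, is invertible.  An inverse is an arrow
  \<open>\<theta> : 1 \<rightarrow> C(c \<lhd> v \<rightarrow> c) \<otimes> v\<close>.  For the embedding this is the definition of preserving tensors, up to
  unitors.  For the representable functors the comparison maps are \<open>C(a \<rightarrow> c) \<otimes> v \<rightarrow> C(a \<rightarrow> c \<lhd> v)\<close>:
  evaluating their inverses at identities gives \<open>\<theta>\<close>, and composing with \<open>\<theta>\<close> inverts them.  Finally, the
  embedding is fully faithful and monoidal, hence a monoidal equivalence as soon as every \<open>(c, v)\<close> is
  isomorphic to some \<open>(b, 1)\<close>; conversely, by the universal property of \<open>\<eta>\<close>, such an isomorphism
  yields \<open>\<theta>\<close> with \<open>b = c \<lhd> v\<close>.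
\<close>

section \<open>Arrows of the base category\<close>

text \<open>\<open>V\<close> is assumed neither strict nor symmetric, so every enriched identity
  carries associators, unitors and oriented crossings. No general coherence theorem is invoked.
  Equations of arrows become equations of states acted on by boxes: associators turn into
  regroupings of a list, disjoint boxes commute, and a strand may slide past a box. Internal homs
  are removed by evaluation, and an arrow of the completion is replaced by the arrow
  \<open>u \<rightarrow> C(a, b) \<otimes> v\<close> that it names.

  Two points shape the equivalence. A monoidal functor has to preserve the unit object on the nose,
  so the inverse functor sends \<open>(b, \<one>)\<close> to \<open>b\<close> itself and any other
  \<open>(a, u)\<close> to \<open>a \<lhd> u\<close>. And the completion of a strict category is
  monoidal only up to coherence arrows; these enter through their types, their naturality and the
  coherence laws of the embedding. The inverse functor is conjugation by the chosen isomorphisms,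
  and its laws are checked after the invertible maps \<open>fmap F a b\<close> of the
  embedding.\<close>

lemma hom_iff: "f \<in> hom V u v \<longleftrightarrow> f \<in> arr V \<and> src V f = u \<and> trg V f = v"
  by (auto simp: hom_def)

context category
begin

declare src_obj [simp] trg_obj [simp]

lemma arr_id [simp]: "u \<in> obj V \<Longrightarrow> \<i> u \<in> arr V"
  and src_id [simp]: "u \<in> obj V \<Longrightarrow> src V (\<i> u) = u"
  and trg_id [simp]: "u \<in> obj V \<Longrightarrow> trg V (\<i> u) = u"
  using id_hom by (auto simp: hom_iff)

lemma arr_cmp [simp]: "\<lbrakk>f \<in> arr V; g \<in> arr V; trg V f = src V g\<rbrakk> \<Longrightarrow> f \<Zsemi> g \<in> arr V"
  and src_cmp [simp]: "\<lbrakk>f \<in> arr V; g \<in> arr V; trg V f = src V g\<rbrakk> \<Longrightarrow> src V (f \<Zsemi> g) = src V f"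
  and trg_cmp [simp]: "\<lbrakk>f \<in> arr V; g \<in> arr V; trg V f = src V g\<rbrakk> \<Longrightarrow> trg V (f \<Zsemi> g) = trg V g"
  using cmp_hom by (auto simp: hom_iff)

lemma cmp_id_left [simp]: "\<lbrakk>f \<in> arr V; src V f = u\<rbrakk> \<Longrightarrow> \<i> u \<Zsemi> f = f"
  using id_left by (auto simp: hom_iff)

lemma cmp_id_right [simp]: "\<lbrakk>f \<in> arr V; trg V f = u\<rbrakk> \<Longrightarrow> f \<Zsemi> \<i> u = f"
  using id_right by (auto simp: hom_iff)

lemma cmp_assoc_arr:
  "\<lbrakk>f \<in> arr V; g \<in> arr V; h \<in> arr V; trg V f = src V g; trg V g = src V h\<rbrakk>
    \<Longrightarrow> (f \<Zsemi> g) \<Zsemi> h = f \<Zsemi> (g \<Zsemi> h)"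
  using cmp_assoc by (auto simp: hom_iff)

section \<open>Inverses, isomorphisms and cancellation\<close>

lemma is_inverse_unique:
  assumes "is_inverse V f g" "is_inverse V f h"
  shows "g = h"
proof -
  have g: "f \<in> arr V" "g \<in> arr V" "src V g = trg V f" "trg V g = src V f"
    "f \<Zsemi> g = \<i> (src V f)" "g \<Zsemi> f = \<i> (trg V f)"
    using assms(1) by (auto simp: is_inverse_def hom_iff)
  have h: "h \<in> arr V" "src V h = trg V f" "trg V h = src V f"
    "f \<Zsemi> h = \<i> (src V f)" "h \<Zsemi> f = \<i> (trg V f)"
    using assms(2) by (auto simp: is_inverse_def hom_iff)
  have "g = g \<Zsemi> (f \<Zsemi> h)" using g h by simp
  also have "\<dots> = (g \<Zsemi> f) \<Zsemi> h" by (subst cmp_assoc_arr) (use g h in auto)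
  also have "\<dots> = h" using g h by simp
  finally show ?thesis .
qed

lemma inverse_arr_eqI: "is_inverse V f g \<Longrightarrow> \<inverse> f = g"
  unfolding inverse_arr_def using is_inverse_unique by blast

text \<open>A predicate that leaves the two ends open, so that invertibility can serve as a side
  condition in rewriting; \<open>isos\<close> fixes both ends.\<close>

definition iso :: "'m \<Rightarrow> bool" where
  "iso f \<longleftrightarrow> (\<exists>g. is_inverse V f g)"

lemma isos_iff: "f \<in> isos V u v \<longleftrightarrow> iso f \<and> src V f = u \<and> trg V f = v"
  by (auto simp: isos_def iso_def hom_iff is_inverse_def)

lemma is_inverse_inverse_arr: "iso f \<Longrightarrow> is_inverse V f (\<inverse> f)"
  using inverse_arr_eqI iso_def by metis

lemma iso_arr: "iso f \<Longrightarrow> f \<in> arr V"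
  and arr_inv [simp]: "iso f \<Longrightarrow> \<inverse> f \<in> arr V"
  and src_inv [simp]: "iso f \<Longrightarrow> src V (\<inverse> f) = trg V f"
  and trg_inv [simp]: "iso f \<Longrightarrow> trg V (\<inverse> f) = src V f"
  and cmp_inv_right [simp]: "iso f \<Longrightarrow> f \<Zsemi> \<inverse> f = \<i> (src V f)"
  and cmp_inv_left [simp]: "iso f \<Longrightarrow> \<inverse> f \<Zsemi> f = \<i> (trg V f)"
  using is_inverse_inverse_arr by (auto simp: is_inverse_def hom_iff)

lemma iso_inv [simp]: "iso f \<Longrightarrow> iso (\<inverse> f)"
  using is_inverse_inverse_arr[of f] unfolding iso_def
  by (intro exI[of _ f]) (auto simp: is_inverse_def hom_iff)

lemma cmp_inv_right_assoc [simp]: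
  "\<lbrakk>iso f; g \<in> arr V; src V g = src V f\<rbrakk> \<Longrightarrow> f \<Zsemi> (\<inverse> f \<Zsemi> g) = g"
  by (simp add: cmp_assoc_arr[symmetric] iso_arr)

lemma cmp_inv_left_assoc [simp]:
  "\<lbrakk>iso f; g \<in> arr V; src V g = trg V f\<rbrakk> \<Longrightarrow> \<inverse> f \<Zsemi> (f \<Zsemi> g) = g"
  by (simp add: cmp_assoc_arr[symmetric] iso_arr)

lemma iso_cancel_left:
  assumes "iso f" "g \<in> arr V" "h \<in> arr V" "src V g = trg V f" "src V h = trg V f" "f \<Zsemi> g = f \<Zsemi> h"
  shows "g = h"
  using assms by (metis cmp_inv_left_assoc)

lemma iso_cancel_right:
  assumes "iso f" "g \<in> arr V" "h \<in> arr V" "trg V g = src V f" "trg V h = src V f" "g \<Zsemi> f = h \<Zsemi> f"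
  shows "g = h"
proof -
  have "g = (g \<Zsemi> f) \<Zsemi> \<inverse> f" using assms(1-5) by (simp add: cmp_assoc_arr iso_arr)
  also have "\<dots> = (h \<Zsemi> f) \<Zsemi> \<inverse> f" by (simp only: assms(6))
  also have "\<dots> = h" using assms(1-5) by (simp add: cmp_assoc_arr iso_arr)
  finally show ?thesis .
qed

lemma isoI:
  assumes "f \<in> arr V" "g \<in> arr V" "src V g = trg V f" "trg V g = src V f"
    "f \<Zsemi> g = \<i> (src V f)" "g \<Zsemi> f = \<i> (trg V f)"
  shows "iso f" and "\<inverse> f = g"
  using assms inverse_arr_eqI unfolding iso_def is_inverse_def hom_iff by blast+

end

section \<open>Monoidal coherence\<close>

context monoidal_category
begin

declare unit_obj [simp] ten_obj [simp]

lemma arr_ten [simp]: "\<lbrakk>f \<in> arr V; g \<in> arr V\<rbrakk> \<Longrightarrow> f \<odot> g \<in> arr V"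
  and src_ten [simp]: "\<lbrakk>f \<in> arr V; g \<in> arr V\<rbrakk> \<Longrightarrow> src V (f \<odot> g) = src V f \<otimes> src V g"
  and trg_ten [simp]: "\<lbrakk>f \<in> arr V; g \<in> arr V\<rbrakk> \<Longrightarrow> trg V (f \<odot> g) = trg V f \<otimes> trg V g"
  using ten_hom by (auto simp: hom_iff)

lemma iso_assoc [simp]: "\<lbrakk>u \<in> obj V; v \<in> obj V; w \<in> obj V\<rbrakk> \<Longrightarrow> iso (\<alpha> u v w)"
  and src_assoc [simp]: "\<lbrakk>u \<in> obj V; v \<in> obj V; w \<in> obj V\<rbrakk> \<Longrightarrow> src V (\<alpha> u v w) = (u \<otimes> v) \<otimes> w"
  and trg_assoc [simp]: "\<lbrakk>u \<in> obj V; v \<in> obj V; w \<in> obj V\<rbrakk> \<Longrightarrow> trg V (\<alpha> u v w) = u \<otimes> (v \<otimes> w)"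
  and iso_lunit [simp]: "u \<in> obj V \<Longrightarrow> iso (\<l> u)"
  and src_lunit [simp]: "u \<in> obj V \<Longrightarrow> src V (\<l> u) = \<one> \<otimes> u"
  and trg_lunit [simp]: "u \<in> obj V \<Longrightarrow> trg V (\<l> u) = u"
  and iso_runit [simp]: "u \<in> obj V \<Longrightarrow> iso (\<r> u)"
  and src_runit [simp]: "u \<in> obj V \<Longrightarrow> src V (\<r> u) = u \<otimes> \<one>"
  and trg_runit [simp]: "u \<in> obj V \<Longrightarrow> trg V (\<r> u) = u"
  using assoc_iso lunit_iso runit_iso by (auto simp: isos_iff)

lemma arr_assoc [simp]: "\<lbrakk>u \<in> obj V; v \<in> obj V; w \<in> obj V\<rbrakk> \<Longrightarrow> \<alpha> u v w \<in> arr V"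
  and arr_lunit [simp]: "u \<in> obj V \<Longrightarrow> \<l> u \<in> arr V"
  and arr_runit [simp]: "u \<in> obj V \<Longrightarrow> \<r> u \<in> arr V"
  by (auto intro: iso_arr)

lemma ten_id_arr [simp]: "\<lbrakk>u \<in> obj V; v \<in> obj V\<rbrakk> \<Longrightarrow> \<i> u \<odot> \<i> v = \<i> (u \<otimes> v)"
  by (rule ten_id)

lemma cmp_ten: "\<lbrakk>f \<in> arr V; f' \<in> arr V; g \<in> arr V; g' \<in> arr V; trg V f = src V f'; trg V g = src V g'\<rbrakk>
    \<Longrightarrow> (f \<odot> g) \<Zsemi> (f' \<odot> g') = (f \<Zsemi> f') \<odot> (g \<Zsemi> g')"
  using ten_cmp by (auto simp: hom_iff)

lemma cmp_ten_assoc: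
  "\<lbrakk>f \<in> arr V; f' \<in> arr V; g \<in> arr V; g' \<in> arr V; trg V f = src V f'; trg V g = src V g'; h \<in> arr V;
     src V h = trg V f' \<otimes> trg V g'\<rbrakk>
    \<Longrightarrow> (f \<odot> g) \<Zsemi> ((f' \<odot> g') \<Zsemi> h) = ((f \<Zsemi> f') \<odot> (g \<Zsemi> g')) \<Zsemi> h"
  by (simp add: cmp_ten[symmetric] cmp_assoc_arr)

lemma assoc_nat_arr: "\<lbrakk>f \<in> arr V; g \<in> arr V; h \<in> arr V; src V f = u; src V g = v; src V h = w\<rbrakk>
    \<Longrightarrow> \<alpha> u v w \<Zsemi> (f \<odot> (g \<odot> h)) = ((f \<odot> g) \<odot> h) \<Zsemi> \<alpha> (trg V f) (trg V g) (trg V h)"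
  using assoc_nat[of f u "trg V f" g v "trg V g" h w "trg V h"] by (simp add: hom_iff)

lemma assoc_inv_nat_arr:
  assumes "f \<in> arr V" "g \<in> arr V" "h \<in> arr V" "src V f = u" "src V g = v" "src V h = w"
  shows "\<inverse> (\<alpha> u v w) \<Zsemi> ((f \<odot> g) \<odot> h) = (f \<odot> (g \<odot> h)) \<Zsemi> \<inverse> (\<alpha> (trg V f) (trg V g) (trg V h))"
proof -
  have "\<inverse> (\<alpha> u v w) \<Zsemi> ((f \<odot> g) \<odot> h)
      = \<inverse> (\<alpha> u v w) \<Zsemi> (((f \<odot> g) \<odot> h) \<Zsemi> \<alpha> (trg V f) (trg V g) (trg V h)) \<Zsemi> \<inverse> (\<alpha> (trg V f) (trg V g) (trg V h))"
    using assms by (auto simp: cmp_assoc_arr)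
  also have "\<dots> = (f \<odot> (g \<odot> h)) \<Zsemi> \<inverse> (\<alpha> (trg V f) (trg V g) (trg V h))"
    unfolding assoc_nat_arr[OF assms, symmetric] using assms by (auto simp: cmp_assoc_arr)
  finally show ?thesis .
qed

lemma lunit_nat_arr: "f \<in> arr V \<Longrightarrow> (\<i> \<one> \<odot> f) \<Zsemi> \<l> (trg V f) = \<l> (src V f) \<Zsemi> f"
  using lunit_nat by (auto simp: hom_iff)

lemma lunit_inv_nat_arr: "f \<in> arr V \<Longrightarrow> \<inverse> (\<l> (src V f)) \<Zsemi> (\<i> \<one> \<odot> f) = f \<Zsemi> \<inverse> (\<l> (trg V f))"
  by (rule iso_cancel_right[of "\<l> (trg V f)"]) (auto simp: cmp_assoc_arr lunit_nat_arr)

lemma runit_nat_arr: "f \<in> arr V \<Longrightarrow> (f \<odot> \<i> \<one>) \<Zsemi> \<r> (trg V f) = \<r> (src V f) \<Zsemi> f"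
  using runit_nat by (auto simp: hom_iff)

text \<open>Tensoring with the unit is faithful because \<open>\<r>\<close> is a natural
  isomorphism. States end in a trailing unit, and this lemma removes it again in
  \<open>box_inj\<close>.\<close>

lemma ten_unit_right_inj:
  assumes "f \<in> arr V" "g \<in> arr V" "src V f = src V g" "trg V f = trg V g" "f \<odot> \<i> \<one> = g \<odot> \<i> \<one>"
  shows "f = g"
  using runit_nat_arr[OF assms(1)] runit_nat_arr[OF assms(2)] assms
  by (intro iso_cancel_left[of "\<r> (src V f)" f g]) auto

lemma ten_unit_left_inj:
  assumes "f \<in> arr V" "g \<in> arr V" "src V f = src V g" "trg V f = trg V g" "\<i> \<one> \<odot> f = \<i> \<one> \<odot> g"
  shows "f = g"
  using lunit_nat_arr[OF assms(1)] lunit_nat_arr[OF assms(2)] assms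
  by (intro iso_cancel_left[of "\<l> (src V f)" f g]) auto

lemma iso_ten [simp]: "\<lbrakk>iso f; iso g\<rbrakk> \<Longrightarrow> iso (f \<odot> g)"
  by (rule isoI(1)[of _ "\<inverse> f \<odot> \<inverse> g"]; simp add: cmp_ten iso_arr)

lemma pentagon_arr:
  "\<lbrakk>u \<in> obj V; v \<in> obj V; w \<in> obj V; x \<in> obj V\<rbrakk>
    \<Longrightarrow> (\<alpha> u v w \<odot> \<i> x) \<Zsemi> (\<alpha> u (v \<otimes> w) x \<Zsemi> (\<i> u \<odot> \<alpha> v w x)) = \<alpha> (u \<otimes> v) w x \<Zsemi> \<alpha> u v (w \<otimes> x)"
  using pentagon by (simp add: cmp_assoc_arr)

text \<open>Kelly's derivation of the left triangle from the pentagon and the middle triangle.\<close>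

lemma lunit_ten:
  assumes u: "u \<in> obj V" and v: "v \<in> obj V"
  shows "\<alpha> \<one> u v \<Zsemi> \<l> (u \<otimes> v) = \<l> u \<odot> \<i> v"
proof (rule ten_unit_left_inj)
  \<comment> \<open>Composed with this invertible arrow, the left side becomes one side of the
    pentagon at \<open>\<one>, \<one>, u, v\<close>, so that the middle triangle applies
    twice.\<close>
  let ?X = "(\<alpha> \<one> \<one> u \<odot> \<i> v) \<Zsemi> \<alpha> \<one> (\<one> \<otimes> u) v"
  have "?X \<Zsemi> (\<i> \<one> \<odot> (\<alpha> \<one> u v \<Zsemi> \<l> (u \<otimes> v)))
      = ((\<alpha> \<one> \<one> u \<odot> \<i> v) \<Zsemi> (\<alpha> \<one> (\<one> \<otimes> u) v \<Zsemi> (\<i> \<one> \<odot> \<alpha> \<one> u v))) \<Zsemi> (\<i> \<one> \<odot> \<l> (u \<otimes> v))"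
    using u v by (simp add: cmp_assoc_arr cmp_ten)
  also have "\<dots> = \<alpha> (\<one> \<otimes> \<one>) u v \<Zsemi> (\<alpha> \<one> \<one> (u \<otimes> v) \<Zsemi> (\<i> \<one> \<odot> \<l> (u \<otimes> v)))"
    using u v by (simp add: cmp_assoc_arr pentagon_arr)
  also have "\<dots> = \<alpha> (\<one> \<otimes> \<one>) u v \<Zsemi> (\<r> \<one> \<odot> (\<i> u \<odot> \<i> v))"
    using u v triangle[of "\<one>" "u \<otimes> v"] by simp
  also have "\<dots> = ((\<r> \<one> \<odot> \<i> u) \<odot> \<i> v) \<Zsemi> \<alpha> \<one> u v"
    using u v by (subst assoc_nat_arr) auto
  also have "\<dots> = ((\<alpha> \<one> \<one> u \<Zsemi> (\<i> \<one> \<odot> \<l> u)) \<odot> \<i> v) \<Zsemi> \<alpha> \<one> u v"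
    using u v triangle[of "\<one>" u] by simp
  also have "\<dots> = (\<alpha> \<one> \<one> u \<odot> \<i> v) \<Zsemi> (((\<i> \<one> \<odot> \<l> u) \<odot> \<i> v) \<Zsemi> \<alpha> \<one> u v)"
    using u v by (simp add: cmp_assoc_arr cmp_ten cmp_ten_assoc)
  also have "((\<i> \<one> \<odot> \<l> u) \<odot> \<i> v) \<Zsemi> \<alpha> \<one> u v = \<alpha> \<one> (\<one> \<otimes> u) v \<Zsemi> (\<i> \<one> \<odot> (\<l> u \<odot> \<i> v))"
    using u v by (subst assoc_nat_arr) auto
  also have "(\<alpha> \<one> \<one> u \<odot> \<i> v) \<Zsemi> (\<alpha> \<one> (\<one> \<otimes> u) v \<Zsemi> (\<i> \<one> \<odot> (\<l> u \<odot> \<i> v))) = ?X \<Zsemi> (\<i> \<one> \<odot> (\<l> u \<odot> \<i> v))"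
    using u v by (simp add: cmp_assoc_arr)
  finally have eq: "?X \<Zsemi> (\<i> \<one> \<odot> (\<alpha> \<one> u v \<Zsemi> \<l> (u \<otimes> v))) = ?X \<Zsemi> (\<i> \<one> \<odot> (\<l> u \<odot> \<i> v))" .
  have iso: "iso ?X"
  proof (rule isoI(1))
    show "?X \<Zsemi> (\<inverse> (\<alpha> \<one> (\<one> \<otimes> u) v) \<Zsemi> (\<inverse> (\<alpha> \<one> \<one> u) \<odot> \<i> v)) = \<i> (src V ?X)"
      using u v by (simp add: cmp_assoc_arr cmp_ten)
    show "(\<inverse> (\<alpha> \<one> (\<one> \<otimes> u) v) \<Zsemi> (\<inverse> (\<alpha> \<one> \<one> u) \<odot> \<i> v)) \<Zsemi> ?X = \<i> (trg V ?X)"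
      using u v by (simp add: cmp_assoc_arr cmp_ten cmp_ten_assoc)
  qed (use u v in auto)
  show "\<i> \<one> \<odot> (\<alpha> \<one> u v \<Zsemi> \<l> (u \<otimes> v)) = \<i> \<one> \<odot> (\<l> u \<odot> \<i> v)"
    by (rule iso_cancel_left[OF iso _ _ _ _ eq]) (use u v in auto)
qed (use u v in auto)

end

section \<open>A calculus of boxes\<close>

text \<open>
  To avoid associators, equations between arrows of \<open>V\<close> are checked on states: a state is an arrow
  into the right-nested product of a list of objects together with that list, and a box
  \<open>Box xs m ys\<close> can be applied to it at position \<open>n\<close> if the sublist there is \<open>xs\<close>, which it
  replaces by \<open>ys\<close>.  An ill-typed application yields \<open>None\<close>, so that the interchange law needs no
  typing hypotheses.
\<close>

datatype ('o, 'm) box = Box (bdom: "'o list") (barr: 'm) (bcod: "'o list")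

context monoidal_category
begin

section \<open>States, boxes and the action of a box\<close>

fun tens :: "'o list \<Rightarrow> 'o" where
  "tens [] = \<one>"
| "tens [u] = u"
| "tens (u # v # us) = u \<otimes> tens (v # us)"

text \<open>Boxes are typed with \<open>tens\<close>, which adds no unit to a nonempty list. The
  state around them uses \<open>app\<close>, whose explicit tail lets everything to the right of a
  box be split off.\<close>

primrec app :: "'o list \<Rightarrow> 'o \<Rightarrow> 'o" where
  "app [] z = z"
| "app (u # us) z = u \<otimes> app us z"

primrec lift :: "'o list \<Rightarrow> 'm \<Rightarrow> 'm" where
  "lift [] f = f"
| "lift (u # us) f = \<i> u \<odot> lift us f"

text \<open>The canonical isomorphism \<open>app xs z \<rightarrow> tens xs \<otimes> z\<close>. Its
  three cases follow those of \<open>tens\<close>: a unit has to be created for the empty list, and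
  nothing happens for a singleton.\<close>

fun pck :: "'o list \<Rightarrow> 'o \<Rightarrow> 'm" where
  "pck [] z = \<inverse> (\<l> z)"
| "pck [u] z = \<i> (u \<otimes> z)"
| "pck (u # v # us) z = (\<i> u \<odot> pck (v # us) z) \<Zsemi> \<inverse> (\<alpha> u (tens (v # us)) z)"

text \<open>\<open>m\<close> applied to the front of a list with tail \<open>z\<close>: regroup,
  tensor with the identity of the tail, regroup back.\<close>

definition act_arr :: "'o list \<Rightarrow> 'm \<Rightarrow> 'o list \<Rightarrow> 'o \<Rightarrow> 'm" where
  "act_arr xs m ys z = pck xs z \<Zsemi> ((m \<odot> \<i> z) \<Zsemi> \<inverse> (pck ys z))"

definition okb :: "('o, 'm) box \<Rightarrow> bool" where
  "okb b \<longleftrightarrow> set (bdom b) \<subseteq> obj V \<and> set (bcod b) \<subseteq> obj V \<and> barr b \<in> arr V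
     \<and> src V (barr b) = tens (bdom b) \<and> trg V (barr b) = tens (bcod b)"

text \<open>The list of a well-typed state, and \<open>None\<close> for any other. Whether a box
  applies depends on this list alone, so positions can be decided without inspecting arrows.\<close>

definition cods :: "('m \<times> 'o list) option \<Rightarrow> 'o list option" where
  "cods p = (case p of None \<Rightarrow> None
     | Some (f, zs) \<Rightarrow> if f \<in> arr V \<and> set zs \<subseteq> obj V \<and> trg V f = app zs \<one> then Some zs else None)"

definition at :: "('m \<times> 'o list) option \<Rightarrow> nat \<Rightarrow> 'o list \<Rightarrow> bool" where
  "at p n xs \<longleftrightarrow> (case cods p of None \<Rightarrow> False
     | Some zs \<Rightarrow> n \<le> length zs \<and> take (length xs) (drop n zs) = xs)"

definition act :: "('m \<times> 'o list) option \<Rightarrow> nat \<Rightarrow> ('o, 'm) box \<Rightarrow> ('m \<times> 'o list) option"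
  ("_ |>_: _" [60, 0, 61] 60) where
  "act p n b = (if okb b \<and> at p n (bdom b) then
     let f = fst (the p); zs = snd (the p); us = take n zs; ws = drop (n + length (bdom b)) zs
     in Some (f \<Zsemi> lift us (act_arr (bdom b) (barr b) (bcod b) (app ws \<one>)), us @ bcod b @ ws)
     else None)"

definition start :: "'o list \<Rightarrow> ('m \<times> 'o list) option" where
  "start xs = Some (\<i> (app xs \<one>), xs)"

text \<open>Since \<open>tens []\<close> and \<open>tens [\<one>]\<close> are the same object,
  creating and deleting a unit are boxes on an identity arrow. In the same way \<open>PK\<close>
  regroups two strands without any arrow of its own.\<close>

abbreviation "U \<equiv> Box [] (\<i> \<one>) [\<one>]"
abbreviation "U' \<equiv> Box [\<one>] (\<i> \<one>) []"

abbreviation PK :: "'o \<Rightarrow> 'o \<Rightarrow> ('o, 'm) box" where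
  "PK u v \<equiv> Box [u, v] (\<i> (u \<otimes> v)) [u \<otimes> v]"

section \<open>Typing of the action and naturality in the tail\<close>

lemma okb_Box [simp]:
  "okb (Box xs m ys) \<longleftrightarrow> set xs \<subseteq> obj V \<and> set ys \<subseteq> obj V \<and> m \<in> arr V \<and> src V m = tens xs \<and> trg V m = tens ys"
  by (simp add: okb_def)

lemma obj_app [simp]: "\<lbrakk>set xs \<subseteq> obj V; z \<in> obj V\<rbrakk> \<Longrightarrow> app xs z \<in> obj V"
  by (induction xs) auto

lemma app_append [simp]: "app (xs @ ys) z = app xs (app ys z)"
  by (induction xs) auto

lemma obj_tens [simp]: "set xs \<subseteq> obj V \<Longrightarrow> tens xs \<in> obj V"
  by (induction xs rule: tens.induct) auto

lemma arr_lift [simp]: "\<lbrakk>set xs \<subseteq> obj V; f \<in> arr V\<rbrakk> \<Longrightarrow> lift xs f \<in> arr V"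
  by (induction xs) auto

lemma src_lift [simp]: "\<lbrakk>set xs \<subseteq> obj V; f \<in> arr V\<rbrakk> \<Longrightarrow> src V (lift xs f) = app xs (src V f)"
  and trg_lift [simp]: "\<lbrakk>set xs \<subseteq> obj V; f \<in> arr V\<rbrakk> \<Longrightarrow> trg V (lift xs f) = app xs (trg V f)"
  by (induction xs) auto

lemma lift_append [simp]: "lift (xs @ ys) f = lift xs (lift ys f)"
  by (induction xs) auto

lemma lift_id [simp]: "\<lbrakk>set xs \<subseteq> obj V; u \<in> obj V\<rbrakk> \<Longrightarrow> lift xs (\<i> u) = \<i> (app xs u)"
  by (induction xs) auto

lemma lift_cmp:
  "\<lbrakk>set xs \<subseteq> obj V; f \<in> arr V; g \<in> arr V; trg V f = src V g\<rbrakk> \<Longrightarrow> lift xs f \<Zsemi> lift xs g = lift xs (f \<Zsemi> g)"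
  by (induction xs) (auto simp: cmp_ten)

lemma inv_id [simp]: "u \<in> obj V \<Longrightarrow> iso (\<i> u)" "u \<in> obj V \<Longrightarrow> \<inverse> (\<i> u) = \<i> u"
  by (rule isoI[of _ "\<i> u"]; simp)+

lemma iso_cmp [simp]: "\<lbrakk>iso f; iso g; trg V f = src V g\<rbrakk> \<Longrightarrow> iso (f \<Zsemi> g)"
  by (rule isoI(1)[of _ "\<inverse> g \<Zsemi> \<inverse> f"]; simp add: cmp_assoc_arr iso_arr)

lemma inv_inv [simp]: "iso f \<Longrightarrow> \<inverse> (\<inverse> f) = f"
  by (rule isoI(2)) (auto simp: iso_arr)

lemma pck_props:
  "set xs \<subseteq> obj V \<Longrightarrow> z \<in> obj V \<Longrightarrow> iso (pck xs z) \<and> src V (pck xs z) = app xs z \<and> trg V (pck xs z) = tens xs \<otimes> z"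
  by (induction xs z rule: pck.induct) (auto simp: iso_arr)

lemma iso_pck [simp]: "\<lbrakk>set xs \<subseteq> obj V; z \<in> obj V\<rbrakk> \<Longrightarrow> iso (pck xs z)"
  and src_pck [simp]: "\<lbrakk>set xs \<subseteq> obj V; z \<in> obj V\<rbrakk> \<Longrightarrow> src V (pck xs z) = app xs z"
  and trg_pck [simp]: "\<lbrakk>set xs \<subseteq> obj V; z \<in> obj V\<rbrakk> \<Longrightarrow> trg V (pck xs z) = tens xs \<otimes> z"
  using pck_props by auto

lemma arr_pck [simp]: "\<lbrakk>set xs \<subseteq> obj V; z \<in> obj V\<rbrakk> \<Longrightarrow> pck xs z \<in> arr V"
  by (simp add: iso_arr)

text \<open>Induction along \<open>tens\<close>: naturality of \<open>\<l>\<close> starts it and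
  naturality of \<open>\<alpha>\<close> adds one object.\<close>

lemma pck_nat:
  "\<lbrakk>set xs \<subseteq> obj V; h \<in> arr V\<rbrakk>
    \<Longrightarrow> lift xs h \<Zsemi> pck xs (trg V h) = pck xs (src V h) \<Zsemi> (\<i> (tens xs) \<odot> h)"
proof (induction xs "src V h" rule: pck.induct)
  case 1
  then show ?case by (simp add: lunit_inv_nat_arr)
next
  case (2 u)
  then show ?case by simp
next
  case (3 u v us)
  let ?t = "tens (v # us)"
  have IH: "lift (v # us) h \<Zsemi> pck (v # us) (trg V h) = pck (v # us) (src V h) \<Zsemi> (\<i> ?t \<odot> h)"
    using 3 by simp
  have "lift (u # v # us) h \<Zsemi> pck (u # v # us) (trg V h)
      = ((\<i> u \<odot> lift (v # us) h) \<Zsemi> (\<i> u \<odot> pck (v # us) (trg V h))) \<Zsemi> \<inverse> (\<alpha> u ?t (trg V h))"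
    using 3(2,3) by (simp add: cmp_assoc_arr)
  also have "\<dots> = (\<i> u \<odot> (lift (v # us) h \<Zsemi> pck (v # us) (trg V h))) \<Zsemi> \<inverse> (\<alpha> u ?t (trg V h))"
    using 3(2,3) by (subst cmp_ten) (auto simp del: lift.simps)
  also have "\<dots> = (\<i> u \<odot> pck (v # us) (src V h)) \<Zsemi> ((\<i> u \<odot> (\<i> ?t \<odot> h)) \<Zsemi> \<inverse> (\<alpha> u ?t (trg V h)))"
    unfolding IH using 3(2,3)
    by (subst cmp_assoc_arr[symmetric]) (auto simp: cmp_ten simp del: lift.simps)
  also have "(\<i> u \<odot> (\<i> ?t \<odot> h)) \<Zsemi> \<inverse> (\<alpha> u ?t (trg V h)) = \<inverse> (\<alpha> u ?t (src V h)) \<Zsemi> ((\<i> u \<odot> \<i> ?t) \<odot> h)"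
    using 3(2,3) by (subst assoc_inv_nat_arr) auto
  finally show ?case using 3(2,3) by (simp add: cmp_assoc_arr)
qed

lemma pck_inv_nat:
  assumes "set xs \<subseteq> obj V" "h \<in> arr V"
  shows "\<inverse> (pck xs (src V h)) \<Zsemi> lift xs h = (\<i> (tens xs) \<odot> h) \<Zsemi> \<inverse> (pck xs (trg V h))"
proof (rule iso_cancel_left[of "pck xs (src V h)"])
  show "pck xs (src V h) \<Zsemi> (\<inverse> (pck xs (src V h)) \<Zsemi> lift xs h)
     = pck xs (src V h) \<Zsemi> ((\<i> (tens xs) \<odot> h) \<Zsemi> \<inverse> (pck xs (trg V h)))"
    using assms by (simp add: cmp_assoc_arr[symmetric] pck_nat[symmetric])
      (simp add: cmp_assoc_arr)
qed (use assms in auto)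

context
  fixes xs ys :: "'o list" and m :: 'm
  assumes ok: "okb (Box xs m ys)"
begin

lemma act_arr_simps [simp]:
  assumes "z \<in> obj V"
  shows "act_arr xs m ys z \<in> arr V" "src V (act_arr xs m ys z) = app xs z" "trg V (act_arr xs m ys z) = app ys z"
  using assms ok by (auto simp: act_arr_def)

text \<open>What acts on the tail commutes with what acts on the front. This is the mathematical
  content of \<open>box_interchange\<close>.\<close>

lemma act_arr_nat:
  assumes h: "h \<in> arr V"
  shows "act_arr xs m ys (src V h) \<Zsemi> lift ys h = lift xs h \<Zsemi> act_arr xs m ys (trg V h)"
proof -
  have "act_arr xs m ys (src V h) \<Zsemi> lift ys h
     = pck xs (src V h) \<Zsemi> ((m \<odot> \<i> (src V h)) \<Zsemi> (\<inverse> (pck ys (src V h)) \<Zsemi> lift ys h))"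
    using ok h by (simp add: act_arr_def cmp_assoc_arr)
  also have "\<dots> = pck xs (src V h) \<Zsemi> ((m \<odot> \<i> (src V h)) \<Zsemi> ((\<i> (tens ys) \<odot> h) \<Zsemi> \<inverse> (pck ys (trg V h))))"
    using ok h by (simp add: pck_inv_nat)
  also have "\<dots> = pck xs (src V h) \<Zsemi> ((\<i> (tens xs) \<odot> h) \<Zsemi> ((m \<odot> \<i> (trg V h)) \<Zsemi> \<inverse> (pck ys (trg V h))))"
    using ok h by (simp add: cmp_ten_assoc)
  also have "\<dots> = (pck xs (src V h) \<Zsemi> (\<i> (tens xs) \<odot> h)) \<Zsemi> ((m \<odot> \<i> (trg V h)) \<Zsemi> \<inverse> (pck ys (trg V h)))"
    using ok h by (simp add: cmp_assoc_arr)
  also have "\<dots> = lift xs h \<Zsemi> act_arr xs m ys (trg V h)"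
    using ok h by (simp add: pck_nat[symmetric] act_arr_def cmp_assoc_arr)
  finally show ?thesis .
qed

end

lemma act_arr_cmp:
  assumes "okb (Box xs m ys)" "okb (Box ys m' zs)" "z \<in> obj V"
  shows "act_arr xs m ys z \<Zsemi> act_arr ys m' zs z = act_arr xs (m \<Zsemi> m') zs z"
  using assms by (simp add: act_arr_def cmp_assoc_arr cmp_ten_assoc)

lemma act_arr_id [simp]:
  assumes "set xs \<subseteq> obj V" "z \<in> obj V" "t = tens xs"
  shows "act_arr xs (\<i> t) xs z = \<i> (app xs z)"
  using assms by (simp add: act_arr_def)

text \<open>Lists evolve independently of the arrows, so rewriting with this rule settles all
  position conditions in the diagrams below.\<close>

lemma cods_act [simp]:
  "cods (p |>n: b) = (case cods p of None \<Rightarrow> None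
     | Some zs \<Rightarrow> if okb b \<and> n \<le> length zs \<and> take (length (bdom b)) (drop n zs) = bdom b
         then Some (take n zs @ bcod b @ drop (n + length (bdom b)) zs) else None)"
proof (cases "okb b \<and> at p n (bdom b)")
  case False
  then show ?thesis by (auto simp: act_def at_def cods_def split: option.splits)
next
  case True
  then obtain f zs where p: "p = Some (f, zs)" "f \<in> arr V" "set zs \<subseteq> obj V" "trg V f = app zs \<one>"
     "n \<le> length zs" "take (length (bdom b)) (drop n zs) = bdom b"
    by (auto simp: at_def cods_def split: option.splits if_splits)
  let ?A = "take n zs" and ?C = "drop (n + length (bdom b)) zs"
  have zs: "zs = ?A @ bdom b @ ?C"
    using p by (metis append_take_drop_id drop_drop add.commute)
  have sub: "set ?A \<subseteq> obj V" "set ?C \<subseteq> obj V"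
    using p(3) set_take_subset set_drop_subset by fast+
  have f: "trg V f = app (?A @ bdom b @ ?C) \<one>" using p zs by simp
  obtain xs m ys where b: "b = Box xs m ys" by (cases b)
  show ?thesis using True p sub f by (auto simp: act_def cods_def Let_def b)
qed

lemma act_at:
  assumes "okb (Box xs m ys)" "f \<in> arr V" "set A \<subseteq> obj V" "set C \<subseteq> obj V"
    "trg V f = app A (app xs (app C \<one>))" "n = length A"
  shows "Some (f, A @ xs @ C) |>n: Box xs m ys = Some (f \<Zsemi> lift A (act_arr xs m ys (app C \<one>)), A @ ys @ C)"
  using assms by (auto simp: act_def at_def cods_def)

lemma act_not_at: "\<not> at p n (bdom b) \<Longrightarrow> p |>n: b = None"
  and act_not_ok: "\<not> okb b \<Longrightarrow> p |>n: b = None"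
  and act_None [simp]: "None |>n: b = None"
  by (auto simp: act_def at_def cods_def)

lemma at_E:
  assumes "at p n xs"
  obtains f A C where "p = Some (f, A @ xs @ C)" "n = length A" "f \<in> arr V" "set A \<subseteq> obj V"
    "set C \<subseteq> obj V" "trg V f = app A (app xs (app C \<one>))"
proof -
  obtain f zs where p: "p = Some (f, zs)" "f \<in> arr V" "set zs \<subseteq> obj V" "trg V f = app zs \<one>"
     "n \<le> length zs" "take (length xs) (drop n zs) = xs"
    using assms by (auto simp: at_def cods_def split: option.splits if_splits)
  let ?A = "take n zs" and ?C = "drop (n + length xs) zs"
  have zs: "zs = ?A @ xs @ ?C"
    using p by (metis append_take_drop_id drop_drop add.commute)
  have sub: "set ?A \<subseteq> obj V" "set ?C \<subseteq> obj V"
    using p(3) set_take_subset set_drop_subset by fast+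
  show thesis
  proof (rule that[of f ?A ?C])
    show "p = Some (f, ?A @ xs @ ?C)" using p(1) zs by simp
    show "trg V f = app ?A (app xs (app ?C \<one>))" using p(4) zs by (metis app_append)
  qed (use p sub in auto)
qed

lemma at_start [simp]: "set xs \<subseteq> obj V \<Longrightarrow> cods (start xs) = Some xs"
  by (simp add: cods_def start_def)

section \<open>Faithfulness, fusion and interchange of boxes\<close>

text \<open>The way back from states to arrows: the regroupings are invertible and the trailing unit
  is removed by \<open>ten_unit_right_inj\<close>, so one test on the start state suffices.\<close>

lemma box_inj:
  assumes "f \<in> arr V" "g \<in> arr V" "set xs \<subseteq> obj V" "set ys \<subseteq> obj V"
    "src V f = tens xs" "src V g = tens xs" "trg V f = tens ys" "trg V g = tens ys"
    and eq: "start xs |>0: Box xs f ys = start xs |>0: Box xs g ys"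
  shows "f = g"
proof -
  have "act_arr xs f ys \<one> = act_arr xs g ys \<one>"
    using assms act_at[of xs f ys "\<i> (app xs \<one>)" "[]" "[]"] act_at[of xs g ys "\<i> (app xs \<one>)" "[]" "[]"]
    by (simp add: start_def)
  then have "(f \<odot> \<i> \<one>) \<Zsemi> \<inverse> (pck ys \<one>) = (g \<odot> \<i> \<one>) \<Zsemi> \<inverse> (pck ys \<one>)"
    unfolding act_arr_def by (rule iso_cancel_left[rotated 5]) (use assms(1-8) in auto)
  then have "f \<odot> \<i> \<one> = g \<odot> \<i> \<one>"
    by (rule iso_cancel_right[rotated 5]) (use assms(1-8) in auto)
  then show ?thesis by (rule ten_unit_right_inj[rotated 4]) (use assms(1-8) in auto)
qed

lemma box_cmp:
  assumes "okb (Box xs m ys)" "okb (Box ys m' zs)"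
  shows "p |>n: Box xs m ys |>n: Box ys m' zs = p |>n: Box xs (m \<Zsemi> m') zs"
proof (cases "at p n xs")
  case True
  then obtain f A C where p: "p = Some (f, A @ xs @ C)" "n = length A" "f \<in> arr V" "set A \<subseteq> obj V"
    "set C \<subseteq> obj V" "trg V f = app A (app xs (app C \<one>))" by (rule at_E)
  moreover have "okb (Box xs (m \<Zsemi> m') zs)" using assms by auto
  ultimately show ?thesis using assms
    by (auto simp: act_at cmp_assoc_arr lift_cmp act_arr_cmp simp del: okb_Box)
qed (simp add: act_not_at)

lemma box_id:
  assumes "at p n xs" "set xs \<subseteq> obj V" "t = tens xs"
  shows "p |>n: Box xs (\<i> t) xs = p"
proof -
  obtain f A C where p: "p = Some (f, A @ xs @ C)" "n = length A" "f \<in> arr V" "set A \<subseteq> obj V"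
    "set C \<subseteq> obj V" "trg V f = app A (app xs (app C \<one>))" using assms(1) by (rule at_E)
  then show ?thesis using assms by (auto simp: act_at)
qed

text \<open>Disjoint boxes commute; the right one is shifted by the change of length that the left
  one causes. Read as a rewrite rule it lets left boxes act first, which gives a normal form. A box
  with empty domain may stand at \<open>n = n'\<close>, which is how inserted objects move past
  other boxes.\<close>

lemma box_interchange:
  assumes le: "n + length (bdom b) \<le> n'"
  shows "p |>n': b' |>n: b = p |>n: b |>(n' - length (bdom b) + length (bcod b)): b'"
proof (cases "okb b \<and> okb b' \<and> at p n (bdom b) \<and> at p n' (bdom b')")
  case True
  obtain xs m ys where b: "b = Box xs m ys" by (cases b)
  obtain xs' m' ys' where b': "b' = Box xs' m' ys'" by (cases b')
  obtain f A' C where p: "p = Some (f, A' @ xs' @ C)" "n' = length A'" "f \<in> arr V" "set A' \<subseteq> obj V"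
    "set C \<subseteq> obj V" "trg V f = app A' (app xs' (app C \<one>))" using True b' by (auto elim!: at_E)
  define A B where "A = take n A'" and "B = drop (n + length xs) A'"
  have take_xs: "take (length xs) (drop n A') = xs"
  proof -
    have ob: "set xs' \<subseteq> obj V" using True b' by simp
    have "cods p = Some (A' @ xs' @ C)"
      using p(1,3-6) ob by (simp add: cods_def)
    then have "take (length xs) (drop n (A' @ xs' @ C)) = xs"
      using True b by (simp only: at_def option.case box.sel)
    then show ?thesis using le p(2) b by simp
  qed
  have "A' = take n A' @ take (length xs) (drop n A') @ drop (length xs) (drop n A')"
    by (simp only: append_take_drop_id)
  then have A': "A' = A @ xs @ B"
    unfolding take_xs by (simp add: A_def B_def add.commute)
  have sub: "set A \<subseteq> obj V" "set B \<subseteq> obj V" using p(4) unfolding A' by auto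
  have lenA: "n = length A" using le p(2) b by (simp add: A_def)
  have n': "n' - length (bdom b) + length (bcod b) = length (A @ ys @ B)"
    using p(2) A' b by simp
  have ok: "okb (Box xs m ys)" "okb (Box xs' m' ys')" using True b b' by auto
  let ?h = "lift B (act_arr xs' m' ys' (app C \<one>))"
  have h: "?h \<in> arr V" "src V ?h = app (B @ xs' @ C) \<one>" "trg V ?h = app (B @ ys' @ C) \<one>"
    using ok sub p by auto
  have "p |>n': b' |>n: b = Some (f, A' @ xs' @ C) |>n': Box xs' m' ys' |>n: Box xs m ys"
    using p b b' by simp
  also have "\<dots> = Some (f \<Zsemi> lift A' (act_arr xs' m' ys' (app C \<one>)), A @ xs @ B @ ys' @ C) |>n: Box xs m ys"
    using p ok by (subst act_at) (auto simp: A')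
  also have "\<dots> = Some (f \<Zsemi> lift A' (act_arr xs' m' ys' (app C \<one>)) \<Zsemi> lift A (act_arr xs m ys (app (B @ ys' @ C) \<one>)), A @ ys @ B @ ys' @ C)"
    using p ok sub lenA A' by (subst act_at) auto
  also have "lift A' (act_arr xs' m' ys' (app C \<one>)) = lift A (lift xs ?h)"
    by (simp add: A')
  also have "f \<Zsemi> lift A (lift xs ?h) \<Zsemi> lift A (act_arr xs m ys (app (B @ ys' @ C) \<one>))
    = f \<Zsemi> lift A (lift xs ?h \<Zsemi> act_arr xs m ys (trg V ?h))"
    using p ok sub h A' by (simp add: cmp_assoc_arr lift_cmp)
  \<comment> \<open>Everything to the right of the left box, the other box included, is one arrow
    \<open>?h\<close> on its tail.\<close>
  also have "lift xs ?h \<Zsemi> act_arr xs m ys (trg V ?h) = act_arr xs m ys (src V ?h) \<Zsemi> lift ys ?h"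
    using act_arr_nat[OF ok(1) h(1)] by simp
  also have "f \<Zsemi> lift A (act_arr xs m ys (src V ?h) \<Zsemi> lift ys ?h)
     = f \<Zsemi> lift A (act_arr xs m ys (app (B @ xs' @ C) \<one>)) \<Zsemi> lift (A @ ys @ B) (act_arr xs' m' ys' (app C \<one>))"
    using p ok sub h A' by (simp add: cmp_assoc_arr lift_cmp)
  also have "Some (\<dots>, A @ ys @ B @ ys' @ C)
     = Some (f \<Zsemi> lift A (act_arr xs m ys (app (B @ xs' @ C) \<one>)), (A @ ys @ B) @ xs' @ C) |>(n' - length (bdom b) + length (bcod b)): Box xs' m' ys'"
    using p ok sub A' n' by (subst act_at) auto
  also have "\<dots> = Some (f, A @ xs @ (B @ xs' @ C)) |>n: Box xs m ys |>(n' - length (bdom b) + length (bcod b)): Box xs' m' ys'"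
    using p ok sub lenA A' by (subst (2) act_at) auto
  finally show ?thesis using p b b' A' by simp
next
  \<comment> \<open>Both sides are undefined. Their lists fail together, and the result of an action
    without a list is \<open>None\<close>.\<close>
  case False
  have take_eq: "take (length (bdom b)) (drop n (take n' zs)) = take (length (bdom b)) (drop n zs)" for zs
    using le by (simp add: drop_take min_absorb1)
  have len_eq: "drop n zs = bdom b \<Longrightarrow> n \<le> length zs \<Longrightarrow> length zs = n + length (bdom b)" for zs
    by (metis le_add_diff_inverse length_drop)
  have "cods (p |>n': b' |>n: b) = None"
    using False le by (auto simp: at_def take_eq split: option.splits)
  moreover have "cods (p |>n: b |>(n' - length (bdom b) + length (bcod b)): b') = None"
    using False le by (auto simp: at_def split: option.splits) (drule (1) len_eq, simp)
  moreover have "cods q = None \<Longrightarrow> q |>k: c = None" for q k c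
    by (simp add: act_def at_def)
  moreover have "cods (q |>k: c) = None \<Longrightarrow> q |>k: c = None" for q k c
    using act_not_at[of q k c] act_not_ok[of c q k] by (auto simp: at_def split: option.splits if_splits)
  ultimately show ?thesis by metis
qed

lemma at_cods:
  assumes "at p n xs"
  obtains A C where "cods p = Some (A @ xs @ C)" "n = length A"
proof -
  from assms obtain zs where zs: "cods p = Some zs" "n \<le> length zs" "take (length xs) (drop n zs) = xs"
    by (auto simp: at_def split: option.splits)
  show thesis
  proof (rule that)
    show "cods p = Some (take n zs @ xs @ drop (length xs) (drop n zs))"
      using zs by (metis append_take_drop_id)
  qed (use zs in simp)
qed

lemma at_iff: "at p n xs \<longleftrightarrow> (case cods p of None \<Rightarrow> False
     | Some zs \<Rightarrow> n \<le> length zs \<and> take (length xs) (drop n zs) = xs)"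
  by (simp add: at_def)

lemma act_cases:
  obtains "p |>n: b = None" | "at (p |>n: b) n (bcod b)"
proof (cases "okb b \<and> at p n (bdom b)")
  case True
  then have "at (p |>n: b) n (bcod b)" by (auto simp: at_iff min_absorb2 split: option.splits)
  then show ?thesis by (rule that(2))
qed (use that act_not_at[of p n b] act_not_ok[of b p n] in auto)

lemma act_at_Suc:
  assumes "okb (Box xs m ys)" "f \<in> arr V" "set A \<subseteq> obj V" "set C \<subseteq> obj V" "u \<in> obj V"
    "trg V f = app A (u \<otimes> app xs (app C \<one>))" "n = length A"
  shows "Some (f, A @ u # xs @ C) |>Suc n: Box xs m ys
     = Some (f \<Zsemi> lift A (\<i> u \<odot> act_arr xs m ys (app C \<one>)), A @ u # ys @ C)"
  using act_at[of xs m ys f "A @ [u]" C "Suc n"] assms by simp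

section \<open>Tensor products and structural arrows as boxes\<close>

lemma act_arr_id_unary [simp]: "\<lbrakk>u \<in> obj V; v \<in> obj V; z \<in> obj V\<rbrakk> \<Longrightarrow> act_arr [u \<otimes> v] (\<i> (u \<otimes> v)) [u, v] z = \<alpha> u v z"
  "\<lbrakk>u \<in> obj V; v \<in> obj V; z \<in> obj V\<rbrakk> \<Longrightarrow> act_arr [u, v] (\<i> (u \<otimes> v)) [u \<otimes> v] z = \<inverse> (\<alpha> u v z)"
  "z \<in> obj V \<Longrightarrow> act_arr [\<one>] (\<i> \<one>) [] z = \<l> z"
  "z \<in> obj V \<Longrightarrow> act_arr [] (\<i> \<one>) [\<one>] z = \<inverse> (\<l> z)"
  by (simp_all add: act_arr_def)

text \<open>In the \<open>native\<close> rules the end lists of a box match the factors of its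
  arrow. Here naturality of \<open>\<alpha>\<close> shows that a tensor product acts as its two
  factors side by side.\<close>

lemma box_ten_native:
  assumes "at p n [u, v]" "f \<in> arr V" "g \<in> arr V" "src V f = u" "src V g = v" "u' = trg V f" "v' = trg V g"
  shows "p |>n: Box [u, v] (f \<odot> g) [u', v'] = p |>n: Box [u] f [u'] |>Suc n: Box [v] g [v']"
proof -
  obtain h A C where p: "p = Some (h, A @ [u, v] @ C)" "n = length A" "h \<in> arr V" "set A \<subseteq> obj V"
    "set C \<subseteq> obj V" "trg V h = app A (app [u, v] (app C \<one>))" using assms(1) by (rule at_E)
  let ?z = "app C \<one>"
  have z: "?z \<in> obj V" using p by simp
  have uv: "u \<in> obj V" "v \<in> obj V" using assms by auto
  have "p |>n: Box [u, v] (f \<odot> g) [u', v'] = Some (h \<Zsemi> lift A (act_arr [u, v] (f \<odot> g) [u', v'] ?z), A @ [u', v'] @ C)"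
    unfolding p(1) using assms(2-) p(2-) by (subst act_at) auto
  moreover have "p |>n: Box [u] f [u'] |>Suc n: Box [v] g [v']
     = Some (h \<Zsemi> lift A (f \<odot> \<i> (v \<otimes> ?z)) \<Zsemi> lift A (\<i> u' \<odot> (g \<odot> \<i> ?z)), A @ u' # [v'] @ C)"
    unfolding p(1) using assms(2-) p(2-) uv act_at[of "[u]" f "[u']" h A "v # C" n] act_at_Suc[of "[v]" g "[v']" "h \<Zsemi> lift A (f \<odot> \<i> (v \<otimes> ?z))" A C u' n]
    by (simp add: act_arr_def)
  moreover have "act_arr [u, v] (f \<odot> g) [u', v'] ?z = f \<odot> (g \<odot> \<i> ?z)"
  proof -
    have "act_arr [u, v] (f \<odot> g) [u', v'] ?z = \<inverse> (\<alpha> u v ?z) \<Zsemi> (((f \<odot> g) \<odot> \<i> ?z) \<Zsemi> \<alpha> u' v' ?z)"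
      using z uv assms by (simp add: act_arr_def)
    also have "\<dots> = (\<inverse> (\<alpha> u v ?z) \<Zsemi> ((f \<odot> g) \<odot> \<i> ?z)) \<Zsemi> \<alpha> u' v' ?z"
      using z uv assms by (simp add: cmp_assoc_arr)
    also have "\<dots> = f \<odot> (g \<odot> \<i> ?z)"
      using z uv assms by (subst assoc_inv_nat_arr) (auto simp: cmp_assoc_arr)
    finally show ?thesis .
  qed
  ultimately show ?thesis using z uv assms(2-) p(2-) by (simp add: cmp_assoc_arr lift_cmp cmp_ten)
qed

text \<open>The pentagon in the form used throughout: an associator only splits
  \<open>u \<otimes> v\<close> and joins \<open>v\<close> with \<open>w\<close>, so it leaves the
  underlying list of strands alone.\<close>

lemma box_assoc_native:
  assumes "at p n [u \<otimes> v, w]" "u \<in> obj V" "v \<in> obj V" "w \<in> obj V"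
  shows "p |>n: Box [u \<otimes> v, w] (\<alpha> u v w) [u, v \<otimes> w]
    = p |>n: Box [u \<otimes> v] (\<i> (u \<otimes> v)) [u, v] |>Suc n: PK v w"
proof -
  obtain h A C where p: "p = Some (h, A @ [u \<otimes> v, w] @ C)" "n = length A" "h \<in> arr V" "set A \<subseteq> obj V"
    "set C \<subseteq> obj V" "trg V h = app A (app [u \<otimes> v, w] (app C \<one>))" using assms(1) by (rule at_E)
  let ?z = "app C \<one>"
  have z: "?z \<in> obj V" using p by simp
  have "p |>n: Box [u \<otimes> v, w] (\<alpha> u v w) [u, v \<otimes> w] = Some (h \<Zsemi> lift A (act_arr [u \<otimes> v, w] (\<alpha> u v w) [u, v \<otimes> w] ?z), A @ [u, v \<otimes> w] @ C)"
    unfolding p(1) using assms(2-) p(2-) by (subst act_at) auto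
  moreover have "p |>n: Box [u \<otimes> v] (\<i> (u \<otimes> v)) [u, v] |>Suc n: PK v w
     = Some (h \<Zsemi> lift A (\<alpha> u v (w \<otimes> ?z)) \<Zsemi> lift A (\<i> u \<odot> \<inverse> (\<alpha> v w ?z)), A @ [u, v \<otimes> w] @ C)"
    unfolding p(1) using assms(2-) p(2-) act_at[of "[u \<otimes> v]" "\<i> (u \<otimes> v)" "[u, v]" h A "w # C"]
      act_at_Suc[of "[v, w]" "\<i> (v \<otimes> w)" "[v \<otimes> w]" "h \<Zsemi> lift A (\<alpha> u v (w \<otimes> ?z))" A C u n] z
    by simp
  moreover have "act_arr [u \<otimes> v, w] (\<alpha> u v w) [u, v \<otimes> w] ?z = \<alpha> u v (w \<otimes> ?z) \<Zsemi> (\<i> u \<odot> \<inverse> (\<alpha> v w ?z))"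
  proof -
    have "act_arr [u \<otimes> v, w] (\<alpha> u v w) [u, v \<otimes> w] ?z = \<inverse> (\<alpha> (u \<otimes> v) w ?z) \<Zsemi> ((\<alpha> u v w \<odot> \<i> ?z) \<Zsemi> \<alpha> u (v \<otimes> w) ?z)"
      using z assms(2-) by (simp add: act_arr_def)
    also have "\<dots> = \<inverse> (\<alpha> (u \<otimes> v) w ?z) \<Zsemi> (((\<alpha> u v w \<odot> \<i> ?z) \<Zsemi> (\<alpha> u (v \<otimes> w) ?z \<Zsemi> (\<i> u \<odot> \<alpha> v w ?z))) \<Zsemi> (\<i> u \<odot> \<inverse> (\<alpha> v w ?z)))"
      using z assms(2-) by (simp add: cmp_assoc_arr cmp_ten)
    also have "\<dots> = \<alpha> u v (w \<otimes> ?z) \<Zsemi> (\<i> u \<odot> \<inverse> (\<alpha> v w ?z))"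
      using z assms(2-) by (simp add: pentagon_arr cmp_assoc_arr)
    finally show ?thesis .
  qed
  ultimately show ?thesis using z assms(2-) p(2-) by (simp add: cmp_assoc_arr lift_cmp)
qed

text \<open>By the left triangle \<open>lunit_ten\<close>, a left unitor deletes the unit strand
  irrespective of what follows.\<close>

lemma box_lunit_native:
  assumes "at p n [\<one>, u]" "u \<in> obj V"
  shows "p |>n: Box [\<one>, u] (\<l> u) [u] = p |>n: U'"
proof -
  obtain h A C where p: "p = Some (h, A @ [\<one>, u] @ C)" "n = length A" "h \<in> arr V" "set A \<subseteq> obj V"
    "set C \<subseteq> obj V" "trg V h = app A (app [\<one>, u] (app C \<one>))" using assms(1) by (rule at_E)
  let ?z = "app C \<one>"
  have z: "?z \<in> obj V" using p by simp
  have "act_arr [\<one>, u] (\<l> u) [u] ?z = \<inverse> (\<alpha> \<one> u ?z) \<Zsemi> (\<l> u \<odot> \<i> ?z)"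
    using z assms(2-) by (simp add: act_arr_def)
  also have "\<dots> = \<l> (u \<otimes> ?z)" using z assms(2-) by (simp add: lunit_ten[symmetric])
  finally show ?thesis
    unfolding p(1) using assms(2-) p(2-) act_at[of "[\<one>, u]" "\<l> u" "[u]" h A C] act_at[of "[\<one>]" "\<i> \<one>" "[]" h A "u # C"]
    by simp
qed

text \<open>The middle triangle axiom: a right unitor deletes the unit strand too, now at the second
  position.\<close>

lemma box_runit_native:
  assumes "at p n [u, \<one>]" "u \<in> obj V"
  shows "p |>n: Box [u, \<one>] (\<r> u) [u] = p |>Suc n: U'"
proof -
  obtain h A C where p: "p = Some (h, A @ [u, \<one>] @ C)" "n = length A" "h \<in> arr V" "set A \<subseteq> obj V"
    "set C \<subseteq> obj V" "trg V h = app A (app [u, \<one>] (app C \<one>))" using assms(1) by (rule at_E)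
  let ?z = "app C \<one>"
  have z: "?z \<in> obj V" using p by simp
  have "act_arr [u, \<one>] (\<r> u) [u] ?z = \<inverse> (\<alpha> u \<one> ?z) \<Zsemi> (\<r> u \<odot> \<i> ?z)"
    using z assms(2-) by (simp add: act_arr_def)
  also have "\<dots> = \<i> u \<odot> \<l> ?z" using z assms(2-) by (simp add: triangle[symmetric])
  finally show ?thesis
    unfolding p(1) using assms(2-) p(2-) act_at[of "[u, \<one>]" "\<r> u" "[u]" h A C]
      act_at_Suc[of "[\<one>]" "\<i> \<one>" "[]" h A C u n]
    by simp
qed

lemma box_pack_native:
  assumes "at p n (u # v # vs)" "u \<in> obj V" "v \<in> obj V" "set vs \<subseteq> obj V" "t = tens (u # v # vs)" "s = tens (v # vs)"
  shows "p |>n: Box (u # v # vs) (\<i> t) [t] = p |>Suc n: Box (v # vs) (\<i> s) [s] |>n: Box [u, s] (\<i> t) [t]"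
proof -
  obtain h A C where p: "p = Some (h, A @ (u # v # vs) @ C)" "n = length A" "h \<in> arr V" "set A \<subseteq> obj V"
    "set C \<subseteq> obj V" "trg V h = app A (app (u # v # vs) (app C \<one>))" using assms(1) by (rule at_E)
  let ?z = "app C \<one>"
  have z: "?z \<in> obj V" using p by simp
  have s: "s \<in> obj V" "t \<in> obj V" and t: "t = u \<otimes> s" using assms by auto
  have a1: "act_arr (u # v # vs) (\<i> t) [t] ?z = pck (u # v # vs) ?z"
    using z assms(2-) s by (simp add: act_arr_def)
  have a2: "act_arr (v # vs) (\<i> s) [s] ?z = pck (v # vs) ?z"
    using z assms(2-) s by (simp add: act_arr_def)
  have "p |>n: Box (u # v # vs) (\<i> t) [t] = Some (h \<Zsemi> lift A (pck (u # v # vs) ?z), A @ [t] @ C)"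
    unfolding p(1) a1[symmetric] by (rule act_at) (use p(2-) assms(2-) s in auto)
  moreover have "p |>Suc n: Box (v # vs) (\<i> s) [s] = Some (h \<Zsemi> lift A (\<i> u \<odot> pck (v # vs) ?z), A @ u # [s] @ C)"
    unfolding p(1) a2[symmetric] using act_at_Suc[of "v # vs" "\<i> s" "[s]" h A C u n] p(2-) assms(2-) s by simp
  moreover have "Some (h \<Zsemi> lift A (\<i> u \<odot> pck (v # vs) ?z), A @ [u, s] @ C) |>n: Box [u, s] (\<i> t) [t]
     = Some (h \<Zsemi> lift A (\<i> u \<odot> pck (v # vs) ?z) \<Zsemi> lift A (\<inverse> (\<alpha> u s ?z)), A @ [t] @ C)"
    unfolding t using s p(2-) assms(2-) z by (subst act_at) (auto simp del: pck.simps)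
  moreover have "h \<Zsemi> lift A (\<i> u \<odot> pck (v # vs) ?z) \<Zsemi> lift A (\<inverse> (\<alpha> u s ?z)) = h \<Zsemi> lift A (pck (u # v # vs) ?z)"
    using p(2-) assms(2-4) z s unfolding pck.simps(3)[of u v vs] assms(6)
    by (simp add: cmp_assoc_arr lift_cmp del: pck.simps)
  ultimately show ?thesis by simp
qed

text \<open>
  The following rules decompose a box according to the structure of its arrow.  They hold for
  arbitrary states, ill-typed ones included.
\<close>

lemma box_cmp_expand:
  assumes "f \<in> arr V" "g \<in> arr V" "trg V f = src V g" "src V f = tens xs" "trg V g = tens ys"
    "set xs \<subseteq> obj V" "set ys \<subseteq> obj V"
  shows "p |>n: Box xs (f \<Zsemi> g) ys = p |>n: Box xs f [trg V f] |>n: Box [trg V f] g ys"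
  using assms by (subst box_cmp) auto

lemma box_cmp_id:
  assumes "set xs \<subseteq> obj V" "set ys \<subseteq> obj V" "set zs \<subseteq> obj V" "tens xs = t" "tens ys = t" "tens zs = t" "t' = t"
  shows "p |>n: Box xs (\<i> t) ys |>n: Box ys (\<i> t') zs = p |>n: Box xs (\<i> t) zs"
  using assms by (subst box_cmp) auto

text \<open>Reduces a box with arbitrary end lists to a native one by regrouping before and after.
  The condition on \<open>F None\<close> covers states to which the box does not apply.\<close>

lemma box_via:
  assumes "okb (Box xs m ys)" "okb (Box xs' m ys')" "x = tens xs'" "y = tens ys'"
    and native: "\<And>p. at p n xs' \<Longrightarrow> p |>n: Box xs' m ys' = F p"
    and "F None = None"
  shows "p |>n: Box xs m ys = F (p |>n: Box xs (\<i> x) xs') |>n: Box ys' (\<i> y) ys"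
proof -
  have "p |>n: Box xs m ys = p |>n: Box xs (\<i> x) xs' |>n: Box xs' m ys' |>n: Box ys' (\<i> y) ys"
    using assms(1-4) by (subst box_cmp, simp_all) (subst box_cmp, simp_all)
  moreover have "p |>n: Box xs (\<i> x) xs' |>n: Box xs' m ys' = F (p |>n: Box xs (\<i> x) xs')"
    by (rule act_cases[of p n "Box xs (\<i> x) xs'"]) (use assms in \<open>auto\<close>)
  ultimately show ?thesis by simp
qed

lemma box_ten:
  assumes "okb (Box xs (f \<odot> g) ys)" "f \<in> arr V" "g \<in> arr V" "x = tens xs" "y = tens ys"
  shows "p |>n: Box xs (f \<odot> g) ys = p |>n: Box xs (\<i> (src V f \<otimes> src V g)) [src V f, src V g] |>n: Box [src V f] f [trg V f]
    |>Suc n: Box [src V g] g [trg V g] |>n: Box [trg V f, trg V g] (\<i> (trg V f \<otimes> trg V g)) ys"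
  by (rule box_via[where F = "\<lambda>p. p |>n: Box [src V f] f [trg V f] |>Suc n: Box [src V g] g [trg V g]"])
    (use assms in \<open>auto simp: box_ten_native\<close>)

lemma box_ten_id_right:
  assumes "okb (Box xs (f \<odot> \<i> v) ys)" "f \<in> arr V" "v \<in> obj V"
  shows "p |>n: Box xs (f \<odot> \<i> v) ys = p |>n: Box xs (\<i> (src V f \<otimes> v)) [src V f, v] |>n: Box [src V f] f [trg V f]
    |>n: Box [trg V f, v] (\<i> (trg V f \<otimes> v)) ys"
proof (rule box_via[where F = "\<lambda>p. p |>n: Box [src V f] f [trg V f]"])
  fix p assume at: "at p n [src V f, v]"
  then obtain A C where c: "cods p = Some (A @ [src V f, v] @ C)" "n = length A" by (rule at_cods)
  show "p |>n: Box [src V f, v] (f \<odot> \<i> v) [trg V f, v] = p |>n: Box [src V f] f [trg V f]"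
    using assms(2,3) at c by (subst box_ten_native) (auto simp: at_iff intro!: box_id)
qed (use assms in auto)

lemma box_ten_id_left:
  assumes "okb (Box xs (\<i> u \<odot> g) ys)" "g \<in> arr V" "u \<in> obj V"
  shows "p |>n: Box xs (\<i> u \<odot> g) ys = p |>n: Box xs (\<i> (u \<otimes> src V g)) [u, src V g]
    |>Suc n: Box [src V g] g [trg V g] |>n: Box [u, trg V g] (\<i> (u \<otimes> trg V g)) ys"
proof (rule box_via[where F = "\<lambda>p. p |>Suc n: Box [src V g] g [trg V g]"])
  fix p assume at: "at p n [u, src V g]"
  then obtain A C where c: "cods p = Some (A @ [u, src V g] @ C)" "n = length A" by (rule at_cods)
  show "p |>n: Box [u, src V g] (\<i> u \<odot> g) [u, trg V g] = p |>Suc n: Box [src V g] g [trg V g]"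
    using assms(2,3) at c by (subst box_ten_native) (auto simp: at_iff box_id)
qed (use assms in auto)

lemma box_assoc:
  assumes "okb (Box xs (\<alpha> u v w) ys)" "u \<in> obj V" "v \<in> obj V" "w \<in> obj V"
  shows "p |>n: Box xs (\<alpha> u v w) ys = p |>n: Box xs (\<i> ((u \<otimes> v) \<otimes> w)) [u \<otimes> v, w]
    |>n: Box [u \<otimes> v] (\<i> (u \<otimes> v)) [u, v] |>Suc n: PK v w
    |>n: Box [u, v \<otimes> w] (\<i> (u \<otimes> (v \<otimes> w))) ys"
  by (rule box_via[where F = "\<lambda>p. p |>n: Box [u \<otimes> v] (\<i> (u \<otimes> v)) [u, v] |>Suc n: PK v w"])
    (use assms in \<open>auto simp: box_assoc_native\<close>)

text \<open>Derived from the rule for \<open>\<alpha>\<close>: the proposed result \<open>?Q\<close>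
  is taken back to \<open>p\<close> by the associator box, so the inverse box takes \<open>p\<close>
  to \<open>?Q\<close>.\<close>

lemma box_assoc_inv_native:
  assumes "at p n [u, v \<otimes> w]" "u \<in> obj V" "v \<in> obj V" "w \<in> obj V"
  shows "p |>n: Box [u, v \<otimes> w] (\<inverse> (\<alpha> u v w)) [u \<otimes> v, w]
    = p |>Suc n: Box [v \<otimes> w] (\<i> (v \<otimes> w)) [v, w] |>n: PK u v"
proof -
  obtain A C where c: "cods p = Some (A @ [u, v \<otimes> w] @ C)" "n = length A" using assms(1) by (rule at_cods)
  let ?Q = "p |>Suc n: Box [v \<otimes> w] (\<i> (v \<otimes> w)) [v, w] |>n: PK u v"
  have "?Q |>n: Box [u \<otimes> v, w] (\<alpha> u v w) [u, v \<otimes> w] = p"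
    using assms(2-) c by (simp add: box_assoc_native at_iff box_cmp_id box_id)
  then have "p |>n: Box [u, v \<otimes> w] (\<inverse> (\<alpha> u v w)) [u \<otimes> v, w]
     = ?Q |>n: Box [u \<otimes> v, w] (\<alpha> u v w) [u, v \<otimes> w] |>n: Box [u, v \<otimes> w] (\<inverse> (\<alpha> u v w)) [u \<otimes> v, w]"
    by simp
  also have "\<dots> = ?Q"
    using assms(2-) c by (subst box_cmp) (auto simp: at_iff intro!: box_id)
  finally show ?thesis .
qed

lemma box_assoc_inv:
  assumes "okb (Box xs (\<inverse> (\<alpha> u v w)) ys)" "u \<in> obj V" "v \<in> obj V" "w \<in> obj V"
  shows "p |>n: Box xs (\<inverse> (\<alpha> u v w)) ys = p |>n: Box xs (\<i> (u \<otimes> (v \<otimes> w))) [u, v \<otimes> w]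
    |>Suc n: Box [v \<otimes> w] (\<i> (v \<otimes> w)) [v, w] |>n: PK u v
    |>n: Box [u \<otimes> v, w] (\<i> ((u \<otimes> v) \<otimes> w)) ys"
  by (rule box_via[where F = "\<lambda>p. p |>Suc n: Box [v \<otimes> w] (\<i> (v \<otimes> w)) [v, w] |>n: PK u v"])
    (use assms in \<open>auto simp: box_assoc_inv_native\<close>)

lemma box_lunit:
  assumes "okb (Box xs (\<l> u) ys)" "u \<in> obj V"
  shows "p |>n: Box xs (\<l> u) ys = p |>n: Box xs (\<i> (\<one> \<otimes> u)) [\<one>, u]
    |>n: U' |>n: Box [u] (\<i> u) ys"
  by (rule box_via[where F = "\<lambda>p. p |>n: U'"])
    (use assms in \<open>auto simp: box_lunit_native\<close>)

lemma box_runit: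
  assumes "okb (Box xs (\<r> u) ys)" "u \<in> obj V"
  shows "p |>n: Box xs (\<r> u) ys = p |>n: Box xs (\<i> (u \<otimes> \<one>)) [u, \<one>]
    |>Suc n: U' |>n: Box [u] (\<i> u) ys"
  by (rule box_via[where F = "\<lambda>p. p |>Suc n: U'"])
    (use assms in \<open>auto simp: box_runit_native\<close>)

lemma box_lunit_inv_native:
  assumes "at p n [u]" "u \<in> obj V"
  shows "p |>n: Box [u] (\<inverse> (\<l> u)) [\<one>, u] = p |>n: U"
proof -
  obtain A C where c: "cods p = Some (A @ [u] @ C)" "n = length A" using assms(1) by (rule at_cods)
  let ?Q = "p |>n: U"
  have "?Q |>n: Box [\<one>, u] (\<l> u) [u] = p"
    using assms(2-) c by (simp add: box_lunit_native at_iff box_cmp_id box_id)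
  then have "p |>n: Box [u] (\<inverse> (\<l> u)) [\<one>, u]
     = ?Q |>n: Box [\<one>, u] (\<l> u) [u] |>n: Box [u] (\<inverse> (\<l> u)) [\<one>, u]" by simp
  also have "\<dots> = ?Q"
    using assms(2-) c by (subst box_cmp) (auto simp: at_iff intro!: box_id)
  finally show ?thesis .
qed

lemma box_runit_inv_native:
  assumes "at p n [u]" "u \<in> obj V"
  shows "p |>n: Box [u] (\<inverse> (\<r> u)) [u, \<one>] = p |>Suc n: U"
proof -
  obtain A C where c: "cods p = Some (A @ [u] @ C)" "n = length A" using assms(1) by (rule at_cods)
  let ?Q = "p |>Suc n: U"
  have "?Q |>n: Box [u, \<one>] (\<r> u) [u] = p"
    using assms(2-) c by (simp add: box_runit_native at_iff box_cmp_id box_id)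
  then have "p |>n: Box [u] (\<inverse> (\<r> u)) [u, \<one>]
     = ?Q |>n: Box [u, \<one>] (\<r> u) [u] |>n: Box [u] (\<inverse> (\<r> u)) [u, \<one>]" by simp
  also have "\<dots> = ?Q"
    using assms(2-) c by (subst box_cmp) (auto simp: at_iff intro!: box_id)
  finally show ?thesis .
qed

lemma box_lunit_inv:
  assumes "okb (Box xs (\<inverse> (\<l> u)) ys)" "u \<in> obj V"
  shows "p |>n: Box xs (\<inverse> (\<l> u)) ys = p |>n: Box xs (\<i> u) [u]
    |>n: U |>n: Box [\<one>, u] (\<i> (\<one> \<otimes> u)) ys"
  by (rule box_via[where F = "\<lambda>p. p |>n: U"])
    (use assms in \<open>auto simp: box_lunit_inv_native\<close>)

lemma box_runit_inv:
  assumes "okb (Box xs (\<inverse> (\<r> u)) ys)" "u \<in> obj V"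
  shows "p |>n: Box xs (\<inverse> (\<r> u)) ys = p |>n: Box xs (\<i> u) [u]
    |>Suc n: U |>n: Box [u, \<one>] (\<i> (u \<otimes> \<one>)) ys"
  by (rule box_via[where F = "\<lambda>p. p |>Suc n: U"])
    (use assms in \<open>auto simp: box_runit_inv_native\<close>)

lemmas box_expand = box_cmp_expand box_ten box_ten_id_right box_ten_id_left box_assoc box_assoc_inv
  box_lunit box_runit box_lunit_inv box_runit_inv

lemma at_cods_obj:
  assumes "at p n xs"
  obtains A C where "cods p = Some (A @ xs @ C)" "n = length A" "set A \<subseteq> obj V" "set xs \<subseteq> obj V" "set C \<subseteq> obj V"
proof -
  obtain A C where c: "cods p = Some (A @ xs @ C)" "n = length A" using assms by (rule at_cods)
  then have "set (A @ xs @ C) \<subseteq> obj V"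
    by (auto simp: cods_def split: option.splits if_splits)
  then show thesis using that c by auto
qed

text \<open>The reverse of packing: \<open>p\<close> is recovered from the unpacked state
  \<open>?q\<close> by packing, and the two regroupings then cancel.\<close>

lemma box_unpack_native:
  assumes at: "at p n [u, s]" and "u \<in> obj V" "v \<in> obj V" "set vs \<subseteq> obj V" "t = tens (u # v # vs)" "s = tens (v # vs)"
  shows "p |>n: Box [u, s] (\<i> t) (u # v # vs) = p |>Suc n: Box [s] (\<i> s) (v # vs)"
proof -
  obtain A C where c: "cods p = Some (A @ [u, s] @ C)" "n = length A" using at by (rule at_cods)
  have ob: "s \<in> obj V" "t \<in> obj V" and t: "t = u \<otimes> s" using assms by auto
  let ?q = "p |>Suc n: Box [s] (\<i> s) (v # vs)"
  have q: "at ?q n (u # v # vs)" using assms c ob by (auto simp: at_iff)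
  have q2: "at ?q (Suc n) (v # vs)" using assms c ob by (auto simp: at_iff)
  have p: "p = ?q |>n: Box (u # v # vs) (\<i> t) [u, s]"
  proof -
    have "?q |>n: Box (u # v # vs) (\<i> t) [u, s] = ?q |>n: Box (u # v # vs) (\<i> t) [t] |>n: Box [t] (\<i> t) [u, s]"
      using assms ob by (subst box_cmp_id) auto
    also have "\<dots> = ?q |>Suc n: Box (v # vs) (\<i> s) [s] |>n: Box [u, s] (\<i> t) [t] |>n: Box [t] (\<i> t) [u, s]"
      using assms q by (subst box_pack_native[where s = s]) auto
    also have "?q |>Suc n: Box (v # vs) (\<i> s) [s] = p"
      using assms c ob by (subst box_cmp_id) (auto simp: at_iff intro!: box_id)
    also have "p |>n: Box [u, s] (\<i> t) [t] |>n: Box [t] (\<i> t) [u, s] = p"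
      using c ob t assms(2) by (subst box_cmp_id) (auto simp: at_iff intro!: box_id)
    finally show ?thesis by simp
  qed
  have "p |>n: Box [u, s] (\<i> t) (u # v # vs) = ?q |>n: Box (u # v # vs) (\<i> t) [u, s] |>n: Box [u, s] (\<i> t) (u # v # vs)"
    using p by simp
  also have "\<dots> = ?q" using assms ob q t by (subst box_cmp_id) (auto intro!: box_id)
  finally show ?thesis .
qed

end

section \<open>Moving an object past a box\<close>

context braided_monoidal_category
begin

lemma iso_braid [simp]: "\<lbrakk>u \<in> obj V; v \<in> obj V\<rbrakk> \<Longrightarrow> iso (\<beta> u v)"
  and src_braid [simp]: "\<lbrakk>u \<in> obj V; v \<in> obj V\<rbrakk> \<Longrightarrow> src V (\<beta> u v) = u \<otimes> v"
  and trg_braid [simp]: "\<lbrakk>u \<in> obj V; v \<in> obj V\<rbrakk> \<Longrightarrow> trg V (\<beta> u v) = v \<otimes> u"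
  using braid_iso by (auto simp: isos_iff)

lemma arr_braid [simp]: "\<lbrakk>u \<in> obj V; v \<in> obj V\<rbrakk> \<Longrightarrow> \<beta> u v \<in> arr V"
  by (simp add: iso_arr)

abbreviation B :: "'o \<Rightarrow> 'o \<Rightarrow> ('o, 'm) box" where
  "B u v \<equiv> Box [u, v] (\<beta> u v) [v, u]"

abbreviation Bi :: "'o \<Rightarrow> 'o \<Rightarrow> ('o, 'm) box" where
  "Bi u v \<equiv> Box [v, u] (\<inverse> (\<beta> u v)) [u, v]"

lemma box_braid:
  assumes "u \<in> obj V" "v \<in> obj V"
  shows "p |>n: Box [x] (\<beta> u v) [y] = p |>n: Box [x] (\<i> x) [u, v] |>n: B u v |>n: Box [v, u] (\<i> y) [y]"
proof (cases "x = u \<otimes> v \<and> y = v \<otimes> u")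
  case True
  then show ?thesis using assms by (simp add: box_cmp)
next
  case False
  then show ?thesis using assms by (cases "y \<in> obj V") (auto simp: act_not_ok)
qed

lemma B_cancel [simp]:
  assumes "at p n [u, v]" "u \<in> obj V" "v \<in> obj V"
  shows "p |>n: B u v |>n: Bi u v = p"
  using assms by (subst box_cmp) (auto intro: box_id)

lemma Bi_cancel [simp]:
  assumes "at p n [v, u]" "u \<in> obj V" "v \<in> obj V"
  shows "p |>n: Bi u v |>n: B u v = p"
  using assms by (subst box_cmp) (auto intro: box_id)

section \<open>Naturality, hexagons and unit crossings on states\<close>

lemma B_nat_left:
  assumes "at p n [u, v]" "f \<in> arr V" "src V f = u" "trg V f = u'" "v \<in> obj V"
  shows "p |>n: Box [u] f [u'] |>n: B u' v = p |>n: B u v |>Suc n: Box [u] f [u']"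
proof -
  obtain A C where c: "cods p = Some (A @ [u, v] @ C)" "n = length A" using assms(1) by (rule at_cods)
  have ob: "u \<in> obj V" "u' \<in> obj V" using assms by auto
  have "(f \<odot> \<i> v) \<Zsemi> \<beta> u' v = \<beta> u v \<Zsemi> (\<i> v \<odot> f)"
    using assms braid_nat[of f u u' "\<i> v" v v] by (auto simp: hom_iff)
  then have "p |>n: Box [u, v] ((f \<odot> \<i> v) \<Zsemi> \<beta> u' v) [v, u'] = p |>n: Box [u, v] (\<beta> u v \<Zsemi> (\<i> v \<odot> f)) [v, u']"
    by simp
  then show ?thesis using assms ob c
    by (simp add: box_cmp[symmetric, where ys = "[u', v]"] box_cmp[symmetric, where ys = "[v, u]"]
        box_ten_native at_iff box_id)
qed

lemma B_nat_right:
  assumes "at p n [v, u]" "f \<in> arr V" "src V f = u" "trg V f = u'" "v \<in> obj V"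
  shows "p |>Suc n: Box [u] f [u'] |>n: B v u' = p |>n: B v u |>n: Box [u] f [u']"
proof -
  obtain A C where c: "cods p = Some (A @ [v, u] @ C)" "n = length A" using assms(1) by (rule at_cods)
  have ob: "u \<in> obj V" "u' \<in> obj V" using assms by auto
  have "(\<i> v \<odot> f) \<Zsemi> \<beta> v u' = \<beta> v u \<Zsemi> (f \<odot> \<i> v)"
    using assms braid_nat[of "\<i> v" v v f u u'] by (auto simp: hom_iff)
  then have "p |>n: Box [v, u] ((\<i> v \<odot> f) \<Zsemi> \<beta> v u') [u', v] = p |>n: Box [v, u] (\<beta> v u \<Zsemi> (f \<odot> \<i> v)) [u', v]"
    by simp
  then show ?thesis using assms ob c
    by (simp add: box_cmp[symmetric, where ys = "[v, u']"] box_cmp[symmetric, where ys = "[u, v]"]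
        box_ten_native at_iff box_id)
qed

text \<open>The first hexagon without associators: crossing a packed pair is crossing its members in
  turn.\<close>

lemma B_hex_right:
  assumes "at p n [u, v, w]" "u \<in> obj V" "v \<in> obj V" "w \<in> obj V"
  shows "p |>Suc n: PK v w |>n: B u (v \<otimes> w)
    = p |>n: B u v |>Suc n: B u w |>n: PK v w"
proof -
  obtain A C where c: "cods p = Some (A @ [u, v, w] @ C)" "n = length A" using assms(1) by (rule at_cods)
  \<comment> \<open>\<open>?q\<close> packs the strands into the source of the hexagon and
    \<open>?E\<close> unpacks its target; expanding the two sides of the axiom gives the two sides
    of the claim.\<close>
  let ?q = "p |>n: PK u v |>n: PK (u \<otimes> v) w"
  let ?E = "\<lambda>m. ?q |>n: Box [(u \<otimes> v) \<otimes> w] m [v \<otimes> (w \<otimes> u)] |>n: Box [v \<otimes> (w \<otimes> u)] (\<i> (v \<otimes> (w \<otimes> u))) [v, w \<otimes> u]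
     |>Suc n: Box [w \<otimes> u] (\<i> (w \<otimes> u)) [w, u] |>n: PK v w"
  have "?E (\<alpha> u v w \<Zsemi> \<beta> u (v \<otimes> w) \<Zsemi> \<alpha> v w u) = ?E ((\<beta> u v \<odot> \<i> w) \<Zsemi> \<alpha> v u w \<Zsemi> (\<i> v \<odot> \<beta> u w))"
    using hexagon1 assms by simp
  moreover have "?E (\<alpha> u v w \<Zsemi> \<beta> u (v \<otimes> w) \<Zsemi> \<alpha> v w u) = p |>Suc n: PK v w |>n: B u (v \<otimes> w)"
    using assms(2-) c by (simp add: box_expand box_braid box_cmp_id box_id at_iff)
  moreover have "?E ((\<beta> u v \<odot> \<i> w) \<Zsemi> \<alpha> v u w \<Zsemi> (\<i> v \<odot> \<beta> u w)) = p |>n: B u v |>Suc n: B u w |>n: PK v w"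
    using assms(2-) c by (simp add: box_expand box_braid box_cmp_id box_id at_iff)
  ultimately show ?thesis by simp
qed

lemma B_hex_left:
  assumes "at p n [u, v, w]" "u \<in> obj V" "v \<in> obj V" "w \<in> obj V"
  shows "p |>n: PK u v |>n: B (u \<otimes> v) w
    = p |>Suc n: B v w |>n: B u w |>Suc n: PK u v"
proof -
  obtain A C where c: "cods p = Some (A @ [u, v, w] @ C)" "n = length A" using assms(1) by (rule at_cods)
  let ?q = "p |>Suc n: PK v w |>n: PK u (v \<otimes> w)"
  let ?E = "\<lambda>m. ?q |>n: Box [u \<otimes> (v \<otimes> w)] m [(w \<otimes> u) \<otimes> v] |>n: Box [(w \<otimes> u) \<otimes> v] (\<i> ((w \<otimes> u) \<otimes> v)) [w \<otimes> u, v]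
     |>n: Box [w \<otimes> u] (\<i> (w \<otimes> u)) [w, u] |>Suc n: PK u v"
  have "?E (\<inverse> (\<alpha> u v w) \<Zsemi> \<beta> (u \<otimes> v) w \<Zsemi> \<inverse> (\<alpha> w u v)) = ?E ((\<i> u \<odot> \<beta> v w) \<Zsemi> \<inverse> (\<alpha> u w v) \<Zsemi> (\<beta> u w \<odot> \<i> v))"
    using hexagon2 assms by simp
  moreover have "?E (\<inverse> (\<alpha> u v w) \<Zsemi> \<beta> (u \<otimes> v) w \<Zsemi> \<inverse> (\<alpha> w u v)) = p |>n: PK u v |>n: B (u \<otimes> v) w"
    using assms(2-) c by (simp add: box_expand box_braid box_cmp_id box_id at_iff)
  moreover have "?E ((\<i> u \<odot> \<beta> v w) \<Zsemi> \<inverse> (\<alpha> u w v) \<Zsemi> (\<beta> u w \<odot> \<i> v)) = p |>Suc n: B v w |>n: B u w |>Suc n: PK u v"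
    using assms(2-) c by (simp add: box_expand box_braid box_cmp_id box_id at_iff)
  ultimately show ?thesis by simp
qed

lemma box_unit_cancel:
  assumes "at p n []"
  shows "p |>n: U |>n: U' = p"
  using assms by (subst box_cmp_id) (auto intro: box_id)

lemma box_unit_cancel':
  assumes "at p n [\<one>]"
  shows "p |>n: U' |>n: U = p"
  using assms by (subst box_cmp_id) (auto intro: box_id)

lemma box_unit_commute:
  "p |>n: U |>n: U = p |>n: U |>Suc n: U"
  by (subst box_interchange) auto

text \<open>
  Braiding past \<open>\<one> \<otimes> \<one>\<close> is braiding past \<open>\<one>\<close> twice; comparing the two through \<open>\<l> \<one>\<close> shows that braiding
  past \<open>\<one>\<close> is trivial.
\<close>

lemma B_unit_right:
  assumes at: "at p n [x]" and x: "x \<in> obj V"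
  shows "p |>Suc n: U |>n: B x \<one> = p |>n: U"
proof -
  obtain A C where c: "cods p = Some (A @ [x] @ C)" "n = length A" using at by (rule at_cods)
  let ?U = "U" and ?U' = "U'"
  let ?q = "p |>Suc n: ?U" and ?d = "p |>Suc n: ?U |>n: B x \<one> |>n: ?U'"
  let ?r = "?q |>Suc n: ?U"
  have "?q = ?r |>Suc n: ?U'"
    using c x by (subst box_unit_cancel) (auto simp: at_iff)
  also have "\<dots> = ?r |>Suc n: PK \<one> \<one> |>Suc n: Box [\<one> \<otimes> \<one>] (\<l> \<one>) [\<one>]"
    using c x by (subst box_cmp) (simp_all add: box_lunit_native at_iff)
  finally have "?q |>n: B x \<one> = ?r |>Suc n: PK \<one> \<one> |>Suc n: Box [\<one> \<otimes> \<one>] (\<l> \<one>) [\<one>] |>n: B x \<one>"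
    by simp
  also have "\<dots> = ?r |>n: B x \<one> |>Suc n: B x \<one> |>n: ?U'"
    using c x by (subst B_nat_right[where u = "\<one> \<otimes> \<one>"])
      (simp_all add: at_iff B_hex_right box_cmp box_lunit_native)
  also have "\<dots> = ?r |>n: B x \<one> |>n: ?U' |>n: B x \<one>"
    by (subst box_interchange) auto
  also have "?r |>n: B x \<one> |>n: ?U' = ?d |>Suc n: ?U"
    by (simp add: box_unit_commute box_interchange)
  finally have "?q |>n: B x \<one> |>n: Bi x \<one> = ?d |>Suc n: ?U |>n: B x \<one> |>n: Bi x \<one>"
    by simp
  then have "?q |>Suc n: ?U' = ?d |>Suc n: ?U |>Suc n: ?U'"
    using c x by (simp add: at_iff)
  then have "p = ?d"
    using c x by (simp add: at_iff box_unit_cancel)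
  then have "p |>n: ?U = ?q |>n: B x \<one> |>n: ?U' |>n: ?U" by simp
  also have "\<dots> = ?q |>n: B x \<one>"
    using c x by (subst box_unit_cancel') (auto simp: at_iff)
  finally show ?thesis by simp
qed

text \<open>Mirror image of the argument for \<open>B_unit_right\<close>, with the second hexagon
  and \<open>\<r> \<one>\<close>.\<close>

lemma B_unit_left:
  assumes at: "at p n [x]" and x: "x \<in> obj V"
  shows "p |>n: U |>n: B \<one> x = p |>Suc n: U"
proof -
  obtain A C where c: "cods p = Some (A @ [x] @ C)" "n = length A" using at by (rule at_cods)
  let ?U = "U" and ?U' = "U'"
  let ?q = "p |>n: ?U" and ?d = "p |>n: ?U |>n: B \<one> x |>Suc n: ?U'"
  let ?r = "?q |>Suc n: ?U"
  have "?q = ?r |>Suc n: ?U'"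
    using c x by (subst box_unit_cancel) (auto simp: at_iff)
  also have "\<dots> = ?r |>n: PK \<one> \<one> |>n: Box [\<one> \<otimes> \<one>] (\<r> \<one>) [\<one>]"
    using c x by (subst box_cmp) (simp_all add: box_runit_native at_iff)
  finally have "?q |>n: B \<one> x = ?r |>n: PK \<one> \<one> |>n: Box [\<one> \<otimes> \<one>] (\<r> \<one>) [\<one>] |>n: B \<one> x"
    by simp
  also have "\<dots> = ?r |>Suc n: B \<one> x |>n: B \<one> x |>Suc (Suc n): ?U'"
    using c x by (subst B_nat_left[where u = "\<one> \<otimes> \<one>"])
      (simp_all add: at_iff B_hex_left box_cmp box_runit_native)
  also have "\<dots> = ?r |>Suc n: B \<one> x |>Suc (Suc n): ?U' |>n: B \<one> x"
    using box_interchange[of n "B \<one> x" "Suc (Suc n)"] by simp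
  also have "?r |>Suc n: B \<one> x |>Suc (Suc n): ?U' = ?d |>n: ?U"
    using box_interchange[of n ?U n ?q "B \<one> x"] box_interchange[of n ?U "Suc n" "?q |>n: B \<one> x" "?U'"]
    by (simp add: box_unit_commute[symmetric])
  finally have "?q |>n: B \<one> x |>n: Bi \<one> x = ?d |>n: ?U |>n: B \<one> x |>n: Bi \<one> x"
    by simp
  then have "?q |>n: ?U' = ?d |>n: ?U |>n: ?U'"
    using c x by (simp add: at_iff)
  then have "p = ?d"
    using c x by (simp add: at_iff box_unit_cancel)
  then have "p |>Suc n: ?U = ?q |>n: B \<one> x |>Suc n: ?U' |>Suc n: ?U" by simp
  also have "\<dots> = ?q |>n: B \<one> x"
    using c x by (subst box_unit_cancel') (auto simp: at_iff)
  finally show ?thesis by simp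
qed

text \<open>
  \<open>mvr\<close> moves \<open>x\<close> to the right over a list and \<open>mvl\<close> to the left; \<open>mvli\<close> and \<open>mvri\<close> are their
  inverses.
\<close>

fun mvr :: "('m \<times> 'o list) option \<Rightarrow> nat \<Rightarrow> 'o \<Rightarrow> 'o list \<Rightarrow> ('m \<times> 'o list) option" where
  "mvr p n x [] = p"
| "mvr p n x (u # us) = mvr (p |>n: B x u) (Suc n) x us"

fun mvl :: "('m \<times> 'o list) option \<Rightarrow> nat \<Rightarrow> 'o list \<Rightarrow> 'o \<Rightarrow> ('m \<times> 'o list) option" where
  "mvl p n [] x = p"
| "mvl p n (u # us) x = mvl p (Suc n) us x |>n: B u x"

fun mvli :: "('m \<times> 'o list) option \<Rightarrow> nat \<Rightarrow> 'o list \<Rightarrow> 'o \<Rightarrow> ('m \<times> 'o list) option" where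
  "mvli p n [] x = p"
| "mvli p n (u # us) x = mvli p (Suc n) us x |>n: Bi x u"

fun mvri :: "('m \<times> 'o list) option \<Rightarrow> nat \<Rightarrow> 'o \<Rightarrow> 'o list \<Rightarrow> ('m \<times> 'o list) option" where
  "mvri p n x [] = p"
| "mvri p n x (u # us) = mvri (p |>n: Bi u x) (Suc n) x us"

text \<open>Crossing a list strand by strand is one crossing of its tensor product: the hexagon adds
  a strand, and triviality of the unit crossing handles the empty list. Naturality of the braiding
  thereby becomes available for boxes with any end lists.\<close>

lemma mvr_eq:
  assumes "at p n (x # xs)"
  shows "mvr p n x xs = p |>Suc n: Box xs (\<i> (tens xs)) [tens xs] |>n: B x (tens xs) |>n: Box [tens xs] (\<i> (tens xs)) xs"
  using assms
proof (induction xs arbitrary: p n rule: tens.induct)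
  case 1
  then obtain A C where c: "cods p = Some (A @ [x] @ C)" "n = length A" "set A \<subseteq> obj V" "set [x] \<subseteq> obj V" "set C \<subseteq> obj V" by (rule at_cods_obj)
  then show ?case by (simp add: B_unit_right at_iff box_unit_cancel)
next
  case (2 u)
  then obtain A C where c: "cods p = Some (A @ [x, u] @ C)" "n = length A" "set A \<subseteq> obj V" "set [x, u] \<subseteq> obj V" "set C \<subseteq> obj V" by (rule at_cods_obj)
  then show ?case by (simp add: box_id at_iff)
next
  case (3 u v vs)
  obtain A C where c: "cods p = Some (A @ (x # u # v # vs) @ C)" "n = length A" "set A \<subseteq> obj V" "set (x # u # v # vs) \<subseteq> obj V" "set C \<subseteq> obj V"
    using 3(2) by (rule at_cods_obj)
  let ?s = "tens (v # vs)"
  have s: "?s \<in> obj V" using c by simp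
  have "mvr p n x (u # v # vs) = mvr (p |>n: B x u) (Suc n) x (v # vs)" by simp
  also have "\<dots> = p |>n: B x u |>Suc (Suc n): Box (v # vs) (\<i> ?s) [?s] |>Suc n: B x ?s |>Suc n: Box [?s] (\<i> ?s) (v # vs)"
    by (rule 3(1)) (use c in \<open>simp add: at_iff\<close>)
  also have "p |>n: B x u |>Suc (Suc n): Box (v # vs) (\<i> ?s) [?s] = p |>Suc (Suc n): Box (v # vs) (\<i> ?s) [?s] |>n: B x u"
    using box_interchange[of n "B x u" "Suc (Suc n)" p "Box (v # vs) (\<i> ?s) [?s]"] by simp
  also have "p |>Suc (Suc n): Box (v # vs) (\<i> ?s) [?s] |>n: B x u |>Suc n: B x ?s |>Suc n: Box [?s] (\<i> ?s) (v # vs)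
     = p |>Suc (Suc n): Box (v # vs) (\<i> ?s) [?s] |>n: B x u |>Suc n: B x ?s |>n: Box [u, ?s] (\<i> (tens (u # v # vs))) (u # v # vs)"
    by (rule box_unpack_native[symmetric]) (use c s in \<open>auto simp: at_iff\<close>)
  also have "\<dots> = p |>Suc (Suc n): Box (v # vs) (\<i> ?s) [?s] |>n: B x u |>Suc n: B x ?s |>n: Box [u, ?s] (\<i> (tens (u # v # vs))) [tens (u # v # vs)]
      |>n: Box [tens (u # v # vs)] (\<i> (tens (u # v # vs))) (u # v # vs)"
    by (rule box_cmp_id[symmetric]) (use c s in auto)
  also have "p |>Suc (Suc n): Box (v # vs) (\<i> ?s) [?s] |>n: B x u |>Suc n: B x ?s |>n: Box [u, ?s] (\<i> (tens (u # v # vs))) [tens (u # v # vs)]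
     = p |>Suc (Suc n): Box (v # vs) (\<i> ?s) [?s] |>Suc n: Box [u, ?s] (\<i> (tens (u # v # vs))) [tens (u # v # vs)] |>n: B x (tens (u # v # vs))"
    using B_hex_right[of "p |>Suc (Suc n): Box (v # vs) (\<i> ?s) [?s]" n x u ?s] c s by (simp add: at_iff)
  also have "p |>Suc (Suc n): Box (v # vs) (\<i> ?s) [?s] |>Suc n: Box [u, ?s] (\<i> (tens (u # v # vs))) [tens (u # v # vs)]
     = p |>Suc n: Box (u # v # vs) (\<i> (tens (u # v # vs))) [tens (u # v # vs)]"
    by (rule box_pack_native[symmetric]) (use c s in \<open>auto simp: at_iff\<close>)
  finally show ?case .
qed

text \<open>The same for a list crossing a single strand, by the second hexagon.\<close>

lemma mvl_eq:
  assumes "at p n (xs @ [x])"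
  shows "mvl p n xs x = p |>n: Box xs (\<i> (tens xs)) [tens xs] |>n: B (tens xs) x |>Suc n: Box [tens xs] (\<i> (tens xs)) xs"
  using assms
proof (induction xs arbitrary: p n rule: tens.induct)
  case 1
  then have "at p n [x]" by simp
  then obtain A C where c: "cods p = Some (A @ [x] @ C)" "n = length A" "set A \<subseteq> obj V" "set [x] \<subseteq> obj V" "set C \<subseteq> obj V" by (rule at_cods_obj)
  then show ?case by (simp add: B_unit_left at_iff box_unit_cancel)
next
  case (2 u)
  then have "at p n [u, x]" by simp
  then obtain A C where c: "cods p = Some (A @ [u, x] @ C)" "n = length A" "set A \<subseteq> obj V" "set [u, x] \<subseteq> obj V" "set C \<subseteq> obj V" by (rule at_cods_obj)
  then show ?case by (simp add: box_id at_iff)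
next
  case (3 u v vs)
  obtain A C where c: "cods p = Some (A @ ((u # v # vs) @ [x]) @ C)" "n = length A" "set A \<subseteq> obj V" "set ((u # v # vs) @ [x]) \<subseteq> obj V" "set C \<subseteq> obj V"
    using 3(2) by (rule at_cods_obj)
  let ?s = "tens (v # vs)" let ?t = "tens (u # v # vs)"
  have s: "?s \<in> obj V" using c by simp
  let ?p = "p |>Suc n: Box (v # vs) (\<i> ?s) [?s]"
  have "mvl p n (u # v # vs) x = mvl p (Suc n) (v # vs) x |>n: B u x" by simp
  also have "mvl p (Suc n) (v # vs) x = ?p |>Suc n: B ?s x |>Suc (Suc n): Box [?s] (\<i> ?s) (v # vs)"
    by (rule 3(1)) (use c in \<open>simp add: at_iff\<close>)
  also have "?p |>Suc n: B ?s x |>Suc (Suc n): Box [?s] (\<i> ?s) (v # vs) |>n: B u x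
     = ?p |>Suc n: B ?s x |>n: B u x |>Suc (Suc n): Box [?s] (\<i> ?s) (v # vs)"
    by (subst box_interchange) auto
  also have "\<dots> = ?p |>Suc n: B ?s x |>n: B u x |>Suc n: Box [u, ?s] (\<i> ?t) (u # v # vs)"
    by (rule box_unpack_native[symmetric]) (use c s in \<open>auto simp: at_iff\<close>)
  also have "\<dots> = ?p |>Suc n: B ?s x |>n: B u x |>Suc n: Box [u, ?s] (\<i> ?t) [?t] |>Suc n: Box [?t] (\<i> ?t) (u # v # vs)"
    by (rule box_cmp_id[symmetric]) (use c s in auto)
  also have "?p |>Suc n: B ?s x |>n: B u x |>Suc n: Box [u, ?s] (\<i> ?t) [?t] = ?p |>n: Box [u, ?s] (\<i> ?t) [?t] |>n: B ?t x"
    using B_hex_left[of ?p n u ?s x] c s by (simp add: at_iff)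
  also have "?p |>n: Box [u, ?s] (\<i> ?t) [?t] = p |>n: Box (u # v # vs) (\<i> ?t) [?t]"
    by (rule box_pack_native[symmetric]) (use c s in \<open>auto simp: at_iff\<close>)
  finally show ?case .
qed

text \<open>A strand slides past a box: pack the lists into single objects and apply naturality of
  the braiding once. With an empty \<open>xs\<close> or \<open>ys\<close> it also covers boxes that
  create or destroy strands.\<close>

lemma mvr_nat:
  assumes "at p n (x # xs)" and ok: "okb (Box xs m ys)"
  shows "mvr (p |>Suc n: Box xs m ys) n x ys = mvr p n x xs |>n: Box xs m ys"
proof -
  obtain A C where c: "cods p = Some (A @ (x # xs) @ C)" "n = length A" "set A \<subseteq> obj V" "set (x # xs) \<subseteq> obj V" "set C \<subseteq> obj V"
    using assms(1) by (rule at_cods_obj)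
  let ?p = "p |>Suc n: Box xs (\<i> (tens xs)) [tens xs]"
  have "mvr (p |>Suc n: Box xs m ys) n x ys = p |>Suc n: Box xs m [tens ys] |>n: B x (tens ys) |>n: Box [tens ys] (\<i> (tens ys)) ys"
    using c ok by (subst mvr_eq) (auto simp: at_iff box_cmp)
  also have "p |>Suc n: Box xs m [tens ys] = ?p |>Suc n: Box [tens xs] m [tens ys]"
    using c ok by (subst box_cmp) auto
  also have "\<dots> |>n: B x (tens ys) = ?p |>n: B x (tens xs) |>n: Box [tens xs] m [tens ys]"
    using c ok by (subst B_nat_right) (auto simp: at_iff)
  also have "\<dots> |>n: Box [tens ys] (\<i> (tens ys)) ys = ?p |>n: B x (tens xs) |>n: Box [tens xs] (\<i> (tens xs)) xs |>n: Box xs m ys"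
    using c ok by (simp add: box_cmp)
  also have "?p |>n: B x (tens xs) |>n: Box [tens xs] (\<i> (tens xs)) xs = mvr p n x xs"
    by (rule mvr_eq[symmetric]) (rule assms(1))
  finally show ?thesis .
qed

lemma mvl_nat:
  assumes "at p n (xs @ [x])" and ok: "okb (Box xs m ys)"
  shows "mvl (p |>n: Box xs m ys) n ys x = mvl p n xs x |>Suc n: Box xs m ys"
proof -
  obtain A C where c: "cods p = Some (A @ (xs @ [x]) @ C)" "n = length A" "set A \<subseteq> obj V" "set (xs @ [x]) \<subseteq> obj V" "set C \<subseteq> obj V"
    using assms(1) by (rule at_cods_obj)
  let ?p = "p |>n: Box xs (\<i> (tens xs)) [tens xs]"
  have "mvl (p |>n: Box xs m ys) n ys x = p |>n: Box xs m [tens ys] |>n: B (tens ys) x |>Suc n: Box [tens ys] (\<i> (tens ys)) ys"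
    using c ok by (subst mvl_eq) (auto simp: at_iff box_cmp)
  also have "p |>n: Box xs m [tens ys] = ?p |>n: Box [tens xs] m [tens ys]"
    using c ok by (subst box_cmp) auto
  also have "\<dots> |>n: B (tens ys) x = ?p |>n: B (tens xs) x |>Suc n: Box [tens xs] m [tens ys]"
    using c ok by (subst B_nat_left) (auto simp: at_iff)
  also have "\<dots> |>Suc n: Box [tens ys] (\<i> (tens ys)) ys = ?p |>n: B (tens xs) x |>Suc n: Box [tens xs] (\<i> (tens xs)) xs |>Suc n: Box xs m ys"
    using c ok by (simp add: box_cmp)
  also have "?p |>n: B (tens xs) x |>Suc n: Box [tens xs] (\<i> (tens xs)) xs = mvl p n xs x"
    by (rule mvl_eq[symmetric]) (rule assms(1))
  finally show ?thesis .
qed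

lemma cods_mvli:
  "\<lbrakk>cods p = Some (A @ xs @ x # C); n = length A; set xs \<subseteq> obj V; x \<in> obj V\<rbrakk> \<Longrightarrow> cods (mvli p n xs x) = Some (A @ x # xs @ C)"
proof (induction xs arbitrary: A n)
  case (Cons u us)
  have "cods (mvli p (Suc n) us x) = Some ((A @ [u]) @ x # us @ C)"
    by (rule Cons.IH) (use Cons.prems in auto)
  then show ?case using Cons.prems by simp
qed simp

lemma cods_mvl:
  "\<lbrakk>cods p = Some (A @ xs @ x # C); n = length A; set xs \<subseteq> obj V; x \<in> obj V\<rbrakk> \<Longrightarrow> cods (mvl p n xs x) = Some (A @ x # xs @ C)"
proof (induction xs arbitrary: A n)
  case (Cons u us)
  have "cods (mvl p (Suc n) us x) = Some ((A @ [u]) @ x # us @ C)"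
    by (rule Cons.IH) (use Cons.prems in auto)
  then show ?case using Cons.prems by simp
qed simp

lemma cods_mvri:
  "\<lbrakk>cods p = Some (A @ x # xs @ C); n = length A; set xs \<subseteq> obj V; x \<in> obj V\<rbrakk> \<Longrightarrow> cods (mvri p n x xs) = Some (A @ xs @ x # C)"
proof (induction xs arbitrary: A n p)
  case (Cons u us)
  have "cods (mvri (p |>n: Bi u x) (Suc n) x us) = Some ((A @ [u]) @ us @ x # C)"
    by (rule Cons.IH) (use Cons.prems in auto)
  then show ?case by simp
qed simp

lemma mvr_mvli:
  "\<lbrakk>cods p = Some (A @ xs @ x # C); n = length A; set xs \<subseteq> obj V; x \<in> obj V\<rbrakk> \<Longrightarrow> mvr (mvli p n xs x) n x xs = p"
proof (induction xs arbitrary: A n)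
  case (Cons u us)
  have "cods (mvli p (Suc n) us x) = Some ((A @ [u]) @ x # us @ C)"
    by (rule cods_mvli) (use Cons.prems in auto)
  moreover have "mvr (mvli p (Suc n) us x) (Suc n) x us = p"
    by (rule Cons.IH[of "A @ [u]"]) (use Cons.prems in auto)
  ultimately show ?case using Cons.prems by (simp add: at_iff)
qed simp

lemma mvli_mvr:
  "\<lbrakk>cods p = Some (A @ x # xs @ C); n = length A; set xs \<subseteq> obj V; x \<in> obj V\<rbrakk> \<Longrightarrow> mvli (mvr p n x xs) n xs x = p"
proof (induction xs arbitrary: A n p)
  case (Cons u us)
  have "mvli (mvr (p |>n: B x u) (Suc n) x us) (Suc n) us x = p |>n: B x u"
    by (rule Cons.IH[of _ "A @ [u]"]) (use Cons.prems in auto)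
  then show ?case using Cons.prems by (simp add: at_iff)
qed simp

lemma mvl_mvri:
  "\<lbrakk>cods p = Some (A @ x # xs @ C); n = length A; set xs \<subseteq> obj V; x \<in> obj V\<rbrakk> \<Longrightarrow> mvl (mvri p n x xs) n xs x = p"
proof (induction xs arbitrary: A n p)
  case (Cons u us)
  have "mvl (mvri (p |>n: Bi u x) (Suc n) x us) (Suc n) us x = p |>n: Bi u x"
    by (rule Cons.IH[of _ "A @ [u]"]) (use Cons.prems in auto)
  then show ?case using Cons.prems by (simp add: at_iff)
qed simp

lemma mvri_mvl:
  "\<lbrakk>cods p = Some (A @ xs @ x # C); n = length A; set xs \<subseteq> obj V; x \<in> obj V\<rbrakk> \<Longrightarrow> mvri (mvl p n xs x) n x xs = p"
proof (induction xs arbitrary: A n)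
  case (Cons u us)
  have "cods (mvl p (Suc n) us x) = Some ((A @ [u]) @ x # us @ C)"
    by (rule cods_mvl) (use Cons.prems in auto)
  moreover have "mvri (mvl p (Suc n) us x) (Suc n) x us = p"
    by (rule Cons.IH[of "A @ [u]"]) (use Cons.prems in auto)
  ultimately show ?case using Cons.prems by (simp add: at_iff)
qed simp

text \<open>Inverse crossings slide as well. Write \<open>p\<close> as a forward crossing of
  \<open>?q\<close>, slide there, and cancel.\<close>

lemma mvli_nat:
  assumes "at p n (xs @ [x])" and ok: "okb (Box xs m ys)"
  shows "mvli (p |>n: Box xs m ys) n ys x = mvli p n xs x |>Suc n: Box xs m ys"
proof -
  obtain A C where c: "cods p = Some (A @ (xs @ [x]) @ C)" "n = length A" "set A \<subseteq> obj V" "set (xs @ [x]) \<subseteq> obj V" "set C \<subseteq> obj V"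
    using assms(1) by (rule at_cods_obj)
  let ?q = "mvli p n xs x"
  have q: "cods ?q = Some (A @ x # xs @ C)" "mvr ?q n x xs = p"
    using c by (auto intro!: cods_mvli mvr_mvli)
  have "p |>n: Box xs m ys = mvr (?q |>Suc n: Box xs m ys) n x ys"
    using q c ok by (subst mvr_nat) (auto simp: at_iff)
  moreover have "cods (?q |>Suc n: Box xs m ys) = Some (A @ x # ys @ C)"
    using q c ok by simp
  ultimately show ?thesis
    using c ok by (metis mvli_mvr okb_Box append.simps set_append Un_iff list.set_intros(1) subsetD)
qed

lemma mvri_nat:
  assumes "at p n (x # xs)" and ok: "okb (Box xs m ys)"
  shows "mvri (p |>Suc n: Box xs m ys) n x ys = mvri p n x xs |>n: Box xs m ys"
proof -
  obtain A C where c: "cods p = Some (A @ (x # xs) @ C)" "n = length A" "set A \<subseteq> obj V" "set (x # xs) \<subseteq> obj V" "set C \<subseteq> obj V"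
    using assms(1) by (rule at_cods_obj)
  let ?q = "mvri p n x xs"
  have q: "cods ?q = Some (A @ xs @ x # C)" "mvl ?q n xs x = p"
    using c by (auto intro!: cods_mvri mvl_mvri)
  have "p |>Suc n: Box xs m ys = mvl (?q |>n: Box xs m ys) n ys x"
    using q c ok by (subst mvl_nat) (auto simp: at_iff)
  moreover have "cods (?q |>n: Box xs m ys) = Some (A @ ys @ x # C)"
    using q c ok by simp
  ultimately show ?thesis
    using c ok by (metis mvri_mvl okb_Box set_append Un_iff list.set_intros(1) subsetD)
qed

end

section \<open>Internal homs\<close>

context monoidal_category
begin

section \<open>Splitting off the argument of an evaluation\<close>

text \<open>A mate takes its argument \<open>u\<close> and the tensor product of everything else, so
  all strands but the first have to be packed.\<close>

lemma box_pack_head: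
  assumes at: "at p n (u # v # vs)" and "t = tens (u # v # vs)" "s = tens (v # vs)"
  shows "p |>n: Box (u # v # vs) (\<i> t) [u, s] = p |>Suc n: Box (v # vs) (\<i> s) [s]"
proof -
  obtain A C where c: "cods p = Some (A @ (u # v # vs) @ C)" "n = length A" "set A \<subseteq> obj V" "set (u # v # vs) \<subseteq> obj V" "set C \<subseteq> obj V"
    using at by (rule at_cods_obj)
  have ob: "s \<in> obj V" "t \<in> obj V" and t: "t = u \<otimes> s" using assms c by auto
  have "p |>n: Box (u # v # vs) (\<i> t) [u, s] = p |>n: Box (u # v # vs) (\<i> t) [t] |>n: Box [t] (\<i> t) [u, s]"
    using assms c ob by (subst box_cmp_id) auto
  also have "\<dots> = p |>Suc n: Box (v # vs) (\<i> s) [s] |>n: Box [u, s] (\<i> t) [t] |>n: Box [t] (\<i> t) [u, s]"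
    using assms c by (subst box_pack_native[where s = s]) auto
  also have "\<dots> = p |>Suc n: Box (v # vs) (\<i> s) [s]"
    using c ob t assms by (subst box_cmp_id) (auto simp: at_iff intro!: box_id)
  finally show ?thesis .
qed

text \<open>An arrow out of the unit consumes a unit strand; this separates the consumption from the
  arrow, which then acts on the empty list and can move freely.\<close>

lemma box_split_nil:
  assumes "m \<in> arr V" "src V m = \<one>"
  shows "p |>n: Box [\<one>] m ys = p |>n: U' |>n: Box [] m ys"
proof (cases "okb (Box [\<one>] m ys)")
  case True then show ?thesis using assms by (subst box_cmp) auto
qed (use assms in \<open>auto simp: act_not_ok\<close>)

lemma box_split_cons:
  assumes "m \<in> arr V" "src V m = u \<otimes> v" "u \<in> obj V" "v \<in> obj V"
  shows "p |>n: Box [x] m ys = p |>n: Box [x] (\<i> x) [u, v] |>n: Box [u, v] m ys"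
proof (cases "okb (Box [x] m ys)")
  case True then show ?thesis using assms by (subst box_cmp) auto
next
  case False
  then have "\<not> okb (Box [x] (\<i> x) [u, v]) \<or> \<not> okb (Box [u, v] m ys)" using assms by auto
  then show ?thesis using False by (auto simp: act_not_ok simp del: okb_Box)
qed

end

context braided_closed_monoidal_category
begin

declare ihom_obj [simp]

section \<open>Currying, evaluation and names\<close>

lemma arr_mate [simp]:
  "\<lbrakk>f \<in> arr V; src V f = u \<otimes> w; u \<in> obj V; w \<in> obj V\<rbrakk> \<Longrightarrow> mate V u w f \<in> arr V"
  and src_mate [simp]:
  "\<lbrakk>f \<in> arr V; src V f = u \<otimes> w; u \<in> obj V; w \<in> obj V\<rbrakk> \<Longrightarrow> src V (mate V u w f) = w"
  and trg_mate [simp]: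
  "\<lbrakk>f \<in> arr V; src V f = u \<otimes> w; u \<in> obj V; w \<in> obj V\<rbrakk> \<Longrightarrow> trg V (mate V u w f) = ihom V u (trg V f)"
  using bij_betwE[OF mate_bij[of u "trg V f" w], rule_format, of f] by (auto simp: hom_iff)

lemma unmate_hom:
  assumes "u \<in> obj V" "v \<in> obj V" "w \<in> obj V" "g \<in> hom V w (ihom V u v)"
  shows "unmate V u w v g \<in> hom V (u \<otimes> w) v" "mate V u w (unmate V u w v g) = g"
  using mate_bij[OF assms(1-3)] assms(4) unfolding unmate_def bij_betw_def
  by (auto intro!: the_inv_into_into f_the_inv_into_f)

lemma arr_ev [simp]: "\<lbrakk>u \<in> obj V; v \<in> obj V\<rbrakk> \<Longrightarrow> \<epsilon> u v \<in> arr V"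
  and src_ev [simp]: "\<lbrakk>u \<in> obj V; v \<in> obj V\<rbrakk> \<Longrightarrow> src V (\<epsilon> u v) = u \<otimes> ihom V u v"
  and trg_ev [simp]: "\<lbrakk>u \<in> obj V; v \<in> obj V\<rbrakk> \<Longrightarrow> trg V (\<epsilon> u v) = v"
  and mate_ev [simp]: "\<lbrakk>u \<in> obj V; v \<in> obj V\<rbrakk> \<Longrightarrow> mate V u (ihom V u v) (\<epsilon> u v) = \<i> (ihom V u v)"
  using unmate_hom[of u v "ihom V u v" "\<i> (ihom V u v)"] unfolding ev_def by (auto simp: hom_iff)

text \<open>Naturality of \<open>mate\<close> at \<open>\<epsilon>\<close>, the arrow whose mate is
  the identity.\<close>

lemma mate_uncurry:
  assumes "h \<in> arr V" "trg V h = ihom V u v" "u \<in> obj V" "v \<in> obj V" "src V h = w"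
  shows "mate V u w ((\<i> u \<odot> h) \<Zsemi> \<epsilon> u v) = h"
  using mate_nat[of u "\<epsilon> u v" "ihom V u v" v h w] assms by (auto simp: hom_iff)

lemma uncurry_mate:
  assumes "f \<in> arr V" "src V f = u \<otimes> w" "trg V f = v" "u \<in> obj V" "w \<in> obj V"
  shows "(\<i> u \<odot> mate V u w f) \<Zsemi> \<epsilon> u v = f"
proof -
  have v: "v \<in> obj V" using assms by auto
  have "mate V u w ((\<i> u \<odot> mate V u w f) \<Zsemi> \<epsilon> u v) = mate V u w f"
    using assms v by (intro mate_uncurry) auto
  moreover have "inj_on (mate V u w) (hom V (u \<otimes> w) v)"
    using mate_bij assms v by (auto simp: bij_betw_def)
  ultimately show ?thesis using assms v by (auto simp: inj_on_def hom_iff)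
qed

lemma unmate_eq:
  assumes "h \<in> arr V" "trg V h = ihom V u v" "u \<in> obj V" "v \<in> obj V" "src V h = w"
  shows "unmate V u w v h = (\<i> u \<odot> h) \<Zsemi> \<epsilon> u v"
proof -
  have w: "w \<in> obj V" using assms by auto
  have "inj_on (mate V u w) (hom V (u \<otimes> w) v)"
    using mate_bij assms w by (auto simp: bij_betw_def)
  then show ?thesis
    using assms w unmate_hom[of u v w h] mate_uncurry[of h u v w] by (auto simp: inj_on_def hom_iff)
qed

text \<open>The beta rule: evaluating a mate returns the original arrow.\<close>

lemma box_mate:
  assumes at: "at p n (u # x # xs)" and f: "f \<in> arr V" "src V f = u \<otimes> w" "trg V f = v"
    and w: "w = tens (x # xs)" and ys: "set ys \<subseteq> obj V" "v = tens ys"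
  shows "p |>Suc n: Box (x # xs) (mate V u w f) [ihom V u v] |>n: Box [u, ihom V u v] (\<epsilon> u v) ys
    = p |>n: Box (u # x # xs) f ys"
proof -
  obtain A C where c: "cods p = Some (A @ (u # x # xs) @ C)" "n = length A" "set A \<subseteq> obj V" "set (u # x # xs) \<subseteq> obj V" "set C \<subseteq> obj V"
    using at by (rule at_cods_obj)
  have ob: "u \<in> obj V" "w \<in> obj V" "v \<in> obj V" using f w c by auto
  have "p |>n: Box (u # x # xs) f ys = p |>n: Box (u # x # xs) (\<i> (u \<otimes> w)) [u, w] |>n: Box [u, w] f ys"
    using c f w ys ob by (subst box_cmp) auto
  also have "p |>n: Box (u # x # xs) (\<i> (u \<otimes> w)) [u, w] = p |>Suc n: Box (x # xs) (\<i> w) [w]"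
    using box_pack_head[OF at _ w] w by simp
  also have "\<dots> |>n: Box [u, w] f ys = \<dots> |>n: Box [u, w] ((\<i> u \<odot> mate V u w f) \<Zsemi> \<epsilon> u v) ys"
    using f ob by (simp add: uncurry_mate)
  also have "\<dots> = p |>Suc n: Box (x # xs) (\<i> w) [w] |>n: Box [u, w] (\<i> u \<odot> mate V u w f) [u, ihom V u v] |>n: Box [u, ihom V u v] (\<epsilon> u v) ys"
    using f ob ys by (subst box_cmp) auto
  also have "p |>Suc n: Box (x # xs) (\<i> w) [w] |>n: Box [u, w] (\<i> u \<odot> mate V u w f) [u, ihom V u v]
    = p |>Suc n: Box (x # xs) (\<i> w) [w] |>Suc n: Box [w] (mate V u w f) [ihom V u v]"
    using c f ob w by (subst box_ten_native) (simp_all add: at_iff box_id)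
  also have "\<dots> = p |>Suc n: Box (x # xs) (mate V u w f) [ihom V u v]"
    using c f ob w by (subst box_cmp) auto
  finally show ?thesis by simp
qed

lemma arr_name [simp]: "\<lbrakk>f \<in> arr V; src V f = v\<rbrakk> \<Longrightarrow> name V v f \<in> arr V"
  and src_name [simp]: "\<lbrakk>f \<in> arr V; src V f = v\<rbrakk> \<Longrightarrow> src V (name V v f) = \<one>"
  and trg_name [simp]: "\<lbrakk>f \<in> arr V; src V f = v\<rbrakk> \<Longrightarrow> trg V (name V v f) = ihom V v (trg V f)"
  by (auto simp: name_def)

text \<open>The beta rule for names, kept separate because no strand follows \<open>u\<close> here;
  the unit created for the name is absorbed by \<open>\<r> u\<close>.\<close>

lemma box_name:
  assumes at: "at p n [u]" and f: "f \<in> arr V" "src V f = u" "trg V f = v" and ys: "set ys \<subseteq> obj V" "v = tens ys"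
  shows "p |>Suc n: Box [] (name V u f) [ihom V u v] |>n: Box [u, ihom V u v] (\<epsilon> u v) ys = p |>n: Box [u] f ys"
proof -
  obtain A C where c: "cods p = Some (A @ [u] @ C)" "n = length A" "set A \<subseteq> obj V" "set [u] \<subseteq> obj V" "set C \<subseteq> obj V"
    using at by (rule at_cods_obj)
  have v: "v \<in> obj V" using f by auto
  have ok: "okb (Box [u, \<one>] (\<r> u) [u])" "okb (Box [u] f ys)" using c(4) f ys by simp_all
  let ?q = "p |>Suc n: U"
  have 1: "p |>Suc n: Box [] (name V u f) [ihom V u v] = ?q |>Suc n: Box [\<one>] (mate V u \<one> (\<r> u \<Zsemi> f)) [ihom V u v]"
    using c f v by (subst box_cmp) (auto simp: name_def)
  have 2: "?q |>Suc n: Box [\<one>] (mate V u \<one> (\<r> u \<Zsemi> f)) [ihom V u v] |>n: Box [u, ihom V u v] (\<epsilon> u v) ys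
      = ?q |>n: Box [u, \<one>] (\<r> u \<Zsemi> f) ys"
    using c f ys v box_mate[of ?q n u "\<one>" "[]" "\<r> u \<Zsemi> f" "\<one>" v ys] by (simp add: at_iff)
  have 3: "?q |>n: Box [u, \<one>] (\<r> u \<Zsemi> f) ys = ?q |>n: Box [u, \<one>] (\<r> u) [u] |>n: Box [u] f ys"
    by (rule box_cmp[OF ok, symmetric])
  have 4: "?q |>n: Box [u, \<one>] (\<r> u) [u] = p"
    using c by (simp add: box_runit_native box_unit_cancel at_iff)
  show ?thesis unfolding 1 2 3 4 ..
qed

lemma name_surj:
  assumes "g \<in> arr V" "src V g = \<one>" "trg V g = ihom V u v" "u \<in> obj V" "v \<in> obj V"
  shows "unname V u v g \<in> arr V" "src V (unname V u v g) = u" "trg V (unname V u v g) = v"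
    "name V u (unname V u v g) = g"
  using assms by (auto simp: unname_def name_def unmate_eq mate_uncurry)

text \<open>The eta rule: arrows into an internal hom are determined by their evaluations. The empty
  list is a separate case since \<open>tens [u]\<close> is \<open>u\<close> and not
  \<open>u \<otimes> \<one>\<close>; there the arrows are names.\<close>

lemma mate_inj:
  assumes f: "f \<in> arr V" "src V f = tens ws" "trg V f = ihom V u v"
    and g: "g \<in> arr V" "src V g = tens ws" "trg V g = ihom V u v"
    and ob: "u \<in> obj V" "v \<in> obj V" "set ws \<subseteq> obj V" "set ys \<subseteq> obj V" "v = tens ys"
    and eq: "start (u # ws) |>Suc 0: Box ws f [ihom V u v] |>0: Box [u, ihom V u v] (\<epsilon> u v) ys
      = start (u # ws) |>Suc 0: Box ws g [ihom V u v] |>0: Box [u, ihom V u v] (\<epsilon> u v) ys"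
  shows "f = g"
proof (cases ws)
  case Nil
  let ?F = "unname V u v f" and ?G = "unname V u v g"
  have F: "?F \<in> arr V" "src V ?F = u" "trg V ?F = v" "name V u ?F = f"
    using name_surj[of f u v] f ob Nil by auto
  have G: "?G \<in> arr V" "src V ?G = u" "trg V ?G = v" "name V u ?G = g"
    using name_surj[of g u v] g ob Nil by auto
  have "start [u] |>0: Box [u] ?F ys = start [u] |>0: Box [u] ?G ys"
    using box_name[of "start [u]" 0 u ?F v ys] box_name[of "start [u]" 0 u ?G v ys] eq F G ob Nil by (simp add: at_iff)
  then have "?F = ?G" by (rule box_inj[rotated -1]) (use F G ob in auto)
  then show ?thesis using F G by metis
next
  case (Cons x xs)
  let ?w = "tens ws"
  let ?F = "(\<i> u \<odot> f) \<Zsemi> \<epsilon> u v" and ?G = "(\<i> u \<odot> g) \<Zsemi> \<epsilon> u v"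
  have F: "?F \<in> arr V" "src V ?F = u \<otimes> ?w" "trg V ?F = v" "mate V u ?w ?F = f"
    using f ob by (auto simp: mate_uncurry)
  have G: "?G \<in> arr V" "src V ?G = u \<otimes> ?w" "trg V ?G = v" "mate V u ?w ?G = g"
    using g ob by (auto simp: mate_uncurry)
  have "start (u # ws) |>0: Box (u # ws) ?F ys = start (u # ws) |>0: Box (u # ws) ?G ys"
    using box_mate[of "start (u # ws)" 0 u x xs ?F ?w v ys] box_mate[of "start (u # ws)" 0 u x xs ?G ?w v ys] eq ob F G unfolding Cons
    by (simp add: at_iff)
  then have "?F = ?G" by (rule box_inj[rotated -1]) (use F G ob Cons in auto)
  then show ?thesis using F G by metis
qed

end

section \<open>Enriched categories\<close>

locale enriched_category = braided_closed_monoidal_category V + V_category V C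
  for V :: "('o, 'm, 'z) bcm_scheme" (structure) and C :: "('a, 'o, 'm, 'y) vcat_scheme"
begin

declare vhom_obj [simp]

lemma arr_vid [simp]: "a \<in> vobj C \<Longrightarrow> vid C a \<in> arr V"
  and src_vid [simp]: "a \<in> vobj C \<Longrightarrow> src V (vid C a) = \<one>"
  and trg_vid [simp]: "a \<in> vobj C \<Longrightarrow> trg V (vid C a) = vhom C a a"
  using vid_hom by (auto simp: hom_iff)

lemma arr_vcmp [simp]: "\<lbrakk>a \<in> vobj C; b \<in> vobj C; c \<in> vobj C\<rbrakk> \<Longrightarrow> vcmp C a b c \<in> arr V"
  and src_vcmp [simp]: "\<lbrakk>a \<in> vobj C; b \<in> vobj C; c \<in> vobj C\<rbrakk> \<Longrightarrow> src V (vcmp C a b c) = vhom C a b \<otimes> vhom C b c"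
  and trg_vcmp [simp]: "\<lbrakk>a \<in> vobj C; b \<in> vobj C; c \<in> vobj C\<rbrakk> \<Longrightarrow> trg V (vcmp C a b c) = vhom C a c"
  using vcmp_hom by (auto simp: hom_iff)

abbreviation M :: "'a \<Rightarrow> 'a \<Rightarrow> 'a \<Rightarrow> ('o, 'm) box" where
  "M a b c \<equiv> Box [vhom C a b, vhom C b c] (vcmp C a b c) [vhom C a c]"

abbreviation J :: "'a \<Rightarrow> ('o, 'm) box" where
  "J a \<equiv> Box [] (vid C a) [vhom C a a]"

lemma box_vcmp:
  "\<lbrakk>a \<in> vobj C; b \<in> vobj C; c \<in> vobj C\<rbrakk> \<Longrightarrow> p |>n: Box [x] (vcmp C a b c) ys
    = p |>n: Box [x] (\<i> x) [vhom C a b, vhom C b c] |>n: Box [vhom C a b, vhom C b c] (vcmp C a b c) ys"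
  by (rule box_split_cons) auto

lemma box_vid: "a \<in> vobj C \<Longrightarrow> p |>n: Box [\<one>] (vid C a) ys = p |>n: U' |>n: Box [] (vid C a) ys"
  by (rule box_split_nil) auto

text \<open>The unit law on states: its unitor becomes the deletion of the unit that was inserted,
  leaving nothing behind.\<close>

lemma J_M_left:
  assumes "at p n [vhom C a b]" "a \<in> vobj C" "b \<in> vobj C"
  shows "p |>n: J a |>n: M a a b = p"
proof -
  let ?h = "vhom C a b"
  obtain A D where c: "cods p = Some (A @ [?h] @ D)" "n = length A" using assms(1) by (rule at_cods)
  have "p |>n: U |>n: Box [\<one>, ?h] ((vid C a \<odot> \<i> ?h) \<Zsemi> vcmp C a a b) [?h]
     = p |>n: U |>n: Box [\<one>, ?h] (\<l> ?h) [?h]"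
    using assms by (simp add: vid_left)
  then show ?thesis using c assms by (simp add: box_expand box_vcmp box_vid box_cmp_id box_id at_iff)
qed

lemma J_M_right:
  assumes "at p n [vhom C a b]" "a \<in> vobj C" "b \<in> vobj C"
  shows "p |>Suc n: J b |>n: M a b b = p"
proof -
  let ?h = "vhom C a b"
  obtain A D where c: "cods p = Some (A @ [?h] @ D)" "n = length A" using assms(1) by (rule at_cods)
  have "p |>Suc n: U |>n: Box [?h, \<one>] ((\<i> ?h \<odot> vid C b) \<Zsemi> vcmp C a b b) [?h]
     = p |>Suc n: U |>n: Box [?h, \<one>] (\<r> ?h) [?h]"
    using assms by (simp add: vid_right)
  then show ?thesis using c assms by (simp add: box_expand box_vcmp box_vid box_cmp_id box_id at_iff)
qed

lemma M_assoc:
  assumes "at p n [vhom C a b, vhom C b c, vhom C c d]" "a \<in> vobj C" "b \<in> vobj C" "c \<in> vobj C" "d \<in> vobj C"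
  shows "p |>n: M a b c |>n: M a c d = p |>Suc n: M b c d |>n: M a b d"
proof -
  let ?ab = "vhom C a b" and ?bc = "vhom C b c" and ?cd = "vhom C c d"
  obtain A D where c: "cods p = Some (A @ [?ab, ?bc, ?cd] @ D)" "n = length A" using assms(1) by (rule at_cods)
  let ?E = "\<lambda>m. p |>n: PK ?ab ?bc |>n: Box [?ab \<otimes> ?bc, ?cd] m [vhom C a d]"
  have "?E ((vcmp C a b c \<odot> \<i> ?cd) \<Zsemi> vcmp C a c d) = ?E (\<alpha> ?ab ?bc ?cd \<Zsemi> (\<i> ?ab \<odot> vcmp C b c d) \<Zsemi> vcmp C a b d)"
    using assms by (simp add: vcmp_assoc)
  then show ?thesis using c assms(2-) by (simp add: box_expand box_vcmp box_vid box_cmp_id box_id at_iff)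
qed

section \<open>Pre- and postcomposition with underlying arrows\<close>

context
  fixes a b c assumes ob [simp]: "a \<in> vobj C" "b \<in> vobj C" "c \<in> vobj C"
begin

lemma postcmp_typ [simp]:
  assumes "g \<in> arr V" "src V g = \<one>" "trg V g = vhom C b c"
  shows "postcmp V C a b c g \<in> arr V" "src V (postcmp V C a b c g) = vhom C a b" "trg V (postcmp V C a b c g) = vhom C a c"
  using assms by (auto simp: postcmp_def)

lemma precmp_typ [simp]:
  assumes "f \<in> arr V" "src V f = \<one>" "trg V f = vhom C a b"
  shows "precmp V C a b c f \<in> arr V" "src V (precmp V C a b c f) = vhom C b c" "trg V (precmp V C a b c f) = vhom C a c"
  using assms by (auto simp: precmp_def)

lemma ucmp_typ [simp]:
  assumes "f \<in> arr V" "src V f = \<one>" "trg V f = vhom C a b" "g \<in> arr V" "src V g = \<one>" "trg V g = vhom C b c"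
  shows "ucmp V C a b c f g \<in> arr V" "src V (ucmp V C a b c f g) = \<one>" "trg V (ucmp V C a b c f g) = vhom C a c"
  using assms by (auto simp: ucmp_def)

lemma box_postcmp:
  assumes "at p n [vhom C a b]" "g \<in> arr V" "src V g = \<one>" "trg V g = vhom C b c"
  shows "p |>n: Box [vhom C a b] (postcmp V C a b c g) [vhom C a c] = p |>Suc n: Box [] g [vhom C b c] |>n: M a b c"
proof -
  obtain A D where c: "cods p = Some (A @ [vhom C a b] @ D)" "n = length A" using assms(1) by (rule at_cods)
  show ?thesis using c assms(2-)
    by (simp add: postcmp_def box_expand box_vcmp box_split_nil[of g] box_cmp_id box_id at_iff)
qed

lemma box_precmp:
  assumes "at p n [vhom C b c]" "f \<in> arr V" "src V f = \<one>" "trg V f = vhom C a b"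
  shows "p |>n: Box [vhom C b c] (precmp V C a b c f) [vhom C a c] = p |>n: Box [] f [vhom C a b] |>n: M a b c"
proof -
  obtain A D where c: "cods p = Some (A @ [vhom C b c] @ D)" "n = length A" using assms(1) by (rule at_cods)
  show ?thesis using c assms(2-)
    by (simp add: precmp_def box_expand box_vcmp box_split_nil[of f] box_cmp_id box_id at_iff)
qed

lemma box_ucmp:
  assumes "at p n []" "f \<in> arr V" "src V f = \<one>" "trg V f = vhom C a b" "g \<in> arr V" "src V g = \<one>" "trg V g = vhom C b c"
  shows "p |>n: Box [] (ucmp V C a b c f g) [vhom C a c]
    = p |>n: Box [] f [vhom C a b] |>Suc n: Box [] g [vhom C b c] |>n: M a b c"
proof -
  obtain A D where c: "cods p = Some (A @ [] @ D)" "n = length A" using assms(1) by (rule at_cods)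
  have "p |>n: Box [] (ucmp V C a b c f g) [vhom C a c] = p |>n: U |>n: Box [\<one>] (ucmp V C a b c f g) [vhom C a c]"
    using assms by (subst box_cmp) auto
  then show ?thesis using c assms(2-)
    by (simp add: ucmp_def box_expand box_vcmp box_split_nil[of f] box_split_nil[of g] box_cmp_id box_id at_iff box_interchange)
qed

end

end

context monoidal_category
begin

text \<open>The normalisation set: decompose arrows, merge regroupings, drop identities and let left
  boxes act first.\<close>

lemmas box_norm = box_expand box_cmp_id box_id at_iff box_interchange

end

section \<open>Tensored categories\<close>

context braided_closed_monoidal_category
begin

text \<open>Evaluating a composite of internal homs is evaluating twice.\<close>

lemma box_self_vcmp:
  assumes at: "at p n [u, ihom V u v, ihom V v w]" and ob: "u \<in> obj V" "v \<in> obj V" "w \<in> obj V"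
    and ys: "set ys \<subseteq> obj V" "w = tens ys"
  shows "p |>Suc n: Box [ihom V u v, ihom V v w] (vcmp (self V) u v w) [ihom V u w] |>n: Box [u, ihom V u w] (\<epsilon> u w) ys
    = p |>n: Box [u, ihom V u v] (\<epsilon> u v) [v] |>n: Box [v, ihom V v w] (\<epsilon> v w) ys"
proof -
  obtain A C where c: "cods p = Some (A @ [u, ihom V u v, ihom V v w] @ C)" "n = length A" using at by (rule at_cods)
  let ?h = "ihom V u v" and ?k = "ihom V v w"
  let ?F = "\<inverse> (\<alpha> u ?h ?k) \<Zsemi> (\<epsilon> u v \<odot> \<i> ?k) \<Zsemi> \<epsilon> v w"
  have "p |>Suc n: Box [?h, ?k] (vcmp (self V) u v w) [ihom V u w] |>n: Box [u, ihom V u w] (\<epsilon> u w) ys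
    = p |>n: Box [u, ?h, ?k] ?F ys"
    unfolding self_def using at ob ys box_mate[of p n u ?h "[?k]" ?F "?h \<otimes> ?k" w ys] by simp
  also have "\<dots> = p |>n: Box [u, ?h, ?k] (\<i> (u \<otimes> (?h \<otimes> ?k))) [u, ?h \<otimes> ?k] |>n: Box [u, ?h \<otimes> ?k] ?F ys"
    using ob ys by (subst box_cmp) auto
  also have "p |>n: Box [u, ?h, ?k] (\<i> (u \<otimes> (?h \<otimes> ?k))) [u, ?h \<otimes> ?k] = p |>Suc n: PK ?h ?k"
    using at box_pack_head[of p n u ?h "[?k]"] by simp
  finally show ?thesis
    using c ob ys by (simp add: box_norm box_split_cons[of "\<epsilon> u v" u ?h] box_split_cons[of "\<epsilon> v (tens ys)" v "ihom V v (tens ys)"])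
qed

end

context enriched_category
begin

section \<open>The universal property of a tensoring\<close>

context
  fixes T :: "('a, 'o, 'm) tensoring"
  assumes T: "is_tensoring V C T"
begin

lemma tensoring_adj: "c \<in> vobj C \<Longrightarrow> V_adjunction V (self V) C (tfun T c) (representable V C c) (tiso T c)"
  using T by (simp add: is_tensoring_def)

lemma representable_functor: "c \<in> vobj C \<Longrightarrow> V_functor V C (self V) (representable V C c)"
  using tensoring_adj by (auto simp: V_adjunction_def)

lemma tobj_obj [simp]: "\<lbrakk>c \<in> vobj C; v \<in> obj V\<rbrakk> \<Longrightarrow> tobj T c v \<in> vobj C"
  using tensoring_adj[of c] by (auto simp: V_adjunction_def V_functor_def self_def tobj_def)

lemma tiso_isos:
  "\<lbrakk>c \<in> vobj C; v \<in> obj V; b \<in> vobj C\<rbrakk> \<Longrightarrow> tiso T c v b \<in> isos V (vhom C (tobj T c v) b) (ihom V v (vhom C c b))"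
  using tensoring_adj[of c] by (auto simp: V_adjunction_def self_def representable_def tobj_def)

lemma tiso_typ [simp]:
  assumes "c \<in> vobj C" "v \<in> obj V" "b \<in> vobj C"
  shows "iso (tiso T c v b)" "tiso T c v b \<in> arr V" "src V (tiso T c v b) = vhom C (tobj T c v) b"
    "trg V (tiso T c v b) = ihom V v (vhom C c b)"
  using tiso_isos[OF assms] by (auto simp: isos_iff iso_arr)

lemma tiso_nat:
  assumes "c \<in> vobj C" "v \<in> obj V" "b \<in> vobj C" "b' \<in> vobj C"
  shows "vcmp C (tobj T c v) b b' \<Zsemi> tiso T c v b'
    = (tiso T c v b \<odot> mate V (vhom C c b) (vhom C b b') (vcmp C c b b')) \<Zsemi> vcmp (self V) v (vhom C c b) (vhom C c b')"
  using tensoring_adj[OF assms(1)] assms unfolding V_adjunction_def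
  by (simp add: self_def[of V] representable_def tobj_def)

abbreviation eta :: "'a \<Rightarrow> 'o \<Rightarrow> 'm" where
  "eta c v \<equiv> tunit V C T c v"

context
  fixes c v assumes cv [simp]: "c \<in> vobj C" "v \<in> obj V"
begin

abbreviation (input) "ct \<equiv> tobj T c v"

abbreviation (input) "H \<equiv> Box [v] (eta c v) [vhom C c ct]"

lemma vid_tiso: "name V v (eta c v) = vid C ct \<Zsemi> tiso T c v ct"
  and eta_typ [simp]: "eta c v \<in> arr V" "src V (eta c v) = v" "trg V (eta c v) = vhom C c ct"
  using name_surj[of "vid C ct \<Zsemi> tiso T c v ct" v "vhom C c ct"] unfolding tunit_def by auto

text \<open>An enriched Yoneda argument: naturality in \<open>b\<close> determines the adjunction
  isomorphism from its value \<open>\<eta>\<close> at the identity, so evaluating it means applying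
  \<open>\<eta>\<close> and composing.\<close>

lemma box_tiso:
  assumes at: "at p n [v, vhom C ct b]" and b: "b \<in> vobj C"
  shows "p |>Suc n: Box [vhom C ct b] (tiso T c v b) [ihom V v (vhom C c b)]
      |>n: Box [v, ihom V v (vhom C c b)] (\<epsilon> v (vhom C c b)) [vhom C c b]
    = p |>n: H |>n: M c ct b"
proof -
  let ?tb = "vhom C ct b" and ?tt = "vhom C ct ct" and ?cb = "vhom C c b" and ?ct = "vhom C c ct"
  let ?E = "\<lambda>p. p |>n: Box [v, ihom V v ?cb] (\<epsilon> v ?cb) [?cb]"
  obtain A D where c: "cods p = Some (A @ [v, ?tb] @ D)" "n = length A" using at by (rule at_cods)
  \<comment> \<open>Inserting an identity of \<open>ct\<close> in front of the hom strand gives the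
    naturality of \<open>tiso\<close> something to act on.\<close>
  let ?q = "p |>Suc n: J ct"
  have q: "cods ?q = Some (A @ [v, ?tt, ?tb] @ D)" using c by simp
  let ?R = "mate V ?ct ?tb (vcmp C c ct b)"
  have "p |>Suc n: Box [?tb] (tiso T c v b) [ihom V v ?cb]
     = ?q |>Suc n: M ct ct b |>Suc n: Box [?tb] (tiso T c v b) [ihom V v ?cb]"
    using c b by (simp add: J_M_left at_iff)
  also have "\<dots> = ?q |>Suc n: Box [?tt, ?tb] (vcmp C ct ct b \<Zsemi> tiso T c v b) [ihom V v ?cb]"
    using b by (simp add: box_cmp)
  also have "\<dots> = ?q |>Suc n: Box [?tt, ?tb] ((tiso T c v ct \<odot> ?R) \<Zsemi> vcmp (self V) v ?ct ?cb) [ihom V v ?cb]"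
    using b by (simp add: tiso_nat)
  also have "\<dots> = ?q |>Suc n: Box [?tt, ?tb] (tiso T c v ct \<odot> ?R) [ihom V v ?ct, ihom V ?ct ?cb] |>Suc n: Box [ihom V v ?ct, ihom V ?ct ?cb] (vcmp (self V) v ?ct ?cb) [ihom V v ?cb]"
    using b by (subst box_cmp) (auto simp: self_def)
  also have "?q |>Suc n: Box [?tt, ?tb] (tiso T c v ct \<odot> ?R) [ihom V v ?ct, ihom V ?ct ?cb]
     = ?q |>Suc n: Box [?tt] (tiso T c v ct) [ihom V v ?ct] |>Suc (Suc n): Box [?tb] ?R [ihom V ?ct ?cb]"
    using b c by (subst box_ten_native) (auto simp: at_iff)
  also have "?q |>Suc n: Box [?tt] (tiso T c v ct) [ihom V v ?ct] = p |>Suc n: Box [] (name V v (eta c v)) [ihom V v ?ct]"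
    by (simp add: box_cmp vid_tiso)
  finally have "?E (p |>Suc n: Box [?tb] (tiso T c v b) [ihom V v ?cb])
     = p |>Suc n: Box [] (name V v (eta c v)) [ihom V v ?ct] |>Suc (Suc n): Box [?tb] ?R [ihom V ?ct ?cb]
       |>n: Box [v, ihom V v ?ct] (\<epsilon> v ?ct) [?ct] |>n: Box [?ct, ihom V ?ct ?cb] (\<epsilon> ?ct ?cb) [?cb]"
    using b c by (simp add: box_self_vcmp at_iff)
  also have "p |>Suc n: Box [] (name V v (eta c v)) [ihom V v ?ct] |>Suc (Suc n): Box [?tb] ?R [ihom V ?ct ?cb]
       |>n: Box [v, ihom V v ?ct] (\<epsilon> v ?ct) [?ct]
     = p |>Suc n: Box [] (name V v (eta c v)) [ihom V v ?ct] |>n: Box [v, ihom V v ?ct] (\<epsilon> v ?ct) [?ct] |>Suc n: Box [?tb] ?R [ihom V ?ct ?cb]"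
    by (subst box_interchange) auto
  also have "p |>Suc n: Box [] (name V v (eta c v)) [ihom V v ?ct] |>n: Box [v, ihom V v ?ct] (\<epsilon> v ?ct) [?ct] = p |>n: H"
    using c by (intro box_name) (auto simp: at_iff)
  also have "p |>n: H |>Suc n: Box [?tb] ?R [ihom V ?ct ?cb] |>n: Box [?ct, ihom V ?ct ?cb] (\<epsilon> ?ct ?cb) [?cb] = p |>n: H |>n: M c ct b"
    using c b by (intro box_mate) (auto simp: at_iff)
  finally show ?thesis .
qed

lemma tmate_typ [simp]:
  assumes "f \<in> arr V" "src V f = v" "trg V f = vhom C c b" "b \<in> vobj C"
  shows "tmate V T c v b f \<in> arr V" "src V (tmate V T c v b f) = \<one>" "trg V (tmate V T c v b f) = vhom C ct b"
  using assms by (auto simp: tmate_def)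

text \<open>Existence in the universal property of \<open>\<eta>\<close>: every
  \<open>v \<rightarrow> C(c, b)\<close> factors through \<open>\<eta>\<close> and its mate.\<close>

lemma box_tmate:
  assumes at: "at p n [v]" and b: "b \<in> vobj C" and f: "f \<in> arr V" "src V f = v" "trg V f = vhom C c b"
  shows "p |>n: H |>Suc n: Box [] (tmate V T c v b f) [vhom C ct b] |>n: M c ct b = p |>n: Box [v] f [vhom C c b]"
proof -
  let ?tb = "vhom C ct b" and ?cb = "vhom C c b" and ?f = "tmate V T c v b f"
  obtain A D where c: "cods p = Some (A @ [v] @ D)" "n = length A" using at by (rule at_cods)
  have "p |>n: H |>Suc n: Box [] ?f [?tb] |>n: M c ct b = p |>Suc n: Box [] ?f [?tb] |>n: H |>n: M c ct b"
    by (simp add: box_interchange)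
  also have "\<dots> = p |>Suc n: Box [] ?f [?tb] |>Suc n: Box [?tb] (tiso T c v b) [ihom V v ?cb] |>n: Box [v, ihom V v ?cb] (\<epsilon> v ?cb) [?cb]"
    using b c f by (intro box_tiso[symmetric]) (auto simp: at_iff)
  also have "p |>Suc n: Box [] ?f [?tb] |>Suc n: Box [?tb] (tiso T c v b) [ihom V v ?cb] = p |>Suc n: Box [] (name V v f) [ihom V v ?cb]"
    using b f by (simp add: box_cmp tmate_def cmp_assoc_arr)
  also have "\<dots> |>n: Box [v, ihom V v ?cb] (\<epsilon> v ?cb) [?cb] = p |>n: Box [v] f [?cb]"
    using at b f by (intro box_name) auto
  finally show ?thesis .
qed

text \<open>Uniqueness in the universal property, with parameters \<open>ws\<close>:
  \<open>tiso\<close> is invertible and \<open>mate_inj\<close> evaluates it. For empty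
  \<open>ws\<close> it concerns underlying arrows out of \<open>c \<lhd> v\<close>.\<close>

lemma tensor_ext:
  assumes f: "f \<in> arr V" "src V f = tens ws" "trg V f = vhom C ct b"
    and g: "g \<in> arr V" "src V g = tens ws" "trg V g = vhom C ct b"
    and ob: "b \<in> vobj C" "set ws \<subseteq> obj V"
    and eq: "start (v # ws) |>0: H |>Suc 0: Box ws f [vhom C ct b] |>0: M c ct b
      = start (v # ws) |>0: H |>Suc 0: Box ws g [vhom C ct b] |>0: M c ct b"
  shows "f = g"
proof -
  let ?tb = "vhom C ct b" and ?cb = "vhom C c b"
  have *: "start (v # ws) |>Suc 0: Box ws (m \<Zsemi> tiso T c v b) [ihom V v ?cb] |>0: Box [v, ihom V v ?cb] (\<epsilon> v ?cb) [?cb]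
     = start (v # ws) |>0: H |>Suc 0: Box ws m [?tb] |>0: M c ct b"
    if m: "m \<in> arr V" "src V m = tens ws" "trg V m = ?tb" for m
  proof -
    have "start (v # ws) |>Suc 0: Box ws (m \<Zsemi> tiso T c v b) [ihom V v ?cb]
       = start (v # ws) |>Suc 0: Box ws m [?tb] |>Suc 0: Box [?tb] (tiso T c v b) [ihom V v ?cb]"
      using m ob by (subst box_cmp) auto
    then have "start (v # ws) |>Suc 0: Box ws (m \<Zsemi> tiso T c v b) [ihom V v ?cb] |>0: Box [v, ihom V v ?cb] (\<epsilon> v ?cb) [?cb]
      = start (v # ws) |>Suc 0: Box ws m [?tb] |>0: H |>0: M c ct b"
      using m ob by (simp add: box_tiso at_iff)
    then show ?thesis by (simp add: box_interchange)
  qed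
  have "f \<Zsemi> tiso T c v b = g \<Zsemi> tiso T c v b"
    by (rule mate_inj[of _ ws v ?cb _ "[?cb]"]) (use f g ob eq in \<open>auto simp: *\<close>)
  then show ?thesis
    by (rule iso_cancel_right[rotated 5]) (use f g ob in auto)
qed

end

end

end

context braided_closed_monoidal_category
begin

text \<open>Asks only that the composition arrow have the right type, so that it applies directly to
  \<open>self V\<close>.\<close>

lemma box_ucmp_raw:
  assumes "at p n []" "f \<in> arr V" "src V f = \<one>" "g \<in> arr V" "src V g = \<one>"
    "vcmp D a b c \<in> arr V" "src V (vcmp D a b c) = trg V f \<otimes> trg V g"
  shows "p |>n: Box [] (ucmp V D a b c f g) [trg V (vcmp D a b c)]
    = p |>n: Box [] f [trg V f] |>Suc n: Box [] g [trg V g] |>n: Box [trg V f, trg V g] (vcmp D a b c) [trg V (vcmp D a b c)]"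
proof -
  obtain A E where c: "cods p = Some (A @ [] @ E)" "n = length A" using assms(1) by (rule at_cods)
  have "p |>n: Box [] (ucmp V D a b c f g) [trg V (vcmp D a b c)] = p |>n: U |>n: Box [\<one>] (ucmp V D a b c f g) [trg V (vcmp D a b c)]"
    using assms by (subst box_cmp) (auto simp: ucmp_def)
  then show ?thesis using c assms(2-)
    by (simp add: ucmp_def box_norm box_split_cons[of "vcmp D a b c" "trg V f" "trg V g"] box_split_nil[of f] box_split_nil[of g])
qed

subsection \<open>The tensoring of the self-enrichment\<close>

lemma name_inj:
  assumes "name V u f = name V u g" "f \<in> arr V" "g \<in> arr V" "src V f = u" "src V g = u" "trg V f = trg V g"
  shows "f = g"
proof -
  have "start [u] |>0: Box [u] f [trg V f] = start [u] |>0: Box [u] g [trg V f]"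
    using box_name[of "start [u]" 0 u f "trg V f" "[trg V f]"] box_name[of "start [u]" 0 u g "trg V f" "[trg V f]"] assms
    by (auto simp: at_iff)
  then show ?thesis by (rule box_inj[rotated -1]) (use assms in auto)
qed

lemma self_simps [simp]: "vobj (self V) = obj V" "vhom (self V) = ihom V" "vid (self V) = (\<lambda>u. name V u (\<i> u))"
  by (simp_all add: self_def)

lemma self_vcmp_typ [simp]:
  assumes "u \<in> obj V" "v \<in> obj V" "w \<in> obj V"
  shows "vcmp (self V) u v w \<in> arr V" "src V (vcmp (self V) u v w) = ihom V u v \<otimes> ihom V v w" "trg V (vcmp (self V) u v w) = ihom V u w"
  using assms by (auto simp: self_def)

text \<open>Naming is functorial; together with \<open>name_surj\<close> this identifies the
  underlying category of \<open>self V\<close> with \<open>V\<close>.\<close>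

lemma ucmp_self:
  assumes f: "f \<in> arr V" "src V f = u" "trg V f = v" and g: "g \<in> arr V" "src V g = v" "trg V g = w"
  shows "ucmp V (self V) u v w (name V u f) (name V v g) = name V u (f \<Zsemi> g)"
proof (rule mate_inj[of _ "[]" u w _ "[w]"])
  have ob: "u \<in> obj V" "v \<in> obj V" "w \<in> obj V" using f g by auto
  show "ucmp V (self V) u v w (name V u f) (name V v g) \<in> arr V"
    "src V (ucmp V (self V) u v w (name V u f) (name V v g)) = tens []"
    "trg V (ucmp V (self V) u v w (name V u f) (name V v g)) = ihom V u w"
    using f g ob by (auto simp: ucmp_def)
  let ?s = "start [u]"
  have "?s |>Suc 0: Box [] (ucmp V (self V) u v w (name V u f) (name V v g)) [ihom V u w]
     = ?s |>Suc 0: Box [] (name V u f) [ihom V u v] |>Suc (Suc 0): Box [] (name V v g) [ihom V v w]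
         |>Suc 0: Box [ihom V u v, ihom V v w] (vcmp (self V) u v w) [ihom V u w]"
    using box_ucmp_raw[of ?s "Suc 0" "name V u f" "name V v g" "self V" u v w] f g ob by (simp add: at_iff)
  then have "?s |>Suc 0: Box [] (ucmp V (self V) u v w (name V u f) (name V v g)) [ihom V u w] |>0: Box [u, ihom V u w] (\<epsilon> u w) [w]
     = ?s |>Suc 0: Box [] (name V u f) [ihom V u v] |>Suc (Suc 0): Box [] (name V v g) [ihom V v w]
         |>0: Box [u, ihom V u v] (\<epsilon> u v) [v] |>0: Box [v, ihom V v w] (\<epsilon> v w) [w]"
    using f g ob by (simp add: box_self_vcmp at_iff)
  also have "\<dots> = ?s |>Suc 0: Box [] (name V u f) [ihom V u v] |>0: Box [u, ihom V u v] (\<epsilon> u v) [v]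
        |>Suc 0: Box [] (name V v g) [ihom V v w] |>0: Box [v, ihom V v w] (\<epsilon> v w) [w]"
    by (simp add: box_interchange)
  also have "\<dots> = ?s |>0: Box [u] (f \<Zsemi> g) [w]"
    using f g ob by (simp add: box_name at_iff box_cmp)
  also have "\<dots> = ?s |>Suc 0: Box [] (name V u (f \<Zsemi> g)) [ihom V u w] |>0: Box [u, ihom V u w] (\<epsilon> u w) [w]"
    using f g ob by (simp add: box_name at_iff)
  finally show "start (u # []) |>Suc 0: Box [] (ucmp V (self V) u v w (name V u f) (name V v g)) [ihom V u w] |>0: Box [u, ihom V u w] (\<epsilon> u w) [w]
     = start (u # []) |>Suc 0: Box [] (name V u (f \<Zsemi> g)) [ihom V u w] |>0: Box [u, ihom V u w] (\<epsilon> u w) [w]" .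
qed (use f g in auto)

text \<open>Carries invertibility across that identification, so tensoredness of a functor into
  \<open>self V\<close> becomes invertibility of arrows of \<open>V\<close>.\<close>

lemma name_uisos_self:
  assumes f: "f \<in> arr V" "src V f = u" "trg V f = v"
  shows "name V u f \<in> uisos V (self V) u v \<longleftrightarrow> iso f"
proof
  have ob: "u \<in> obj V" "v \<in> obj V" using f by auto
  assume "name V u f \<in> uisos V (self V) u v"
  then obtain g where g: "g \<in> hom V \<one> (ihom V v u)" "ucmp V (self V) u v u (name V u f) g = name V u (\<i> u)"
    "ucmp V (self V) v u v g (name V u f) = name V v (\<i> v)"
    by (auto simp: uisos_def uhom_def)
  then obtain g' where g': "g' \<in> arr V" "src V g' = v" "trg V g' = u" "name V v g' = g"
    using name_surj[of g v u] ob by (auto simp: hom_iff)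
  have "name V u (f \<Zsemi> g') = name V u (\<i> u)" "name V v (g' \<Zsemi> f) = name V v (\<i> v)"
    using g g' f ob ucmp_self[of f u v g' u] ucmp_self[of g' v u f v] by auto
  then have "f \<Zsemi> g' = \<i> u" "g' \<Zsemi> f = \<i> v"
    using f g' ob by (auto dest!: name_inj)
  then show "iso f" using f g' by (intro isoI(1)[of f g']) auto
next
  have ob: "u \<in> obj V" "v \<in> obj V" using f by auto
  assume "iso f"
  then show "name V u f \<in> uisos V (self V) u v"
    using f ob ucmp_self[of f u v "\<inverse> f" u] ucmp_self[of "\<inverse> f" v u f v]
    by (auto simp: uisos_def uhom_def hom_iff intro!: bexI[of _ "name V v (\<inverse> f)"])
qed

context
  fixes u v w :: 'o
  assumes ob [simp]: "u \<in> obj V" "v \<in> obj V" "w \<in> obj V"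
begin

abbreviation (input) "S \<equiv> tiso (self_tensoring V) u v w"

lemma self_tiso_typ [simp]:
  shows "S \<in> arr V" "src V S = ihom V (u \<otimes> v) w" "trg V S = ihom V v (ihom V u w)"
  by (auto simp: self_tensoring_def)

text \<open>Currying: evaluating \<open>S\<close> at \<open>v\<close> and then at \<open>u\<close>
  is one evaluation at \<open>u \<otimes> v\<close>.\<close>

lemma box_self_tiso:
  assumes at: "at p n [u, v, ihom V (u \<otimes> v) w]" and ys: "set ys \<subseteq> obj V" "w = tens ys"
  shows "p |>Suc (Suc n): Box [ihom V (u \<otimes> v) w] S [ihom V v (ihom V u w)]
      |>Suc n: Box [v, ihom V v (ihom V u w)] (\<epsilon> v (ihom V u w)) [ihom V u w] |>n: Box [u, ihom V u w] (\<epsilon> u w) ys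
    = p |>n: PK u v |>n: Box [u \<otimes> v, ihom V (u \<otimes> v) w] (\<epsilon> (u \<otimes> v) w) ys"
proof -
  let ?h = "ihom V (u \<otimes> v) w"
  let ?G = "\<inverse> (\<alpha> u v ?h) \<Zsemi> \<epsilon> (u \<otimes> v) w"
  let ?F = "mate V u (v \<otimes> ?h) ?G"
  obtain A C where c: "cods p = Some (A @ [u, v, ?h] @ C)" "n = length A" using at by (rule at_cods)
  have 1: "p |>Suc (Suc n): Box [?h] S [ihom V v (ihom V u w)] |>Suc n: Box [v, ihom V v (ihom V u w)] (\<epsilon> v (ihom V u w)) [ihom V u w]
     = p |>Suc n: Box [v, ?h] ?F [ihom V u w]"
    unfolding self_tensoring_def using c box_mate[of p "Suc n" v ?h "[]" ?F ?h "ihom V u w" "[ihom V u w]"] by (simp add: at_iff)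
  have 2: "p |>Suc n: Box [v, ?h] ?F [ihom V u w] |>n: Box [u, ihom V u w] (\<epsilon> u w) ys = p |>n: Box [u, v, ?h] ?G ys"
    using c box_mate[of p n u v "[?h]" ?G "v \<otimes> ?h" w ys] ys by (simp add: at_iff)
  have 3: "p |>n: Box [u, v, ?h] ?G ys = p |>n: Box [u, v, ?h] (\<i> (u \<otimes> (v \<otimes> ?h))) [u, v \<otimes> ?h] |>n: Box [u, v \<otimes> ?h] ?G ys"
    using ys by (subst box_cmp) auto
  have 4: "p |>n: Box [u, v, ?h] (\<i> (u \<otimes> (v \<otimes> ?h))) [u, v \<otimes> ?h] = p |>Suc n: PK v ?h"
    using at box_pack_head[of p n u v "[?h]"] by simp
  have ob': "tens ys \<in> obj V" using ob(3) ys by simp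
  show ?thesis unfolding 1 2 3 4
    using c ob' ys by (simp add: box_norm box_split_cons[of "\<epsilon> (u \<otimes> v) (tens ys)" "u \<otimes> v" "ihom V (u \<otimes> v) (tens ys)"])
qed

lemma iso_self_tiso [simp]: "iso S"
proof -
  let ?h = "ihom V (u \<otimes> v) w" and ?k = "ihom V v (ihom V u w)"
  let ?G = "\<alpha> u v ?k \<Zsemi> (\<i> u \<odot> \<epsilon> v (ihom V u w)) \<Zsemi> \<epsilon> u w"
  \<comment> \<open>The candidate inverse uncurries: evaluate at \<open>v\<close>, then at
    \<open>u\<close>.\<close>
  let ?N = "mate V (u \<otimes> v) ?k ?G"
  have N [simp]: "?N \<in> arr V" "src V ?N = ?k" "trg V ?N = ?h" by auto
  have boxN: "p |>Suc n: Box [?k] ?N [?h] |>n: Box [u \<otimes> v, ?h] (\<epsilon> (u \<otimes> v) w) [w]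
    = p |>n: Box [u \<otimes> v] (\<i> (u \<otimes> v)) [u, v] |>Suc n: Box [v, ?k] (\<epsilon> v (ihom V u w)) [ihom V u w] |>n: Box [u, ihom V u w] (\<epsilon> u w) [w]"
    if at: "at p n [u \<otimes> v, ?k]" for p n
  proof -
    obtain A C where c: "cods p = Some (A @ [u \<otimes> v, ?k] @ C)" "n = length A" using at by (rule at_cods)
    have "p |>Suc n: Box [?k] ?N [?h] |>n: Box [u \<otimes> v, ?h] (\<epsilon> (u \<otimes> v) w) [w] = p |>n: Box [u \<otimes> v, ?k] ?G [w]"
      using at box_mate[of p n "u \<otimes> v" ?k "[]" ?G ?k w "[w]"] by simp
    then show ?thesis using c
      by (simp add: box_norm box_split_cons[of "\<epsilon> v (ihom V u w)" v ?k] box_split_cons[of "\<epsilon> u w" u "ihom V u w"])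
  qed
  have "S \<Zsemi> ?N = \<i> ?h"
  proof (rule mate_inj[of _ "[?h]" "u \<otimes> v" w _ "[w]"])
    let ?s = "start [u \<otimes> v, ?h]"
    have "?s |>Suc 0: Box [?h] (S \<Zsemi> ?N) [?h] = ?s |>Suc 0: Box [?h] S [?k] |>Suc 0: Box [?k] ?N [?h]"
      by (subst box_cmp) auto
    then have "?s |>Suc 0: Box [?h] (S \<Zsemi> ?N) [?h] |>0: Box [u \<otimes> v, ?h] (\<epsilon> (u \<otimes> v) w) [w]
      = ?s |>Suc 0: Box [?h] S [?k] |>0: Box [u \<otimes> v] (\<i> (u \<otimes> v)) [u, v] |>Suc 0: Box [v, ?k] (\<epsilon> v (ihom V u w)) [ihom V u w] |>0: Box [u, ihom V u w] (\<epsilon> u w) [w]"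
      using boxN[of "?s |>Suc 0: Box [?h] S [?k]" 0] by (simp add: at_iff)
    also have "\<dots> = ?s |>0: Box [u \<otimes> v] (\<i> (u \<otimes> v)) [u, v] |>Suc (Suc 0): Box [?h] S [?k] |>Suc 0: Box [v, ?k] (\<epsilon> v (ihom V u w)) [ihom V u w] |>0: Box [u, ihom V u w] (\<epsilon> u w) [w]"
      by (simp add: box_interchange)
    also have "\<dots> = ?s |>0: Box [u \<otimes> v] (\<i> (u \<otimes> v)) [u, v] |>0: PK u v |>0: Box [u \<otimes> v, ?h] (\<epsilon> (u \<otimes> v) w) [w]"
      by (rule box_self_tiso) (auto simp: at_iff)
    finally show "start ((u \<otimes> v) # [?h]) |>Suc 0: Box [?h] (S \<Zsemi> ?N) [?h] |>0: Box [u \<otimes> v, ?h] (\<epsilon> (u \<otimes> v) w) [w]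
       = start ((u \<otimes> v) # [?h]) |>Suc 0: Box [?h] (\<i> ?h) [?h] |>0: Box [u \<otimes> v, ?h] (\<epsilon> (u \<otimes> v) w) [w]"
      by (simp add: box_norm)
  qed auto
  moreover have "?N \<Zsemi> S = \<i> ?k"
  proof (rule mate_inj[of _ "[?k]" v "ihom V u w" _ "[ihom V u w]"])
    let ?W = "ihom V u w" let ?s = "start [v, ?k]"
    let ?E = "Box [v, ?k] (\<epsilon> v ?W) [?W]" and ?e = "Box [u, ?W] (\<epsilon> u w) [w]"
    let ?X = "(\<i> v \<odot> (?N \<Zsemi> S)) \<Zsemi> \<epsilon> v ?W"
    have X: "p |>n: Box [v, ?k] ?X [?W] = p |>Suc n: Box [?k] (?N \<Zsemi> S) [?k] |>n: ?E" if "at p n [v, ?k]" for p n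
    proof -
      obtain A C where c: "cods p = Some (A @ [v, ?k] @ C)" "n = length A" using \<open>at p n [v, ?k]\<close> by (rule at_cods)
      have "p |>n: Box [v, ?k] ?X [?W] = p |>n: Box [v, ?k] (\<i> v \<odot> (?N \<Zsemi> S)) [v, ?k] |>n: ?E"
        by (subst box_cmp) auto
      then show ?thesis using c by (simp add: box_ten_native at_iff box_id)
    qed
    \<comment> \<open>After evaluation at \<open>v\<close> the target is still the internal hom
      \<open>?W\<close>, so a second evaluation at \<open>u\<close> is needed to compare.\<close>
    have "?X = \<epsilon> v ?W"
    proof (rule mate_inj[of _ "[v, ?k]" u w _ "[w]"])
      let ?t = "start [u, v, ?k]"
      have "?t |>Suc 0: Box [v, ?k] ?X [?W] |>0: ?e = ?t |>Suc (Suc 0): Box [?k] ?N [?h] |>Suc (Suc 0): Box [?h] S [?k] |>Suc 0: ?E |>0: ?e"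
        by (simp add: X at_iff box_cmp)
      also have "\<dots> = ?t |>Suc (Suc 0): Box [?k] ?N [?h] |>0: PK u v |>0: Box [u \<otimes> v, ?h] (\<epsilon> (u \<otimes> v) w) [w]"
        by (rule box_self_tiso) (auto simp: at_iff)
      also have "\<dots> = ?t |>0: PK u v |>Suc 0: Box [?k] ?N [?h] |>0: Box [u \<otimes> v, ?h] (\<epsilon> (u \<otimes> v) w) [w]"
        by (simp add: box_interchange)
      also have "\<dots> = ?t |>0: PK u v |>0: Box [u \<otimes> v] (\<i> (u \<otimes> v)) [u, v] |>Suc 0: ?E |>0: ?e"
        by (rule boxN) (simp add: at_iff)
      finally show "start (u # [v, ?k]) |>Suc 0: Box [v, ?k] ?X [?W] |>0: ?e = start (u # [v, ?k]) |>Suc 0: Box [v, ?k] (\<epsilon> v ?W) [?W] |>0: ?e"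
        by (simp add: box_norm)
    qed auto
    then show "start (v # [?k]) |>Suc 0: Box [?k] (?N \<Zsemi> S) [?k] |>0: ?E = start (v # [?k]) |>Suc 0: Box [?k] (\<i> ?k) [?k] |>0: ?E"
      using X[of ?s 0] by (simp add: at_iff box_id)
  qed auto
  ultimately show ?thesis by (intro isoI(1)[of _ ?N]) auto
qed

lemma name_self_tiso:
  assumes f: "f \<in> arr V" "src V f = u \<otimes> v" "trg V f = w"
  shows "name V (u \<otimes> v) f \<Zsemi> S = name V v (mate V u v f)"
proof -
  let ?h = "ihom V (u \<otimes> v) w" and ?k = "ihom V v (ihom V u w)" and ?W = "ihom V u w"
  let ?g = "unname V v ?W (name V (u \<otimes> v) f \<Zsemi> S)"
  have g: "?g \<in> arr V" "src V ?g = v" "trg V ?g = ?W" "name V v ?g = name V (u \<otimes> v) f \<Zsemi> S"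
    using name_surj[of "name V (u \<otimes> v) f \<Zsemi> S" v ?W] f by auto
  have "?g = mate V u v f"
  proof (rule mate_inj[of _ "[v]" u w _ "[w]"])
    let ?s = "start [u, v]" and ?e = "Box [u, ?W] (\<epsilon> u w) [w]"
    have "?s |>Suc 0: Box [v] ?g [?W] |>0: ?e
      = ?s |>Suc (Suc 0): Box [] (name V v ?g) [?k] |>Suc 0: Box [v, ?k] (\<epsilon> v ?W) [?W] |>0: ?e"
      using g box_name[of ?s "Suc 0" v ?g ?W "[?W]"] by (simp add: at_iff)
    also have "\<dots> = ?s |>Suc (Suc 0): Box [] (name V (u \<otimes> v) f) [?h] |>Suc (Suc 0): Box [?h] S [?k] |>Suc 0: Box [v, ?k] (\<epsilon> v ?W) [?W] |>0: ?e"
      unfolding g(4) using f by (subst box_cmp) auto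
    also have "\<dots> = ?s |>Suc (Suc 0): Box [] (name V (u \<otimes> v) f) [?h] |>0: PK u v |>0: Box [u \<otimes> v, ?h] (\<epsilon> (u \<otimes> v) w) [w]"
      using f by (intro box_self_tiso) (auto simp: at_iff)
    also have "\<dots> = ?s |>0: PK u v |>Suc 0: Box [] (name V (u \<otimes> v) f) [?h] |>0: Box [u \<otimes> v, ?h] (\<epsilon> (u \<otimes> v) w) [w]"
      by (simp add: box_interchange)
    also have "\<dots> = ?s |>0: Box [u, v] f [w]"
      using f by (simp add: box_name at_iff box_cmp)
    also have "\<dots> = ?s |>Suc 0: Box [v] (mate V u v f) [?W] |>0: ?e"
      using f box_mate[of ?s 0 u v "[]" f v w "[w]"] by (simp add: at_iff)
    finally show "start (u # [v]) |>Suc 0: Box [v] ?g [?W] |>0: ?e = start (u # [v]) |>Suc 0: Box [v] (mate V u v f) [?W] |>0: ?e" .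
  qed (use f g in auto)
  then show ?thesis using g by metis
qed

text \<open>Mates for the tensoring of \<open>self V\<close> are uncurryings: from the name of a
  curried arrow one gets back the name of the arrow itself.\<close>

lemma self_tmate:
  assumes f: "f \<in> arr V" "src V f = u \<otimes> v" "trg V f = w"
  shows "name V v (mate V u v f) \<Zsemi> \<inverse> S = name V (u \<otimes> v) f"
  using f by (simp add: name_self_tiso[symmetric] cmp_assoc_arr)

end

end

section \<open>Representable functors that preserve tensors\<close>

context enriched_category
begin

context
  fixes T :: "('a, 'o, 'm) tensoring"
  assumes T: "is_tensoring V C T"
begin

abbreviation tact :: "'a \<Rightarrow> 'a \<Rightarrow> 'o \<Rightarrow> 'm" where
  "tact a c v \<equiv> (\<i> (vhom C a c) \<odot> tunit V C T c v) \<Zsemi> vcmp C a c (tobj T c v)"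

text \<open>The two equations are the two inverse laws between \<open>\<theta>\<close> and
  \<open>\<eta>\<close>, with composition in the completion unfolded into \<open>V\<close>. The
  condition thus speaks of \<open>C\<close> alone and can be compared with the representable
  functors directly.\<close>

definition splits :: "'a \<Rightarrow> 'o \<Rightarrow> 'm \<Rightarrow> bool" where
  "splits c v \<theta> \<longleftrightarrow> \<theta> \<in> hom V \<one> (vhom C (tobj T c v) c \<otimes> v)
    \<and> \<theta> \<Zsemi> tact (tobj T c v) c v = vid C (tobj T c v)
    \<and> tunit V C T c v \<Zsemi> \<inverse> (\<r> (vhom C c (tobj T c v))) \<Zsemi> (\<i> (vhom C c (tobj T c v)) \<odot> \<theta>)
        \<Zsemi> \<inverse> (\<alpha> (vhom C c (tobj T c v)) (vhom C (tobj T c v) c) v) \<Zsemi> (vcmp C c (tobj T c v) c \<odot> \<i> v)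
      = \<inverse> (\<l> v) \<Zsemi> (vid C c \<odot> \<i> v)"

lemmas T_simps [simp] = eta_typ[OF T] tobj_obj[OF T] tiso_typ[OF T] tmate_typ[OF T]

context
  fixes c v assumes cv [simp]: "c \<in> vobj C" "v \<in> obj V"
begin

abbreviation (input) "t \<equiv> tobj T c v"

lemma box_tact:
  assumes at: "at p n [vhom C a c, v]" and a: "a \<in> vobj C"
  shows "p |>n: Box [vhom C a c, v] (tact a c v) [vhom C a t] = p |>Suc n: H T c v |>n: M a c t"
proof -
  obtain A D where c: "cods p = Some (A @ [vhom C a c, v] @ D)" "n = length A" using at by (rule at_cods)
  show ?thesis using c a by (simp add: box_norm box_vcmp)
qed

context
  fixes \<theta> assumes th [simp]: "\<theta> \<in> arr V" "src V \<theta> = \<one>" "trg V \<theta> = vhom C t c \<otimes> v"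
begin

abbreviation (input) "\<Theta> \<equiv> Box [] \<theta> [vhom C t c, v]"

lemma box_split_right:
  assumes at: "at p n []"
  shows "p |>n: \<Theta> |>Suc n: H T c v |>n: M t c t = p |>n: Box [] (\<theta> \<Zsemi> tact t c v) [vhom C t t]"
proof -
  obtain A D where c: "cods p = Some (A @ [] @ D)" "n = length A" using at by (rule at_cods)
  have "p |>n: Box [] (\<theta> \<Zsemi> tact t c v) [vhom C t t] = p |>n: \<Theta> |>n: Box [vhom C t c, v] (tact t c v) [vhom C t t]"
    by (subst box_cmp) auto
  then show ?thesis using c by (simp add: box_tact at_iff)
qed

lemma box_split_left:
  assumes at: "at p n [v]"
  shows "p |>n: H T c v |>Suc n: \<Theta> |>n: M c t c = p |>n: Box [v] (tunit V C T c v \<Zsemi> \<inverse> (\<r> (vhom C c t)) \<Zsemi> (\<i> (vhom C c t) \<odot> \<theta>)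
        \<Zsemi> \<inverse> (\<alpha> (vhom C c t) (vhom C t c) v) \<Zsemi> (vcmp C c t c \<odot> \<i> v)) [vhom C c c, v]"
proof -
  obtain A D where c: "cods p = Some (A @ [v] @ D)" "n = length A" using at by (rule at_cods)
  have *: "p |>n: Box [\<one>] \<theta> ys = p |>n: U' |>n: Box [] \<theta> ys" for p n ys
    by (rule box_split_nil) auto
  have **: "p |>n: Box [] \<theta> [vhom C t c \<otimes> v] = p |>n: \<Theta> |>n: Box [vhom C t c, v] (\<i> (vhom C t c \<otimes> v)) [vhom C t c \<otimes> v]" for p n
    by (subst box_cmp) auto
  show ?thesis using c by (simp add: box_norm box_vcmp * **)
qed

end

lemma box_insert_vid:
  assumes at: "at p n [v]"
  shows "p |>n: J c = p |>n: Box [v] (\<inverse> (\<l> v) \<Zsemi> (vid C c \<odot> \<i> v)) [vhom C c c, v]"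
proof -
  obtain A D where c: "cods p = Some (A @ [v] @ D)" "n = length A" using at by (rule at_cods)
  show ?thesis using c by (simp add: box_norm box_vid)
qed

lemma splitsD:
  assumes "splits c v \<theta>"
  shows "\<theta> \<in> arr V" "src V \<theta> = \<one>" "trg V \<theta> = vhom C t c \<otimes> v"
    and "at p n [] \<Longrightarrow> p |>n: Box [] \<theta> [vhom C t c, v] |>Suc n: H T c v |>n: M t c t = p |>n: J t"
    and "at p n [v] \<Longrightarrow> p |>n: H T c v |>Suc n: Box [] \<theta> [vhom C t c, v] |>n: M c t c = p |>n: J c"
proof -
  show th: "\<theta> \<in> arr V" "src V \<theta> = \<one>" "trg V \<theta> = vhom C t c \<otimes> v"
    using assms by (auto simp: splits_def hom_iff)
  show "at p n [] \<Longrightarrow> p |>n: Box [] \<theta> [vhom C t c, v] |>Suc n: H T c v |>n: M t c t = p |>n: J t"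
    using assms by (simp add: box_split_right[OF th] splits_def)
  show "at p n [v] \<Longrightarrow> p |>n: H T c v |>Suc n: Box [] \<theta> [vhom C t c, v] |>n: M c t c = p |>n: J c"
    using assms by (simp add: box_split_left[OF th] splits_def box_insert_vid)
qed

lemma splitsI:
  assumes th: "\<theta> \<in> arr V" "src V \<theta> = \<one>" "trg V \<theta> = vhom C t c \<otimes> v"
    and 1: "start [] |>0: Box [] \<theta> [vhom C t c, v] |>Suc 0: H T c v |>0: M t c t = start [] |>0: J t"
    and 2: "start [v] |>0: H T c v |>Suc 0: Box [] \<theta> [vhom C t c, v] |>0: M c t c = start [v] |>0: J c"
  shows "splits c v \<theta>"
  unfolding splits_def
proof (intro conjI)
  show "\<theta> \<in> hom V \<one> (vhom C t c \<otimes> v)" using th by (simp add: hom_iff)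
  show "\<theta> \<Zsemi> tact t c v = vid C t"
    by (rule box_inj[where xs = "[]" and ys = "[vhom C t t]"])
      (use th 1 box_split_right[OF th, of "start []" 0] in \<open>auto simp: at_iff\<close>)
  show "tunit V C T c v \<Zsemi> \<inverse> (\<r> (vhom C c t)) \<Zsemi> (\<i> (vhom C c t) \<odot> \<theta>)
        \<Zsemi> \<inverse> (\<alpha> (vhom C c t) (vhom C t c) v) \<Zsemi> (vcmp C c t c \<odot> \<i> v) = \<inverse> (\<l> v) \<Zsemi> (vid C c \<odot> \<i> v)"
    by (rule box_inj[where xs = "[v]" and ys = "[vhom C c c, v]"])
      (use th 2 box_split_left[OF th, of "start [v]" 0] in \<open>auto simp: at_iff box_insert_vid\<close>)
qed

section \<open>Splittings and invertible comparison maps\<close>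

text \<open>Taking \<open>\<theta>\<close> from the comparison map at \<open>a = t\<close> makes one
  inverse law immediate. The other is an equation of arrows
  \<open>v \<rightarrow> C(c, c) \<otimes> v\<close>; it is tested after the comparison map at
  \<open>a = c\<close>, which is invertible too.\<close>

lemma tact_iso_imp_splits:
  assumes "\<And>a. a \<in> vobj C \<Longrightarrow> iso (tact a c v)"
  shows "\<exists>\<theta>. splits c v \<theta>"
proof -
  let ?\<theta> = "vid C t \<Zsemi> \<inverse> (tact t c v)"
  have iso: "iso (tact t c v)" "iso (tact c c v)" using assms by auto
  have th: "?\<theta> \<in> arr V" "src V ?\<theta> = \<one>" "trg V ?\<theta> = vhom C t c \<otimes> v"
    using iso by auto
  let ?Th = "Box [] ?\<theta> [vhom C t c, v]"
  have right: "p |>n: ?Th |>Suc n: H T c v |>n: M t c t = p |>n: J t" if "at p n []" for p n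
    unfolding box_split_right[OF th that] using iso by (simp add: cmp_assoc_arr)
  have "splits c v ?\<theta>"
  proof (rule splitsI[OF th right])
    let ?s = "start [v]"
    let ?X = "tunit V C T c v \<Zsemi> \<inverse> (\<r> (vhom C c t)) \<Zsemi> (\<i> (vhom C c t) \<odot> ?\<theta>)
        \<Zsemi> \<inverse> (\<alpha> (vhom C c t) (vhom C t c) v) \<Zsemi> (vcmp C c t c \<odot> \<i> v)"
    let ?Y = "\<inverse> (\<l> v) \<Zsemi> (vid C c \<odot> \<i> v)"
    have XY: "?X \<in> arr V" "src V ?X = v" "trg V ?X = vhom C c c \<otimes> v" "?Y \<in> arr V" "src V ?Y = v" "trg V ?Y = vhom C c c \<otimes> v"
      using th by auto
    have box_tact': "?s |>0: Box [v] (f \<Zsemi> tact c c v) [vhom C c t] = ?s |>0: Box [v] f [vhom C c c, v] |>Suc 0: H T c v |>0: M c c t"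
      if f: "f \<in> arr V" "src V f = v" "trg V f = vhom C c c \<otimes> v" for f
    proof -
      have "?s |>0: Box [v] (f \<Zsemi> tact c c v) [vhom C c t] = ?s |>0: Box [v] f [vhom C c c, v] |>0: Box [vhom C c c, v] (tact c c v) [vhom C c t]"
        using f by (subst box_cmp) auto
      then show ?thesis using f by (simp add: box_tact at_iff)
    qed
    have "?s |>0: Box [v] (?X \<Zsemi> tact c c v) [vhom C c t] = ?s |>0: H T c v |>Suc 0: ?Th |>0: M c t c |>Suc 0: H T c v |>0: M c c t"
      using box_tact'[OF XY(1-3)] box_split_left[OF th, of ?s 0] by (simp add: at_iff)
    also have "\<dots> = ?s |>0: H T c v |>Suc 0: ?Th |>Suc (Suc 0): H T c v |>0: M c t c |>0: M c c t"
      by (simp add: box_interchange)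
    \<comment> \<open>Associativity brings \<open>\<theta>\<close> together with the second copy of
      \<open>\<eta>\<close>, a pair already known to compose to the identity of
      \<open>t\<close>.\<close>
    also have "\<dots> = ?s |>0: H T c v |>Suc 0: ?Th |>Suc (Suc 0): H T c v |>Suc 0: M t c t |>0: M c t t"
      using th by (simp add: M_assoc at_iff)
    also have "\<dots> = ?s |>0: H T c v"
      using right[of "?s |>0: H T c v" "Suc 0"] by (simp add: at_iff J_M_right)
    also have "\<dots> = ?s |>0: H T c v |>0: J c |>0: M c c t"
      by (simp add: J_M_left at_iff)
    also have "\<dots> = ?s |>0: J c |>Suc 0: H T c v |>0: M c c t"
      by (simp add: box_interchange)
    also have "\<dots> = ?s |>0: Box [v] (?Y \<Zsemi> tact c c v) [vhom C c t]"
      using box_tact'[OF XY(4-6)] by (simp add: box_insert_vid at_iff)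
    finally have "?X \<Zsemi> tact c c v = ?Y \<Zsemi> tact c c v"
      by (rule box_inj[rotated -1]) (use XY in auto)
    then have "?X = ?Y"
      by (rule iso_cancel_right[OF iso(2), rotated -1]) (use XY in auto)
    then show "?s |>0: H T c v |>Suc 0: ?Th |>0: M c t c = ?s |>0: J c"
      using box_split_left[OF th, of ?s 0] box_insert_vid[of ?s 0] by (simp add: at_iff)
  qed (simp add: at_iff)
  then show ?thesis by blast
qed

text \<open>Associativity brings \<open>\<eta>\<close> and \<open>\<theta>\<close> next to each
  other; the two orders of composition use the laws \<open>left\<close> and \<open>right\<close>
  respectively.\<close>

lemma splits_imp_tact_iso:
  assumes s: "splits c v \<theta>" and a [simp]: "a \<in> vobj C"
  shows "iso (tact a c v)"
proof -
  note th [simp] = splitsD(1-3)[OF s] and right = splitsD(4)[OF s] and left = splitsD(5)[OF s]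
  let ?Th = "Box [] \<theta> [vhom C t c, v]"
  let ?at = "vhom C a t" and ?ac = "vhom C a c" and ?tc = "vhom C t c"
  let ?N = "\<inverse> (\<r> ?at) \<Zsemi> (\<i> ?at \<odot> \<theta>) \<Zsemi> \<inverse> (\<alpha> ?at ?tc v) \<Zsemi> (vcmp C a t c \<odot> \<i> v)"
  have N [simp]: "?N \<in> arr V" "src V ?N = ?at" "trg V ?N = ?ac \<otimes> v" by auto
  have boxN: "p |>n: Box [?at] ?N [?ac, v] = p |>Suc n: ?Th |>n: M a t c" if at: "at p n [?at]" for p n
  proof -
    obtain A D where c: "cods p = Some (A @ [?at] @ D)" "n = length A" using at by (rule at_cods)
    have *: "p |>n: Box [\<one>] \<theta> ys = p |>n: U' |>n: Box [] \<theta> ys" for p n ys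
      by (rule box_split_nil) auto
    have **: "p |>n: Box [] \<theta> [?tc \<otimes> v] = p |>n: ?Th |>n: PK ?tc v" for p n
      by (subst box_cmp) auto
    show ?thesis using c by (simp add: box_norm box_vcmp * **)
  qed
  have "tact a c v \<Zsemi> ?N = \<i> (?ac \<otimes> v)"
  proof (rule box_inj[where xs = "[?ac, v]" and ys = "[?ac, v]"])
    let ?s = "start [?ac, v]"
    have "?s |>0: Box [?ac, v] (tact a c v \<Zsemi> ?N) [?ac, v] = ?s |>0: Box [?ac, v] (tact a c v) [?at] |>0: Box [?at] ?N [?ac, v]"
      by (subst box_cmp) auto
    also have "\<dots> = ?s |>Suc 0: H T c v |>0: M a c t |>Suc 0: ?Th |>0: M a t c"
      by (simp add: box_tact boxN at_iff del: N)
    also have "\<dots> = ?s |>Suc 0: H T c v |>Suc (Suc 0): ?Th |>0: M a c t |>0: M a t c"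
      by (simp add: box_interchange)
    also have "\<dots> = ?s |>Suc 0: H T c v |>Suc (Suc 0): ?Th |>Suc 0: M c t c |>0: M a c c"
      by (simp add: M_assoc at_iff)
    also have "\<dots> = ?s" using left[of ?s "Suc 0"] by (simp add: at_iff J_M_right)
    finally show "?s |>0: Box [?ac, v] (tact a c v \<Zsemi> ?N) [?ac, v] = ?s |>0: Box [?ac, v] (\<i> (?ac \<otimes> v)) [?ac, v]"
      by (simp add: box_id at_iff)
  qed auto
  moreover have "?N \<Zsemi> tact a c v = \<i> ?at"
  proof (rule box_inj[where xs = "[?at]" and ys = "[?at]"])
    let ?s = "start [?at]"
    have "?s |>0: Box [?at] (?N \<Zsemi> tact a c v) [?at] = ?s |>0: Box [?at] ?N [?ac, v] |>0: Box [?ac, v] (tact a c v) [?at]"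
      by (subst box_cmp) auto
    also have "\<dots> = ?s |>Suc 0: ?Th |>0: M a t c |>Suc 0: H T c v |>0: M a c t"
      by (simp add: box_tact boxN at_iff del: N)
    also have "\<dots> = ?s |>Suc 0: ?Th |>Suc (Suc 0): H T c v |>0: M a t c |>0: M a c t"
      by (simp add: box_interchange)
    also have "\<dots> = ?s |>Suc 0: ?Th |>Suc (Suc 0): H T c v |>Suc 0: M t c t |>0: M a t t"
      by (simp add: M_assoc at_iff)
    also have "\<dots> = ?s" using right[of ?s "Suc 0"] by (simp add: at_iff J_M_right)
    finally show "?s |>0: Box [?at] (?N \<Zsemi> tact a c v) [?at] = ?s |>0: Box [?at] (\<i> ?at) [?at]"
      by (simp add: box_id at_iff)
  qed auto
  ultimately show ?thesis by (intro isoI(1)[of _ ?N]) auto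
qed

text \<open>Naturality of \<open>mate\<close> rewrites \<open>\<eta>\<close> followed by the action
  of the functor as the mate of \<open>tact\<close>; in \<open>self V\<close> the tensoring then
  uncurries it.\<close>

lemma representable_mu:
  assumes a [simp]: "a \<in> vobj C"
  shows "tensored_mu V C T (self_tensoring V) (representable V C a) c v = name V (vhom C a c \<otimes> v) (tact a c v)"
proof -
  let ?ac = "vhom C a c" and ?at = "vhom C a t"
  have "tunit V C T c v \<Zsemi> mate V ?ac (vhom C c t) (vcmp C a c t) = mate V ?ac v (tact a c v)"
    using mate_nat[of ?ac "vcmp C a c t" "vhom C c t" ?at "tunit V C T c v" v] by (simp add: hom_iff)
  then show ?thesis
    using self_tmate[of ?ac v ?at "tact a c v"] unfolding tensored_mu_def tmate_def representable_def by simp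
qed

end

lemma representables_tensored_iff:
  "(\<forall>a \<in> vobj C. tensored_functor V C T (self V) (self_tensoring V) (representable V C a))
    \<longleftrightarrow> (\<forall>c \<in> vobj C. \<forall>v \<in> obj V. \<exists>\<theta>. splits c v \<theta>)"
proof -
  have "tensored_functor V C T (self V) (self_tensoring V) (representable V C a)
    \<longleftrightarrow> (\<forall>c \<in> vobj C. \<forall>v \<in> obj V. iso (tact a c v))" if a: "a \<in> vobj C" for a
  proof -
    have "tensored_mu V C T (self_tensoring V) (representable V C a) c v
        \<in> uisos V (self V) (tobj (self_tensoring V) (fobj (representable V C a) c) v) (fobj (representable V C a) (tobj T c v))
      \<longleftrightarrow> iso (tact a c v)" if "c \<in> vobj C" "v \<in> obj V" for c v
    proof -
      have "tobj (self_tensoring V) (fobj (representable V C a) c) v = vhom C a c \<otimes> v"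
        "fobj (representable V C a) (tobj T c v) = vhom C a (tobj T c v)"
        by (simp_all add: tobj_def self_tensoring_def representable_def)
      then show ?thesis using a that by (simp only: representable_mu) (rule name_uisos_self; simp)
    qed
    then show ?thesis
      unfolding tensored_functor_def using representable_functor[OF T a] by simp
  qed
  then show ?thesis
    by (meson tact_iso_imp_splits splits_imp_tact_iso)
qed

end

end

section \<open>Enriched monoidal categories\<close>

text \<open>The laws that a strict category and its completion share in the same form. Associativity
  and units of the tensor product hold for the completion up to coherence arrows and are treated
  separately.\<close>

locale tensor_enriched = enriched_category V D
  for V :: "('o, 'm, 'z) bcm_scheme" (structure) and D :: "('a, 'o, 'm, 'y) vmoncat_scheme" +
  assumes unit_in [simp]: "munit D \<in> vobj D"
    and mten_in [simp]: "\<lbrakk>a \<in> vobj D; b \<in> vobj D\<rbrakk> \<Longrightarrow> mten D a b \<in> vobj D"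
    and mtenm_in: "\<lbrakk>a \<in> vobj D; b \<in> vobj D; c \<in> vobj D; d \<in> vobj D\<rbrakk>
          \<Longrightarrow> mtenm D a b c d \<in> hom V (vhom D a b \<otimes> vhom D c d) (vhom D (mten D a c) (mten D b d))"
    and tensor_vid: "\<lbrakk>a \<in> vobj D; b \<in> vobj D\<rbrakk>
          \<Longrightarrow> \<inverse> (\<l> \<one>) \<Zsemi> (vid D a \<odot> vid D b) \<Zsemi> mtenm D a a b b = vid D (mten D a b)"
    and tensor_vcmp: "\<lbrakk>a \<in> vobj D; b \<in> vobj D; c \<in> vobj D; d \<in> vobj D; e \<in> vobj D; f \<in> vobj D\<rbrakk>
          \<Longrightarrow> (mtenm D a b d e \<odot> mtenm D b c e f) \<Zsemi> vcmp D (mten D a d) (mten D b e) (mten D c f)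
            = exch V (\<beta> (vhom D d e) (vhom D b c))
                (vhom D a b) (vhom D d e) (vhom D b c) (vhom D e f) \<Zsemi>
              (vcmp D a b c \<odot> vcmp D d e f) \<Zsemi> mtenm D a c d f"
begin

section \<open>Tensor products of morphisms on states\<close>

abbreviation T :: "'a \<Rightarrow> 'a \<Rightarrow> 'a \<Rightarrow> 'a \<Rightarrow> ('o, 'm) box" where
  "T a b c d \<equiv> Box [vhom D a b, vhom D c d] (mtenm D a b c d) [vhom D (mten D a c) (mten D b d)]"

lemma mtenm_typ [simp]:
  assumes "a \<in> vobj D" "b \<in> vobj D" "c \<in> vobj D" "d \<in> vobj D"
  shows "mtenm D a b c d \<in> arr V" "src V (mtenm D a b c d) = vhom D a b \<otimes> vhom D c d"
    "trg V (mtenm D a b c d) = vhom D (mten D a c) (mten D b d)"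
  using mtenm_in[OF assms] by (auto simp: hom_iff)

lemma box_mtenm:
  "\<lbrakk>a \<in> vobj D; b \<in> vobj D; c \<in> vobj D; d \<in> vobj D\<rbrakk> \<Longrightarrow> p |>n: Box [x] (mtenm D a b c d) ys
    = p |>n: Box [x] (\<i> x) [vhom D a b, vhom D c d] |>n: Box [vhom D a b, vhom D c d] (mtenm D a b c d) ys"
  by (rule box_split_cons) auto

lemma uten_typ [simp]:
  assumes "a \<in> vobj D" "b \<in> vobj D" "c \<in> vobj D" "d \<in> vobj D"
    "f \<in> arr V" "src V f = \<one>" "trg V f = vhom D a b" "g \<in> arr V" "src V g = \<one>" "trg V g = vhom D c d"
  shows "uten V D a b c d f g \<in> arr V" "src V (uten V D a b c d f g) = \<one>"
    "trg V (uten V D a b c d f g) = vhom D (mten D a c) (mten D b d)"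
  using assms by (auto simp: uten_def)

lemma box_uten:
  assumes "at p n []" "a \<in> vobj D" "b \<in> vobj D" "c \<in> vobj D" "d \<in> vobj D"
    "f \<in> arr V" "src V f = \<one>" "trg V f = vhom D a b" "g \<in> arr V" "src V g = \<one>" "trg V g = vhom D c d"
  shows "p |>n: Box [] (uten V D a b c d f g) [vhom D (mten D a c) (mten D b d)]
    = p |>n: Box [] f [vhom D a b] |>Suc n: Box [] g [vhom D c d] |>n: T a b c d"
proof -
  obtain A E where c: "cods p = Some (A @ [] @ E)" "n = length A" using assms(1) by (rule at_cods)
  have "p |>n: Box [] (uten V D a b c d f g) [vhom D (mten D a c) (mten D b d)]
     = p |>n: U |>n: Box [\<one>] (uten V D a b c d f g) [vhom D (mten D a c) (mten D b d)]"
    using assms by (subst box_cmp) auto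
  then show ?thesis using c assms(2-)
    by (simp add: uten_def box_norm box_mtenm box_split_nil[of f] box_split_nil[of g])
qed

lemma uten_vid: "\<lbrakk>a \<in> vobj D; b \<in> vobj D\<rbrakk> \<Longrightarrow> uten V D a a b b (vid D a) (vid D b) = vid D (mten D a b)"
  by (simp add: uten_def tensor_vid)

text \<open>On states the exchange with all its associators is just \<open>q\<close> on the two
  middle strands.\<close>

lemma box_exch:
  assumes at: "at p n [w, x, y, z]" and ob: "w \<in> obj V" "x \<in> obj V" "y \<in> obj V" "z \<in> obj V"
    and q: "q \<in> arr V" "src V q = x \<otimes> y" "trg V q = y \<otimes> x"
  shows "p |>n: PK w x |>Suc n: PK y z
      |>n: Box [w \<otimes> x, y \<otimes> z] (exch V q w x y z) [w \<otimes> y, x \<otimes> z]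
    = p |>Suc n: Box [x, y] q [y, x] |>n: PK w y |>Suc n: PK x z"
proof -
  obtain A E where c: "cods p = Some (A @ [w, x, y, z] @ E)" "n = length A" using at by (rule at_cods)
  have *: "p |>n: Box [x \<otimes> y] q [y \<otimes> x] = p |>n: Box [x \<otimes> y] (\<i> (x \<otimes> y)) [x, y] |>n: Box [x, y] q [y, x] |>n: PK y x" for p n
    using ob q by (simp add: box_cmp)
  show ?thesis using c ob q by (simp add: exch_def box_norm *)
qed

lemma T_M:
  assumes at: "at p n [vhom D a b, vhom D d e, vhom D b c, vhom D e f]"
    and ob: "a \<in> vobj D" "b \<in> vobj D" "c \<in> vobj D" "d \<in> vobj D" "e \<in> vobj D" "f \<in> vobj D"
  shows "p |>n: T a b d e |>Suc n: T b c e f |>n: M (mten D a d) (mten D b e) (mten D c f)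
    = p |>Suc n: B (vhom D d e) (vhom D b c) |>n: M a b c |>Suc n: M d e f |>n: T a c d f"
proof -
  let ?ab = "vhom D a b" and ?de = "vhom D d e" and ?bc = "vhom D b c" and ?ef = "vhom D e f"
  obtain A E where c: "cods p = Some (A @ [?ab, ?de, ?bc, ?ef] @ E)" "n = length A" using at by (rule at_cods)
  let ?q = "p |>n: PK ?ab ?de |>Suc n: PK ?bc ?ef"
  let ?R = "?q |>n: Box [?ab \<otimes> ?de, ?bc \<otimes> ?ef] (exch V (\<beta> ?de ?bc) ?ab ?de ?bc ?ef) [?ab \<otimes> ?bc, ?de \<otimes> ?ef]
      |>n: Box [?ab \<otimes> ?bc, ?de \<otimes> ?ef] (vcmp D a b c \<odot> vcmp D d e f) [vhom D a c, vhom D d f] |>n: T a c d f"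
  have "?q |>n: Box [?ab \<otimes> ?de, ?bc \<otimes> ?ef] ((mtenm D a b d e \<odot> mtenm D b c e f) \<Zsemi> vcmp D (mten D a d) (mten D b e) (mten D c f)) [vhom D (mten D a d) (mten D c f)]
     = ?R"
    using ob by (simp add: tensor_vcmp exch_def box_cmp)
  moreover have "?R = p |>Suc n: B (vhom D d e) (vhom D b c) |>n: M a b c |>Suc n: M d e f |>n: T a c d f"
    using c ob by (simp add: box_exch at_iff) (simp add: box_norm box_vcmp)
  ultimately show ?thesis using c ob by (simp add: box_norm box_mtenm box_vcmp)
qed

lemma J_T:
  assumes at: "at p n []" and ob: "a \<in> vobj D" "b \<in> vobj D"
  shows "p |>n: J a |>Suc n: J b |>n: T a a b b = p |>n: J (mten D a b)"
  using box_uten[of p n a a b b "vid D a" "vid D b"] assms by (simp add: uten_vid)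

text \<open>An object created from nothing may be created on either side of a strand, so its
  crossing disappears. This is \<open>mvr_nat\<close> with an empty list.\<close>

lemma B_insert:
  assumes "at p n [x]" "x \<in> obj V" "y \<in> obj V" "g \<in> arr V" "src V g = \<one>" "trg V g = y"
  shows "p |>Suc n: Box [] g [y] |>n: B x y = p |>n: Box [] g [y]"
  using mvr_nat[of p n x "[]" g "[y]"] assms by auto

text \<open>Interchange would make \<open>C(c, d)\<close> cross the hom object inserted by
  \<open>g\<close>. Since \<open>g\<close> starts from the unit, that crossing vanishes and no
  braiding is left.\<close>

lemma post_T:
  assumes at: "at p n [vhom D a b, vhom D c d]"
    and ob: "a \<in> vobj D" "b \<in> vobj D" "b' \<in> vobj D" "c \<in> vobj D" "d \<in> vobj D" "d' \<in> vobj D"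
    and g: "g \<in> arr V" "src V g = \<one>" "trg V g = vhom D b b'"
    and g': "g' \<in> arr V" "src V g' = \<one>" "trg V g' = vhom D d d'"
  shows "p |>Suc n: Box [] g [vhom D b b'] |>n: M a b b' |>Suc (Suc n): Box [] g' [vhom D d d'] |>Suc n: M c d d' |>n: T a b' c d'
    = p |>n: T a b c d |>Suc n: Box [] (uten V D b b' d d' g g') [vhom D (mten D b d) (mten D b' d')]
      |>n: M (mten D a c) (mten D b d) (mten D b' d')"
proof -
  obtain A E where c: "cods p = Some (A @ [vhom D a b, vhom D c d] @ E)" "n = length A" using at by (rule at_cods)
  have "p |>n: T a b c d |>Suc n: Box [] (uten V D b b' d d' g g') [vhom D (mten D b d) (mten D b' d')]
      |>n: M (mten D a c) (mten D b d) (mten D b' d')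
    = p |>n: T a b c d |>Suc n: Box [] g [vhom D b b'] |>Suc (Suc n): Box [] g' [vhom D d d'] |>Suc n: T b b' d d'
      |>n: M (mten D a c) (mten D b d) (mten D b' d')"
    using c ob g g' by (simp add: box_uten at_iff)
  also have "\<dots> = p |>Suc (Suc n): Box [] g [vhom D b b'] |>Suc (Suc (Suc n)): Box [] g' [vhom D d d'] |>n: T a b c d |>Suc n: T b b' d d'
      |>n: M (mten D a c) (mten D b d) (mten D b' d')"
    by (simp add: box_interchange)
  also have "\<dots> = p |>Suc (Suc n): Box [] g [vhom D b b'] |>Suc (Suc (Suc n)): Box [] g' [vhom D d d'] |>Suc n: B (vhom D c d) (vhom D b b')
      |>n: M a b b' |>Suc n: M c d d' |>n: T a b' c d'"
    using c ob g g' by (intro T_M) (auto simp: at_iff)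
  also have "\<dots> = p |>Suc (Suc n): Box [] g [vhom D b b'] |>Suc n: B (vhom D c d) (vhom D b b') |>Suc (Suc (Suc n)): Box [] g' [vhom D d d']
      |>n: M a b b' |>Suc n: M c d d' |>n: T a b' c d'"
    by (simp add: box_interchange)
  also have "\<dots> = p |>Suc n: Box [] g [vhom D b b'] |>Suc (Suc (Suc n)): Box [] g' [vhom D d d'] |>n: M a b b' |>Suc n: M c d d' |>n: T a b' c d'"
    using c ob g by (subst B_insert) (auto simp: at_iff)
  finally show ?thesis by (simp add: box_interchange)
qed

text \<open>As for \<open>post_T\<close>, but now the inserted object is the one that crosses, so
  \<open>mvl_nat\<close> removes the braiding.\<close>

lemma pre_T:
  assumes at: "at p n [vhom D b c, vhom D e f]"
    and ob: "a \<in> vobj D" "b \<in> vobj D" "c \<in> vobj D" "d \<in> vobj D" "e \<in> vobj D" "f \<in> vobj D"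
    and g: "g \<in> arr V" "src V g = \<one>" "trg V g = vhom D a b"
    and g': "g' \<in> arr V" "src V g' = \<one>" "trg V g' = vhom D d e"
  shows "p |>n: Box [] g [vhom D a b] |>n: M a b c |>Suc n: Box [] g' [vhom D d e] |>Suc n: M d e f |>n: T a c d f
    = p |>n: T b c e f |>n: Box [] (uten V D a b d e g g') [vhom D (mten D a d) (mten D b e)]
      |>n: M (mten D a d) (mten D b e) (mten D c f)"
proof -
  obtain A E where c: "cods p = Some (A @ [vhom D b c, vhom D e f] @ E)" "n = length A" using at by (rule at_cods)
  have "p |>n: T b c e f |>n: Box [] (uten V D a b d e g g') [vhom D (mten D a d) (mten D b e)]
      |>n: M (mten D a d) (mten D b e) (mten D c f)
    = p |>n: T b c e f |>n: Box [] g [vhom D a b] |>Suc n: Box [] g' [vhom D d e] |>n: T a b d e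
      |>n: M (mten D a d) (mten D b e) (mten D c f)"
    using c ob g g' by (simp add: box_uten at_iff)
  also have "\<dots> = p |>n: Box [] g [vhom D a b] |>Suc n: Box [] g' [vhom D d e] |>n: T a b d e |>Suc n: T b c e f
      |>n: M (mten D a d) (mten D b e) (mten D c f)"
    by (simp add: box_interchange)
  also have "\<dots> = p |>n: Box [] g [vhom D a b] |>Suc n: Box [] g' [vhom D d e] |>Suc n: B (vhom D d e) (vhom D b c)
      |>n: M a b c |>Suc n: M d e f |>n: T a c d f"
    using c ob g g' by (intro T_M) (auto simp: at_iff)
  also have "p |>n: Box [] g [vhom D a b] |>Suc n: Box [] g' [vhom D d e] |>Suc n: B (vhom D d e) (vhom D b c)
     = p |>n: Box [] g [vhom D a b] |>Suc (Suc n): Box [] g' [vhom D d e]"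
    using mvl_nat[of "p |>n: Box [] g [vhom D a b]" "Suc n" "[]" "vhom D b c" g' "[vhom D d e]"] c ob g g' by (simp add: at_iff)
  finally show ?thesis by (simp add: box_interchange)
qed

text \<open>The underlying tensor product is functorial without any braiding, because interchange is
  applied to arrows out of the unit only.\<close>

lemma uten_ucmp:
  assumes ob: "a \<in> vobj D" "b \<in> vobj D" "b' \<in> vobj D" "c \<in> vobj D" "d \<in> vobj D" "d' \<in> vobj D"
    and f: "f \<in> arr V" "src V f = \<one>" "trg V f = vhom D a b"
    and f': "f' \<in> arr V" "src V f' = \<one>" "trg V f' = vhom D c d"
    and g: "g \<in> arr V" "src V g = \<one>" "trg V g = vhom D b b'"
    and g': "g' \<in> arr V" "src V g' = \<one>" "trg V g' = vhom D d d'"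
  shows "uten V D a b' c d' (ucmp V D a b b' f g) (ucmp V D c d d' f' g')
    = ucmp V D (mten D a c) (mten D b d) (mten D b' d') (uten V D a b c d f f') (uten V D b b' d d' g g')"
proof (rule box_inj[where xs = "[]" and ys = "[vhom D (mten D a c) (mten D b' d')]"])
  let ?s = "start []"
  have "?s |>0: Box [] (uten V D a b' c d' (ucmp V D a b b' f g) (ucmp V D c d d' f' g')) [vhom D (mten D a c) (mten D b' d')]
    = ?s |>0: Box [] f [vhom D a b] |>Suc 0: Box [] f' [vhom D c d] |>Suc 0: Box [] g [vhom D b b'] |>0: M a b b' |>Suc (Suc 0): Box [] g' [vhom D d d'] |>Suc 0: M c d d' |>0: T a b' c d'"
    using ob f f' g g' by (simp add: box_uten box_ucmp at_iff) (simp add: box_interchange)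
  also have "\<dots> = ?s |>0: Box [] f [vhom D a b] |>Suc 0: Box [] f' [vhom D c d] |>0: T a b c d |>Suc 0: Box [] (uten V D b b' d d' g g') [vhom D (mten D b d) (mten D b' d')]
      |>0: M (mten D a c) (mten D b d) (mten D b' d')"
    using ob f f' g g' by (intro post_T) (auto simp: at_iff)
  also have "\<dots> = ?s |>0: Box [] (ucmp V D (mten D a c) (mten D b d) (mten D b' d') (uten V D a b c d f f') (uten V D b b' d d' g g')) [vhom D (mten D a c) (mten D b' d')]"
    using ob f f' g g' by (simp add: box_uten[of _ _ a b c d] box_ucmp at_iff)
  finally show "?s |>0: Box [] (uten V D a b' c d' (ucmp V D a b b' f g) (ucmp V D c d d' f' g')) [vhom D (mten D a c) (mten D b' d')]
    = ?s |>0: Box [] (ucmp V D (mten D a c) (mten D b d) (mten D b' d') (uten V D a b c d f f') (uten V D b b' d d' g g')) [vhom D (mten D a c) (mten D b' d')]" .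
qed (use assms in auto)

end

locale strict_enriched = enriched_category V C + strict_V_monoidal_category V C
  for V :: "('o, 'm, 'z) bcm_scheme" (structure) and C :: "('a, 'o, 'm, 'y) vmoncat_scheme"

sublocale strict_enriched \<subseteq> tensor_enriched V C
  by unfold_locales (auto simp: munit_obj mten_obj mtenm_hom mtenm_vid interchange)

context strict_enriched
begin

lemmas strict_simps [simp] = mten_assoc mten_unit_left mten_unit_right massoc_strict mlunit_strict mrunit_strict

text \<open>The associativity law on states; its associator has become a regrouping and drops
  out.\<close>

lemma T_assoc:
  assumes at: "at p n [vhom C a b, vhom C c d, vhom C e f]"
    and ob: "a \<in> vobj C" "b \<in> vobj C" "c \<in> vobj C" "d \<in> vobj C" "e \<in> vobj C" "f \<in> vobj C"
  shows "p |>n: T a b c d |>n: T (mten C a c) (mten C b d) e f = p |>Suc n: T c d e f |>n: T a b (mten C c e) (mten C d f)"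
proof -
  let ?ab = "vhom C a b" and ?cd = "vhom C c d" and ?ef = "vhom C e f"
  obtain A E where c: "cods p = Some (A @ [?ab, ?cd, ?ef] @ E)" "n = length A" using at by (rule at_cods)
  let ?E = "\<lambda>m. p |>n: PK ?ab ?cd |>n: Box [?ab \<otimes> ?cd, ?ef] m [vhom C (mten C a (mten C c e)) (mten C b (mten C d f))]"
  have "?E ((mtenm C a b c d \<odot> \<i> ?ef) \<Zsemi> mtenm C (mten C a c) (mten C b d) e f)
      = ?E (\<alpha> ?ab ?cd ?ef \<Zsemi> (\<i> ?ab \<odot> mtenm C c d e f) \<Zsemi> mtenm C a b (mten C c e) (mten C d f))"
    using ob by (simp add: mtenm_assoc)
  then show ?thesis using c ob by (simp add: box_norm box_mtenm)
qed

lemma T_unit_left: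
  assumes at: "at p n [vhom C a b]" and ob: "a \<in> vobj C" "b \<in> vobj C"
  shows "p |>n: J (munit C) |>n: T (munit C) (munit C) a b = p"
proof -
  let ?h = "vhom C a b"
  obtain A E where c: "cods p = Some (A @ [?h] @ E)" "n = length A" using at by (rule at_cods)
  have "p |>n: U |>n: Box [\<one>, ?h] ((vid C (munit C) \<odot> \<i> ?h) \<Zsemi> mtenm C (munit C) (munit C) a b) [?h]
     = p |>n: U |>n: Box [\<one>, ?h] (\<l> ?h) [?h]"
    using ob by (simp add: mtenm_unit_left)
  then show ?thesis using c ob by (simp add: box_norm box_mtenm box_vid)
qed

lemma T_unit_right:
  assumes at: "at p n [vhom C a b]" and ob: "a \<in> vobj C" "b \<in> vobj C"
  shows "p |>Suc n: J (munit C) |>n: T a b (munit C) (munit C) = p"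
proof -
  let ?h = "vhom C a b"
  obtain A E where c: "cods p = Some (A @ [?h] @ E)" "n = length A" using at by (rule at_cods)
  have "p |>Suc n: U |>n: Box [?h, \<one>] ((\<i> ?h \<odot> vid C (munit C)) \<Zsemi> mtenm C a b (munit C) (munit C)) [?h]
     = p |>Suc n: U |>n: Box [?h, \<one>] (\<r> ?h) [?h]"
    using ob by (simp add: mtenm_unit_right)
  then show ?thesis using c ob by (simp add: box_norm box_mtenm box_vid)
qed

end

section \<open>The completion\<close>

context strict_enriched
begin

section \<open>The completion as an enriched category\<close>

abbreviation "K \<equiv> completion V C"

lemma completion_simps [simp]:
  "vobj K = vobj C \<times> obj V"
  "vhom K (a, u) (b, v) = ihom V u (vhom C a b \<otimes> v)"
  "munit K = (munit C, \<one>)"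
  "mten K (a, u) (b, v) = (mten C a b, u \<otimes> v)"
  "vid K (a, u) = name V u (\<inverse> (\<l> u) \<Zsemi> (vid C a \<odot> \<i> u))"
  by (simp_all add: completion_def)

abbreviation hm :: "'a \<Rightarrow> 'o \<Rightarrow> 'a \<Rightarrow> 'o \<Rightarrow> 'o" where
  "hm a u b v \<equiv> ihom V u (vhom C a b \<otimes> v)"

abbreviation E :: "'a \<Rightarrow> 'o \<Rightarrow> 'a \<Rightarrow> 'o \<Rightarrow> ('o, 'm) box" where
  "E a u b v \<equiv> Box [u, hm a u b v] (\<epsilon> u (vhom C a b \<otimes> v)) [vhom C a b, v]"

lemma box_ev:
  assumes "a \<in> vobj C" "b \<in> vobj C" "u \<in> obj V" "v \<in> obj V"
  shows "p |>n: Box [u \<otimes> hm a u b v] (\<epsilon> u (vhom C a b \<otimes> v)) [vhom C a b \<otimes> v]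
    = p |>n: Box [u \<otimes> hm a u b v] (\<i> (u \<otimes> hm a u b v)) [u, hm a u b v] |>n: E a u b v
        |>n: Box [vhom C a b, v] (\<i> (vhom C a b \<otimes> v)) [vhom C a b \<otimes> v]"
  using assms by (simp add: box_cmp)

lemma completion_ext:
  assumes f: "f \<in> arr V" "src V f = tens ws" "trg V f = hm a u b v"
    and g: "g \<in> arr V" "src V g = tens ws" "trg V g = hm a u b v"
    and ob: "a \<in> vobj C" "b \<in> vobj C" "u \<in> obj V" "v \<in> obj V" "set ws \<subseteq> obj V"
    and eq: "start (u # ws) |>Suc 0: Box ws f [hm a u b v] |>0: E a u b v
      = start (u # ws) |>Suc 0: Box ws g [hm a u b v] |>0: E a u b v"
  shows "f = g"
  by (rule mate_inj[of _ ws u "vhom C a b \<otimes> v" _ "[vhom C a b, v]"]) (use assms in auto)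

lemma box_Kid:
  assumes at: "at p n [u]" and ob: "a \<in> vobj C" "u \<in> obj V"
  shows "p |>Suc n: Box [] (vid K (a, u)) [hm a u a u] |>n: E a u a u = p |>n: J a"
proof -
  obtain A D where c: "cods p = Some (A @ [u] @ D)" "n = length A" using at by (rule at_cods)
  show ?thesis using at c ob by (simp add: box_name) (simp add: box_norm box_vid)
qed

text \<open>The working form of composition in the completion: evaluate the two hom objects in turn,
  then compose in \<open>C\<close>.\<close>

lemma box_Kcmp:
  assumes at: "at p n [u, hm a u b v, hm b v c w]"
    and ob: "a \<in> vobj C" "b \<in> vobj C" "c \<in> vobj C" "u \<in> obj V" "v \<in> obj V" "w \<in> obj V"
  shows "p |>Suc n: Box [hm a u b v, hm b v c w] (vcmp K (a, u) (b, v) (c, w)) [hm a u c w] |>n: E a u c w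
    = p |>n: E a u b v |>Suc n: E b v c w |>n: M a b c"
proof -
  let ?h = "hm a u b v" and ?k = "hm b v c w" and ?ab = "vhom C a b" and ?bc = "vhom C b c"
  let ?F = "\<inverse> (\<alpha> u ?h ?k) \<Zsemi> (\<epsilon> u (?ab \<otimes> v) \<odot> \<i> ?k) \<Zsemi>
             \<alpha> ?ab v ?k \<Zsemi> (\<i> ?ab \<odot> \<epsilon> v (?bc \<otimes> w)) \<Zsemi>
             \<inverse> (\<alpha> ?ab ?bc w) \<Zsemi> (vcmp C a b c \<odot> \<i> w)"
  obtain A D where c: "cods p = Some (A @ [u, ?h, ?k] @ D)" "n = length A" using at by (rule at_cods)
  have F: "?F \<in> arr V" "src V ?F = u \<otimes> (?h \<otimes> ?k)" "trg V ?F = vhom C a c \<otimes> w" using ob by simp_all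
  have K: "vcmp K (a, u) (b, v) (c, w) = mate V u (?h \<otimes> ?k) ?F" by (simp add: completion_def Let_def)
  have 1: "p |>Suc n: Box [?h, ?k] (vcmp K (a, u) (b, v) (c, w)) [hm a u c w] |>n: E a u c w = p |>n: Box [u, ?h, ?k] ?F [vhom C a c, w]"
    unfolding K by (rule box_mate[OF at F]) (use ob in simp_all)
  have 2: "p |>n: Box [u, ?h, ?k] ?F [vhom C a c, w] = p |>n: Box [u, ?h, ?k] (\<i> (u \<otimes> (?h \<otimes> ?k))) [u, ?h \<otimes> ?k] |>n: Box [u, ?h \<otimes> ?k] ?F [vhom C a c, w]"
    using ob F by (subst box_cmp) simp_all
  have 3: "p |>n: Box [u, ?h, ?k] (\<i> (u \<otimes> (?h \<otimes> ?k))) [u, ?h \<otimes> ?k] = p |>Suc n: PK ?h ?k"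
    using at box_pack_head[of p n u ?h "[?k]"] by simp
  show ?thesis unfolding 1 2 3 using c ob by (simp add: box_norm box_ev box_vcmp)
qed

lemma Kid_typ:
  assumes "a \<in> vobj C" "u \<in> obj V"
  shows "vid K (a, u) \<in> arr V" "src V (vid K (a, u)) = \<one>" "trg V (vid K (a, u)) = hm a u a u"
  using assms by auto

lemma Kcmp_typ [simp]:
  assumes "a \<in> vobj C" "b \<in> vobj C" "c \<in> vobj C" "u \<in> obj V" "v \<in> obj V" "w \<in> obj V"
  shows "vcmp K (a, u) (b, v) (c, w) \<in> arr V" "src V (vcmp K (a, u) (b, v) (c, w)) = hm a u b v \<otimes> hm b v c w"
    "trg V (vcmp K (a, u) (b, v) (c, w)) = hm a u c w"
  using assms by (auto simp: completion_def Let_def)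

lemma box_Kcmp_split:
  assumes "a \<in> vobj C" "b \<in> vobj C" "c \<in> vobj C" "u \<in> obj V" "v \<in> obj V" "w \<in> obj V"
  shows "p |>n: Box [x] (vcmp K (a, u) (b, v) (c, w)) ys = p |>n: Box [x] (\<i> x) [hm a u b v, hm b v c w]
    |>n: Box [hm a u b v, hm b v c w] (vcmp K (a, u) (b, v) (c, w)) ys"
  by (rule box_split_cons) (use assms in auto)

lemma box_Kid_split:
  assumes "a \<in> vobj C" "u \<in> obj V"
  shows "p |>n: Box [\<one>] (vid K (a, u)) ys = p |>n: U' |>n: Box [] (vid K (a, u)) ys"
  by (rule box_split_nil) (use assms in auto)

text \<open>By \<open>completion_ext\<close> each law may be checked after evaluation, where
  \<open>box_Kid\<close> and \<open>box_Kcmp\<close> reduce it to the corresponding law of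
  \<open>C\<close>.\<close>

lemma K_V_category: "V_category V K"
proof
  fix X assume "X \<in> vobj K"
  then obtain a u where X: "X = (a, u)" and ob [simp]: "a \<in> vobj C" "u \<in> obj V" by auto
  show "vid K X \<in> hom V \<one> (vhom K X X)" unfolding X using Kid_typ[OF ob] by (simp add: hom_iff)
next
  fix X Y assume "X \<in> vobj K" "Y \<in> vobj K"
  then obtain a u b v where X: "X = (a, u)" "Y = (b, v)"
    and ob [simp]: "a \<in> vobj C" "u \<in> obj V" "b \<in> vobj C" "v \<in> obj V" by auto
  show "vhom K X Y \<in> obj V" unfolding X by simp
  let ?h = "hm a u b v"
  note i = Kid_typ[OF ob(1,2)] Kid_typ[OF ob(3,4)]
  show "(vid K X \<odot> \<i> (vhom K X Y)) \<Zsemi> vcmp K X X Y = \<l> (vhom K X Y)"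
    unfolding X completion_simps(2)
  proof (rule completion_ext[of _ "[\<one>, ?h]"])
    let ?s = "start [u, \<one>, ?h]"
    have "?s |>Suc 0: Box [\<one>, ?h] ((vid K (a, u) \<odot> \<i> ?h) \<Zsemi> vcmp K (a, u) (a, u) (b, v)) [?h] |>0: E a u b v
       = ?s |>Suc 0: U' |>Suc 0: Box [] (vid K (a, u)) [hm a u a u] |>0: E a u a u |>Suc 0: E a u b v |>0: M a a b"
      using i by (simp add: box_norm box_Kcmp_split box_Kid_split box_Kcmp del: completion_simps(5))
    also have "\<dots> = ?s |>Suc 0: U' |>0: E a u b v"
    proof -
      let ?p = "?s |>Suc 0: U'"
      have "?p |>Suc 0: Box [] (vid K (a, u)) [hm a u a u] |>0: E a u a u = ?p |>0: J a"
        by (rule box_Kid) (auto simp: at_iff)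
      moreover have "?p |>0: J a |>Suc 0: E a u b v = ?p |>0: E a u b v |>0: J a"
        using box_interchange[of 0 "J a" 0 ?p "E a u b v"] by simp
      moreover have "?p |>0: E a u b v |>0: J a |>0: M a a b = ?p |>0: E a u b v"
        by (rule J_M_left) (auto simp: at_iff)
      ultimately show ?thesis by simp
    qed
    finally show "start (u # [\<one>, ?h]) |>Suc 0: Box [\<one>, ?h] ((vid K (a, u) \<odot> \<i> ?h) \<Zsemi> vcmp K (a, u) (a, u) (b, v)) [?h] |>0: E a u b v
      = start (u # [\<one>, ?h]) |>Suc 0: Box [\<one>, ?h] (\<l> ?h) [?h] |>0: E a u b v"
      by (simp add: box_norm)
  qed (use i in \<open>auto simp del: completion_simps(5)\<close>)
  show "(\<i> (vhom K X Y) \<odot> vid K Y) \<Zsemi> vcmp K X Y Y = \<r> (vhom K X Y)"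
    unfolding X completion_simps(2)
  proof (rule completion_ext[of _ "[?h, \<one>]"])
    let ?s = "start [u, ?h, \<one>]"
    have "?s |>Suc 0: Box [?h, \<one>] ((\<i> ?h \<odot> vid K (b, v)) \<Zsemi> vcmp K (a, u) (b, v) (b, v)) [?h] |>0: E a u b v
       = ?s |>Suc (Suc 0): U' |>0: E a u b v |>Suc (Suc 0): Box [] (vid K (b, v)) [hm b v b v] |>Suc 0: E b v b v |>0: M a b b"
      using i by (simp add: box_norm box_Kcmp_split box_Kid_split box_Kcmp del: completion_simps(5))
    also have "\<dots> = ?s |>Suc (Suc 0): U' |>0: E a u b v"
      by (simp add: box_Kid at_iff J_M_right del: completion_simps(5))
    finally show "start (u # [?h, \<one>]) |>Suc 0: Box [?h, \<one>] ((\<i> ?h \<odot> vid K (b, v)) \<Zsemi> vcmp K (a, u) (b, v) (b, v)) [?h] |>0: E a u b v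
      = start (u # [?h, \<one>]) |>Suc 0: Box [?h, \<one>] (\<r> ?h) [?h] |>0: E a u b v"
      by (simp add: box_norm)
  qed (use i in \<open>auto simp del: completion_simps(5)\<close>)
next
  fix X Y Z assume "X \<in> vobj K" "Y \<in> vobj K" "Z \<in> vobj K"
  then obtain a u b v c w where X: "X = (a, u)" "Y = (b, v)" "Z = (c, w)"
    and ob [simp]: "a \<in> vobj C" "u \<in> obj V" "b \<in> vobj C" "v \<in> obj V" "c \<in> vobj C" "w \<in> obj V" by auto
  show "vcmp K X Y Z \<in> hom V (vhom K X Y \<otimes> vhom K Y Z) (vhom K X Z)" unfolding X by (simp add: hom_iff)
next
  fix X Y Z W assume "X \<in> vobj K" "Y \<in> vobj K" "Z \<in> vobj K" "W \<in> vobj K"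
  then obtain a u b v c w d x where X: "X = (a, u)" "Y = (b, v)" "Z = (c, w)" "W = (d, x)"
    and ob [simp]: "a \<in> vobj C" "u \<in> obj V" "b \<in> vobj C" "v \<in> obj V" "c \<in> vobj C" "w \<in> obj V" "d \<in> vobj C" "x \<in> obj V" by auto
  let ?h = "hm a u b v" and ?k = "hm b v c w" and ?l = "hm c w d x" and ?t = "hm a u d x"
  show "(vcmp K X Y Z \<odot> \<i> (vhom K Z W)) \<Zsemi> vcmp K X Z W
      = \<alpha> (vhom K X Y) (vhom K Y Z) (vhom K Z W) \<Zsemi> (\<i> (vhom K X Y) \<odot> vcmp K Y Z W) \<Zsemi> vcmp K X Y W"
    unfolding X completion_simps(2)
  proof (rule completion_ext[of _ "[?h \<otimes> ?k, ?l]"])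
    let ?s = "start [u, ?h \<otimes> ?k, ?l]" let ?q = "?s |>Suc 0: Box [?h \<otimes> ?k] (\<i> (?h \<otimes> ?k)) [?h, ?k]"
    have 1: "?s |>Suc 0: Box [?h \<otimes> ?k, ?l] ((vcmp K (a, u) (b, v) (c, w) \<odot> \<i> ?l) \<Zsemi> vcmp K (a, u) (c, w) (d, x)) [?t] |>0: E a u d x
       = ?q |>0: E a u b v |>Suc 0: E b v c w |>0: M a b c |>Suc 0: E c w d x |>0: M a c d"
      by (simp add: box_norm box_Kcmp_split box_Kcmp)
    have 2: "?s |>Suc 0: Box [?h \<otimes> ?k, ?l] (\<alpha> ?h ?k ?l \<Zsemi> (\<i> ?h \<odot> vcmp K (b, v) (c, w) (d, x)) \<Zsemi> vcmp K (a, u) (b, v) (d, x)) [?t] |>0: E a u d x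
       = ?q |>0: E a u b v |>Suc 0: E b v c w |>Suc (Suc 0): E c w d x |>Suc 0: M b c d |>0: M a b d"
      by (simp add: box_norm box_Kcmp_split box_Kcmp)
    have "?q |>0: E a u b v |>Suc 0: E b v c w |>Suc (Suc 0): E c w d x |>Suc 0: M b c d |>0: M a b d
      = ?q |>0: E a u b v |>Suc 0: E b v c w |>Suc (Suc 0): E c w d x |>0: M a b c |>0: M a c d"
      by (simp add: M_assoc at_iff)
    also have "\<dots> = ?q |>0: E a u b v |>Suc 0: E b v c w |>0: M a b c |>Suc 0: E c w d x |>0: M a c d"
      by (simp add: box_interchange)
    finally show "start (u # [?h \<otimes> ?k, ?l]) |>Suc 0: Box [?h \<otimes> ?k, ?l] ((vcmp K (a, u) (b, v) (c, w) \<odot> \<i> ?l) \<Zsemi> vcmp K (a, u) (c, w) (d, x)) [?t] |>0: E a u d x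
       = start (u # [?h \<otimes> ?k, ?l]) |>Suc 0: Box [?h \<otimes> ?k, ?l] (\<alpha> ?h ?k ?l \<Zsemi> (\<i> ?h \<odot> vcmp K (b, v) (c, w) (d, x)) \<Zsemi> vcmp K (a, u) (b, v) (d, x)) [?t] |>0: E a u d x"
      unfolding 1 2 by simp
  qed auto
qed

end

context braided_closed_monoidal_category
begin

lemma exch_typ:
  assumes "w \<in> obj V" "x \<in> obj V" "y \<in> obj V" "z \<in> obj V" "q \<in> arr V" "src V q = x \<otimes> y" "trg V q = y \<otimes> x"
  shows "exch V q w x y z \<in> arr V" "src V (exch V q w x y z) = (w \<otimes> x) \<otimes> (y \<otimes> z)"
    "trg V (exch V q w x y z) = (w \<otimes> y) \<otimes> (x \<otimes> z)"
  using assms by (simp_all add: exch_def)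

end

context strict_enriched
begin

section \<open>The tensor product of the completion and its interchange law\<close>

lemma Kten_typ [simp]:
  assumes ob: "a \<in> vobj C" "b \<in> vobj C" "c \<in> vobj C" "d \<in> vobj C" "u \<in> obj V" "v \<in> obj V" "w \<in> obj V" "x \<in> obj V"
  shows "mtenm K (a, u) (b, v) (c, w) (d, x) \<in> arr V"
    "src V (mtenm K (a, u) (b, v) (c, w) (d, x)) = hm a u b v \<otimes> hm c w d x"
    "trg V (mtenm K (a, u) (b, v) (c, w) (d, x)) = hm (mten C a c) (u \<otimes> w) (mten C b d) (v \<otimes> x)"
  using ob by (simp_all add: completion_def Let_def exch_typ)

text \<open>The working form of the tensor product: \<open>w\<close> crosses the first hom object so
  that each hom meets its argument, and after evaluation the second hom of \<open>C\<close> comes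
  back over \<open>v\<close> by an inverse crossing.\<close>

lemma box_Kten:
  assumes at: "at p n [u, w, hm a u b v, hm c w d x]"
    and ob: "a \<in> vobj C" "b \<in> vobj C" "c \<in> vobj C" "d \<in> vobj C" "u \<in> obj V" "v \<in> obj V" "w \<in> obj V" "x \<in> obj V"
  shows "p |>n: PK u w
      |>Suc n: Box [hm a u b v, hm c w d x] (mtenm K (a, u) (b, v) (c, w) (d, x)) [hm (mten C a c) (u \<otimes> w) (mten C b d) (v \<otimes> x)]
      |>n: E (mten C a c) (u \<otimes> w) (mten C b d) (v \<otimes> x)
    = p |>Suc n: B w (hm a u b v) |>n: E a u b v |>Suc (Suc n): E c w d x |>Suc n: Bi (vhom C c d) v |>n: T a b c d
      |>Suc n: PK v x"
proof -
  let ?h = "hm a u b v" and ?k = "hm c w d x" and ?ab = "vhom C a b" and ?cd = "vhom C c d"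
  let ?ac = "mten C a c" and ?bd = "mten C b d"
  let ?e1 = "exch V (\<beta> w ?h) u w ?h ?k" and ?e2 = "exch V (\<inverse> (\<beta> ?cd v)) ?ab v ?cd x"
  let ?F = "?e1 \<Zsemi> (\<epsilon> u (?ab \<otimes> v) \<odot> \<epsilon> w (?cd \<otimes> x)) \<Zsemi> ?e2 \<Zsemi> (mtenm C a b c d \<odot> \<i> (v \<otimes> x))"
  obtain A D where c: "cods p = Some (A @ [u, w, ?h, ?k] @ D)" "n = length A" using at by (rule at_cods)
  have e: "?e1 \<in> arr V" "src V ?e1 = (u \<otimes> w) \<otimes> (?h \<otimes> ?k)" "trg V ?e1 = (u \<otimes> ?h) \<otimes> (w \<otimes> ?k)"
    "?e2 \<in> arr V" "src V ?e2 = (?ab \<otimes> v) \<otimes> (?cd \<otimes> x)" "trg V ?e2 = (?ab \<otimes> ?cd) \<otimes> (v \<otimes> x)"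
    using ob by (simp_all add: exch_typ)
  have F: "?F \<in> arr V" "src V ?F = (u \<otimes> w) \<otimes> (?h \<otimes> ?k)" "trg V ?F = vhom C ?ac ?bd \<otimes> (v \<otimes> x)"
    using ob e by simp_all
  have K: "mtenm K (a, u) (b, v) (c, w) (d, x) = mate V (u \<otimes> w) (?h \<otimes> ?k) ?F" by (simp add: completion_def Let_def)
  let ?q = "p |>n: PK u w"
  let ?r = "?q |>Suc n: PK ?h ?k"
  have q: "at ?q n [u \<otimes> w, ?h, ?k]" using c ob by (simp add: at_iff)
  have 1: "?q |>Suc n: Box [?h, ?k] (mtenm K (a, u) (b, v) (c, w) (d, x)) [hm ?ac (u \<otimes> w) ?bd (v \<otimes> x)] |>n: E ?ac (u \<otimes> w) ?bd (v \<otimes> x)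
     = ?q |>n: Box [u \<otimes> w, ?h, ?k] ?F [vhom C ?ac ?bd, v \<otimes> x]"
    unfolding K by (rule box_mate[OF q F]) (use ob in simp_all)
  have 2: "?q |>n: Box [u \<otimes> w, ?h, ?k] ?F [vhom C ?ac ?bd, v \<otimes> x]
     = ?q |>n: Box [u \<otimes> w, ?h, ?k] (\<i> ((u \<otimes> w) \<otimes> (?h \<otimes> ?k))) [u \<otimes> w, ?h \<otimes> ?k] |>n: Box [u \<otimes> w, ?h \<otimes> ?k] ?F [vhom C ?ac ?bd, v \<otimes> x]"
    using ob F by (subst box_cmp) simp_all
  have 3: "?q |>n: Box [u \<otimes> w, ?h, ?k] (\<i> ((u \<otimes> w) \<otimes> (?h \<otimes> ?k))) [u \<otimes> w, ?h \<otimes> ?k] = ?r"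
    using q box_pack_head[of ?q n "u \<otimes> w" ?h "[?k]"] by simp
  let ?G = "?e1 \<Zsemi> (\<epsilon> u (?ab \<otimes> v) \<odot> \<epsilon> w (?cd \<otimes> x)) \<Zsemi> ?e2"
  have G: "?G \<in> arr V" "src V ?G = (u \<otimes> w) \<otimes> (?h \<otimes> ?k)" "trg V ?G = (?ab \<otimes> ?cd) \<otimes> (v \<otimes> x)" using ob e by simp_all
  have 4: "?r |>n: Box [u \<otimes> w, ?h \<otimes> ?k] ?F [vhom C ?ac ?bd, v \<otimes> x] = ?r |>n: Box [u \<otimes> w, ?h \<otimes> ?k] ?e1 [u \<otimes> ?h, w \<otimes> ?k]
      |>n: Box [u \<otimes> ?h, w \<otimes> ?k] (\<epsilon> u (?ab \<otimes> v) \<odot> \<epsilon> w (?cd \<otimes> x)) [?ab \<otimes> v, ?cd \<otimes> x]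
      |>n: Box [?ab \<otimes> v, ?cd \<otimes> x] ?e2 [?ab \<otimes> ?cd, v \<otimes> x]
      |>n: Box [?ab \<otimes> ?cd, v \<otimes> x] (mtenm C a b c d \<odot> \<i> (v \<otimes> x)) [vhom C ?ac ?bd, v \<otimes> x]"
    using ob e G by (simp add: box_cmp)
  let ?p1 = "p |>Suc n: B w ?h"
  have p1: "cods ?p1 = Some (A @ [u, ?h, w, ?k] @ D)" using c ob by simp
  have 5: "?r |>n: Box [u \<otimes> w, ?h \<otimes> ?k] ?e1 [u \<otimes> ?h, w \<otimes> ?k] = ?p1 |>n: PK u ?h |>Suc n: PK w ?k"
    using at ob by (intro box_exch) auto
  let ?p2 = "?p1 |>n: E a u b v |>Suc (Suc n): E c w d x"
  have p2: "cods ?p2 = Some (A @ [?ab, v, ?cd, x] @ D)" using c p1 ob by simp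
  have 6: "?p1 |>n: PK u ?h |>Suc n: PK w ?k
      |>n: Box [u \<otimes> ?h, w \<otimes> ?k] (\<epsilon> u (?ab \<otimes> v) \<odot> \<epsilon> w (?cd \<otimes> x)) [?ab \<otimes> v, ?cd \<otimes> x]
     = ?p2 |>n: PK ?ab v |>Suc n: PK ?cd x"
    using p1 c(2) ob by (simp add: box_norm box_ev)
  have 7: "?p2 |>n: PK ?ab v |>Suc n: PK ?cd x
      |>n: Box [?ab \<otimes> v, ?cd \<otimes> x] ?e2 [?ab \<otimes> ?cd, v \<otimes> x]
    = ?p2 |>Suc n: Bi ?cd v |>n: PK ?ab ?cd |>Suc n: PK v x"
    using p2 c(2) ob by (intro box_exch) (auto simp: at_iff)
  let ?p3 = "?p2 |>Suc n: Bi ?cd v"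
  have p3: "cods ?p3 = Some (A @ [?ab, ?cd, v, x] @ D)" using p2 c(2) ob by simp
  have 8: "?p3 |>n: PK ?ab ?cd |>Suc n: PK v x
      |>n: Box [?ab \<otimes> ?cd, v \<otimes> x] (mtenm C a b c d \<odot> \<i> (v \<otimes> x)) [vhom C ?ac ?bd, v \<otimes> x]
    = ?p3 |>n: T a b c d |>Suc n: PK v x"
    using p3 c(2) ob by (simp add: box_norm box_mtenm)
  show ?thesis unfolding 1 2 3 4 5 6 7 8 ..
qed

text \<open>The counterpart of \<open>B_insert\<close> for inverse crossings.\<close>

lemma Bi_insert:
  assumes "at p n [x]" "x \<in> obj V" "y \<in> obj V" "g \<in> arr V" "src V g = \<one>" "trg V g = y"
  shows "p |>Suc n: Box [] g [y] |>n: Bi y x = p |>n: Box [] g [y]"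
  using mvri_nat[of p n x "[]" g "[y]"] assms by auto

lemma box_Kten_split:
  assumes ob: "a \<in> vobj C" "b \<in> vobj C" "c \<in> vobj C" "d \<in> vobj C" "u \<in> obj V" "v \<in> obj V" "w \<in> obj V" "x \<in> obj V"
  shows "p |>n: Box [y] (mtenm K (a, u) (b, v) (c, w) (d, x)) ys = p |>n: Box [y] (\<i> y) [hm a u b v, hm c w d x]
    |>n: Box [hm a u b v, hm c w d x] (mtenm K (a, u) (b, v) (c, w) (d, x)) ys"
  by (rule box_split_cons) (use assms in auto)

text \<open>Both crossings in the tensor product involve an object just created by an identity, so
  \<open>B_insert\<close> and \<open>Bi_insert\<close> remove them and \<open>J_T\<close>
  remains.\<close>

lemma K_tensor_vid:
  assumes ob [simp]: "a \<in> vobj C" "c \<in> vobj C" "u \<in> obj V" "w \<in> obj V"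
  shows "\<inverse> (\<l> \<one>) \<Zsemi> (vid K (a, u) \<odot> vid K (c, w)) \<Zsemi> mtenm K (a, u) (a, u) (c, w) (c, w) = vid K (mten K (a, u) (c, w))"
    (is "?L = _")
  unfolding completion_simps(4)
proof (rule completion_ext[of _ "[]"])
  note i = Kid_typ[OF ob(1,3)] Kid_typ[OF ob(2,4)]
  let ?ac = "mten C a c" and ?uw = "u \<otimes> w"
  note i' = Kid_typ[of ?ac ?uw]
  let ?h = "hm a u a u" and ?k = "hm c w c w"
  let ?s = "start [?uw]" let ?q = "?s |>0: Box [?uw] (\<i> ?uw) [u, w]"
  let ?p = "Box [u, w] (\<i> ?uw) [?uw]" and ?E = "E ?ac ?uw ?ac ?uw"
  have 0: "?s |>Suc 0: Box [] f ys = ?q |>0: ?p |>Suc 0: Box [] f ys" for f ys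
    by (simp add: box_norm)
  have "?s |>Suc 0: Box [] ?L [hm ?ac ?uw ?ac ?uw] = ?q |>0: ?p |>Suc 0: U |>Suc 0: Box [\<one>] ?L [hm ?ac ?uw ?ac ?uw]"
    using i by (subst 0, subst box_cmp) (simp_all del: completion_simps(5))
  also have "\<dots> = ?q |>0: ?p |>Suc 0: Box [] (vid K (a, u)) [?h] |>Suc (Suc 0): Box [] (vid K (c, w)) [?k]
      |>Suc 0: Box [?h, ?k] (mtenm K (a, u) (a, u) (c, w) (c, w)) [hm ?ac ?uw ?ac ?uw]"
    using i by (simp add: box_norm box_Kten_split box_Kid_split del: completion_simps(5))
  finally have "?s |>Suc 0: Box [] ?L [hm ?ac ?uw ?ac ?uw] |>0: ?E = ?q |>0: ?p |>Suc 0: Box [] (vid K (a, u)) [?h] |>Suc (Suc 0): Box [] (vid K (c, w)) [?k]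
      |>Suc 0: Box [?h, ?k] (mtenm K (a, u) (a, u) (c, w) (c, w)) [hm ?ac ?uw ?ac ?uw] |>0: ?E" by simp
  also have "\<dots> = ?q |>Suc (Suc 0): Box [] (vid K (a, u)) [?h] |>Suc (Suc (Suc 0)): Box [] (vid K (c, w)) [?k] |>0: ?p
      |>Suc 0: Box [?h, ?k] (mtenm K (a, u) (a, u) (c, w) (c, w)) [hm ?ac ?uw ?ac ?uw] |>0: ?E"
    by (simp add: box_interchange)
  also have "\<dots> = ?q |>Suc (Suc 0): Box [] (vid K (a, u)) [?h] |>Suc (Suc (Suc 0)): Box [] (vid K (c, w)) [?k] |>Suc 0: B w ?h
      |>0: E a u a u |>Suc (Suc 0): E c w c w |>Suc 0: Bi (vhom C c c) u |>0: T a a c c |>Suc 0: ?p"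
    using i by (intro box_Kten) (simp_all add: at_iff del: completion_simps(5))
  also have "\<dots> = ?q |>Suc (Suc 0): Box [] (vid K (a, u)) [?h] |>Suc 0: B w ?h |>Suc (Suc (Suc 0)): Box [] (vid K (c, w)) [?k]
      |>0: E a u a u |>Suc (Suc 0): E c w c w |>Suc 0: Bi (vhom C c c) u |>0: T a a c c |>Suc 0: ?p"
    by (simp add: box_interchange del: completion_simps(5))
  also have "?q |>Suc (Suc 0): Box [] (vid K (a, u)) [?h] |>Suc 0: B w ?h = ?q |>Suc 0: Box [] (vid K (a, u)) [?h]"
    using i by (intro B_insert) (simp_all add: at_iff del: completion_simps(5))
  also have "?q |>Suc 0: Box [] (vid K (a, u)) [?h] |>Suc (Suc (Suc 0)): Box [] (vid K (c, w)) [?k] |>0: E a u a u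
     = ?q |>Suc 0: Box [] (vid K (a, u)) [?h] |>0: E a u a u |>Suc (Suc (Suc 0)): Box [] (vid K (c, w)) [?k]"
    by (simp add: box_interchange del: completion_simps(5))
  also have "?q |>Suc 0: Box [] (vid K (a, u)) [?h] |>0: E a u a u = ?q |>0: J a"
    by (intro box_Kid) (simp_all add: at_iff)
  also have "?q |>0: J a |>Suc (Suc (Suc 0)): Box [] (vid K (c, w)) [?k] |>Suc (Suc 0): E c w c w = ?q |>0: J a |>Suc (Suc 0): J c"
    by (intro box_Kid) (simp_all add: at_iff)
  also have "?q |>0: J a |>Suc (Suc 0): J c |>Suc 0: Bi (vhom C c c) u = ?q |>0: J a |>Suc 0: J c"
    by (intro Bi_insert) (simp_all add: at_iff)
  also have "?q |>0: J a |>Suc 0: J c |>0: T a a c c = ?q |>0: J ?ac"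
    by (intro J_T) (simp_all add: at_iff)
  also have "?q |>0: J ?ac |>Suc 0: ?p = ?s |>0: J ?ac" 
  proof -
    have "?q |>0: J ?ac |>Suc 0: ?p = ?q |>0: ?p |>0: J ?ac"
      using box_interchange[of 0 "J ?ac" 0 ?q ?p] by simp
    then show ?thesis by (simp add: box_norm)
  qed
  also have "\<dots> = ?s |>Suc 0: Box [] (vid K (?ac, ?uw)) [hm ?ac ?uw ?ac ?uw] |>0: ?E"
    by (intro box_Kid[symmetric]) (simp_all add: at_iff)
  finally show "start (?uw # []) |>Suc 0: Box [] ?L [hm ?ac ?uw ?ac ?uw] |>0: ?E
     = start (?uw # []) |>Suc 0: Box [] (vid K (?ac, ?uw)) [hm ?ac ?uw ?ac ?uw] |>0: ?E" .
  show "?L \<in> arr V" "src V ?L = tens []" "trg V ?L = hm ?ac ?uw ?ac ?uw"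
    using i by (simp_all del: completion_simps(5))
  show "vid K (?ac, ?uw) \<in> arr V" "src V (vid K (?ac, ?uw)) = tens []" "trg V (vid K (?ac, ?uw)) = hm ?ac ?uw ?ac ?uw"
    using i' by (simp_all del: completion_simps(5))
qed auto

text \<open>
  Both sides of the interchange law for the completion evaluate to the same diagram, in which the
  hom object \<open>de\<close> has crossed \<open>v\<close>; on one side it crosses \<open>bc \<otimes> w\<close> and then goes back over \<open>w\<close>.
\<close>

lemma K_interchange_diagram:
  assumes ob [simp]: "a \<in> vobj C" "b \<in> vobj C" "c \<in> vobj C" "d \<in> vobj C" "e \<in> vobj C" "f \<in> vobj C"
    "u \<in> obj V" "v \<in> obj V" "w \<in> obj V" "x \<in> obj V" "y \<in> obj V" "z \<in> obj V"
    and c: "cods p = Some [u, x, hm a u b v, hm d x e y, hm b v c w, hm e y f z]"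
  shows "p |>Suc 0: B x (hm a u b v) |>0: E a u b v |>Suc (Suc 0): E d x e y |>Suc 0: Bi (vhom C d e) v |>0: T a b d e
      |>Suc (Suc 0): B y (hm b v c w) |>Suc 0: E b v c w |>Suc (Suc (Suc 0)): E e y f z |>Suc (Suc 0): Bi (vhom C e f) w |>Suc 0: T b c e f
      |>0: M (mten C a d) (mten C b e) (mten C c f)
    = p |>Suc (Suc (Suc 0)): B (hm d x e y) (hm b v c w) |>Suc 0: B x (hm a u b v) |>Suc (Suc 0): B x (hm b v c w)
      |>0: E a u b v |>Suc 0: E b v c w |>0: M a b c |>Suc (Suc 0): E d x e y |>Suc (Suc (Suc 0)): E e y f z |>Suc (Suc 0): M d e f
      |>Suc 0: Bi (vhom C d f) w |>0: T a c d f"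
proof -
  let ?ab = "vhom C a b" and ?bc = "vhom C b c" and ?de = "vhom C d e" and ?ef = "vhom C e f" and ?df = "vhom C d f"
  let ?h1 = "hm a u b v" and ?h2 = "hm d x e y" and ?k1 = "hm b v c w" and ?k2 = "hm e y f z"
  let ?M = "M (mten C a d) (mten C b e) (mten C c f)"
  let ?X = "p |>Suc 0: B x ?h1 |>0: E a u b v |>Suc (Suc 0): E d x e y"
  have X: "cods ?X = Some [?ab, v, ?de, y, ?k1, ?k2]" using c by simp
  let ?Q = "?X |>Suc (Suc (Suc 0)): B y ?k1 |>Suc 0: Bi ?de v"
  have Q: "cods ?Q = Some [?ab, ?de, v, ?k1, y, ?k2]" using X by simp
  let ?Z = "?X |>Suc (Suc (Suc 0)): B y ?k1 |>Suc (Suc 0): B ?de ?k1 |>Suc 0: E b v c w"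
  have Z: "cods ?Z = Some [?ab, ?bc, w, ?de, y, ?k2]" using X by simp
  \<comment> \<open>Sliding \<open>de\<close> past the evaluation of \<open>k1\<close>: crossing
    \<open>v, k1\<close> beforehand is crossing \<open>bc, w\<close> afterwards. The crossing of
    \<open>v\<close> cancels against the earlier inverse crossing.\<close>
  have cross: "?Q |>Suc (Suc 0): E b v c w |>Suc 0: B ?de ?bc = ?Z |>Suc (Suc 0): Bi ?de w"
  proof -
    have "?Q |>Suc (Suc 0): E b v c w |>Suc 0: B ?de ?bc |>Suc (Suc 0): B ?de w
      = ?Q |>Suc 0: B ?de v |>Suc (Suc 0): B ?de ?k1 |>Suc 0: E b v c w"
      using mvr_nat[of ?Q "Suc 0" ?de "[v, ?k1]" "\<epsilon> v (?bc \<otimes> w)" "[?bc, w]"] Q by (simp add: at_iff)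
    also have "?Q |>Suc 0: B ?de v = ?X |>Suc (Suc (Suc 0)): B y ?k1"
      using X by (intro Bi_cancel) (simp_all add: at_iff)
    finally have "?Q |>Suc (Suc 0): E b v c w |>Suc 0: B ?de ?bc |>Suc (Suc 0): B ?de w |>Suc (Suc 0): Bi ?de w = ?Z |>Suc (Suc 0): Bi ?de w"
      by simp
    moreover have "?Q |>Suc (Suc 0): E b v c w |>Suc 0: B ?de ?bc |>Suc (Suc 0): B ?de w |>Suc (Suc 0): Bi ?de w
      = ?Q |>Suc (Suc 0): E b v c w |>Suc 0: B ?de ?bc"
      using Q by (intro B_cancel) (simp_all add: at_iff)
    ultimately show ?thesis by simp
  qed
  let ?L = "?X |>Suc 0: Bi ?de v |>0: T a b d e
      |>Suc (Suc 0): B y ?k1 |>Suc 0: E b v c w |>Suc (Suc (Suc 0)): E e y f z |>Suc (Suc 0): Bi ?ef w |>Suc 0: T b c e f |>0: ?M"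
  have "?L = ?Q |>Suc (Suc 0): E b v c w |>Suc (Suc (Suc (Suc 0))): E e y f z |>Suc (Suc (Suc 0)): Bi ?ef w
      |>0: T a b d e |>Suc 0: T b c e f |>0: ?M"
    by (simp add: box_interchange)
  also have "\<dots> = ?Q |>Suc (Suc 0): E b v c w |>Suc (Suc (Suc (Suc 0))): E e y f z |>Suc (Suc (Suc 0)): Bi ?ef w
      |>Suc 0: B ?de ?bc |>0: M a b c |>Suc 0: M d e f |>0: T a c d f"
    by (rule T_M) (use Q in \<open>simp_all add: at_iff\<close>)
  also have "\<dots> = ?Q |>Suc (Suc 0): E b v c w |>Suc 0: B ?de ?bc |>Suc (Suc (Suc (Suc 0))): E e y f z |>Suc (Suc (Suc 0)): Bi ?ef w
      |>0: M a b c |>Suc 0: M d e f |>0: T a c d f"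
    by (simp add: box_interchange)
  also have "\<dots> = ?Z |>Suc (Suc 0): Bi ?de w |>Suc (Suc (Suc (Suc 0))): E e y f z |>Suc (Suc (Suc 0)): Bi ?ef w
      |>0: M a b c |>Suc 0: M d e f |>0: T a c d f"
    unfolding cross ..
  finally have L: "?L = \<dots>" .
  let ?W = "p |>Suc 0: B x ?h1"
  have W: "cods ?W = Some [u, ?h1, x, ?h2, ?k1, ?k2]" using c by simp
  \<comment> \<open>Here \<open>k1\<close> moves left past \<open>x\<close> and \<open>h2\<close>;
    by sliding it may equally move past their evaluation \<open>de, y\<close>.\<close>
  have slide: "?W |>Suc (Suc (Suc 0)): B ?h2 ?k1 |>Suc (Suc 0): B x ?k1 |>Suc (Suc (Suc 0)): E d x e y
     = ?W |>Suc (Suc 0): E d x e y |>Suc (Suc (Suc 0)): B y ?k1 |>Suc (Suc 0): B ?de ?k1"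
    using mvl_nat[of ?W "Suc (Suc 0)" "[x, ?h2]" ?k1 "\<epsilon> x (?de \<otimes> y)" "[?de, y]"] W by (simp add: at_iff)
  let ?R = "p |>Suc (Suc (Suc 0)): B ?h2 ?k1 |>Suc 0: B x ?h1 |>Suc (Suc 0): B x ?k1
      |>0: E a u b v |>Suc 0: E b v c w |>0: M a b c |>Suc (Suc 0): E d x e y |>Suc (Suc (Suc 0)): E e y f z |>Suc (Suc 0): M d e f
      |>Suc 0: Bi ?df w |>0: T a c d f"
  have "?R = ?W |>Suc (Suc (Suc 0)): B ?h2 ?k1 |>Suc (Suc 0): B x ?k1 |>Suc (Suc (Suc 0)): E d x e y
      |>0: E a u b v |>Suc 0: E b v c w |>Suc (Suc (Suc (Suc 0))): E e y f z |>0: M a b c |>Suc (Suc 0): M d e f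
      |>Suc 0: Bi ?df w |>0: T a c d f"
    by (simp add: box_interchange)
  also have "\<dots> = ?W |>Suc (Suc 0): E d x e y |>Suc (Suc (Suc 0)): B y ?k1 |>Suc (Suc 0): B ?de ?k1
      |>0: E a u b v |>Suc 0: E b v c w |>Suc (Suc (Suc (Suc 0))): E e y f z |>0: M a b c |>Suc (Suc 0): M d e f
      |>Suc 0: Bi ?df w |>0: T a c d f"
    unfolding slide ..
  also have "\<dots> = ?Z |>Suc (Suc (Suc (Suc 0))): E e y f z |>0: M a b c |>Suc (Suc 0): M d e f |>Suc 0: Bi ?df w |>0: T a c d f"
    by (simp add: box_interchange)
  \<comment> \<open>The inverse crossing of the composite \<open>df\<close> over \<open>w\<close> is
    split into those of its factors \<open>de\<close> and \<open>ef\<close>.\<close>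
  also have "\<dots> = ?Z |>Suc (Suc (Suc (Suc 0))): E e y f z |>0: M a b c |>Suc 0: Bi ?de w |>Suc (Suc 0): Bi ?ef w |>Suc 0: M d e f |>0: T a c d f"
    using mvri_nat[of "?Z |>Suc (Suc (Suc (Suc 0))): E e y f z |>0: M a b c" "Suc 0" w "[?de, ?ef]" "vcmp C d e f" "[?df]"] Z
    by (simp add: at_iff)
  also have "\<dots> = ?Z |>Suc (Suc 0): Bi ?de w |>Suc (Suc (Suc (Suc 0))): E e y f z |>Suc (Suc (Suc 0)): Bi ?ef w
      |>0: M a b c |>Suc 0: M d e f |>0: T a c d f"
    by (simp add: box_interchange)
  finally have "?R = \<dots>" .
  then show ?thesis using L by simp
qed

text \<open>Evaluating both sides with \<open>box_Kten\<close> and \<open>box_Kcmp\<close>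
  eliminates all internal homs from the law; what is left is \<open>K_interchange_diagram\<close>
  followed by packing \<open>w\<close> and \<open>z\<close>.\<close>

lemma K_interchange:
  assumes ob [simp]: "a \<in> vobj C" "b \<in> vobj C" "c \<in> vobj C" "d \<in> vobj C" "e \<in> vobj C" "f \<in> vobj C"
    "u \<in> obj V" "v \<in> obj V" "w \<in> obj V" "x \<in> obj V" "y \<in> obj V" "z \<in> obj V"
  shows "(mtenm K (a, u) (b, v) (d, x) (e, y) \<odot> mtenm K (b, v) (c, w) (e, y) (f, z))
      \<Zsemi> vcmp K (mten C a d, u \<otimes> x) (mten C b e, v \<otimes> y) (mten C c f, w \<otimes> z)
    = exch V (\<beta> (hm d x e y) (hm b v c w)) (hm a u b v) (hm d x e y) (hm b v c w) (hm e y f z)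
      \<Zsemi> (vcmp K (a, u) (b, v) (c, w) \<odot> vcmp K (d, x) (e, y) (f, z))
      \<Zsemi> mtenm K (a, u) (c, w) (d, x) (f, z)" (is "?L = ?ex \<Zsemi> ?cc \<Zsemi> ?T")
proof (rule completion_ext)
  let ?h1 = "hm a u b v" and ?h2 = "hm d x e y" and ?k1 = "hm b v c w" and ?k2 = "hm e y f z"
  let ?ws = "[?h1 \<otimes> ?h2, ?k1 \<otimes> ?k2]"
  let ?ad = "mten C a d" and ?be = "mten C b e" and ?cf = "mten C c f"
  have ex: "?ex \<in> arr V" "src V ?ex = (?h1 \<otimes> ?h2) \<otimes> (?k1 \<otimes> ?k2)" "trg V ?ex = (?h1 \<otimes> ?k1) \<otimes> (?h2 \<otimes> ?k2)"
    by (simp_all add: exch_typ)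
  show "?L \<in> arr V" "src V ?L = tens ?ws" "trg V ?L = hm ?ad (u \<otimes> x) ?cf (w \<otimes> z)"
    by simp_all
  show "?ex \<Zsemi> ?cc \<Zsemi> ?T \<in> arr V" "src V (?ex \<Zsemi> ?cc \<Zsemi> ?T) = tens ?ws" "trg V (?ex \<Zsemi> ?cc \<Zsemi> ?T) = hm ?ad (u \<otimes> x) ?cf (w \<otimes> z)"
    using ex by simp_all
  let ?hl = "hm ?ad (u \<otimes> x) ?cf (w \<otimes> z)" and ?EE = "E ?ad (u \<otimes> x) ?cf (w \<otimes> z)"
  let ?s = "start ((u \<otimes> x) # ?ws)"
  let ?p = "?s |>0: Box [u \<otimes> x] (\<i> (u \<otimes> x)) [u, x] |>Suc (Suc 0): Box [?h1 \<otimes> ?h2] (\<i> (?h1 \<otimes> ?h2)) [?h1, ?h2]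
     |>Suc (Suc (Suc (Suc 0))): Box [?k1 \<otimes> ?k2] (\<i> (?k1 \<otimes> ?k2)) [?k1, ?k2]"
  have p: "cods ?p = Some [u, x, ?h1, ?h2, ?k1, ?k2]" by simp
  let ?t1 = "Box [?h1, ?h2] (mtenm K (a, u) (b, v) (d, x) (e, y)) [hm ?ad (u \<otimes> x) ?be (v \<otimes> y)]"
  let ?t2 = "Box [?k1, ?k2] (mtenm K (b, v) (c, w) (e, y) (f, z)) [hm ?be (v \<otimes> y) ?cf (w \<otimes> z)]"
  let ?ux = "PK u x" and ?vy = "PK v y" and ?wz = "PK w z"
  have L1: "?s |>Suc 0: Box ?ws ?L [?hl] |>0: ?EE
     = ?p |>0: ?ux |>Suc 0: ?t1 |>0: E ?ad (u \<otimes> x) ?be (v \<otimes> y) |>Suc (Suc 0): ?t2 |>Suc 0: E ?be (v \<otimes> y) ?cf (w \<otimes> z) |>0: M ?ad ?be ?cf"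
    by (simp add: box_norm box_Kcmp_split box_Kten_split box_Kcmp)
  have L2: "?p |>0: ?ux |>Suc 0: ?t1 |>0: E ?ad (u \<otimes> x) ?be (v \<otimes> y)
     = ?p |>Suc 0: B x ?h1 |>0: E a u b v |>Suc (Suc 0): E d x e y |>Suc 0: Bi (vhom C d e) v |>0: T a b d e |>Suc 0: ?vy"
    by (rule box_Kten) (use p in \<open>simp_all add: at_iff\<close>)
  have L3: "?p |>Suc 0: B x ?h1 |>0: E a u b v |>Suc (Suc 0): E d x e y |>Suc 0: Bi (vhom C d e) v |>0: T a b d e |>Suc 0: ?vy
     |>Suc (Suc 0): ?t2 |>Suc 0: E ?be (v \<otimes> y) ?cf (w \<otimes> z)
    = ?p |>Suc 0: B x ?h1 |>0: E a u b v |>Suc (Suc 0): E d x e y |>Suc 0: Bi (vhom C d e) v |>0: T a b d e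
      |>Suc (Suc 0): B y ?k1 |>Suc 0: E b v c w |>Suc (Suc (Suc 0)): E e y f z |>Suc (Suc 0): Bi (vhom C e f) w |>Suc 0: T b c e f |>Suc (Suc 0): ?wz"
    by (rule box_Kten) (use p in \<open>simp_all add: at_iff\<close>)
  have L: "?s |>Suc 0: Box ?ws ?L [?hl] |>0: ?EE
     = ?p |>Suc 0: B x ?h1 |>0: E a u b v |>Suc (Suc 0): E d x e y |>Suc 0: Bi (vhom C d e) v |>0: T a b d e
      |>Suc (Suc 0): B y ?k1 |>Suc 0: E b v c w |>Suc (Suc (Suc 0)): E e y f z |>Suc (Suc 0): Bi (vhom C e f) w |>Suc 0: T b c e f
      |>0: M ?ad ?be ?cf |>Suc 0: ?wz"
    unfolding L1 L2 L3 by (simp add: box_interchange)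
  let ?c1 = "Box [?h1, ?k1] (vcmp K (a, u) (b, v) (c, w)) [hm a u c w]"
  let ?c2 = "Box [?h2, ?k2] (vcmp K (d, x) (e, y) (f, z)) [hm d x f z]"
  let ?p' = "?p |>Suc (Suc (Suc 0)): B ?h2 ?k1"
  have R0: "?s = ?p |>0: ?ux |>Suc 0: PK ?h1 ?h2 |>Suc (Suc 0): PK ?k1 ?k2"
    by (simp add: box_norm)
  have R1: "?s |>Suc 0: Box ?ws (?ex \<Zsemi> ?cc \<Zsemi> ?T) [?hl] |>0: ?EE
     = ?p |>0: ?ux |>Suc 0: PK ?h1 ?h2 |>Suc (Suc 0): PK ?k1 ?k2 |>Suc 0: Box ?ws ?ex [?h1 \<otimes> ?k1, ?h2 \<otimes> ?k2]
        |>Suc 0: Box [?h1 \<otimes> ?k1, ?h2 \<otimes> ?k2] ?cc [hm a u c w, hm d x f z] |>Suc 0: Box [hm a u c w, hm d x f z] ?T [?hl] |>0: ?EE"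
    unfolding R0[symmetric] using ex by (simp add: box_cmp)
  have R2: "?p |>0: ?ux |>Suc 0: PK ?h1 ?h2 |>Suc (Suc 0): PK ?k1 ?k2 |>Suc 0: Box ?ws ?ex [?h1 \<otimes> ?k1, ?h2 \<otimes> ?k2]
     = ?p |>0: ?ux |>Suc (Suc 0): B ?h2 ?k1 |>Suc 0: PK ?h1 ?k1 |>Suc (Suc 0): PK ?h2 ?k2"
    using p by (intro box_exch) (simp_all add: at_iff)
  have R3: "?p |>0: ?ux |>Suc (Suc 0): B ?h2 ?k1 |>Suc 0: PK ?h1 ?k1 |>Suc (Suc 0): PK ?h2 ?k2
        |>Suc 0: Box [?h1 \<otimes> ?k1, ?h2 \<otimes> ?k2] ?cc [hm a u c w, hm d x f z] |>Suc 0: Box [hm a u c w, hm d x f z] ?T [?hl] |>0: ?EE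
     = ?p' |>Suc (Suc 0): ?c1 |>Suc (Suc (Suc 0)): ?c2 |>0: ?ux |>Suc 0: Box [hm a u c w, hm d x f z] ?T [?hl] |>0: ?EE"
    by (simp add: box_norm box_Kcmp_split)
  have R4: "?p' |>Suc (Suc 0): ?c1 |>Suc (Suc (Suc 0)): ?c2 |>0: ?ux |>Suc 0: Box [hm a u c w, hm d x f z] ?T [?hl] |>0: ?EE
     = ?p' |>Suc (Suc 0): ?c1 |>Suc (Suc (Suc 0)): ?c2 |>Suc 0: B x (hm a u c w) |>0: E a u c w |>Suc (Suc 0): E d x f z
        |>Suc 0: Bi (vhom C d f) w |>0: T a c d f |>Suc 0: ?wz"
    using p by (intro box_Kten) (simp_all add: at_iff)
  have p': "cods ?p' = Some [u, x, ?h1, ?k1, ?h2, ?k2]" using p by simp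
  have R5: "?p' |>Suc (Suc 0): ?c1 |>Suc (Suc (Suc 0)): ?c2 |>Suc 0: B x (hm a u c w)
     = ?p' |>Suc (Suc 0): ?c1 |>Suc 0: B x (hm a u c w) |>Suc (Suc (Suc 0)): ?c2"
    by (simp add: box_interchange)
  \<comment> \<open>Crossing the composite hom is crossing \<open>h1\<close> and \<open>k1\<close>
    before they are composed.\<close>
  have R6: "?p' |>Suc (Suc 0): ?c1 |>Suc 0: B x (hm a u c w) = ?p' |>Suc 0: B x ?h1 |>Suc (Suc 0): B x ?k1 |>Suc 0: ?c1"
    using mvr_nat[of ?p' "Suc 0" x "[?h1, ?k1]" "vcmp K (a, u) (b, v) (c, w)" "[hm a u c w]"] p' by (simp add: at_iff)
  let ?p'' = "?p' |>Suc 0: B x ?h1 |>Suc (Suc 0): B x ?k1"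
  have p'': "cods ?p'' = Some [u, ?h1, ?k1, x, ?h2, ?k2]" using p' by simp
  have R7: "?p'' |>Suc 0: ?c1 |>Suc (Suc (Suc 0)): ?c2 |>0: E a u c w = ?p'' |>Suc 0: ?c1 |>0: E a u c w |>Suc (Suc (Suc 0)): ?c2"
    by (simp add: box_interchange)
  have R8: "?p'' |>Suc 0: ?c1 |>0: E a u c w = ?p'' |>0: E a u b v |>Suc 0: E b v c w |>0: M a b c"
    using p'' by (intro box_Kcmp) (simp_all add: at_iff)
  let ?p3 = "?p'' |>0: E a u b v |>Suc 0: E b v c w |>0: M a b c"
  have R9: "?p3 |>Suc (Suc (Suc 0)): ?c2 |>Suc (Suc 0): E d x f z = ?p3 |>Suc (Suc 0): E d x e y |>Suc (Suc (Suc 0)): E e y f z |>Suc (Suc 0): M d e f"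
    using p'' by (intro box_Kcmp) (simp_all add: at_iff)
  have R: "?s |>Suc 0: Box ?ws (?ex \<Zsemi> ?cc \<Zsemi> ?T) [?hl] |>0: ?EE
     = ?p3 |>Suc (Suc 0): E d x e y |>Suc (Suc (Suc 0)): E e y f z |>Suc (Suc 0): M d e f |>Suc 0: Bi (vhom C d f) w |>0: T a c d f |>Suc 0: ?wz"
    unfolding R1 R2 R3 R4 R5 R6 R7 R8 R9 ..
  show "?s |>Suc 0: Box ?ws ?L [?hl] |>0: ?EE = ?s |>Suc 0: Box ?ws (?ex \<Zsemi> ?cc \<Zsemi> ?T) [?hl] |>0: ?EE"
    unfolding L R K_interchange_diagram[OF ob p] ..
qed simp_all

lemma K_tensor_enriched: "tensor_enriched V K"
proof -
  interpret K: V_category V K by (rule K_V_category)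
  show ?thesis
  proof
    show "munit K \<in> vobj K" by (simp add: munit_obj)
  next
    fix X Y assume "X \<in> vobj K" "Y \<in> vobj K"
    then obtain a u b v where X: "X = (a, u)" "Y = (b, v)"
      and ob [simp]: "a \<in> vobj C" "u \<in> obj V" "b \<in> vobj C" "v \<in> obj V" by auto
    show "mten K X Y \<in> vobj K" unfolding X by simp
    show "\<inverse> (\<l> \<one>) \<Zsemi> (vid K X \<odot> vid K Y) \<Zsemi> mtenm K X X Y Y = vid K (mten K X Y)"
      unfolding X by (rule K_tensor_vid) simp_all
  next
    fix X Y Z W assume "X \<in> vobj K" "Y \<in> vobj K" "Z \<in> vobj K" "W \<in> vobj K"
    then obtain a u b v c w d x where X: "X = (a, u)" "Y = (b, v)" "Z = (c, w)" "W = (d, x)"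
      and ob [simp]: "a \<in> vobj C" "u \<in> obj V" "b \<in> vobj C" "v \<in> obj V" "c \<in> vobj C" "w \<in> obj V" "d \<in> vobj C" "x \<in> obj V" by auto
    show "mtenm K X Y Z W \<in> hom V (vhom K X Y \<otimes> vhom K Z W) (vhom K (mten K X Z) (mten K Y W))"
      unfolding X by (simp add: hom_iff)
  next
    fix X1 X2 X3 Y1 Y2 Y3
    assume "X1 \<in> vobj K" "X2 \<in> vobj K" "X3 \<in> vobj K" "Y1 \<in> vobj K" "Y2 \<in> vobj K" "Y3 \<in> vobj K"
    then obtain a u b v c w d x e y f z where X: "X1 = (a, u)" "X2 = (b, v)" "X3 = (c, w)" "Y1 = (d, x)" "Y2 = (e, y)" "Y3 = (f, z)"
      and ob [simp]: "a \<in> vobj C" "b \<in> vobj C" "c \<in> vobj C" "d \<in> vobj C" "e \<in> vobj C" "f \<in> vobj C"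
        "u \<in> obj V" "v \<in> obj V" "w \<in> obj V" "x \<in> obj V" "y \<in> obj V" "z \<in> obj V" by auto
    show "(mtenm K X1 X2 Y1 Y2 \<odot> mtenm K X2 X3 Y2 Y3) \<Zsemi> vcmp K (mten K X1 Y1) (mten K X2 Y2) (mten K X3 Y3)
      = exch V (\<beta> (vhom K Y1 Y2) (vhom K X2 X3)) (vhom K X1 X2) (vhom K Y1 Y2) (vhom K X2 X3) (vhom K Y2 Y3) \<Zsemi>
        (vcmp K X1 X2 X3 \<odot> vcmp K Y1 Y2 Y3) \<Zsemi> mtenm K X1 X3 Y1 Y3"
      unfolding X completion_simps by (rule K_interchange) simp_all
  qed
qed

end

sublocale strict_enriched \<subseteq> K: tensor_enriched V "completion V C"
  by (rule K_tensor_enriched)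

section \<open>Underlying arrows of the completion\<close>

context strict_enriched
begin

text \<open>
  \<open>ku f a u b v\<close>: \<open>f\<close> is an arrow \<open>(a, u) \<rightarrow> (b, v)\<close> of the underlying category of the completion.
  Equations between such arrows are checked on the corresponding arrows \<open>fl f a u b v : u \<rightarrow> C(a \<rightarrow> b) \<otimes> v\<close>.
\<close>

definition ku :: "'m \<Rightarrow> 'a \<Rightarrow> 'o \<Rightarrow> 'a \<Rightarrow> 'o \<Rightarrow> bool" where
  "ku f a u b v \<longleftrightarrow> a \<in> vobj C \<and> b \<in> vobj C \<and> u \<in> obj V \<and> v \<in> obj V
     \<and> f \<in> arr V \<and> src V f = \<one> \<and> trg V f = hm a u b v"

definition fl :: "'m \<Rightarrow> 'a \<Rightarrow> 'o \<Rightarrow> 'a \<Rightarrow> 'o \<Rightarrow> 'm" where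
  "fl f a u b v = unname V u (vhom C a b \<otimes> v) f"

abbreviation FL :: "'m \<Rightarrow> 'a \<Rightarrow> 'o \<Rightarrow> 'a \<Rightarrow> 'o \<Rightarrow> ('o, 'm) box" where
  "FL f a u b v \<equiv> Box [u] (fl f a u b v) [vhom C a b, v]"

lemma ku_iff: "\<lbrakk>a \<in> vobj C; b \<in> vobj C; u \<in> obj V; v \<in> obj V\<rbrakk> \<Longrightarrow> ku f a u b v \<longleftrightarrow> f \<in> uhom V K (a, u) (b, v)"
  by (auto simp: ku_def uhom_def hom_iff)

lemma fl_typ:
  assumes "ku f a u b v"
  shows "fl f a u b v \<in> arr V" "src V (fl f a u b v) = u" "trg V (fl f a u b v) = vhom C a b \<otimes> v"
    "name V u (fl f a u b v) = f"
  using name_surj[of f u "vhom C a b \<otimes> v"] assms by (auto simp: ku_def fl_def)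

declare fl_typ(1-3) [simp]

lemma fl_name:
  assumes "m \<in> arr V" "src V m = u" "trg V m = vhom C a b \<otimes> v" "a \<in> vobj C" "b \<in> vobj C" "u \<in> obj V" "v \<in> obj V"
  shows "ku (name V u m) a u b v" "fl (name V u m) a u b v = m"
proof -
  show k: "ku (name V u m) a u b v" using assms by (simp add: ku_def)
  show "fl (name V u m) a u b v = m" by (rule name_inj[OF fl_typ(4)[OF k]]) (simp_all add: assms fl_typ(1-3)[OF k])
qed

lemma kuD:
  assumes "ku f a u b v"
  shows "a \<in> vobj C" "b \<in> vobj C" "u \<in> obj V" "v \<in> obj V" "f \<in> arr V" "src V f = \<one>" "trg V f = hm a u b v"
  using assms by (auto simp: ku_def)

text \<open>The beta rule for arrows of the completion: evaluation turns \<open>f\<close> into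
  \<open>fl f\<close>.\<close>

lemma box_fl:
  assumes "at p n [u]" "ku f a u b v"
  shows "p |>Suc n: Box [] f [hm a u b v] |>n: E a u b v = p |>n: FL f a u b v"
  using box_name[OF assms(1) fl_typ(1-3)[OF assms(2)], of "[vhom C a b, v]"] kuD[OF assms(2)] fl_typ(4)[OF assms(2)] by simp

lemma ku_ext:
  assumes f: "ku f a u b v" and g: "ku g a u b v"
    and eq: "start [u] |>0: FL f a u b v = start [u] |>0: FL g a u b v"
  shows "f = g"
proof -
  have "fl f a u b v = fl g a u b v"
    by (rule box_inj[OF _ _ _ _ _ _ _ _ eq]) (simp_all add: fl_typ[OF f] fl_typ[OF g] kuD(1-4)[OF f])
  then have "name V u (fl f a u b v) = name V u (fl g a u b v)" by (rule arg_cong)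
  then show ?thesis unfolding fl_typ(4)[OF f] fl_typ(4)[OF g] .
qed

lemma ku_ucmp:
  assumes f: "ku f a u b v" and g: "ku g b v c w"
  shows "ku (ucmp V K (a, u) (b, v) (c, w) f g) a u c w"
  using kuD[OF f] kuD[OF g] K.ucmp_typ[of "(a, u)" "(b, v)" "(c, w)" f g] by (simp add: ku_def)

text \<open>Underlying arrows compose in Kleisli style: \<open>g\<close> acts on the
  \<open>v\<close> that \<open>f\<close> leaves over, and the two hom strands are composed.\<close>

lemma box_fl_ucmp:
  assumes at: "at p n [u]" and f: "ku f a u b v" and g: "ku g b v c w"
  shows "p |>n: FL (ucmp V K (a, u) (b, v) (c, w) f g) a u c w = p |>n: FL f a u b v |>Suc n: FL g b v c w |>n: M a b c"
proof -
  note ob = kuD[OF f] kuD[OF g]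
  obtain A D where c: "cods p = Some (A @ [u] @ D)" "n = length A" using at by (rule at_cods)
  have "p |>n: FL (ucmp V K (a, u) (b, v) (c, w) f g) a u c w = p |>Suc n: Box [] (ucmp V K (a, u) (b, v) (c, w) f g) [hm a u c w] |>n: E a u c w"
    using at ku_ucmp[OF f g] by (simp add: box_fl)
  also have "\<dots> = p |>Suc n: Box [] f [hm a u b v] |>Suc (Suc n): Box [] g [hm b v c w]
      |>Suc n: Box [hm a u b v, hm b v c w] (vcmp K (a, u) (b, v) (c, w)) [hm a u c w] |>n: E a u c w"
    using K.box_ucmp[of "(a, u)" "(b, v)" "(c, w)" p "Suc n" f g] ob c by (simp add: at_iff)
  also have "\<dots> = p |>Suc n: Box [] f [hm a u b v] |>Suc (Suc n): Box [] g [hm b v c w] |>n: E a u b v |>Suc n: E b v c w |>n: M a b c"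
    using ob c by (intro box_Kcmp) (simp_all add: at_iff)
  also have "\<dots> = p |>Suc n: Box [] f [hm a u b v] |>n: E a u b v |>Suc (Suc n): Box [] g [hm b v c w] |>Suc n: E b v c w |>n: M a b c"
    by (simp add: box_interchange)
  finally show ?thesis using f g ob c by (simp add: box_fl at_iff)
qed

lemma ku_uten:
  assumes f: "ku f a u b v" and g: "ku g c w d x"
  shows "ku (uten V K (a, u) (b, v) (c, w) (d, x) f g) (mten C a c) (u \<otimes> w) (mten C b d) (v \<otimes> x)"
  using kuD[OF f] kuD[OF g] K.uten_typ[of "(a, u)" "(b, v)" "(c, w)" "(d, x)" f g] by (simp add: ku_def)

text \<open>Of the two crossings in \<open>box_Kten\<close> the first disappears by
  \<open>B_insert\<close>, as \<open>f\<close> comes from the unit; the inverse crossing of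
  \<open>C(c, d)\<close> over \<open>v\<close> stays.\<close>

lemma box_fl_uten:
  assumes at: "at p n [u, w]" and f: "ku f a u b v" and g: "ku g c w d x"
  shows "p |>n: PK u w
      |>n: FL (uten V K (a, u) (b, v) (c, w) (d, x) f g) (mten C a c) (u \<otimes> w) (mten C b d) (v \<otimes> x)
    = p |>n: FL f a u b v |>Suc (Suc n): FL g c w d x |>Suc n: Bi (vhom C c d) v |>n: T a b c d
      |>Suc n: PK v x"
proof -
  note ob = kuD[OF f] kuD[OF g]
  obtain A D where c: "cods p = Some (A @ [u, w] @ D)" "n = length A" using at by (rule at_cods)
  let ?q = "p |>n: PK u w"
  let ?ac = "mten C a c" and ?bd = "mten C b d"
  let ?h = "hm a u b v" and ?k = "hm c w d x" and ?m = "hm ?ac (u \<otimes> w) ?bd (v \<otimes> x)"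
  let ?E = "E ?ac (u \<otimes> w) ?bd (v \<otimes> x)"
  let ?t = "Box [?h, ?k] (mtenm K (a, u) (b, v) (c, w) (d, x)) [?m]"
  have "?q |>n: FL (uten V K (a, u) (b, v) (c, w) (d, x) f g) ?ac (u \<otimes> w) ?bd (v \<otimes> x)
     = ?q |>Suc n: Box [] (uten V K (a, u) (b, v) (c, w) (d, x) f g) [?m] |>n: ?E"
    using c ob ku_uten[OF f g] by (simp add: box_fl at_iff)
  also have "\<dots> = ?q |>Suc n: Box [] f [?h] |>Suc (Suc n): Box [] g [?k] |>Suc n: ?t |>n: ?E"
    using K.box_uten[of ?q "Suc n" "(a, u)" "(b, v)" "(c, w)" "(d, x)" f g] ob c by (simp add: at_iff)
  also have "\<dots> = p |>Suc (Suc n): Box [] f [?h] |>Suc (Suc (Suc n)): Box [] g [?k] |>n: PK u w |>Suc n: ?t |>n: ?E"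
    by (simp add: box_interchange)
  also have "\<dots> = p |>Suc (Suc n): Box [] f [?h] |>Suc (Suc (Suc n)): Box [] g [?k] |>Suc n: B w ?h
     |>n: E a u b v |>Suc (Suc n): E c w d x |>Suc n: Bi (vhom C c d) v |>n: T a b c d |>Suc n: PK v x"
    using ob c by (intro box_Kten) (simp_all add: at_iff)
  also have "\<dots> = p |>Suc (Suc n): Box [] f [?h] |>Suc n: B w ?h |>Suc (Suc (Suc n)): Box [] g [?k]
     |>n: E a u b v |>Suc (Suc n): E c w d x |>Suc n: Bi (vhom C c d) v |>n: T a b c d |>Suc n: PK v x"
    by (simp add: box_interchange)
  also have "p |>Suc (Suc n): Box [] f [?h] |>Suc n: B w ?h = p |>Suc n: Box [] f [?h]"
    using ob c by (intro B_insert) (simp_all add: at_iff)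
  also have "p |>Suc n: Box [] f [?h] |>Suc (Suc (Suc n)): Box [] g [?k] |>n: E a u b v |>Suc (Suc n): E c w d x
     = p |>Suc n: Box [] f [?h] |>n: E a u b v |>Suc (Suc (Suc n)): Box [] g [?k] |>Suc (Suc n): E c w d x"
    by (simp add: box_interchange)
  also have "\<dots> = p |>n: FL f a u b v |>Suc (Suc n): FL g c w d x"
    using f g ob c by (simp add: box_fl at_iff)
  finally show ?thesis .
qed

lemma ku_vid: "\<lbrakk>a \<in> vobj C; u \<in> obj V\<rbrakk> \<Longrightarrow> ku (vid K (a, u)) a u a u"
  by (simp add: ku_def)

lemma box_fl_vid: "\<lbrakk>at p n [u]; a \<in> vobj C; u \<in> obj V\<rbrakk> \<Longrightarrow> p |>n: FL (vid K (a, u)) a u a u = p |>n: J a"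
  using box_Kid[of p n u a] ku_vid[of a u] box_fl[of p n u "vid K (a, u)" a a u] by (simp del: completion_simps(5))

section \<open>Coherence arrows of the completion and their naturality\<close>

context
  fixes a b c u v w
  assumes ob [simp]: "a \<in> vobj C" "b \<in> vobj C" "c \<in> vobj C" "u \<in> obj V" "v \<in> obj V" "w \<in> obj V"
begin

lemma ku_massoc: "ku (massoc K (a, u) (b, v) (c, w)) (mten C a (mten C b c)) ((u \<otimes> v) \<otimes> w) (mten C a (mten C b c)) (u \<otimes> (v \<otimes> w))"
  by (simp add: completion_def ku_def)

lemma box_fl_massoc:
  assumes "at p n [u, v, w]"
  shows "p |>n: PK u v |>n: PK (u \<otimes> v) w
      |>n: FL (massoc K (a, u) (b, v) (c, w)) (mten C a (mten C b c)) ((u \<otimes> v) \<otimes> w) (mten C a (mten C b c)) (u \<otimes> (v \<otimes> w))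
    = p |>n: J (mten C a (mten C b c)) |>Suc (Suc n): PK v w |>Suc n: PK u (v \<otimes> w)"
proof -
  obtain A D where c: "cods p = Some (A @ [u, v, w] @ D)" "n = length A" using assms by (rule at_cods)
  have "fl (massoc K (a, u) (b, v) (c, w)) (mten C a (mten C b c)) ((u \<otimes> v) \<otimes> w) (mten C a (mten C b c)) (u \<otimes> (v \<otimes> w))
    = \<alpha> u v w \<Zsemi> \<inverse> (\<l> (u \<otimes> (v \<otimes> w))) \<Zsemi> (vid C (mten C a (mten C b c)) \<odot> \<i> (u \<otimes> (v \<otimes> w)))"
    using fl_name(2)[of "\<alpha> u v w \<Zsemi> \<inverse> (\<l> (u \<otimes> (v \<otimes> w))) \<Zsemi> (vid C (mten C a (mten C b c)) \<odot> \<i> (u \<otimes> (v \<otimes> w)))"]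
    by (simp add: completion_def)
  then show ?thesis using c by (simp add: box_norm box_vid)
qed

end

context
  fixes a u
  assumes ob [simp]: "a \<in> vobj C" "u \<in> obj V"
begin

lemma ku_mlunit: "ku (mlunit K (a, u)) a (\<one> \<otimes> u) a u"
  and ku_mrunit: "ku (mrunit K (a, u)) a (u \<otimes> \<one>) a u"
  by (simp_all add: completion_def ku_def)

lemma box_fl_mlunit:
  assumes "at p n [\<one>, u]"
  shows "p |>n: PK \<one> u |>n: FL (mlunit K (a, u)) a (\<one> \<otimes> u) a u = p |>n: U' |>n: J a"
proof -
  obtain A D where c: "cods p = Some (A @ [\<one>, u] @ D)" "n = length A" using assms by (rule at_cods)
  have "fl (mlunit K (a, u)) a (\<one> \<otimes> u) a u = \<l> u \<Zsemi> \<inverse> (\<l> u) \<Zsemi> (vid C a \<odot> \<i> u)"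
    using fl_name(2)[of "\<l> u \<Zsemi> \<inverse> (\<l> u) \<Zsemi> (vid C a \<odot> \<i> u)"] by (simp add: completion_def)
  then show ?thesis using c by (simp add: box_norm box_vid)
qed

lemma box_fl_mrunit:
  assumes "at p n [u, \<one>]"
  shows "p |>n: PK u \<one> |>n: FL (mrunit K (a, u)) a (u \<otimes> \<one>) a u = p |>Suc n: U' |>n: J a"
proof -
  obtain A D where c: "cods p = Some (A @ [u, \<one>] @ D)" "n = length A" using assms by (rule at_cods)
  have "fl (mrunit K (a, u)) a (u \<otimes> \<one>) a u = \<r> u \<Zsemi> \<inverse> (\<l> u) \<Zsemi> (vid C a \<odot> \<i> u)"
    using fl_name(2)[of "\<r> u \<Zsemi> \<inverse> (\<l> u) \<Zsemi> (vid C a \<odot> \<i> u)"] by (simp add: completion_def)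
  then have "p |>n: PK u \<one> |>n: FL (mrunit K (a, u)) a (u \<otimes> \<one>) a u
     = p |>Suc n: U' |>n: U |>n: U' |>n: J a"
    using c by (simp add: box_norm box_vid)
  then show ?thesis using c by (simp add: box_norm)
qed

end

text \<open>Both sides reduce to the state \<open>?t\<close>, in which the three arrows have been
  applied and their homs gathered on the left, followed by the same packing. The coherence arrows
  contribute identities of \<open>C\<close>, and \<open>T_assoc\<close> compares the two
  bracketings.\<close>

lemma massoc_nat:
  assumes f: "ku f a u a' u'" and g: "ku g b v b' v'" and k: "ku k c w c' w'"
  defines "X \<equiv> mten K (mten K (a, u) (b, v)) (c, w)" and "X' \<equiv> mten K (mten K (a', u') (b', v')) (c', w')"
    and "Y \<equiv> mten K (a, u) (mten K (b, v) (c, w))" and "Y' \<equiv> mten K (a', u') (mten K (b', v') (c', w'))"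
  shows "ucmp V K X X' Y' (uten V K (mten K (a, u) (b, v)) (mten K (a', u') (b', v')) (c, w) (c', w')
        (uten V K (a, u) (a', u') (b, v) (b', v') f g) k) (massoc K (a', u') (b', v') (c', w'))
    = ucmp V K X Y Y' (massoc K (a, u) (b, v) (c, w)) (uten V K (a, u) (a', u') (mten K (b, v) (c, w)) (mten K (b', v') (c', w'))
        f (uten V K (b, v) (b', v') (c, w) (c', w') g k))" (is "?L = ?R")
proof -
  note obs = kuD(1-4)[OF f] kuD(1-4)[OF g] kuD(1-4)[OF k]
  note [simp] = obs f g k
  let ?x = "mten C a (mten C b c)" and ?x' = "mten C a' (mten C b' c')"
  let ?ab = "mten C a b" and ?ab' = "mten C a' b'" and ?bc = "mten C b c" and ?bc' = "mten C b' c'"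
  let ?fg = "uten V K (a, u) (a', u') (b, v) (b', v') f g" and ?gk = "uten V K (b, v) (b', v') (c, w) (c', w') g k"
  have fg: "ku ?fg ?ab (u \<otimes> v) ?ab' (u' \<otimes> v')" and gk: "ku ?gk ?bc (v \<otimes> w) ?bc' (v' \<otimes> w')"
    by (simp_all add: ku_uten)
  let ?fgk = "uten V K (?ab, u \<otimes> v) (?ab', u' \<otimes> v') (c, w) (c', w') ?fg k"
  let ?gkf = "uten V K (a, u) (a', u') (?bc, v \<otimes> w) (?bc', v' \<otimes> w') f ?gk"
  have fgk: "ku ?fgk ?x ((u \<otimes> v) \<otimes> w) ?x' ((u' \<otimes> v') \<otimes> w')" using ku_uten[OF fg k] by simp
  have gkf: "ku ?gkf ?x (u \<otimes> (v \<otimes> w)) ?x' (u' \<otimes> (v' \<otimes> w'))" using ku_uten[OF f gk] by simp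
  let ?m = "massoc K (a, u) (b, v) (c, w)" and ?m' = "massoc K (a', u') (b', v') (c', w')"
  have m: "ku ?m ?x ((u \<otimes> v) \<otimes> w) ?x (u \<otimes> (v \<otimes> w))" by (rule ku_massoc) (simp_all add: obs)
  have m': "ku ?m' ?x' ((u' \<otimes> v') \<otimes> w') ?x' (u' \<otimes> (v' \<otimes> w'))" by (rule ku_massoc) (simp_all add: obs)
  let ?aa = "vhom C a a'" and ?bb = "vhom C b b'" and ?cc = "vhom C c c'"
  let ?s = "start [(u \<otimes> v) \<otimes> w]"
  let ?p = "?s |>0: Box [(u \<otimes> v) \<otimes> w] (\<i> ((u \<otimes> v) \<otimes> w)) [u \<otimes> v, w] |>0: Box [u \<otimes> v] (\<i> (u \<otimes> v)) [u, v]"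
  have p: "cods ?p = Some [u, v, w]" by simp
  have s: "?s = ?p |>0: PK u v |>0: PK (u \<otimes> v) w" by (simp add: box_norm)
  let ?F = "FL f a u a' u'" and ?G = "FL g b v b' v'" and ?K = "FL k c w c' w'"
  let ?q = "?p |>0: ?F |>Suc (Suc 0): ?G |>Suc 0: Bi ?bb u' |>0: T a a' b b'"
  have q: "cods ?q = Some [vhom C ?ab ?ab', u', v', w]" by simp
  have L1: "?p |>0: PK u v |>0: FL ?fg ?ab (u \<otimes> v) ?ab' (u' \<otimes> v') = ?q |>Suc 0: PK u' v'"
    by (rule box_fl_uten) (simp_all add: at_iff)
  have L2: "?p |>0: PK u v |>0: PK (u \<otimes> v) w |>0: FL ?fgk ?x ((u \<otimes> v) \<otimes> w) ?x' ((u' \<otimes> v') \<otimes> w')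
     = ?p |>0: PK u v |>0: FL ?fg ?ab (u \<otimes> v) ?ab' (u' \<otimes> v') |>Suc (Suc 0): ?K |>Suc 0: Bi ?cc (u' \<otimes> v') |>0: T ?ab ?ab' c c'
       |>Suc 0: PK (u' \<otimes> v') w'"
    using box_fl_uten[of "?p |>0: PK u v" 0 "u \<otimes> v" w ?fg ?ab ?ab' "u' \<otimes> v'" k c c' w'] fg by (simp add: at_iff)
  let ?r = "?q |>Suc (Suc (Suc 0)): ?K"
  have r: "cods ?r = Some [vhom C ?ab ?ab', u', v', ?cc, w']" by simp
  have L3: "?q |>Suc 0: PK u' v' |>Suc (Suc 0): ?K = ?r |>Suc 0: PK u' v'"
    by (simp add: box_interchange)
  \<comment> \<open>An inverse crossing over the packed \<open>u' \<otimes> v'\<close> is one over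
    each of \<open>v'\<close> and \<open>u'\<close>.\<close>
  have L4: "?r |>Suc 0: PK u' v' |>Suc 0: Bi ?cc (u' \<otimes> v') = ?r |>Suc (Suc 0): Bi ?cc v' |>Suc 0: Bi ?cc u' |>Suc (Suc 0): PK u' v'"
    using mvli_nat[of ?r "Suc 0" "[u', v']" ?cc "\<i> (u' \<otimes> v')" "[u' \<otimes> v']"] by (simp add: at_iff)
  have L5: "?r |>Suc (Suc 0): Bi ?cc v' |>Suc 0: Bi ?cc u' |>Suc (Suc 0): PK u' v' |>0: T ?ab ?ab' c c'
     = ?r |>Suc (Suc 0): Bi ?cc v' |>Suc 0: Bi ?cc u' |>0: T ?ab ?ab' c c' |>Suc 0: PK u' v'"
    by (simp add: box_interchange)
  let ?t = "?r |>Suc (Suc 0): Bi ?cc v' |>Suc 0: Bi ?cc u' |>0: T ?ab ?ab' c c'"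
  have t: "cods ?t = Some [vhom C ?x ?x', u', v', w']" by simp
  have L6: "?t |>Suc 0: PK u' v' |>Suc 0: PK (u' \<otimes> v') w' |>Suc 0: FL ?m' ?x' ((u' \<otimes> v') \<otimes> w') ?x' (u' \<otimes> (v' \<otimes> w')) |>0: M ?x ?x' ?x'
     = ?t |>Suc (Suc 0): PK v' w' |>Suc 0: PK u' (v' \<otimes> w')"
  proof -
    have "?t |>Suc 0: PK u' v' |>Suc 0: PK (u' \<otimes> v') w' |>Suc 0: FL ?m' ?x' ((u' \<otimes> v') \<otimes> w') ?x' (u' \<otimes> (v' \<otimes> w'))
      = ?t |>Suc 0: J ?x' |>Suc (Suc (Suc 0)): PK v' w' |>Suc (Suc 0): PK u' (v' \<otimes> w')"
      by (rule box_fl_massoc) (use t in \<open>simp_all add: at_iff\<close>)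
    moreover have "?t |>Suc 0: J ?x' |>Suc (Suc (Suc 0)): PK v' w' |>Suc (Suc 0): PK u' (v' \<otimes> w') |>0: M ?x ?x' ?x'
      = ?t |>Suc 0: J ?x' |>0: M ?x ?x' ?x' |>Suc (Suc 0): PK v' w' |>Suc 0: PK u' (v' \<otimes> w')"
      by (simp add: box_interchange)
    moreover have "?t |>Suc 0: J ?x' |>0: M ?x ?x' ?x' = ?t"
      by (rule J_M_right) (use t in \<open>simp_all add: at_iff\<close>)
    ultimately show ?thesis by simp
  qed
  have kL: "ku ?L ?x ((u \<otimes> v) \<otimes> w) ?x' (u' \<otimes> (v' \<otimes> w'))"
    unfolding X_def X'_def Y'_def using ku_ucmp[OF fgk m'] by simp
  have L: "?s |>0: FL ?L ?x ((u \<otimes> v) \<otimes> w) ?x' (u' \<otimes> (v' \<otimes> w')) = ?t |>Suc (Suc 0): PK v' w' |>Suc 0: PK u' (v' \<otimes> w')"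
  proof -
    have "?s |>0: FL ?L ?x ((u \<otimes> v) \<otimes> w) ?x' (u' \<otimes> (v' \<otimes> w'))
      = ?s |>0: FL ?fgk ?x ((u \<otimes> v) \<otimes> w) ?x' ((u' \<otimes> v') \<otimes> w') |>Suc 0: FL ?m' ?x' ((u' \<otimes> v') \<otimes> w') ?x' (u' \<otimes> (v' \<otimes> w')) |>0: M ?x ?x' ?x'"
      unfolding X_def X'_def Y'_def using box_fl_ucmp[OF _ fgk m', of ?s 0] by (simp add: at_iff)
    also have "\<dots> = ?p |>0: PK u v |>0: PK (u \<otimes> v) w |>0: FL ?fgk ?x ((u \<otimes> v) \<otimes> w) ?x' ((u' \<otimes> v') \<otimes> w')
       |>Suc 0: FL ?m' ?x' ((u' \<otimes> v') \<otimes> w') ?x' (u' \<otimes> (v' \<otimes> w')) |>0: M ?x ?x' ?x'"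
      unfolding s[symmetric] ..
    finally show ?thesis unfolding L2 L1 L3 L4 L5 L6 .
  qed
  have kR: "ku ?R ?x ((u \<otimes> v) \<otimes> w) ?x' (u' \<otimes> (v' \<otimes> w'))"
    unfolding X_def Y_def Y'_def using ku_ucmp[OF m gkf] by simp
  have R1: "?p |>Suc 0: PK v w |>0: PK u (v \<otimes> w) |>0: FL ?gkf ?x (u \<otimes> (v \<otimes> w)) ?x' (u' \<otimes> (v' \<otimes> w'))
     = ?p |>Suc 0: PK v w |>0: ?F |>Suc (Suc 0): FL ?gk ?bc (v \<otimes> w) ?bc' (v' \<otimes> w') |>Suc 0: Bi (vhom C ?bc ?bc') u' |>0: T a a' ?bc ?bc'
       |>Suc 0: PK u' (v' \<otimes> w')"
    using box_fl_uten[of "?p |>Suc 0: PK v w" 0 u "v \<otimes> w" f a a' u' ?gk ?bc ?bc' "v' \<otimes> w'"] gk by (simp add: at_iff)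
  have R2: "?p |>Suc 0: PK v w |>0: ?F = ?p |>0: ?F |>Suc (Suc 0): PK v w"
    by (simp add: box_interchange)
  let ?q' = "?p |>0: ?F |>Suc (Suc 0): ?G |>Suc (Suc (Suc (Suc 0))): ?K |>Suc (Suc (Suc 0)): Bi ?cc v'"
  have q': "cods ?q' = Some [?aa, u', ?bb, ?cc, v', w']" by simp
  have R3: "?p |>0: ?F |>Suc (Suc 0): PK v w |>Suc (Suc 0): FL ?gk ?bc (v \<otimes> w) ?bc' (v' \<otimes> w')
     = ?q' |>Suc (Suc 0): T b b' c c' |>Suc (Suc (Suc 0)): PK v' w'"
    by (rule box_fl_uten) (simp_all add: at_iff)
  have R4: "?q' |>Suc (Suc 0): T b b' c c' |>Suc (Suc (Suc 0)): PK v' w' |>Suc 0: Bi (vhom C ?bc ?bc') u' |>0: T a a' ?bc ?bc'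
     = ?q' |>Suc (Suc 0): T b b' c c' |>Suc 0: Bi (vhom C ?bc ?bc') u' |>0: T a a' ?bc ?bc' |>Suc (Suc 0): PK v' w'"
    by (simp add: box_interchange)
  \<comment> \<open>On this side the hom strand that crosses \<open>u'\<close> is a tensor product,
    and the crossing splits over its two factors.\<close>
  have R5: "?q' |>Suc (Suc 0): T b b' c c' |>Suc 0: Bi (vhom C ?bc ?bc') u'
     = ?q' |>Suc 0: Bi ?bb u' |>Suc (Suc 0): Bi ?cc u' |>Suc 0: T b b' c c'"
    using mvri_nat[of ?q' "Suc 0" u' "[?bb, ?cc]" "mtenm C b b' c c'" "[vhom C ?bc ?bc']"] by (simp add: at_iff)
  have R6: "?q' |>Suc 0: Bi ?bb u' |>Suc (Suc 0): Bi ?cc u' |>Suc 0: T b b' c c' |>0: T a a' ?bc ?bc'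
     = ?q' |>Suc 0: Bi ?bb u' |>Suc (Suc 0): Bi ?cc u' |>0: T a a' b b' |>0: T ?ab ?ab' c c'"
    by (rule T_assoc[symmetric]) (use q' in \<open>simp_all add: at_iff\<close>)
  have R7: "?q' |>Suc 0: Bi ?bb u' |>Suc (Suc 0): Bi ?cc u' |>0: T a a' b b' |>0: T ?ab ?ab' c c' = ?t"
    by (simp add: box_interchange)
  have R8: "?p |>Suc 0: PK v w |>0: PK u (v \<otimes> w) |>0: FL ?gkf ?x (u \<otimes> (v \<otimes> w)) ?x' (u' \<otimes> (v' \<otimes> w'))
     = ?t |>Suc (Suc 0): PK v' w' |>Suc 0: PK u' (v' \<otimes> w')"
    unfolding R1 R2 R3 R4 R5 R6 R7 ..
  have R: "?s |>0: FL ?R ?x ((u \<otimes> v) \<otimes> w) ?x' (u' \<otimes> (v' \<otimes> w')) = ?t |>Suc (Suc 0): PK v' w' |>Suc 0: PK u' (v' \<otimes> w')"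
  proof -
    have "?s |>0: FL ?R ?x ((u \<otimes> v) \<otimes> w) ?x' (u' \<otimes> (v' \<otimes> w'))
      = ?p |>0: PK u v |>0: PK (u \<otimes> v) w |>0: FL ?m ?x ((u \<otimes> v) \<otimes> w) ?x (u \<otimes> (v \<otimes> w)) |>Suc 0: FL ?gkf ?x (u \<otimes> (v \<otimes> w)) ?x' (u' \<otimes> (v' \<otimes> w')) |>0: M ?x ?x ?x'"
      unfolding s[symmetric] X_def Y_def Y'_def using box_fl_ucmp[OF _ m gkf, of ?s 0] by (simp add: at_iff)
    also have "?p |>0: PK u v |>0: PK (u \<otimes> v) w |>0: FL ?m ?x ((u \<otimes> v) \<otimes> w) ?x (u \<otimes> (v \<otimes> w))
      = ?p |>0: J ?x |>Suc (Suc 0): PK v w |>Suc 0: PK u (v \<otimes> w)"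
      by (rule box_fl_massoc) (simp_all add: at_iff)
    also have "?p |>0: J ?x |>Suc (Suc 0): PK v w |>Suc 0: PK u (v \<otimes> w) |>Suc 0: FL ?gkf ?x (u \<otimes> (v \<otimes> w)) ?x' (u' \<otimes> (v' \<otimes> w'))
      = ?p |>Suc 0: PK v w |>0: PK u (v \<otimes> w) |>0: FL ?gkf ?x (u \<otimes> (v \<otimes> w)) ?x' (u' \<otimes> (v' \<otimes> w')) |>0: J ?x"
      by (simp add: box_interchange)
    also have "\<dots> |>0: M ?x ?x ?x' = ?p |>Suc 0: PK v w |>0: PK u (v \<otimes> w) |>0: FL ?gkf ?x (u \<otimes> (v \<otimes> w)) ?x' (u' \<otimes> (v' \<otimes> w'))"
      by (rule J_M_left) (use gkf in \<open>simp_all add: at_iff\<close>)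
    finally show ?thesis unfolding R8 .
  qed
  show ?thesis by (rule ku_ext[OF kL kR]) (simp only: L R)
qed

end

context braided_monoidal_category
begin

text \<open>Crossing a unit amounts to deleting it and creating it on the other side: slide the
  strand past the box that deletes the unit.\<close>

lemma B_unit_swap:
  assumes at: "at p n [\<one>, x]" and x: "x \<in> obj V"
  shows "p |>n: B \<one> x = p |>n: U' |>Suc n: U"
proof -
  obtain A D where c: "cods p = Some (A @ [\<one>, x] @ D)" "n = length A" using at by (rule at_cods)
  have "p |>n: U' = p |>n: B \<one> x |>Suc n: U'"
    using mvl_nat[of p n "[\<one>]" x "\<i> \<one>" "[]"] at x by simp
  then show ?thesis using c x by (simp add: box_unit_cancel' at_iff)
qed

lemma Bi_unit_swap:
  assumes at: "at p n [\<one>, x]" and x: "x \<in> obj V"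
  shows "p |>n: Bi x \<one> = p |>n: U' |>Suc n: U"
proof -
  obtain A D where c: "cods p = Some (A @ [\<one>, x] @ D)" "n = length A" using at by (rule at_cods)
  have "p |>n: U' = p |>n: Bi x \<one> |>Suc n: U'"
    using mvli_nat[of p n "[\<one>]" x "\<i> \<one>" "[]"] at x by simp
  then show ?thesis using c x by (simp add: box_unit_cancel' at_iff)
qed

end

context strict_enriched
begin

text \<open>The crossing in the tensor product with the identity goes over the unit object, so it
  moves a unit without effect; \<open>T_unit_left\<close> absorbs the inserted identity of the
  unit.\<close>

lemma mlunit_nat:
  assumes f: "ku f a u a' u'"
  shows "ucmp V K (mten K (munit K) (a, u)) (mten K (munit K) (a', u')) (a', u')
      (uten V K (munit K) (munit K) (a, u) (a', u') (vid K (munit K)) f) (mlunit K (a', u'))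
    = ucmp V K (mten K (munit K) (a, u)) (a, u) (a', u') (mlunit K (a, u)) f" (is "?L = ?R")
proof -
  note ob [simp] = kuD(1-4)[OF f]
  let ?i = "munit C" and ?aa = "vhom C a a'"
  let ?id = "vid K (munit C, \<one>)"
  have id: "ku ?id ?i \<one> ?i \<one>" by (rule ku_vid) simp_all
  let ?t = "uten V K (?i, \<one>) (?i, \<one>) (a, u) (a', u') ?id f"
  have t: "ku ?t a (\<one> \<otimes> u) a' (\<one> \<otimes> u')" using ku_uten[OF id f] by simp
  let ?m = "mlunit K (a, u)" and ?m' = "mlunit K (a', u')"
  have m: "ku ?m a (\<one> \<otimes> u) a u" and m': "ku ?m' a' (\<one> \<otimes> u') a' u'" by (simp_all add: ku_mlunit)
  have kL: "ku ?L a (\<one> \<otimes> u) a' u'" using ku_ucmp[OF t m'] by (simp del: completion_simps(5))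
  have kR: "ku ?R a (\<one> \<otimes> u) a' u'" using ku_ucmp[OF m f] by simp
  let ?s = "start [\<one> \<otimes> u]"
  let ?p = "?s |>0: Box [\<one> \<otimes> u] (\<i> (\<one> \<otimes> u)) [\<one>, u]"
  have p: "cods ?p = Some [\<one>, u]" by simp
  have s: "?s = ?p |>0: PK \<one> u" by (simp add: box_norm)
  let ?F = "FL f a u a' u'"
  have "?s |>0: FL ?L a (\<one> \<otimes> u) a' u' = ?p |>0: PK \<one> u |>0: FL ?t a (\<one> \<otimes> u) a' (\<one> \<otimes> u') |>Suc 0: FL ?m' a' (\<one> \<otimes> u') a' u' |>0: M a a' a'"
    unfolding s[symmetric] using box_fl_ucmp[OF _ t m', of ?s 0] by (simp add: at_iff del: completion_simps(5))
  also have "?p |>0: PK \<one> u |>0: FL ?t a (\<one> \<otimes> u) a' (\<one> \<otimes> u')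
     = ?p |>0: FL ?id ?i \<one> ?i \<one> |>Suc (Suc 0): ?F |>Suc 0: Bi ?aa \<one> |>0: T ?i ?i a a' |>Suc 0: PK \<one> u'"
    using box_fl_uten[OF _ id f, of ?p 0] by (simp add: at_iff del: completion_simps(5))
  also have "?p |>0: FL ?id ?i \<one> ?i \<one> = ?p |>0: J ?i"
    by (rule box_fl_vid) (simp_all add: at_iff)
  also have "?p |>0: J ?i |>Suc (Suc 0): ?F |>Suc 0: Bi ?aa \<one> = ?p |>0: J ?i |>Suc (Suc 0): ?F |>Suc 0: U' |>Suc (Suc 0): U"
    by (rule Bi_unit_swap) (use f in \<open>simp_all add: at_iff\<close>)
  also have "\<dots> = ?p |>0: U' |>0: ?F |>Suc 0: U |>0: J ?i"
    using f by (simp add: box_interchange)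
  also have "?p |>0: U' |>0: ?F |>Suc 0: U |>0: J ?i |>0: T ?i ?i a a' = ?p |>0: U' |>0: ?F |>Suc 0: U"
    by (rule T_unit_left) (use f in \<open>simp_all add: at_iff\<close>)
  also have "?p |>0: U' |>0: ?F |>Suc 0: U |>Suc 0: PK \<one> u' |>Suc 0: FL ?m' a' (\<one> \<otimes> u') a' u'
     = ?p |>0: U' |>0: ?F |>Suc 0: U |>Suc 0: U' |>Suc 0: J a'"
    by (rule box_fl_mlunit) (use f in \<open>simp_all add: at_iff\<close>)
  also have "\<dots> |>0: M a a' a' = ?p |>0: U' |>0: ?F"
    using f by (simp add: box_unit_cancel J_M_right at_iff)
  finally have L: "?s |>0: FL ?L a (\<one> \<otimes> u) a' u' = ?p |>0: U' |>0: ?F" .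
  have "?s |>0: FL ?R a (\<one> \<otimes> u) a' u' = ?p |>0: PK \<one> u |>0: FL ?m a (\<one> \<otimes> u) a u |>Suc 0: ?F |>0: M a a a'"
    unfolding s[symmetric] using box_fl_ucmp[OF _ m f, of ?s 0] by (simp add: at_iff)
  also have "?p |>0: PK \<one> u |>0: FL ?m a (\<one> \<otimes> u) a u = ?p |>0: U' |>0: J a"
    by (rule box_fl_mlunit) (simp_all add: at_iff)
  also have "?p |>0: U' |>0: J a |>Suc 0: ?F = ?p |>0: U' |>0: ?F |>0: J a"
    using f by (simp add: box_interchange)
  also have "\<dots> |>0: M a a a' = ?p |>0: U' |>0: ?F"
    by (rule J_M_left) (use f in \<open>simp_all add: at_iff\<close>)
  finally have R: "?s |>0: FL ?R a (\<one> \<otimes> u) a' u' = ?p |>0: U' |>0: ?F" .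
  show ?thesis by (rule ku_ext[OF kL kR]) (simp only: L R)
qed

text \<open>The hom of the unit object arises from an identity, so its inverse crossing over
  \<open>u'\<close> vanishes by \<open>Bi_insert\<close>, and \<open>T_unit_right\<close> absorbs
  it.\<close>

lemma mrunit_nat:
  assumes f: "ku f a u a' u'"
  shows "ucmp V K (mten K (a, u) (munit K)) (mten K (a', u') (munit K)) (a', u')
      (uten V K (a, u) (a', u') (munit K) (munit K) f (vid K (munit K))) (mrunit K (a', u'))
    = ucmp V K (mten K (a, u) (munit K)) (a, u) (a', u') (mrunit K (a, u)) f" (is "?L = ?R")
proof -
  note ob [simp] = kuD(1-4)[OF f]
  let ?i = "munit C" and ?aa = "vhom C a a'"
  let ?id = "vid K (munit C, \<one>)"
  have id: "ku ?id ?i \<one> ?i \<one>" by (rule ku_vid) simp_all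
  let ?t = "uten V K (a, u) (a', u') (?i, \<one>) (?i, \<one>) f ?id"
  have t: "ku ?t a (u \<otimes> \<one>) a' (u' \<otimes> \<one>)" using ku_uten[OF f id] by simp
  let ?m = "mrunit K (a, u)" and ?m' = "mrunit K (a', u')"
  have m: "ku ?m a (u \<otimes> \<one>) a u" and m': "ku ?m' a' (u' \<otimes> \<one>) a' u'" by (simp_all add: ku_mrunit)
  have kL: "ku ?L a (u \<otimes> \<one>) a' u'" using ku_ucmp[OF t m'] by (simp del: completion_simps(5))
  have kR: "ku ?R a (u \<otimes> \<one>) a' u'" using ku_ucmp[OF m f] by simp
  let ?s = "start [u \<otimes> \<one>]"
  let ?p = "?s |>0: Box [u \<otimes> \<one>] (\<i> (u \<otimes> \<one>)) [u, \<one>]"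
  have p: "cods ?p = Some [u, \<one>]" by simp
  have s: "?s = ?p |>0: PK u \<one>" by (simp add: box_norm)
  let ?F = "FL f a u a' u'"
  have "?s |>0: FL ?L a (u \<otimes> \<one>) a' u' = ?p |>0: PK u \<one> |>0: FL ?t a (u \<otimes> \<one>) a' (u' \<otimes> \<one>) |>Suc 0: FL ?m' a' (u' \<otimes> \<one>) a' u' |>0: M a a' a'"
    unfolding s[symmetric] using box_fl_ucmp[OF _ t m', of ?s 0] by (simp add: at_iff del: completion_simps(5))
  also have "?p |>0: PK u \<one> |>0: FL ?t a (u \<otimes> \<one>) a' (u' \<otimes> \<one>)
     = ?p |>0: ?F |>Suc (Suc 0): FL ?id ?i \<one> ?i \<one> |>Suc 0: Bi (vhom C ?i ?i) u' |>0: T a a' ?i ?i |>Suc 0: PK u' \<one>"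
    using box_fl_uten[OF _ f id, of ?p 0] by (simp add: at_iff del: completion_simps(5))
  also have "?p |>0: ?F |>Suc (Suc 0): FL ?id ?i \<one> ?i \<one> = ?p |>0: ?F |>Suc (Suc 0): J ?i"
    by (rule box_fl_vid) (use f in \<open>simp_all add: at_iff\<close>)
  also have "?p |>0: ?F |>Suc (Suc 0): J ?i |>Suc 0: Bi (vhom C ?i ?i) u' = ?p |>0: ?F |>Suc 0: J ?i"
    by (rule Bi_insert) (use f in \<open>simp_all add: at_iff\<close>)
  also have "?p |>0: ?F |>Suc 0: J ?i |>0: T a a' ?i ?i = ?p |>0: ?F"
    by (rule T_unit_right) (use f in \<open>simp_all add: at_iff\<close>)
  also have "?p |>0: ?F |>Suc 0: PK u' \<one> |>Suc 0: FL ?m' a' (u' \<otimes> \<one>) a' u' = ?p |>0: ?F |>Suc (Suc 0): U' |>Suc 0: J a'"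
    by (rule box_fl_mrunit) (use f in \<open>simp_all add: at_iff\<close>)
  also have "\<dots> |>0: M a a' a' = ?p |>0: ?F |>Suc (Suc 0): U'"
    by (rule J_M_right) (use f in \<open>simp_all add: at_iff\<close>)
  finally have L: "?s |>0: FL ?L a (u \<otimes> \<one>) a' u' = ?p |>0: ?F |>Suc (Suc 0): U'" .
  have "?s |>0: FL ?R a (u \<otimes> \<one>) a' u' = ?p |>0: PK u \<one> |>0: FL ?m a (u \<otimes> \<one>) a u |>Suc 0: ?F |>0: M a a a'"
    unfolding s[symmetric] using box_fl_ucmp[OF _ m f, of ?s 0] by (simp add: at_iff)
  also have "?p |>0: PK u \<one> |>0: FL ?m a (u \<otimes> \<one>) a u = ?p |>Suc 0: U' |>0: J a"
    by (rule box_fl_mrunit) (simp_all add: at_iff)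
  also have "?p |>Suc 0: U' |>0: J a |>Suc 0: ?F = ?p |>0: ?F |>Suc (Suc 0): U' |>0: J a"
    using f by (simp add: box_interchange)
  also have "\<dots> |>0: M a a a' = ?p |>0: ?F |>Suc (Suc 0): U'"
    by (rule J_M_left) (use f in \<open>simp_all add: at_iff\<close>)
  finally have R: "?s |>0: FL ?R a (u \<otimes> \<one>) a' u' = ?p |>0: ?F |>Suc (Suc 0): U'" .
  show ?thesis by (rule ku_ext[OF kL kR]) (simp only: L R)
qed

subsection \<open>The embedding into the completion\<close>

abbreviation "Emb \<equiv> completion_embedding V C"

lemma Emb_obj [simp]: "fobj Emb a = (a, \<one>)"
  by (simp add: completion_embedding_def)

lemma Emb_typ [simp]:
  assumes "a \<in> vobj C" "b \<in> vobj C"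
  shows "fmap Emb a b \<in> arr V" "src V (fmap Emb a b) = vhom C a b" "trg V (fmap Emb a b) = hm a \<one> b \<one>"
  using assms by (simp_all add: completion_embedding_def)

abbreviation FI :: "'a \<Rightarrow> 'a \<Rightarrow> ('o, 'm) box" where
  "FI a b \<equiv> Box [vhom C a b] (fmap Emb a b) [hm a \<one> b \<one>]"

text \<open>Evaluated at the unit, the embedding only moves the unit strand from the left of
  \<open>C(a, b)\<close> to its right.\<close>

lemma box_Emb:
  assumes at: "at p n [\<one>, vhom C a b]" and ob: "a \<in> vobj C" "b \<in> vobj C"
  shows "p |>Suc n: FI a b |>n: E a \<one> b \<one> = p |>n: U' |>Suc n: U"
proof -
  let ?F = "\<l> (vhom C a b) \<Zsemi> \<inverse> (\<r> (vhom C a b))"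
  obtain A D where c: "cods p = Some (A @ [\<one>, vhom C a b] @ D)" "n = length A" using at by (rule at_cods)
  have F: "?F \<in> arr V" "src V ?F = \<one> \<otimes> vhom C a b" "trg V ?F = vhom C a b \<otimes> \<one>" using ob by simp_all
  have "p |>Suc n: FI a b |>n: E a \<one> b \<one> = p |>n: Box [\<one>, vhom C a b] ?F [vhom C a b, \<one>]"
    unfolding completion_embedding_def vfun.simps using box_mate[OF at F, of "[vhom C a b, \<one>]"] ob by simp
  then show ?thesis using c ob by (simp add: box_norm)
qed

text \<open>After evaluation the two functor laws reduce to moving the unit strand, once for each
  application of the embedding.\<close>

lemma Emb_functor: "V_functor V C K Emb"
  unfolding V_functor_def
proof (intro conjI ballI)
  fix a b assume ob [simp]: "a \<in> vobj C" "b \<in> vobj C"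
  show "fobj Emb a \<in> vobj K" by simp
  show "fmap Emb a b \<in> hom V (vhom C a b) (vhom K (fobj Emb a) (fobj Emb b))" by (simp add: hom_iff)
next
  fix a assume ob [simp]: "a \<in> vobj C"
  have k: "ku (vid C a \<Zsemi> fmap Emb a a) a \<one> a \<one>" by (simp add: ku_def)
  have "start [\<one>] |>0: FL (vid C a \<Zsemi> fmap Emb a a) a \<one> a \<one> = start [\<one>] |>Suc 0: Box [] (vid C a \<Zsemi> fmap Emb a a) [hm a \<one> a \<one>] |>0: E a \<one> a \<one>"
    using k by (simp add: box_fl at_iff)
  also have "\<dots> = start [\<one>] |>Suc 0: J a |>Suc 0: FI a a |>0: E a \<one> a \<one>"
    by (simp add: box_cmp)
  also have "\<dots> = start [\<one>] |>Suc 0: J a |>0: U' |>Suc 0: U"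
    by (rule box_Emb) (simp_all add: at_iff)
  also have "\<dots> = start [\<one>] |>0: U' |>0: U |>0: J a"
    by (simp add: box_interchange)
  also have "\<dots> = start [\<one>] |>0: FL (vid K (a, \<one>)) a \<one> a \<one>"
    using box_fl_vid[of "start [\<one>]" 0 \<one> a] by (simp add: box_unit_cancel' at_iff del: completion_simps(5))
  finally show "vid C a \<Zsemi> fmap Emb a a = vid K (fobj Emb a)"
    unfolding Emb_obj by (intro ku_ext[OF k] ku_vid) simp_all
next
  fix a b c assume ob [simp]: "a \<in> vobj C" "b \<in> vobj C" "c \<in> vobj C"
  let ?ws = "[vhom C a b, vhom C b c]" let ?s = "start (\<one> # ?ws)"
  let ?R = "(fmap Emb a b \<odot> fmap Emb b c) \<Zsemi> vcmp K (a, \<one>) (b, \<one>) (c, \<one>)"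
  have "vcmp C a b c \<Zsemi> fmap Emb a c = ?R"
  proof (rule completion_ext)
    show "vcmp C a b c \<Zsemi> fmap Emb a c \<in> arr V" "src V (vcmp C a b c \<Zsemi> fmap Emb a c) = tens ?ws"
      "trg V (vcmp C a b c \<Zsemi> fmap Emb a c) = hm a \<one> c \<one>" by simp_all
    show "?R \<in> arr V" "src V ?R = tens ?ws" "trg V ?R = hm a \<one> c \<one>" by simp_all
    have "?s |>Suc 0: Box ?ws (vcmp C a b c \<Zsemi> fmap Emb a c) [hm a \<one> c \<one>] |>0: E a \<one> c \<one>
       = ?s |>Suc 0: M a b c |>Suc 0: FI a c |>0: E a \<one> c \<one>"
      by (simp add: box_cmp)
    also have "\<dots> = ?s |>Suc 0: M a b c |>0: U' |>Suc 0: U"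
      by (rule box_Emb) (simp_all add: at_iff)
    finally have L: "?s |>Suc 0: Box ?ws (vcmp C a b c \<Zsemi> fmap Emb a c) [hm a \<one> c \<one>] |>0: E a \<one> c \<one> = ?s |>0: U' |>0: M a b c |>Suc 0: U"
      by (simp add: box_interchange)
    have "?s |>Suc 0: Box ?ws ?R [hm a \<one> c \<one>] |>0: E a \<one> c \<one>
       = ?s |>Suc 0: Box ?ws (fmap Emb a b \<odot> fmap Emb b c) [hm a \<one> b \<one>, hm b \<one> c \<one>]
         |>Suc 0: Box [hm a \<one> b \<one>, hm b \<one> c \<one>] (vcmp K (a, \<one>) (b, \<one>) (c, \<one>)) [hm a \<one> c \<one>] |>0: E a \<one> c \<one>"
      by (subst box_cmp) simp_all
    also have "?s |>Suc 0: Box ?ws (fmap Emb a b \<odot> fmap Emb b c) [hm a \<one> b \<one>, hm b \<one> c \<one>] = ?s |>Suc 0: FI a b |>Suc (Suc 0): FI b c"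
      by (rule box_ten_native) (simp_all add: at_iff)
    also have "?s |>Suc 0: FI a b |>Suc (Suc 0): FI b c |>Suc 0: Box [hm a \<one> b \<one>, hm b \<one> c \<one>] (vcmp K (a, \<one>) (b, \<one>) (c, \<one>)) [hm a \<one> c \<one>] |>0: E a \<one> c \<one>
       = ?s |>Suc 0: FI a b |>Suc (Suc 0): FI b c |>0: E a \<one> b \<one> |>Suc 0: E b \<one> c \<one> |>0: M a b c"
      by (rule box_Kcmp) (simp_all add: at_iff)
    also have "?s |>Suc 0: FI a b |>Suc (Suc 0): FI b c |>0: E a \<one> b \<one> = ?s |>Suc 0: FI a b |>0: E a \<one> b \<one> |>Suc (Suc 0): FI b c"
      by (simp add: box_interchange)
    also have "?s |>Suc 0: FI a b |>0: E a \<one> b \<one> = ?s |>0: U' |>Suc 0: U"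
      by (rule box_Emb) (simp_all add: at_iff)
    also have "?s |>0: U' |>Suc 0: U |>Suc (Suc 0): FI b c |>Suc 0: E b \<one> c \<one> = ?s |>0: U' |>Suc 0: U |>Suc 0: U' |>Suc (Suc 0): U"
      by (rule box_Emb) (simp_all add: at_iff)
    also have "?s |>0: U' |>Suc 0: U |>Suc 0: U' = ?s |>0: U'"
      by (rule box_unit_cancel) (simp add: at_iff)
    also have "?s |>0: U' |>Suc (Suc 0): U |>0: M a b c = ?s |>0: U' |>0: M a b c |>Suc 0: U"
      by (simp add: box_interchange)
    finally show "?s |>Suc 0: Box ?ws (vcmp C a b c \<Zsemi> fmap Emb a c) [hm a \<one> c \<one>] |>0: E a \<one> c \<one>
       = ?s |>Suc 0: Box ?ws ?R [hm a \<one> c \<one>] |>0: E a \<one> c \<one>" using L by simp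
  qed simp_all
  then show "vcmp C a b c \<Zsemi> fmap Emb a c = (fmap Emb a b \<odot> fmap Emb b c) \<Zsemi> vcmp K (fobj Emb a) (fobj Emb b) (fobj Emb c)"
    by simp
qed

text \<open>Full faithfulness: the inverse creates a unit, evaluates there and deletes the unit that
  is left over.\<close>

lemma Emb_iso [simp]:
  assumes ob [simp]: "a \<in> vobj C" "b \<in> vobj C"
  shows "iso (fmap Emb a b)"
proof -
  let ?ab = "vhom C a b" and ?h = "hm a \<one> b \<one>"
  let ?N = "\<inverse> (\<l> ?h) \<Zsemi> \<epsilon> \<one> (?ab \<otimes> \<one>) \<Zsemi> \<r> ?ab"
  have N [simp]: "?N \<in> arr V" "src V ?N = ?h" "trg V ?N = ?ab" by simp_all
  have boxN: "p |>n: Box [?h] ?N [?ab] = p |>n: U |>n: E a \<one> b \<one> |>Suc n: U'" if at: "at p n [?h]" for p n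
  proof -
    obtain A D where c: "cods p = Some (A @ [?h] @ D)" "n = length A" using at by (rule at_cods)
    show ?thesis using c by (simp add: box_norm box_ev)
  qed
  have "fmap Emb a b \<Zsemi> ?N = \<i> ?ab"
  proof (rule box_inj[where xs = "[?ab]" and ys = "[?ab]"])
    let ?s = "start [?ab]"
    have "?s |>0: Box [?ab] (fmap Emb a b \<Zsemi> ?N) [?ab] = ?s |>0: FI a b |>0: Box [?h] ?N [?ab]"
      by (subst box_cmp) (simp_all del: N)
    also have "\<dots> = ?s |>0: FI a b |>0: U |>0: E a \<one> b \<one> |>Suc 0: U'"
      by (rule boxN) (simp add: at_iff)
    also have "?s |>0: FI a b |>0: U = ?s |>0: U |>Suc 0: FI a b"
      by (simp add: box_interchange)
    also have "?s |>0: U |>Suc 0: FI a b |>0: E a \<one> b \<one> = ?s |>0: U |>0: U' |>Suc 0: U"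
      by (rule box_Emb) (simp_all add: at_iff)
    also have "\<dots> |>Suc 0: U' = ?s"
      by (simp add: box_unit_cancel at_iff)
    finally show "?s |>0: Box [?ab] (fmap Emb a b \<Zsemi> ?N) [?ab] = ?s |>0: Box [?ab] (\<i> ?ab) [?ab]"
      by (simp add: box_id at_iff)
  qed simp_all
  moreover have "?N \<Zsemi> fmap Emb a b = \<i> ?h"
  proof (rule completion_ext)
    let ?s = "start [\<one>, ?h]"
    show "?N \<Zsemi> fmap Emb a b \<in> arr V" "src V (?N \<Zsemi> fmap Emb a b) = tens [?h]" "trg V (?N \<Zsemi> fmap Emb a b) = ?h" by simp_all
    have "?s |>Suc 0: Box [?h] (?N \<Zsemi> fmap Emb a b) [?h] |>0: E a \<one> b \<one> = ?s |>Suc 0: Box [?h] ?N [?ab] |>Suc 0: FI a b |>0: E a \<one> b \<one>"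
      by (subst box_cmp) simp_all
    also have "\<dots> = ?s |>Suc 0: Box [?h] ?N [?ab] |>0: U' |>Suc 0: U"
      by (rule box_Emb) (simp_all add: at_iff)
    also have "?s |>Suc 0: Box [?h] ?N [?ab] = ?s |>Suc 0: U |>Suc 0: E a \<one> b \<one> |>Suc (Suc 0): U'"
      by (rule boxN) (simp add: at_iff)
    also have "?s |>Suc 0: U |>Suc 0: E a \<one> b \<one> |>Suc (Suc 0): U' |>0: U' |>Suc 0: U
       = ?s |>Suc 0: U |>0: U' |>0: E a \<one> b \<one> |>Suc 0: U' |>Suc 0: U"
      by (simp add: box_interchange)
    also have "\<dots> = ?s |>Suc 0: U |>0: U' |>0: E a \<one> b \<one>"
      by (rule box_unit_cancel') (simp add: at_iff)
    also have "?s |>Suc 0: U |>0: U' = ?s"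
      using box_interchange[of 0 U' "Suc 0" ?s U] by (simp add: box_unit_cancel' at_iff)
    finally show "start (\<one> # [?h]) |>Suc 0: Box [?h] (?N \<Zsemi> fmap Emb a b) [?h] |>0: E a \<one> b \<one>
       = start (\<one> # [?h]) |>Suc 0: Box [?h] (\<i> ?h) [?h] |>0: E a \<one> b \<one>"
      by (simp add: box_id at_iff)
  qed simp_all
  ultimately show ?thesis by (intro isoI(1)[of _ ?N]) simp_all
qed

end

context braided_monoidal_category
begin

text \<open>Says that \<open>\<l>\<close> at \<open>\<one> \<otimes> z\<close> is
  \<open>\<i> \<one> \<odot> \<l> z\<close>: deleting the new unit or the old one makes no
  difference. It follows from interchange with the empty-domain box \<open>U\<close>.\<close>

lemma box_unit_shift_left:
  assumes "at p n [\<one>]"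
  shows "p |>n: U |>Suc n: U' = p"
  using box_interchange[of n "U" n p "U'"] box_unit_cancel'[OF assms] by simp

end

context enriched_category
begin

lemma ucmp_vid_left:
  assumes "a \<in> vobj C" "b \<in> vobj C" "f \<in> arr V" "src V f = \<one>" "trg V f = vhom C a b"
  shows "ucmp V C a a b (vid C a) f = f"
proof (rule box_inj[where xs = "[]" and ys = "[vhom C a b]"])
  let ?s = "start []" let ?f = "Box [] f [vhom C a b]"
  have "?s |>0: Box [] (ucmp V C a a b (vid C a) f) [vhom C a b] = ?s |>0: J a |>Suc 0: ?f |>0: M a a b"
    using assms by (intro box_ucmp) (simp_all add: at_iff)
  also have "?s |>0: J a |>Suc 0: ?f = ?s |>0: ?f |>0: J a"
    using box_interchange[of 0 "J a" 0 ?s ?f] by simp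
  also have "\<dots> |>0: M a a b = ?s |>0: ?f"
    using assms by (intro J_M_left) (simp_all add: at_iff)
  finally show "?s |>0: Box [] (ucmp V C a a b (vid C a) f) [vhom C a b] = ?s |>0: ?f" .
qed (use assms in auto)

lemma ucmp_vid_right:
  assumes "a \<in> vobj C" "b \<in> vobj C" "f \<in> arr V" "src V f = \<one>" "trg V f = vhom C a b"
  shows "ucmp V C a b b f (vid C b) = f"
proof (rule box_inj[where xs = "[]" and ys = "[vhom C a b]"])
  let ?s = "start []" let ?f = "Box [] f [vhom C a b]"
  have "?s |>0: Box [] (ucmp V C a b b f (vid C b)) [vhom C a b] = ?s |>0: ?f |>Suc 0: J b |>0: M a b b"
    using assms by (intro box_ucmp) (simp_all add: at_iff)
  also have "\<dots> = ?s |>0: ?f"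
    using assms by (intro J_M_right) (simp_all add: at_iff)
  finally show "?s |>0: Box [] (ucmp V C a b b f (vid C b)) [vhom C a b] = ?s |>0: ?f" .
qed (use assms in auto)

end

context strict_enriched
begin

section \<open>The monoidal structure of the embedding\<close>

context
  fixes a b assumes ob [simp]: "a \<in> vobj C" "b \<in> vobj C"
begin

lemma ku_nu: "ku (nu Emb a b) (mten C a b) \<one> (mten C a b) (\<one> \<otimes> \<one>)"
  by (simp add: completion_embedding_def ku_def)

lemma box_fl_nu:
  assumes "at p n [\<one>]"
  shows "p |>n: FL (nu Emb a b) (mten C a b) \<one> (mten C a b) (\<one> \<otimes> \<one>) = p |>n: J (mten C a b) |>Suc n: U |>Suc n: PK \<one> \<one>"
proof -
  obtain A D where c: "cods p = Some (A @ [\<one>] @ D)" "n = length A" using assms by (rule at_cods)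
  let ?F = "\<inverse> (\<l> \<one>) \<Zsemi> \<inverse> (\<l> (\<one> \<otimes> \<one>)) \<Zsemi> (vid C (mten C a b) \<odot> \<i> (\<one> \<otimes> \<one>))"
  have "fl (nu Emb a b) (mten C a b) \<one> (mten C a b) (\<one> \<otimes> \<one>) = ?F"
    using fl_name(2)[of ?F] by (simp add: completion_embedding_def)
  then show ?thesis using c by (simp add: box_norm box_vid)
qed

text \<open>Witness for invertibility of \<open>\<nu>\<close>: it deletes the additional unit that
  \<open>\<nu>\<close> creates.\<close>

definition nu_inv :: "'m" where
  "nu_inv = name V (\<one> \<otimes> \<one>) (\<l> \<one> \<Zsemi> \<inverse> (\<l> \<one>) \<Zsemi> (vid C (mten C a b) \<odot> \<i> \<one>))"

lemma ku_nu_inv: "ku nu_inv (mten C a b) (\<one> \<otimes> \<one>) (mten C a b) \<one>"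
  by (simp add: nu_inv_def ku_def)

lemma box_fl_nu_inv:
  assumes "at p n [\<one>, \<one>]"
  shows "p |>n: PK \<one> \<one> |>n: FL nu_inv (mten C a b) (\<one> \<otimes> \<one>) (mten C a b) \<one> = p |>n: U' |>n: J (mten C a b)"
proof -
  obtain A D where c: "cods p = Some (A @ [\<one>, \<one>] @ D)" "n = length A" using assms by (rule at_cods)
  let ?F = "\<l> \<one> \<Zsemi> \<inverse> (\<l> \<one>) \<Zsemi> (vid C (mten C a b) \<odot> \<i> \<one>)"
  have "fl nu_inv (mten C a b) (\<one> \<otimes> \<one>) (mten C a b) \<one> = ?F"
    using fl_name(2)[of ?F] by (simp add: nu_inv_def)
  then show ?thesis using c by (simp add: box_norm box_vid)
qed

text \<open>Each composite creates and deletes one unit and composes two identities of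
  \<open>C\<close>; the remaining effort is regrouping.\<close>

lemma nu_uisos: "nu Emb a b \<in> uisos V K (mten C a b, \<one>) (mten C a b, \<one> \<otimes> \<one>)"
proof -
  let ?ab = "mten C a b" and ?n = "nu Emb a b"
  note k = ku_nu ku_nu_inv
  let ?X = "(?ab, \<one>)" and ?Y = "(?ab, \<one> \<otimes> \<one>)"
  have 1: "ucmp V K ?X ?Y ?X ?n nu_inv = vid K ?X"
  proof (rule ku_ext[of _ ?ab \<one> ?ab \<one>])
    let ?s = "start [\<one>]"
    have "?s |>0: FL (ucmp V K ?X ?Y ?X ?n nu_inv) ?ab \<one> ?ab \<one>
       = ?s |>0: FL ?n ?ab \<one> ?ab (\<one> \<otimes> \<one>) |>Suc 0: FL nu_inv ?ab (\<one> \<otimes> \<one>) ?ab \<one> |>0: M ?ab ?ab ?ab"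
      by (rule box_fl_ucmp[OF _ k]) (simp add: at_iff)
    also have "?s |>0: FL ?n ?ab \<one> ?ab (\<one> \<otimes> \<one>) = ?s |>0: J ?ab |>Suc 0: U |>Suc 0: PK \<one> \<one>"
      by (rule box_fl_nu) (simp add: at_iff)
    also have "?s |>0: J ?ab |>Suc 0: U |>Suc 0: PK \<one> \<one> |>Suc 0: FL nu_inv ?ab (\<one> \<otimes> \<one>) ?ab \<one> = ?s |>0: J ?ab |>Suc 0: U |>Suc 0: U' |>Suc 0: J ?ab"
      by (rule box_fl_nu_inv) (simp add: at_iff)
    also have "\<dots> |>0: M ?ab ?ab ?ab = ?s |>0: J ?ab"
      by (simp add: box_unit_cancel J_M_right at_iff)
    also have "\<dots> = ?s |>0: FL (vid K ?X) ?ab \<one> ?ab \<one>"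
      by (rule box_fl_vid[symmetric]) (simp_all add: at_iff)
    finally show "?s |>0: FL (ucmp V K ?X ?Y ?X ?n nu_inv) ?ab \<one> ?ab \<one> = ?s |>0: FL (vid K ?X) ?ab \<one> ?ab \<one>" .
  qed (rule ku_ucmp[OF k], rule ku_vid, simp_all)
  have 2: "ucmp V K ?Y ?X ?Y nu_inv ?n = vid K ?Y"
  proof (rule ku_ext[of _ ?ab "\<one> \<otimes> \<one>" ?ab "\<one> \<otimes> \<one>"])
    let ?s = "start [\<one> \<otimes> \<one>]" let ?p = "?s |>0: Box [\<one> \<otimes> \<one>] (\<i> (\<one> \<otimes> \<one>)) [\<one>, \<one>]"
    have s: "?s = ?p |>0: PK \<one> \<one>" by (simp add: box_norm)
    have "?s |>0: FL (ucmp V K ?Y ?X ?Y nu_inv ?n) ?ab (\<one> \<otimes> \<one>) ?ab (\<one> \<otimes> \<one>)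
       = ?s |>0: FL nu_inv ?ab (\<one> \<otimes> \<one>) ?ab \<one> |>Suc 0: FL ?n ?ab \<one> ?ab (\<one> \<otimes> \<one>) |>0: M ?ab ?ab ?ab"
      by (rule box_fl_ucmp[OF _ k(2,1)]) (simp add: at_iff)
    also have "\<dots> = ?p |>0: PK \<one> \<one> |>0: FL nu_inv ?ab (\<one> \<otimes> \<one>) ?ab \<one> |>Suc 0: FL ?n ?ab \<one> ?ab (\<one> \<otimes> \<one>) |>0: M ?ab ?ab ?ab"
      unfolding s[symmetric] ..
    also have "?p |>0: PK \<one> \<one> |>0: FL nu_inv ?ab (\<one> \<otimes> \<one>) ?ab \<one> = ?p |>0: U' |>0: J ?ab"
      by (rule box_fl_nu_inv) (simp add: at_iff)
    also have "?p |>0: U' |>0: J ?ab |>Suc 0: FL ?n ?ab \<one> ?ab (\<one> \<otimes> \<one>) = ?p |>0: U' |>0: J ?ab |>Suc 0: J ?ab |>Suc (Suc 0): U |>Suc (Suc 0): PK \<one> \<one>"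
      by (rule box_fl_nu) (simp add: at_iff)
    also have "\<dots> |>0: M ?ab ?ab ?ab = ?p |>0: U' |>0: J ?ab |>Suc 0: J ?ab |>0: M ?ab ?ab ?ab |>Suc 0: U |>Suc 0: PK \<one> \<one>"
      by (simp add: box_interchange)
    also have "?p |>0: U' |>0: J ?ab |>Suc 0: J ?ab |>0: M ?ab ?ab ?ab = ?p |>0: U' |>0: J ?ab"
      by (rule J_M_right) (simp_all add: at_iff)
    also have "?p |>0: U' |>0: J ?ab |>Suc 0: U = ?p |>0: U' |>0: U |>0: J ?ab"
      using box_interchange[of 0 "J ?ab" 0 "?p |>0: U'" U] by simp
    also have "?p |>0: U' |>0: U = ?p"
      by (rule box_unit_cancel') (simp add: at_iff)
    also have "?p |>0: J ?ab |>Suc 0: PK \<one> \<one> = ?p |>0: PK \<one> \<one> |>0: J ?ab"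
      using box_interchange[of 0 "J ?ab" 0 ?p "PK \<one> \<one>"] by simp
    also have "?p |>0: PK \<one> \<one> = ?s" using s by simp
    also have "?s |>0: J ?ab = ?s |>0: FL (vid K ?Y) ?ab (\<one> \<otimes> \<one>) ?ab (\<one> \<otimes> \<one>)"
      by (rule box_fl_vid[symmetric]) (simp_all add: at_iff)
    finally show "?s |>0: FL (ucmp V K ?Y ?X ?Y nu_inv ?n) ?ab (\<one> \<otimes> \<one>) ?ab (\<one> \<otimes> \<one>) = ?s |>0: FL (vid K ?Y) ?ab (\<one> \<otimes> \<one>) ?ab (\<one> \<otimes> \<one>)" .
  qed (rule ku_ucmp[OF k(2,1)], rule ku_vid, simp_all)
  show ?thesis
    using 1 2 k by (auto simp: uisos_def ku_iff simp del: completion_simps(5))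
qed

end

text \<open>The tensor product of the completion contributes two crossings, but here both are
  against unit strands. Each becomes a deletion and a creation, after which the sides differ by
  interchange alone.\<close>

lemma nu_natural:
  assumes ob [simp]: "a \<in> vobj C" "b \<in> vobj C" "c \<in> vobj C" "d \<in> vobj C"
  shows "mtenm C a c b d \<Zsemi> fmap Emb (mten C a b) (mten C c d) \<Zsemi>
      postcmp V K (mten C a b, \<one>) (mten C c d, \<one>) (mten C c d, \<one> \<otimes> \<one>) (nu Emb c d)
    = (fmap Emb a c \<odot> fmap Emb b d) \<Zsemi> mtenm K (a, \<one>) (c, \<one>) (b, \<one>) (d, \<one>) \<Zsemi>
      precmp V K (mten C a b, \<one>) (mten C a b, \<one> \<otimes> \<one>) (mten C c d, \<one> \<otimes> \<one>) (nu Emb a b)"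
proof (rule completion_ext)
  let ?ab = "mten C a b" and ?cd = "mten C c d" and ?ac = "vhom C a c" and ?bd = "vhom C b d"
  let ?post = "postcmp V K (?ab, \<one>) (?cd, \<one>) (?cd, \<one> \<otimes> \<one>) (nu Emb c d)"
  let ?pre = "precmp V K (?ab, \<one>) (?ab, \<one> \<otimes> \<one>) (?cd, \<one> \<otimes> \<one>) (nu Emb a b)"
  let ?L = "mtenm C a c b d \<Zsemi> fmap Emb ?ab ?cd \<Zsemi> ?post"
  let ?KT = "mtenm K (a, \<one>) (c, \<one>) (b, \<one>) (d, \<one>)"
  let ?R = "(fmap Emb a c \<odot> fmap Emb b d) \<Zsemi> ?KT \<Zsemi> ?pre"
  let ?h = "hm ?ab \<one> ?cd (\<one> \<otimes> \<one>)" let ?ws = "[?ac, ?bd]"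
  note nab = kuD[OF ku_nu[OF ob(1,2)]] and ncd = kuD[OF ku_nu[OF ob(3,4)]]
  have post: "?post \<in> arr V" "src V ?post = hm ?ab \<one> ?cd \<one>" "trg V ?post = ?h"
    using K.postcmp_typ[of "(?ab, \<one>)" "(?cd, \<one>)" "(?cd, \<one> \<otimes> \<one>)" "nu Emb c d"] ncd by simp_all
  have pre: "?pre \<in> arr V" "src V ?pre = hm ?ab (\<one> \<otimes> \<one>) ?cd (\<one> \<otimes> \<one>)" "trg V ?pre = ?h"
    using K.precmp_typ[of "(?ab, \<one>)" "(?ab, \<one> \<otimes> \<one>)" "(?cd, \<one> \<otimes> \<one>)" "nu Emb a b"] nab by simp_all
  show "?L \<in> arr V" "src V ?L = tens ?ws" "trg V ?L = ?h" using post by simp_all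
  show "?R \<in> arr V" "src V ?R = tens ?ws" "trg V ?R = ?h" using pre by simp_all
  let ?s = "start (\<one> # ?ws)"
  let ?E = "E ?ab \<one> ?cd (\<one> \<otimes> \<one>)"
  let ?N1 = "Box [] (nu Emb c d) [hm ?cd \<one> ?cd (\<one> \<otimes> \<one>)]" and ?N2 = "Box [] (nu Emb a b) [hm ?ab \<one> ?ab (\<one> \<otimes> \<one>)]"
  let ?T = "T a c b d"
  have "?s |>Suc 0: Box ?ws ?L [?h] |>0: ?E = ?s |>Suc 0: ?T |>Suc 0: FI ?ab ?cd |>Suc 0: Box [hm ?ab \<one> ?cd \<one>] ?post [?h] |>0: ?E"
    using post by (simp add: box_cmp)
  also have "?s |>Suc 0: ?T |>Suc 0: FI ?ab ?cd |>Suc 0: Box [hm ?ab \<one> ?cd \<one>] ?post [?h]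
     = ?s |>Suc 0: ?T |>Suc 0: FI ?ab ?cd |>Suc (Suc 0): ?N1 |>Suc 0: Box [hm ?ab \<one> ?cd \<one>, hm ?cd \<one> ?cd (\<one> \<otimes> \<one>)] (vcmp K (?ab, \<one>) (?cd, \<one>) (?cd, \<one> \<otimes> \<one>)) [?h]"
    using K.box_postcmp[of "(?ab, \<one>)" "(?cd, \<one>)" "(?cd, \<one> \<otimes> \<one>)" "?s |>Suc 0: ?T |>Suc 0: FI ?ab ?cd" "Suc 0" "nu Emb c d"] ncd
    by (simp add: at_iff)
  also have "\<dots> |>0: ?E = ?s |>Suc 0: ?T |>Suc 0: FI ?ab ?cd |>Suc (Suc 0): ?N1 |>0: E ?ab \<one> ?cd \<one> |>Suc 0: E ?cd \<one> ?cd (\<one> \<otimes> \<one>) |>0: M ?ab ?cd ?cd"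
    by (rule box_Kcmp) (use ncd in \<open>simp_all add: at_iff\<close>)
  also have "?s |>Suc 0: ?T |>Suc 0: FI ?ab ?cd |>Suc (Suc 0): ?N1 |>0: E ?ab \<one> ?cd \<one> = ?s |>Suc 0: ?T |>Suc 0: FI ?ab ?cd |>0: E ?ab \<one> ?cd \<one> |>Suc (Suc 0): ?N1"
    by (simp add: box_interchange)
  also have "?s |>Suc 0: ?T |>Suc 0: FI ?ab ?cd |>0: E ?ab \<one> ?cd \<one> = ?s |>Suc 0: ?T |>0: U' |>Suc 0: U"
    by (rule box_Emb) (simp_all add: at_iff)
  also have "?s |>Suc 0: ?T |>0: U' |>Suc 0: U |>Suc (Suc 0): ?N1 |>Suc 0: E ?cd \<one> ?cd (\<one> \<otimes> \<one>) = ?s |>Suc 0: ?T |>0: U' |>Suc 0: U |>Suc 0: FL (nu Emb c d) ?cd \<one> ?cd (\<one> \<otimes> \<one>)"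
    by (rule box_fl) (simp_all add: at_iff ku_nu)
  also have "\<dots> = ?s |>Suc 0: ?T |>0: U' |>Suc 0: U |>Suc 0: J ?cd |>Suc (Suc 0): U |>Suc (Suc 0): PK \<one> \<one>"
    by (rule box_fl_nu) (simp_all add: at_iff)
  also have "\<dots> |>0: M ?ab ?cd ?cd = ?s |>Suc 0: ?T |>0: U' |>Suc 0: U |>Suc 0: J ?cd |>0: M ?ab ?cd ?cd |>Suc 0: U |>Suc 0: PK \<one> \<one>"
    by (simp add: box_interchange)
  also have "?s |>Suc 0: ?T |>0: U' |>Suc 0: U |>Suc 0: J ?cd |>0: M ?ab ?cd ?cd = ?s |>Suc 0: ?T |>0: U' |>Suc 0: U"
    by (rule J_M_right) (simp_all add: at_iff)
  finally have L: "?s |>Suc 0: Box ?ws ?L [?h] |>0: ?E = ?s |>Suc 0: ?T |>0: U' |>Suc 0: U |>Suc 0: U |>Suc 0: PK \<one> \<one>" .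
  let ?ik = "[hm a \<one> c \<one>, hm b \<one> d \<one>]" and ?h1 = "hm ?ab (\<one> \<otimes> \<one>) ?cd (\<one> \<otimes> \<one>)"
  let ?t = "Box ?ik ?KT [?h1]"
  have "?s |>Suc 0: Box ?ws ?R [?h] |>0: ?E = ?s |>Suc 0: Box ?ws (fmap Emb a c \<odot> fmap Emb b d) ?ik |>Suc 0: ?t |>Suc 0: Box [?h1] ?pre [?h] |>0: ?E"
    using pre by (simp add: box_cmp)
  also have "?s |>Suc 0: Box ?ws (fmap Emb a c \<odot> fmap Emb b d) ?ik = ?s |>Suc 0: FI a c |>Suc (Suc 0): FI b d"
    by (rule box_ten_native) (simp_all add: at_iff)
  also have "?s |>Suc 0: FI a c |>Suc (Suc 0): FI b d |>Suc 0: ?t |>Suc 0: Box [?h1] ?pre [?h]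
     = ?s |>Suc 0: FI a c |>Suc (Suc 0): FI b d |>Suc 0: ?t |>Suc 0: ?N2 |>Suc 0: Box [hm ?ab \<one> ?ab (\<one> \<otimes> \<one>), ?h1] (vcmp K (?ab, \<one>) (?ab, \<one> \<otimes> \<one>) (?cd, \<one> \<otimes> \<one>)) [?h]"
    using K.box_precmp[of "(?ab, \<one>)" "(?ab, \<one> \<otimes> \<one>)" "(?cd, \<one> \<otimes> \<one>)" "?s |>Suc 0: FI a c |>Suc (Suc 0): FI b d |>Suc 0: ?t" "Suc 0" "nu Emb a b"] nab
    by (simp add: at_iff)
  also have "\<dots> |>0: ?E = ?s |>Suc 0: FI a c |>Suc (Suc 0): FI b d |>Suc 0: ?t |>Suc 0: ?N2 |>0: E ?ab \<one> ?ab (\<one> \<otimes> \<one>) |>Suc 0: E ?ab (\<one> \<otimes> \<one>) ?cd (\<one> \<otimes> \<one>) |>0: M ?ab ?ab ?cd"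
    by (rule box_Kcmp) (use nab in \<open>simp_all add: at_iff\<close>)
  also have "?s |>Suc 0: FI a c |>Suc (Suc 0): FI b d |>Suc 0: ?t |>Suc 0: ?N2 |>0: E ?ab \<one> ?ab (\<one> \<otimes> \<one>)
     = ?s |>Suc 0: ?N2 |>0: E ?ab \<one> ?ab (\<one> \<otimes> \<one>) |>Suc (Suc 0): FI a c |>Suc (Suc (Suc 0)): FI b d |>Suc (Suc 0): ?t"
    by (simp add: box_interchange)
  also have "?s |>Suc 0: ?N2 |>0: E ?ab \<one> ?ab (\<one> \<otimes> \<one>) = ?s |>0: FL (nu Emb a b) ?ab \<one> ?ab (\<one> \<otimes> \<one>)"
    by (rule box_fl) (simp_all add: at_iff ku_nu)
  also have "\<dots> = ?s |>0: J ?ab |>Suc 0: U |>Suc 0: PK \<one> \<one>"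
    by (rule box_fl_nu) (simp_all add: at_iff)
  finally have R1: "?s |>Suc 0: Box ?ws ?R [?h] |>0: ?E
     = ?s |>0: J ?ab |>Suc 0: U |>Suc 0: PK \<one> \<one> |>Suc (Suc 0): FI a c |>Suc (Suc (Suc 0)): FI b d |>Suc (Suc 0): ?t
        |>Suc 0: E ?ab (\<one> \<otimes> \<one>) ?cd (\<one> \<otimes> \<one>) |>0: M ?ab ?ab ?cd" .
  let ?j = "?s |>0: J ?ab"
  let ?q = "?j |>Suc 0: U |>Suc (Suc (Suc 0)): FI a c |>Suc (Suc (Suc (Suc 0))): FI b d"
  have R2: "?j |>Suc 0: U |>Suc 0: PK \<one> \<one> |>Suc (Suc 0): FI a c |>Suc (Suc (Suc 0)): FI b d = ?q |>Suc 0: PK \<one> \<one>"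
    by (simp add: box_interchange)
  let ?hc = "hm a \<one> c \<one>"
  have R3: "?q |>Suc 0: PK \<one> \<one> |>Suc (Suc 0): ?t |>Suc 0: E ?ab (\<one> \<otimes> \<one>) ?cd (\<one> \<otimes> \<one>)
     = ?q |>Suc (Suc 0): B \<one> ?hc |>Suc 0: E a \<one> c \<one> |>Suc (Suc (Suc 0)): E b \<one> d \<one> |>Suc (Suc 0): Bi ?bd \<one> |>Suc 0: ?T |>Suc (Suc 0): PK \<one> \<one>"
    by (rule box_Kten) (simp_all add: at_iff)
  \<comment> \<open>First of the two crossings; the other, an inverse one, is treated in
    \<open>R10\<close>.\<close>
  have R4: "?q |>Suc (Suc 0): B \<one> ?hc = ?q |>Suc (Suc 0): U' |>Suc (Suc (Suc 0)): U"
    by (rule B_unit_swap) (simp_all add: at_iff)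
  let ?r = "?j |>Suc 0: U |>Suc (Suc 0): U'"
  have r: "?r = ?j"
    by (rule box_unit_shift_left) (simp add: at_iff)
  have R5: "?q |>Suc (Suc 0): U' |>Suc (Suc (Suc 0)): U = ?j |>Suc (Suc 0): FI a c |>Suc (Suc (Suc 0)): U |>Suc (Suc (Suc (Suc 0))): FI b d"
  proof -
    have "?q |>Suc (Suc 0): U' |>Suc (Suc (Suc 0)): U = ?r |>Suc (Suc 0): FI a c |>Suc (Suc (Suc 0)): U |>Suc (Suc (Suc (Suc 0))): FI b d"
      by (simp add: box_interchange)
    then show ?thesis unfolding r .
  qed
  have R6: "?j |>Suc (Suc 0): FI a c |>Suc (Suc (Suc 0)): U |>Suc (Suc (Suc (Suc 0))): FI b d |>Suc 0: E a \<one> c \<one>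
     = ?j |>Suc (Suc 0): FI a c |>Suc 0: E a \<one> c \<one> |>Suc (Suc (Suc 0)): U |>Suc (Suc (Suc (Suc 0))): FI b d"
    by (simp add: box_interchange)
  have R7: "?j |>Suc (Suc 0): FI a c |>Suc 0: E a \<one> c \<one> = ?j |>Suc 0: U' |>Suc (Suc 0): U"
    by (rule box_Emb) (simp_all add: at_iff)
  let ?k = "?j |>Suc 0: U' |>Suc (Suc 0): U"
  have k: "cods ?k = Some [vhom C ?ab ?ab, ?ac, \<one>, ?bd]" by simp
  have R8: "?k |>Suc (Suc (Suc 0)): U |>Suc (Suc (Suc (Suc 0))): FI b d |>Suc (Suc (Suc 0)): E b \<one> d \<one>
     = ?k |>Suc (Suc (Suc 0)): U |>Suc (Suc (Suc 0)): U' |>Suc (Suc (Suc (Suc 0))): U"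
    by (rule box_Emb) (simp_all add: at_iff)
  have R9: "?k |>Suc (Suc (Suc 0)): U |>Suc (Suc (Suc 0)): U' = ?k"
    by (rule box_unit_cancel) (simp add: at_iff)
  have R10: "?k |>Suc (Suc (Suc (Suc 0))): U |>Suc (Suc 0): Bi ?bd \<one> = ?k |>Suc (Suc (Suc (Suc 0))): U |>Suc (Suc 0): U' |>Suc (Suc (Suc 0)): U"
    by (rule Bi_unit_swap) (simp_all add: at_iff)
  have R11: "?k |>Suc (Suc (Suc (Suc 0))): U |>Suc (Suc 0): U' = ?j |>Suc 0: U' |>Suc (Suc (Suc 0)): U"
  proof -
    have "?k |>Suc (Suc (Suc (Suc 0))): U |>Suc (Suc 0): U' = ?k |>Suc (Suc 0): U' |>Suc (Suc (Suc 0)): U"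
      by (subst box_interchange) simp_all
    also have "?k |>Suc (Suc 0): U' = ?j |>Suc 0: U'"
      by (rule box_unit_cancel) (simp add: at_iff)
    finally show ?thesis .
  qed
  let ?z = "?s |>Suc 0: ?T |>0: U' |>Suc 0: U |>Suc 0: U |>Suc 0: PK \<one> \<one>"
  have R12: "?j |>Suc 0: U' |>Suc (Suc (Suc 0)): U |>Suc (Suc (Suc 0)): U |>Suc 0: ?T |>Suc (Suc 0): PK \<one> \<one> = ?z |>0: J ?ab"
    by (simp add: box_interchange)
  have R13: "?z |>0: J ?ab |>0: M ?ab ?ab ?cd = ?z"
    by (rule J_M_left) (simp_all add: at_iff)
  have R: "?s |>Suc 0: Box ?ws ?R [?h] |>0: ?E = ?z"
    unfolding R1 R2 R3 R4 R5 R6 R7 R8 R9 R10 R11 R12 R13 ..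
  show "?s |>Suc 0: Box ?ws ?L [?h] |>0: ?E = ?s |>Suc 0: Box ?ws ?R [?h] |>0: ?E"
    using L R by simp
qed simp_all

text \<open>\<open>\<nu>\<close> creates a unit on the left while the right unitor deletes the one
  on the right; \<open>box_unit_shift_left\<close> shows that they still cancel.\<close>

lemma nu_runit:
  assumes a [simp]: "a \<in> vobj C"
  shows "ucmp V K (a, \<one>) (a, \<one> \<otimes> \<one>) (a, \<one>) (nu Emb a (munit C)) (mrunit K (a, \<one>)) = vid K (a, \<one>)" (is "?L = _")
proof -
  have n: "ku (nu Emb a (munit C)) a \<one> a (\<one> \<otimes> \<one>)" using ku_nu[of a "munit C"] by simp
  have m: "ku (mrunit K (a, \<one>)) a (\<one> \<otimes> \<one>) a \<one>" by (rule ku_mrunit) simp_all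
  let ?s = "start [\<one>]"
  have "?s |>0: FL ?L a \<one> a \<one> = ?s |>0: FL (nu Emb a (munit C)) a \<one> a (\<one> \<otimes> \<one>) |>Suc 0: FL (mrunit K (a, \<one>)) a (\<one> \<otimes> \<one>) a \<one> |>0: M a a a"
    by (rule box_fl_ucmp[OF _ n m]) (simp add: at_iff)
  also have "?s |>0: FL (nu Emb a (munit C)) a \<one> a (\<one> \<otimes> \<one>) = ?s |>0: J a |>Suc 0: U |>Suc 0: PK \<one> \<one>"
    using box_fl_nu[of a "munit C" ?s 0] by (simp add: at_iff)
  also have "\<dots> |>Suc 0: FL (mrunit K (a, \<one>)) a (\<one> \<otimes> \<one>) a \<one> = ?s |>0: J a |>Suc 0: U |>Suc (Suc 0): U' |>Suc 0: J a"
    by (rule box_fl_mrunit) (simp_all add: at_iff)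
  also have "?s |>0: J a |>Suc 0: U |>Suc (Suc 0): U' = ?s |>0: J a"
    by (rule box_unit_shift_left) (simp add: at_iff)
  also have "?s |>0: J a |>Suc 0: J a |>0: M a a a = ?s |>0: J a"
    by (rule J_M_right) (simp_all add: at_iff)
  also have "\<dots> = ?s |>0: FL (vid K (a, \<one>)) a \<one> a \<one>"
    by (rule box_fl_vid[symmetric]) (simp_all add: at_iff)
  finally show ?thesis
    by (intro ku_ext[OF ku_ucmp[OF n m] ku_vid]) simp_all
qed

lemma nu_lunit:
  assumes a [simp]: "a \<in> vobj C"
  shows "ucmp V K (a, \<one>) (a, \<one> \<otimes> \<one>) (a, \<one>) (nu Emb (munit C) a) (mlunit K (a, \<one>)) = vid K (a, \<one>)" (is "?L = _")
proof -
  have n: "ku (nu Emb (munit C) a) a \<one> a (\<one> \<otimes> \<one>)" using ku_nu[of "munit C" a] by simp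
  have m: "ku (mlunit K (a, \<one>)) a (\<one> \<otimes> \<one>) a \<one>" by (rule ku_mlunit) simp_all
  let ?s = "start [\<one>]"
  have "?s |>0: FL ?L a \<one> a \<one> = ?s |>0: FL (nu Emb (munit C) a) a \<one> a (\<one> \<otimes> \<one>) |>Suc 0: FL (mlunit K (a, \<one>)) a (\<one> \<otimes> \<one>) a \<one> |>0: M a a a"
    by (rule box_fl_ucmp[OF _ n m]) (simp add: at_iff)
  also have "?s |>0: FL (nu Emb (munit C) a) a \<one> a (\<one> \<otimes> \<one>) = ?s |>0: J a |>Suc 0: U |>Suc 0: PK \<one> \<one>"
    using box_fl_nu[of "munit C" a ?s 0] by (simp add: at_iff)
  also have "\<dots> |>Suc 0: FL (mlunit K (a, \<one>)) a (\<one> \<otimes> \<one>) a \<one> = ?s |>0: J a |>Suc 0: U |>Suc 0: U' |>Suc 0: J a"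
    by (rule box_fl_mlunit) (simp_all add: at_iff)
  also have "?s |>0: J a |>Suc 0: U |>Suc 0: U' = ?s |>0: J a"
    by (rule box_unit_cancel) (simp add: at_iff)
  also have "?s |>0: J a |>Suc 0: J a |>0: M a a a = ?s |>0: J a"
    by (rule J_M_right) (simp_all add: at_iff)
  also have "\<dots> = ?s |>0: FL (vid K (a, \<one>)) a \<one> a \<one>"
    by (rule box_fl_vid[symmetric]) (simp_all add: at_iff)
  finally show ?thesis
    by (intro ku_ext[OF ku_ucmp[OF n m] ku_vid]) simp_all
qed

text \<open>Either side creates two units and packs the three strands to the right. They differ in
  where the second unit is created, which \<open>box_unit_commute\<close> makes irrelevant.\<close>

lemma nu_assoc:
  assumes ob [simp]: "a \<in> vobj C" "b \<in> vobj C" "c \<in> vobj C"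
  defines "x \<equiv> mten C a (mten C b c)"
  shows "ucmp V K (x, \<one>) (x, (\<one> \<otimes> \<one>) \<otimes> \<one>) (x, \<one> \<otimes> (\<one> \<otimes> \<one>))
      (ucmp V K (x, \<one>) (x, \<one> \<otimes> \<one>) (x, (\<one> \<otimes> \<one>) \<otimes> \<one>) (nu Emb (mten C a b) c)
        (uten V K (mten C a b, \<one>) (mten C a b, \<one> \<otimes> \<one>) (c, \<one>) (c, \<one>) (nu Emb a b) (vid K (c, \<one>))))
      (massoc K (a, \<one>) (b, \<one>) (c, \<one>))
    = ucmp V K (x, \<one>) (x, \<one> \<otimes> \<one>) (x, \<one> \<otimes> (\<one> \<otimes> \<one>)) (nu Emb a (mten C b c))
        (uten V K (a, \<one>) (a, \<one>) (mten C b c, \<one>) (mten C b c, \<one> \<otimes> \<one>) (vid K (a, \<one>)) (nu Emb b c))"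
    (is "ucmp V K _ _ _ (ucmp V K _ _ _ ?n1 ?u1) ?m = ucmp V K _ _ _ ?n2 ?u2")
proof -
  let ?ab = "mten C a b" and ?bc = "mten C b c"
  have x [simp]: "x \<in> vobj C" "mten C ?ab c = x" "mten C a ?bc = x" by (simp_all add: x_def)
  note nab = ku_nu[OF ob(1,2)] and nbc = ku_nu[OF ob(2,3)]
  have va: "ku (vid K (a, \<one>)) a \<one> a \<one>" and vc: "ku (vid K (c, \<one>)) c \<one> c \<one>" by (simp_all add: ku_vid del: completion_simps(5))
  have n1: "ku ?n1 x \<one> x (\<one> \<otimes> \<one>)" and n2: "ku ?n2 x \<one> x (\<one> \<otimes> \<one>)"
    using ku_nu[of ?ab c] ku_nu[of a ?bc] by (simp_all only: x ob mten_in)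
  have u1: "ku ?u1 x (\<one> \<otimes> \<one>) x ((\<one> \<otimes> \<one>) \<otimes> \<one>)" using ku_uten[OF nab vc] by (simp only: x)
  have u2: "ku ?u2 x (\<one> \<otimes> \<one>) x (\<one> \<otimes> (\<one> \<otimes> \<one>))" using ku_uten[OF va nbc] by (simp only: x)
  have m: "ku ?m x ((\<one> \<otimes> \<one>) \<otimes> \<one>) x (\<one> \<otimes> (\<one> \<otimes> \<one>))" unfolding x_def by (rule ku_massoc) simp_all
  let ?s = "start [\<one>]"
  let ?p = "?s |>0: J x |>Suc 0: U"
  have p: "cods ?p = Some [vhom C x x, \<one>, \<one>]" by simp
  have N1: "?s |>0: FL ?n1 x \<one> x (\<one> \<otimes> \<one>) = ?p |>Suc 0: PK \<one> \<one>"
    using box_fl_nu[of ?ab c ?s 0] by (simp only: x ob mten_in) (simp add: at_iff)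
  have N2: "?s |>0: FL ?n2 x \<one> x (\<one> \<otimes> \<one>) = ?p |>Suc 0: PK \<one> \<one>"
    using box_fl_nu[of a ?bc ?s 0] by (simp only: x ob mten_in) (simp add: at_iff)
  let ?J = "J x"
  have U1: "?p |>Suc 0: PK \<one> \<one> |>Suc 0: FL ?u1 x (\<one> \<otimes> \<one>) x ((\<one> \<otimes> \<one>) \<otimes> \<one>)
     = ?p |>Suc 0: J x |>Suc (Suc 0): U |>Suc (Suc 0): PK \<one> \<one> |>Suc (Suc 0): PK (\<one> \<otimes> \<one>) \<one>"
  proof -
    have "?p |>Suc 0: PK \<one> \<one> |>Suc 0: FL ?u1 x (\<one> \<otimes> \<one>) x ((\<one> \<otimes> \<one>) \<otimes> \<one>)
      = ?p |>Suc 0: FL (nu Emb a b) ?ab \<one> ?ab (\<one> \<otimes> \<one>) |>Suc (Suc (Suc 0)): FL (vid K (c, \<one>)) c \<one> c \<one>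
         |>Suc (Suc 0): Bi (vhom C c c) (\<one> \<otimes> \<one>) |>Suc 0: T ?ab ?ab c c |>Suc (Suc 0): PK (\<one> \<otimes> \<one>) \<one>"
      using box_fl_uten[OF _ nab vc, of ?p "Suc 0"] by (simp only: x) (simp add: at_iff del: completion_simps(5))
    also have "?p |>Suc 0: FL (nu Emb a b) ?ab \<one> ?ab (\<one> \<otimes> \<one>) = ?p |>Suc 0: J ?ab |>Suc (Suc 0): U |>Suc (Suc 0): PK \<one> \<one>"
      by (rule box_fl_nu) (simp_all add: at_iff)
    also have "\<dots> |>Suc (Suc (Suc 0)): FL (vid K (c, \<one>)) c \<one> c \<one> = \<dots> |>Suc (Suc (Suc 0)): J c"
      by (rule box_fl_vid) (simp_all add: at_iff)
    also have "\<dots> |>Suc (Suc 0): Bi (vhom C c c) (\<one> \<otimes> \<one>) = ?p |>Suc 0: J ?ab |>Suc (Suc 0): U |>Suc (Suc 0): PK \<one> \<one> |>Suc (Suc 0): J c"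
      by (rule Bi_insert) (simp_all add: at_iff)
    also have "\<dots> |>Suc 0: T ?ab ?ab c c = ?p |>Suc 0: J ?ab |>Suc (Suc 0): J c |>Suc 0: T ?ab ?ab c c |>Suc (Suc 0): U |>Suc (Suc 0): PK \<one> \<one>"
      by (simp add: box_interchange)
    also have "?p |>Suc 0: J ?ab |>Suc (Suc 0): J c |>Suc 0: T ?ab ?ab c c = ?p |>Suc 0: J x"
      using J_T[of ?p "Suc 0" ?ab c] by (simp only: x ob mten_in) (simp add: at_iff)
    finally show ?thesis .
  qed
  have U2: "?p |>Suc 0: PK \<one> \<one> |>Suc 0: FL ?u2 x (\<one> \<otimes> \<one>) x (\<one> \<otimes> (\<one> \<otimes> \<one>))
     = ?p |>Suc 0: J x |>Suc (Suc (Suc 0)): U |>Suc (Suc (Suc 0)): PK \<one> \<one> |>Suc (Suc 0): PK \<one> (\<one> \<otimes> \<one>)"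
  proof -
    have "?p |>Suc 0: PK \<one> \<one> |>Suc 0: FL ?u2 x (\<one> \<otimes> \<one>) x (\<one> \<otimes> (\<one> \<otimes> \<one>))
      = ?p |>Suc 0: FL (vid K (a, \<one>)) a \<one> a \<one> |>Suc (Suc (Suc 0)): FL (nu Emb b c) ?bc \<one> ?bc (\<one> \<otimes> \<one>)
         |>Suc (Suc 0): Bi (vhom C ?bc ?bc) \<one> |>Suc 0: T a a ?bc ?bc |>Suc (Suc 0): PK \<one> (\<one> \<otimes> \<one>)"
      using box_fl_uten[OF _ va nbc, of ?p "Suc 0"] by (simp only: x) (simp add: at_iff del: completion_simps(5))
    also have "?p |>Suc 0: FL (vid K (a, \<one>)) a \<one> a \<one> = ?p |>Suc 0: J a"
      by (rule box_fl_vid) (simp_all add: at_iff)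
    also have "?p |>Suc 0: J a |>Suc (Suc (Suc 0)): FL (nu Emb b c) ?bc \<one> ?bc (\<one> \<otimes> \<one>)
      = ?p |>Suc 0: J a |>Suc (Suc (Suc 0)): J ?bc |>Suc (Suc (Suc (Suc 0))): U |>Suc (Suc (Suc (Suc 0))): PK \<one> \<one>"
      by (rule box_fl_nu) (simp_all add: at_iff)
    also have "\<dots> |>Suc (Suc 0): Bi (vhom C ?bc ?bc) \<one>
      = ?p |>Suc 0: J a |>Suc (Suc (Suc 0)): J ?bc |>Suc (Suc 0): Bi (vhom C ?bc ?bc) \<one> |>Suc (Suc (Suc (Suc 0))): U |>Suc (Suc (Suc (Suc 0))): PK \<one> \<one>"
      by (simp add: box_interchange)
    also have "?p |>Suc 0: J a |>Suc (Suc (Suc 0)): J ?bc |>Suc (Suc 0): Bi (vhom C ?bc ?bc) \<one> = ?p |>Suc 0: J a |>Suc (Suc 0): J ?bc"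
      by (rule Bi_insert) (simp_all add: at_iff)
    also have "\<dots> |>Suc (Suc (Suc (Suc 0))): U |>Suc (Suc (Suc (Suc 0))): PK \<one> \<one> |>Suc 0: T a a ?bc ?bc
      = ?p |>Suc 0: J a |>Suc (Suc 0): J ?bc |>Suc 0: T a a ?bc ?bc |>Suc (Suc (Suc 0)): U |>Suc (Suc (Suc 0)): PK \<one> \<one>"
      by (simp add: box_interchange)
    also have "?p |>Suc 0: J a |>Suc (Suc 0): J ?bc |>Suc 0: T a a ?bc ?bc = ?p |>Suc 0: J x"
      using J_T[of ?p "Suc 0" a ?bc] by (simp only: x ob mten_in) (simp add: at_iff)
    finally show ?thesis .
  qed
  have JJ: "?p |>Suc 0: J x |>0: M x x x = ?p" by (rule J_M_right) (simp_all add: at_iff)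
  let ?q = "?p |>Suc 0: U"
  have q: "cods ?q = Some [vhom C x x, \<one>, \<one>, \<one>]" by simp
  have L: "?s |>0: FL (ucmp V K (x, \<one>) (x, \<one> \<otimes> \<one>) (x, (\<one> \<otimes> \<one>) \<otimes> \<one>) ?n1 ?u1) x \<one> x ((\<one> \<otimes> \<one>) \<otimes> \<one>)
     = ?q |>Suc 0: PK \<one> \<one> |>Suc 0: PK (\<one> \<otimes> \<one>) \<one>"
  proof -
    have "?s |>0: FL (ucmp V K (x, \<one>) (x, \<one> \<otimes> \<one>) (x, (\<one> \<otimes> \<one>) \<otimes> \<one>) ?n1 ?u1) x \<one> x ((\<one> \<otimes> \<one>) \<otimes> \<one>)
      = ?s |>0: FL ?n1 x \<one> x (\<one> \<otimes> \<one>) |>Suc 0: FL ?u1 x (\<one> \<otimes> \<one>) x ((\<one> \<otimes> \<one>) \<otimes> \<one>) |>0: M x x x"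
      by (rule box_fl_ucmp[OF _ n1 u1]) (simp add: at_iff)
    also have "\<dots> = ?p |>Suc 0: J x |>Suc (Suc 0): U |>Suc (Suc 0): PK \<one> \<one> |>Suc (Suc 0): PK (\<one> \<otimes> \<one>) \<one> |>0: M x x x"
      unfolding N1 U1 ..
    also have "\<dots> = ?p |>Suc 0: J x |>0: M x x x |>Suc 0: U |>Suc 0: PK \<one> \<one> |>Suc 0: PK (\<one> \<otimes> \<one>) \<one>"
      by (simp add: box_interchange)
    finally show ?thesis unfolding JJ .
  qed
  have LL: "?s |>0: FL (ucmp V K (x, \<one>) (x, (\<one> \<otimes> \<one>) \<otimes> \<one>) (x, \<one> \<otimes> (\<one> \<otimes> \<one>)) (ucmp V K (x, \<one>) (x, \<one> \<otimes> \<one>) (x, (\<one> \<otimes> \<one>) \<otimes> \<one>) ?n1 ?u1) ?m) x \<one> x (\<one> \<otimes> (\<one> \<otimes> \<one>))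
     = ?q |>Suc (Suc 0): PK \<one> \<one> |>Suc 0: PK \<one> (\<one> \<otimes> \<one>)"
  proof -
    have "?s |>0: FL (ucmp V K (x, \<one>) (x, (\<one> \<otimes> \<one>) \<otimes> \<one>) (x, \<one> \<otimes> (\<one> \<otimes> \<one>)) (ucmp V K (x, \<one>) (x, \<one> \<otimes> \<one>) (x, (\<one> \<otimes> \<one>) \<otimes> \<one>) ?n1 ?u1) ?m) x \<one> x (\<one> \<otimes> (\<one> \<otimes> \<one>))
      = ?s |>0: FL (ucmp V K (x, \<one>) (x, \<one> \<otimes> \<one>) (x, (\<one> \<otimes> \<one>) \<otimes> \<one>) ?n1 ?u1) x \<one> x ((\<one> \<otimes> \<one>) \<otimes> \<one>) |>Suc 0: FL ?m x ((\<one> \<otimes> \<one>) \<otimes> \<one>) x (\<one> \<otimes> (\<one> \<otimes> \<one>)) |>0: M x x x"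
      by (rule box_fl_ucmp[OF _ ku_ucmp[OF n1 u1] m]) (simp add: at_iff)
    also have "\<dots> = ?q |>Suc 0: PK \<one> \<one> |>Suc 0: PK (\<one> \<otimes> \<one>) \<one> |>Suc 0: FL ?m x ((\<one> \<otimes> \<one>) \<otimes> \<one>) x (\<one> \<otimes> (\<one> \<otimes> \<one>)) |>0: M x x x"
      unfolding L ..
    also have "?q |>Suc 0: PK \<one> \<one> |>Suc 0: PK (\<one> \<otimes> \<one>) \<one> |>Suc 0: FL ?m x ((\<one> \<otimes> \<one>) \<otimes> \<one>) x (\<one> \<otimes> (\<one> \<otimes> \<one>))
      = ?q |>Suc 0: J x |>Suc (Suc (Suc 0)): PK \<one> \<one> |>Suc (Suc 0): PK \<one> (\<one> \<otimes> \<one>)"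
      using box_fl_massoc[of a b c \<one> \<one> \<one> ?q "Suc 0"] unfolding x_def[symmetric] by (simp add: at_iff)
    also have "\<dots> |>0: M x x x = ?q |>Suc 0: J x |>0: M x x x |>Suc (Suc 0): PK \<one> \<one> |>Suc 0: PK \<one> (\<one> \<otimes> \<one>)"
      by (simp add: box_interchange)
    also have "?q |>Suc 0: J x |>0: M x x x = ?q" by (rule J_M_right) (simp_all add: at_iff)
    finally show ?thesis .
  qed
  have RR: "?s |>0: FL (ucmp V K (x, \<one>) (x, \<one> \<otimes> \<one>) (x, \<one> \<otimes> (\<one> \<otimes> \<one>)) ?n2 ?u2) x \<one> x (\<one> \<otimes> (\<one> \<otimes> \<one>))
     = ?q |>Suc (Suc 0): PK \<one> \<one> |>Suc 0: PK \<one> (\<one> \<otimes> \<one>)"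
  proof -
    have "?s |>0: FL (ucmp V K (x, \<one>) (x, \<one> \<otimes> \<one>) (x, \<one> \<otimes> (\<one> \<otimes> \<one>)) ?n2 ?u2) x \<one> x (\<one> \<otimes> (\<one> \<otimes> \<one>))
      = ?s |>0: FL ?n2 x \<one> x (\<one> \<otimes> \<one>) |>Suc 0: FL ?u2 x (\<one> \<otimes> \<one>) x (\<one> \<otimes> (\<one> \<otimes> \<one>)) |>0: M x x x"
      by (rule box_fl_ucmp[OF _ n2 u2]) (simp add: at_iff)
    also have "\<dots> = ?p |>Suc 0: J x |>Suc (Suc (Suc 0)): U |>Suc (Suc (Suc 0)): PK \<one> \<one> |>Suc (Suc 0): PK \<one> (\<one> \<otimes> \<one>) |>0: M x x x"
      unfolding N2 U2 ..
    also have "\<dots> = ?p |>Suc 0: J x |>0: M x x x |>Suc (Suc 0): U |>Suc (Suc 0): PK \<one> \<one> |>Suc 0: PK \<one> (\<one> \<otimes> \<one>)"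
      by (simp add: box_interchange)
    also have "\<dots> = ?p |>Suc (Suc 0): U |>Suc (Suc 0): PK \<one> \<one> |>Suc 0: PK \<one> (\<one> \<otimes> \<one>)" unfolding JJ ..
    also have "?p |>Suc (Suc 0): U = ?q" by (rule box_unit_commute[symmetric])
    finally show ?thesis .
  qed
  show ?thesis
    by (rule ku_ext[OF ku_ucmp[OF ku_ucmp[OF n1 u1] m] ku_ucmp[OF n2 u2]]) (simp only: LL RR)
qed

lemma Emb_monoidal: "V_monoidal_functor V C K Emb"
proof -
  have vid: "vid C a \<Zsemi> fmap Emb a a = vid K (a, \<one>)" if "a \<in> vobj C" for a
    using Emb_functor that by (simp add: V_functor_def)
  show ?thesis
    unfolding V_monoidal_functor_def Let_def
  proof (intro conjI ballI)
    fix a assume a [simp]: "a \<in> vobj C"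
    show "ucmp V K (fobj Emb (mten C a (munit C))) (mten K (fobj Emb a) (munit K)) (fobj Emb a) (nu Emb a (munit C)) (mrunit K (fobj Emb a))
      = mrunit C a \<Zsemi> fmap Emb (mten C a (munit C)) a"
      using nu_runit[OF a] by (simp add: vid del: completion_simps(5))
    show "ucmp V K (fobj Emb (mten C (munit C) a)) (mten K (munit K) (fobj Emb a)) (fobj Emb a) (nu Emb (munit C) a) (mlunit K (fobj Emb a))
      = mlunit C a \<Zsemi> fmap Emb (mten C (munit C) a) a"
      using nu_lunit[OF a] by (simp add: vid del: completion_simps(5))
  next
    fix a b c assume ob [simp]: "a \<in> vobj C" "b \<in> vobj C" "c \<in> vobj C"
    let ?x = "mten C a (mten C b c)"
    let ?R = "ucmp V K (?x, \<one>) (?x, \<one> \<otimes> \<one>) (?x, \<one> \<otimes> (\<one> \<otimes> \<one>)) (nu Emb a (mten C b c))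
        (uten V K (a, \<one>) (a, \<one>) (mten C b c, \<one>) (mten C b c, \<one> \<otimes> \<one>) (vid K (a, \<one>)) (nu Emb b c))"
    have "ku (uten V K (a, \<one>) (a, \<one>) (mten C b c, \<one>) (mten C b c, \<one> \<otimes> \<one>) (vid K (a, \<one>)) (nu Emb b c)) ?x (\<one> \<otimes> \<one>) ?x (\<one> \<otimes> (\<one> \<otimes> \<one>))"
      by (rule ku_uten) (simp_all add: ku_vid ku_nu del: completion_simps(5))
    then have R: "ku ?R ?x \<one> ?x (\<one> \<otimes> (\<one> \<otimes> \<one>))"
      using ku_nu[of a "mten C b c"] by (intro ku_ucmp) simp_all
    have "ucmp V K (?x, \<one>) (?x, \<one>) (?x, \<one> \<otimes> (\<one> \<otimes> \<one>)) (vid K (?x, \<one>)) ?R = ?R"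
      using kuD[OF R] by (intro K.ucmp_vid_left) simp_all
    then show "ucmp V K (fobj Emb (mten C (mten C a b) c)) (mten K (mten K (fobj Emb a) (fobj Emb b)) (fobj Emb c)) (mten K (fobj Emb a) (mten K (fobj Emb b) (fobj Emb c)))
       (ucmp V K (fobj Emb (mten C (mten C a b) c)) (mten K (fobj Emb (mten C a b)) (fobj Emb c)) (mten K (mten K (fobj Emb a) (fobj Emb b)) (fobj Emb c))
         (nu Emb (mten C a b) c)
         (uten V K (fobj Emb (mten C a b)) (mten K (fobj Emb a) (fobj Emb b)) (fobj Emb c) (fobj Emb c) (nu Emb a b) (vid K (fobj Emb c))))
       (massoc K (fobj Emb a) (fobj Emb b) (fobj Emb c))
      = ucmp V K (fobj Emb (mten C (mten C a b) c)) (fobj Emb (mten C a (mten C b c))) (mten K (fobj Emb a) (mten K (fobj Emb b) (fobj Emb c)))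
         (massoc C a b c \<Zsemi> fmap Emb (mten C (mten C a b) c) (mten C a (mten C b c)))
         (ucmp V K (fobj Emb (mten C a (mten C b c))) (mten K (fobj Emb a) (fobj Emb (mten C b c))) (mten K (fobj Emb a) (mten K (fobj Emb b) (fobj Emb c)))
           (nu Emb a (mten C b c))
           (uten V K (fobj Emb a) (fobj Emb a) (fobj Emb (mten C b c)) (mten K (fobj Emb b) (fobj Emb c)) (vid K (fobj Emb a)) (nu Emb b c)))"
      using nu_assoc[OF ob] by (simp add: vid del: completion_simps(5))
  next
    fix a b assume ob [simp]: "a \<in> vobj C" "b \<in> vobj C"
    show "nu Emb a b \<in> uisos V K (fobj Emb (mten C a b)) (mten K (fobj Emb a) (fobj Emb b))"
      using nu_uisos[OF ob] by simp
  next
    fix a b c d assume ob [simp]: "a \<in> vobj C" "b \<in> vobj C" "c \<in> vobj C" "d \<in> vobj C"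
    show "mtenm C a c b d \<Zsemi> fmap Emb (mten C a b) (mten C c d) \<Zsemi>
          postcmp V K (fobj Emb (mten C a b)) (fobj Emb (mten C c d)) (mten K (fobj Emb c) (fobj Emb d)) (nu Emb c d)
        = (fmap Emb a c \<odot> fmap Emb b d) \<Zsemi> mtenm K (fobj Emb a) (fobj Emb c) (fobj Emb b) (fobj Emb d) \<Zsemi>
          precmp V K (fobj Emb (mten C a b)) (mten K (fobj Emb a) (fobj Emb b)) (mten K (fobj Emb c) (fobj Emb d)) (nu Emb a b)"
      using nu_natural[OF ob] by simp
  qed (use Emb_functor in simp_all)
qed

end

section \<open>Enriched functors on underlying categories\<close>

context enriched_category
begin

lemma uhom_iff: "f \<in> uhom V C a b \<longleftrightarrow> f \<in> arr V \<and> src V f = \<one> \<and> trg V f = vhom C a b"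
  by (simp add: uhom_def hom_iff)

section \<open>Associativity with underlying arrows among the factors\<close>

lemma post_post:
  assumes "a \<in> vobj C" "b \<in> vobj C" "c \<in> vobj C" "d \<in> vobj C" "f \<in> uhom V C b c" "g \<in> uhom V C c d"
  shows "postcmp V C a b c f \<Zsemi> postcmp V C a c d g = postcmp V C a b d (ucmp V C b c d f g)"
proof (rule box_inj[where xs = "[vhom C a b]" and ys = "[vhom C a d]"])
  note [simp] = assms(1-4) and u [simp] = assms(5,6)[unfolded uhom_iff]
  let ?s = "start [vhom C a b]"
  have "?s |>0: Box [vhom C a b] (postcmp V C a b c f \<Zsemi> postcmp V C a c d g) [vhom C a d]
     = ?s |>Suc 0: Box [] f [vhom C b c] |>0: M a b c |>Suc 0: Box [] g [vhom C c d] |>0: M a c d"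
    by (subst box_cmp[symmetric, where ys = "[vhom C a c]"]) (simp_all add: box_postcmp at_iff)
  also have "\<dots> = ?s |>Suc 0: Box [] f [vhom C b c] |>Suc (Suc 0): Box [] g [vhom C c d] |>0: M a b c |>0: M a c d"
    by (simp add: box_interchange)
  also have "\<dots> = ?s |>Suc 0: Box [] f [vhom C b c] |>Suc (Suc 0): Box [] g [vhom C c d] |>Suc 0: M b c d |>0: M a b d"
    by (rule M_assoc) (simp_all add: at_iff)
  also have "\<dots> = ?s |>0: Box [vhom C a b] (postcmp V C a b d (ucmp V C b c d f g)) [vhom C a d]"
    by (simp add: box_postcmp box_ucmp at_iff)
  finally show "?s |>0: Box [vhom C a b] (postcmp V C a b c f \<Zsemi> postcmp V C a c d g) [vhom C a d] = \<dots>" .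
qed (use assms in \<open>simp_all add: uhom_iff\<close>)

text \<open>Precomposition is contravariant, hence the reversed order of \<open>g\<close> and
  \<open>f\<close> in the composite.\<close>

lemma pre_pre:
  assumes "a \<in> vobj C" "b \<in> vobj C" "c \<in> vobj C" "d \<in> vobj C" "f \<in> uhom V C b c" "g \<in> uhom V C a b"
  shows "precmp V C b c d f \<Zsemi> precmp V C a b d g = precmp V C a c d (ucmp V C a b c g f)"
proof (rule box_inj[where xs = "[vhom C c d]" and ys = "[vhom C a d]"])
  note [simp] = assms(1-4) and u [simp] = assms(5,6)[unfolded uhom_iff]
  let ?s = "start [vhom C c d]"
  have "?s |>0: Box [vhom C c d] (precmp V C b c d f \<Zsemi> precmp V C a b d g) [vhom C a d]
     = ?s |>0: Box [] f [vhom C b c] |>0: M b c d |>0: Box [] g [vhom C a b] |>0: M a b d"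
    by (subst box_cmp[symmetric, where ys = "[vhom C b d]"]) (simp_all add: box_precmp at_iff)
  also have "\<dots> = ?s |>0: Box [] g [vhom C a b] |>Suc 0: Box [] f [vhom C b c] |>Suc 0: M b c d |>0: M a b d"
    by (simp add: box_interchange)
  also have "\<dots> = ?s |>0: Box [] g [vhom C a b] |>Suc 0: Box [] f [vhom C b c] |>0: M a b c |>0: M a c d"
    by (rule M_assoc[symmetric]) (simp_all add: at_iff)
  also have "\<dots> = ?s |>0: Box [vhom C c d] (precmp V C a c d (ucmp V C a b c g f)) [vhom C a d]"
    by (simp add: box_precmp box_ucmp at_iff)
  finally show "?s |>0: Box [vhom C c d] (precmp V C b c d f \<Zsemi> precmp V C a b d g) [vhom C a d] = \<dots>" .
qed (use assms in \<open>simp_all add: uhom_iff\<close>)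

lemma pre_post:
  assumes "a \<in> vobj C" "b \<in> vobj C" "c \<in> vobj C" "d \<in> vobj C" "f \<in> uhom V C a b" "g \<in> uhom V C c d"
  shows "precmp V C a b c f \<Zsemi> postcmp V C a c d g = postcmp V C b c d g \<Zsemi> precmp V C a b d f"
proof (rule box_inj[where xs = "[vhom C b c]" and ys = "[vhom C a d]"])
  note [simp] = assms(1-4) and u [simp] = assms(5,6)[unfolded uhom_iff]
  let ?s = "start [vhom C b c]"
  have "?s |>0: Box [vhom C b c] (precmp V C a b c f \<Zsemi> postcmp V C a c d g) [vhom C a d]
     = ?s |>0: Box [] f [vhom C a b] |>0: M a b c |>Suc 0: Box [] g [vhom C c d] |>0: M a c d"
    by (subst box_cmp[symmetric, where ys = "[vhom C a c]"]) (simp_all add: box_precmp box_postcmp at_iff)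
  also have "\<dots> = ?s |>0: Box [] f [vhom C a b] |>Suc (Suc 0): Box [] g [vhom C c d] |>0: M a b c |>0: M a c d"
    by (simp add: box_interchange)
  also have "\<dots> = ?s |>0: Box [] f [vhom C a b] |>Suc (Suc 0): Box [] g [vhom C c d] |>Suc 0: M b c d |>0: M a b d"
    by (rule M_assoc) (simp_all add: at_iff)
  also have "\<dots> = ?s |>Suc 0: Box [] g [vhom C c d] |>0: M b c d |>0: Box [] f [vhom C a b] |>0: M a b d"
    by (simp add: box_interchange)
  also have "\<dots> = ?s |>0: Box [vhom C b c] (postcmp V C b c d g \<Zsemi> precmp V C a b d f) [vhom C a d]"
    by (subst box_cmp[symmetric, where ys = "[vhom C b d]"]) (simp_all add: box_precmp box_postcmp at_iff)
  finally show "?s |>0: Box [vhom C b c] (precmp V C a b c f \<Zsemi> postcmp V C a c d g) [vhom C a d] = \<dots>" .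
qed (use assms in \<open>simp_all add: uhom_iff\<close>)

lemma post_vid [simp]:
  assumes "a \<in> vobj C" "b \<in> vobj C"
  shows "postcmp V C a b b (vid C b) = \<i> (vhom C a b)"
proof (rule box_inj[where xs = "[vhom C a b]" and ys = "[vhom C a b]"])
  show "start [vhom C a b] |>0: Box [vhom C a b] (postcmp V C a b b (vid C b)) [vhom C a b] = start [vhom C a b] |>0: Box [vhom C a b] (\<i> (vhom C a b)) [vhom C a b]"
    using assms by (simp add: box_postcmp J_M_right at_iff box_id)
qed (use assms in simp_all)

lemma pre_vid [simp]:
  assumes "a \<in> vobj C" "b \<in> vobj C"
  shows "precmp V C a a b (vid C a) = \<i> (vhom C a b)"
proof (rule box_inj[where xs = "[vhom C a b]" and ys = "[vhom C a b]"])
  show "start [vhom C a b] |>0: Box [vhom C a b] (precmp V C a a b (vid C a)) [vhom C a b] = start [vhom C a b] |>0: Box [vhom C a b] (\<i> (vhom C a b)) [vhom C a b]"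
    using assms by (simp add: box_precmp J_M_left at_iff box_id)
qed (use assms in simp_all)

lemma global_post:
  assumes "a \<in> vobj C" "b \<in> vobj C" "c \<in> vobj C" "f \<in> uhom V C a b" "g \<in> uhom V C b c"
  shows "f \<Zsemi> postcmp V C a b c g = ucmp V C a b c f g"
proof (rule box_inj[where xs = "[]" and ys = "[vhom C a c]"])
  note [simp] = assms(1-3) and u [simp] = assms(4,5)[unfolded uhom_iff]
  show "start [] |>0: Box [] (f \<Zsemi> postcmp V C a b c g) [vhom C a c] = start [] |>0: Box [] (ucmp V C a b c f g) [vhom C a c]"
    by (subst box_cmp[symmetric, where ys = "[vhom C a b]"]) (simp_all add: box_postcmp box_ucmp at_iff)
qed (use assms in \<open>simp_all add: uhom_iff\<close>)

lemma global_pre: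
  assumes "a \<in> vobj C" "b \<in> vobj C" "c \<in> vobj C" "f \<in> uhom V C a b" "g \<in> uhom V C b c"
  shows "g \<Zsemi> precmp V C a b c f = ucmp V C a b c f g"
proof (rule box_inj[where xs = "[]" and ys = "[vhom C a c]"])
  note [simp] = assms(1-3) and u [simp] = assms(4,5)[unfolded uhom_iff]
  have "start [] |>0: Box [] g [vhom C b c] |>0: Box [] f [vhom C a b] = start [] |>0: Box [] f [vhom C a b] |>Suc 0: Box [] g [vhom C b c]"
    using box_interchange[of 0 "Box [] f [vhom C a b]" 0 "start []" "Box [] g [vhom C b c]"] by simp
  then show "start [] |>0: Box [] (g \<Zsemi> precmp V C a b c f) [vhom C a c] = start [] |>0: Box [] (ucmp V C a b c f g) [vhom C a c]"
    by (subst box_cmp[symmetric, where ys = "[vhom C b c]"]) (simp_all add: box_precmp box_ucmp at_iff)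
qed (use assms in \<open>simp_all add: uhom_iff\<close>)

lemma vcmp_post:
  assumes "a \<in> vobj C" "b \<in> vobj C" "c \<in> vobj C" "d \<in> vobj C" "g \<in> uhom V C c d"
  shows "vcmp C a b c \<Zsemi> postcmp V C a c d g = (\<i> (vhom C a b) \<odot> postcmp V C b c d g) \<Zsemi> vcmp C a b d"
proof (rule box_inj[where xs = "[vhom C a b, vhom C b c]" and ys = "[vhom C a d]"])
  note [simp] = assms(1-4) and u [simp] = assms(5)[unfolded uhom_iff]
  let ?xs = "[vhom C a b, vhom C b c]" let ?s = "start ?xs"
  have "?s |>0: Box ?xs (vcmp C a b c \<Zsemi> postcmp V C a c d g) [vhom C a d] = ?s |>0: M a b c |>Suc 0: Box [] g [vhom C c d] |>0: M a c d"
    by (subst box_cmp[symmetric, where ys = "[vhom C a c]"]) (simp_all add: box_postcmp at_iff)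
  also have "\<dots> = ?s |>Suc (Suc 0): Box [] g [vhom C c d] |>0: M a b c |>0: M a c d"
    by (simp add: box_interchange)
  also have "\<dots> = ?s |>Suc (Suc 0): Box [] g [vhom C c d] |>Suc 0: M b c d |>0: M a b d"
    by (rule M_assoc) (simp_all add: at_iff)
  also have "\<dots> = ?s |>0: Box ?xs ((\<i> (vhom C a b) \<odot> postcmp V C b c d g) \<Zsemi> vcmp C a b d) [vhom C a d]"
    by (subst box_cmp[symmetric, where ys = "[vhom C a b, vhom C b d]"]) (simp_all add: box_ten_native box_postcmp at_iff box_id)
  finally show "?s |>0: Box ?xs (vcmp C a b c \<Zsemi> postcmp V C a c d g) [vhom C a d] = \<dots>" .
qed (use assms in \<open>simp_all add: uhom_iff\<close>)

lemma vcmp_pre: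
  assumes "a \<in> vobj C" "b \<in> vobj C" "c \<in> vobj C" "d \<in> vobj C" "f \<in> uhom V C a b"
  shows "vcmp C b c d \<Zsemi> precmp V C a b d f = (precmp V C a b c f \<odot> \<i> (vhom C c d)) \<Zsemi> vcmp C a c d"
proof (rule box_inj[where xs = "[vhom C b c, vhom C c d]" and ys = "[vhom C a d]"])
  note [simp] = assms(1-4) and u [simp] = assms(5)[unfolded uhom_iff]
  let ?xs = "[vhom C b c, vhom C c d]" let ?s = "start ?xs"
  have "?s |>0: Box ?xs (vcmp C b c d \<Zsemi> precmp V C a b d f) [vhom C a d] = ?s |>0: M b c d |>0: Box [] f [vhom C a b] |>0: M a b d"
    by (subst box_cmp[symmetric, where ys = "[vhom C b d]"]) (simp_all add: box_precmp at_iff)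
  also have "\<dots> = ?s |>0: Box [] f [vhom C a b] |>Suc 0: M b c d |>0: M a b d"
    by (simp add: box_interchange)
  also have "\<dots> = ?s |>0: Box [] f [vhom C a b] |>0: M a b c |>0: M a c d"
    by (rule M_assoc[symmetric]) (simp_all add: at_iff)
  also have "\<dots> = ?s |>0: Box ?xs ((precmp V C a b c f \<odot> \<i> (vhom C c d)) \<Zsemi> vcmp C a c d) [vhom C a d]"
    by (subst box_cmp[symmetric, where ys = "[vhom C a c, vhom C c d]"]) (simp_all add: box_ten_native box_precmp at_iff box_id)
  finally show "?s |>0: Box ?xs (vcmp C b c d \<Zsemi> precmp V C a b d f) [vhom C a d] = \<dots>" .
qed (use assms in \<open>simp_all add: uhom_iff\<close>)

text \<open>An arrow in the middle of a composite may be attached to either neighbour. This later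
  brings a chosen isomorphism next to its inverse.\<close>

lemma post_vcmp:
  assumes "a \<in> vobj C" "b \<in> vobj C" "c \<in> vobj C" "d \<in> vobj C" "g \<in> uhom V C b c"
  shows "(postcmp V C a b c g \<odot> \<i> (vhom C c d)) \<Zsemi> vcmp C a c d = (\<i> (vhom C a b) \<odot> precmp V C b c d g) \<Zsemi> vcmp C a b d"
proof (rule box_inj[where xs = "[vhom C a b, vhom C c d]" and ys = "[vhom C a d]"])
  note [simp] = assms(1-4) and u [simp] = assms(5)[unfolded uhom_iff]
  let ?xs = "[vhom C a b, vhom C c d]" let ?s = "start ?xs"
  have "?s |>0: Box ?xs ((postcmp V C a b c g \<odot> \<i> (vhom C c d)) \<Zsemi> vcmp C a c d) [vhom C a d] = ?s |>Suc 0: Box [] g [vhom C b c] |>0: M a b c |>0: M a c d"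
    by (subst box_cmp[symmetric, where ys = "[vhom C a c, vhom C c d]"]) (simp_all add: box_ten_native box_postcmp at_iff box_id)
  also have "\<dots> = ?s |>Suc 0: Box [] g [vhom C b c] |>Suc 0: M b c d |>0: M a b d"
    by (rule M_assoc) (simp_all add: at_iff)
  also have "\<dots> = ?s |>0: Box ?xs ((\<i> (vhom C a b) \<odot> precmp V C b c d g) \<Zsemi> vcmp C a b d) [vhom C a d]"
    by (subst box_cmp[symmetric, where ys = "[vhom C a b, vhom C b d]"]) (simp_all add: box_ten_native box_precmp at_iff box_id)
  finally show "?s |>0: Box ?xs ((postcmp V C a b c g \<odot> \<i> (vhom C c d)) \<Zsemi> vcmp C a c d) [vhom C a d] = \<dots>" .
qed (use assms in \<open>simp_all add: uhom_iff\<close>)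

lemma ucmp_uhom [simp]:
  "\<lbrakk>a \<in> vobj C; b \<in> vobj C; c \<in> vobj C; f \<in> uhom V C a b; g \<in> uhom V C b c\<rbrakk> \<Longrightarrow> ucmp V C a b c f g \<in> uhom V C a c"
  by (simp add: uhom_iff)

lemma ucmp_assoc:
  assumes "a \<in> vobj C" "b \<in> vobj C" "c \<in> vobj C" "d \<in> vobj C" "f \<in> uhom V C a b" "g \<in> uhom V C b c" "h \<in> uhom V C c d"
  shows "ucmp V C a c d (ucmp V C a b c f g) h = ucmp V C a b d f (ucmp V C b c d g h)"
proof -
  have "ucmp V C a c d (ucmp V C a b c f g) h = (f \<Zsemi> postcmp V C a b c g) \<Zsemi> postcmp V C a c d h"
    using assms by (simp add: global_post)
  also have "\<dots> = f \<Zsemi> (postcmp V C a b c g \<Zsemi> postcmp V C a c d h)"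
    using assms by (subst cmp_assoc_arr) (simp_all add: uhom_iff)
  finally show ?thesis using assms by (simp add: post_post global_post)
qed

text \<open>
  Triples record the source and target of an underlying arrow, so that \<open>oc\<close> and, below, \<open>ot\<close> are
  binary operations whose composites the simplifier can normalise.
\<close>

definition uarr :: "'a \<times> 'm \<times> 'a \<Rightarrow> bool" where
  "uarr p \<longleftrightarrow> fst p \<in> vobj C \<and> snd (snd p) \<in> vobj C \<and> fst (snd p) \<in> uhom V C (fst p) (snd (snd p))"

definition oc :: "'a \<times> 'm \<times> 'a \<Rightarrow> 'a \<times> 'm \<times> 'a \<Rightarrow> 'a \<times> 'm \<times> 'a" where
  "oc p q = (fst p, ucmp V C (fst p) (snd (snd p)) (snd (snd q)) (fst (snd p)) (fst (snd q)), snd (snd q))"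

definition od :: "'a \<Rightarrow> 'a \<times> 'm \<times> 'a" where
  "od a = (a, vid C a, a)"

lemma uarr_triple [simp]: "uarr (a, f, b) \<longleftrightarrow> a \<in> vobj C \<and> b \<in> vobj C \<and> f \<in> uhom V C a b"
  by (simp add: uarr_def)

lemma oc_simps [simp]: "fst (oc p q) = fst p" "snd (snd (oc p q)) = snd (snd q)"
  "fst (od a) = a" "snd (snd (od a)) = a"
  by (simp_all add: oc_def od_def)

lemma uarr_oc [simp]: "\<lbrakk>uarr p; uarr q; snd (snd p) = fst q\<rbrakk> \<Longrightarrow> uarr (oc p q)"
  by (simp add: uarr_def oc_def)

lemma uarr_od [simp]: "a \<in> vobj C \<Longrightarrow> uarr (od a)"
  by (simp add: od_def uhom_iff)

lemma oc_od [simp]: "\<lbrakk>uarr p; snd (snd p) = a\<rbrakk> \<Longrightarrow> oc p (od a) = p" "\<lbrakk>uarr p; fst p = a\<rbrakk> \<Longrightarrow> oc (od a) p = p"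
  by (auto simp: uarr_def od_def oc_def uhom_iff ucmp_vid_left ucmp_vid_right)

lemma oc_assoc:
  "\<lbrakk>uarr p; uarr q; uarr r; snd (snd p) = fst q; snd (snd q) = fst r\<rbrakk> \<Longrightarrow> oc (oc p q) r = oc p (oc q r)"
  by (auto simp: uarr_def oc_def ucmp_assoc)

end

section \<open>Tensor products of underlying arrows\<close>

context tensor_enriched
begin

lemma uten_uhom [simp]:
  "\<lbrakk>a \<in> vobj D; b \<in> vobj D; c \<in> vobj D; d \<in> vobj D; f \<in> uhom V D a b; g \<in> uhom V D c d\<rbrakk>
    \<Longrightarrow> uten V D a b c d f g \<in> uhom V D (mten D a c) (mten D b d)"
  by (simp add: uhom_iff)

text \<open>\<open>post_T\<close> as an equation of arrows of \<open>V\<close>, for use inside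
  naturality squares that live on hom objects.\<close>

lemma mtenm_post:
  assumes "a \<in> vobj D" "b \<in> vobj D" "b' \<in> vobj D" "c \<in> vobj D" "d \<in> vobj D" "d' \<in> vobj D"
    and "g \<in> uhom V D b b'" "g' \<in> uhom V D d d'"
  shows "(postcmp V D a b b' g \<odot> postcmp V D c d d' g') \<Zsemi> mtenm D a b' c d'
    = mtenm D a b c d \<Zsemi> postcmp V D (mten D a c) (mten D b d) (mten D b' d') (uten V D b b' d d' g g')"
proof (rule box_inj[where xs = "[vhom D a b, vhom D c d]" and ys = "[vhom D (mten D a c) (mten D b' d')]"])
  note [simp] = assms(1-6) and u [simp] = assms(7,8)[unfolded uhom_iff]
  let ?xs = "[vhom D a b, vhom D c d]" let ?s = "start ?xs" let ?ys = "[vhom D (mten D a c) (mten D b' d')]"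
  have "?s |>0: Box ?xs ((postcmp V D a b b' g \<odot> postcmp V D c d d' g') \<Zsemi> mtenm D a b' c d') ?ys
    = ?s |>Suc 0: Box [] g [vhom D b b'] |>0: M a b b' |>Suc (Suc 0): Box [] g' [vhom D d d'] |>Suc 0: M c d d' |>0: T a b' c d'"
    by (subst box_cmp[symmetric, where ys = "[vhom D a b', vhom D c d']"]) (simp_all add: box_ten_native box_postcmp at_iff)
  also have "\<dots> = ?s |>0: T a b c d |>Suc 0: Box [] (uten V D b b' d d' g g') [vhom D (mten D b d) (mten D b' d')]
      |>0: M (mten D a c) (mten D b d) (mten D b' d')"
    by (rule post_T) (simp_all add: at_iff)
  also have "\<dots> = ?s |>0: Box ?xs (mtenm D a b c d \<Zsemi> postcmp V D (mten D a c) (mten D b d) (mten D b' d') (uten V D b b' d d' g g')) ?ys"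
    by (subst box_cmp[symmetric, where ys = "[vhom D (mten D a c) (mten D b d)]"]) (simp_all add: box_postcmp at_iff)
  finally show "?s |>0: Box ?xs ((postcmp V D a b b' g \<odot> postcmp V D c d d' g') \<Zsemi> mtenm D a b' c d') ?ys = \<dots>" .
qed (use assms in \<open>simp_all add: uhom_iff\<close>)

lemma mtenm_pre:
  assumes "a \<in> vobj D" "b \<in> vobj D" "c \<in> vobj D" "d \<in> vobj D" "e \<in> vobj D" "f \<in> vobj D"
    and "g \<in> uhom V D a b" "g' \<in> uhom V D d e"
  shows "(precmp V D a b c g \<odot> precmp V D d e f g') \<Zsemi> mtenm D a c d f
    = mtenm D b c e f \<Zsemi> precmp V D (mten D a d) (mten D b e) (mten D c f) (uten V D a b d e g g')"
proof (rule box_inj[where xs = "[vhom D b c, vhom D e f]" and ys = "[vhom D (mten D a d) (mten D c f)]"])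
  note [simp] = assms(1-6) and u [simp] = assms(7,8)[unfolded uhom_iff]
  let ?xs = "[vhom D b c, vhom D e f]" let ?s = "start ?xs" let ?ys = "[vhom D (mten D a d) (mten D c f)]"
  have "?s |>0: Box ?xs ((precmp V D a b c g \<odot> precmp V D d e f g') \<Zsemi> mtenm D a c d f) ?ys
    = ?s |>0: Box [] g [vhom D a b] |>0: M a b c |>Suc 0: Box [] g' [vhom D d e] |>Suc 0: M d e f |>0: T a c d f"
    by (subst box_cmp[symmetric, where ys = "[vhom D a c, vhom D d f]"]) (simp_all add: box_ten_native box_precmp at_iff)
  also have "\<dots> = ?s |>0: T b c e f |>0: Box [] (uten V D a b d e g g') [vhom D (mten D a d) (mten D b e)]
      |>0: M (mten D a d) (mten D b e) (mten D c f)"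
    by (rule pre_T) (simp_all add: at_iff)
  also have "\<dots> = ?s |>0: Box ?xs (mtenm D b c e f \<Zsemi> precmp V D (mten D a d) (mten D b e) (mten D c f) (uten V D a b d e g g')) ?ys"
    by (subst box_cmp[symmetric, where ys = "[vhom D (mten D b e) (mten D c f)]"]) (simp_all add: box_precmp at_iff)
  finally show "?s |>0: Box ?xs ((precmp V D a b c g \<odot> precmp V D d e f g') \<Zsemi> mtenm D a c d f) ?ys = \<dots>" .
qed (use assms in \<open>simp_all add: uhom_iff\<close>)

definition ot :: "'a \<times> 'm \<times> 'a \<Rightarrow> 'a \<times> 'm \<times> 'a \<Rightarrow> 'a \<times> 'm \<times> 'a" where
  "ot p q = (mten D (fst p) (fst q), uten V D (fst p) (snd (snd p)) (fst q) (snd (snd q)) (fst (snd p)) (fst (snd q)),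
     mten D (snd (snd p)) (snd (snd q)))"

lemma ot_simps [simp]: "fst (ot p q) = mten D (fst p) (fst q)" "snd (snd (ot p q)) = mten D (snd (snd p)) (snd (snd q))"
  by (simp_all add: ot_def)

lemma uarr_ot [simp]: "\<lbrakk>uarr p; uarr q\<rbrakk> \<Longrightarrow> uarr (ot p q)"
  by (simp add: uarr_def ot_def)

lemma ot_od [simp]: "\<lbrakk>a \<in> vobj D; b \<in> vobj D\<rbrakk> \<Longrightarrow> ot (od a) (od b) = od (mten D a b)"
  by (simp add: ot_def od_def uten_vid)

lemma oc_ot:
  "\<lbrakk>uarr p; uarr p'; uarr q; uarr q'; snd (snd p) = fst p'; snd (snd q) = fst q'\<rbrakk>
    \<Longrightarrow> oc (ot p q) (ot p' q') = ot (oc p p') (oc q q')"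
  by (auto simp: uarr_def oc_def ot_def uten_ucmp uhom_iff)

end

section \<open>Enriched functors acting on underlying arrows\<close>

context
  fixes V :: "('o, 'm, 'z) bcm_scheme" (structure) and C :: "('a, 'o, 'm, 'y) vcat_scheme"
    and D :: "('b, 'o, 'm, 'x) vcat_scheme" and F :: "('a, 'b, 'm, 'w) vfun_scheme"
  assumes "enriched_category V C" "enriched_category V D" and F: "V_functor V C D F"
begin

interpretation C: enriched_category V C by fact
interpretation D: enriched_category V D by fact

lemma V_functor_obj: "a \<in> vobj C \<Longrightarrow> fobj F a \<in> vobj D"
  using F by (auto simp: V_functor_def)

lemma V_functor_typ:
  assumes "a \<in> vobj C" "b \<in> vobj C"
  shows "fmap F a b \<in> arr V" "src V (fmap F a b) = vhom C a b"
    "trg V (fmap F a b) = vhom D (fobj F a) (fobj F b)"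
  using F assms by (auto simp: V_functor_def hom_iff)

lemma V_functor_vid: "a \<in> vobj C \<Longrightarrow> vid C a \<Zsemi> fmap F a a = vid D (fobj F a)"
  using F by (auto simp: V_functor_def)

lemma V_functor_vcmp:
  "\<lbrakk>a \<in> vobj C; b \<in> vobj C; c \<in> vobj C\<rbrakk> \<Longrightarrow> vcmp C a b c \<Zsemi> fmap F a c
    = (fmap F a b \<odot> fmap F b c) \<Zsemi> vcmp D (fobj F a) (fobj F b) (fobj F c)"
  using F by (auto simp: V_functor_def)

lemma V_functor_uhom:
  "\<lbrakk>a \<in> vobj C; b \<in> vobj C; f \<in> uhom V C a b\<rbrakk> \<Longrightarrow> f \<Zsemi> fmap F a b \<in> uhom V D (fobj F a) (fobj F b)"
  using V_functor_obj V_functor_typ by (simp add: C.uhom_iff D.uhom_iff)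

text \<open>Compatibility of the functor with composition, restricted along \<open>g\<close> in the
  second factor; naturality of \<open>\<r>\<close> moves \<open>fmap F a b\<close> out in
  front.\<close>

lemma V_functor_postcmp:
  assumes ob: "a \<in> vobj C" "b \<in> vobj C" "c \<in> vobj C" and g: "g \<in> uhom V C b c"
  shows "postcmp V C a b c g \<Zsemi> fmap F a c = fmap F a b \<Zsemi> postcmp V D (fobj F a) (fobj F b) (fobj F c) (g \<Zsemi> fmap F b c)"
proof -
  note [simp] = ob V_functor_obj V_functor_typ and u [simp] = g[unfolded C.uhom_iff]
  let ?ab = "vhom C a b" and ?Fab = "vhom D (fobj F a) (fobj F b)"
  have "postcmp V C a b c g \<Zsemi> fmap F a c = \<inverse> (\<r> ?ab) \<Zsemi> ((\<i> ?ab \<odot> g) \<Zsemi> (vcmp C a b c \<Zsemi> fmap F a c))"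
    by (simp add: postcmp_def C.cmp_assoc_arr)
  also have "\<dots> = \<inverse> (\<r> ?ab) \<Zsemi> ((fmap F a b \<odot> (g \<Zsemi> fmap F b c)) \<Zsemi> vcmp D (fobj F a) (fobj F b) (fobj F c))"
    by (simp add: V_functor_vcmp C.cmp_ten_assoc)
  also have "fmap F a b \<odot> (g \<Zsemi> fmap F b c) = (fmap F a b \<odot> \<i> \<one>) \<Zsemi> (\<i> ?Fab \<odot> (g \<Zsemi> fmap F b c))"
    by (simp add: C.cmp_ten)
  also have "\<inverse> (\<r> ?ab) \<Zsemi> ((fmap F a b \<odot> \<i> \<one>) \<Zsemi> (\<i> ?Fab \<odot> (g \<Zsemi> fmap F b c)) \<Zsemi> vcmp D (fobj F a) (fobj F b) (fobj F c))
     = (\<inverse> (\<r> ?ab) \<Zsemi> (fmap F a b \<odot> \<i> \<one>)) \<Zsemi> ((\<i> ?Fab \<odot> (g \<Zsemi> fmap F b c)) \<Zsemi> vcmp D (fobj F a) (fobj F b) (fobj F c))"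
    by (simp add: C.cmp_assoc_arr del: C.cmp_ten)
  also have "\<inverse> (\<r> ?ab) \<Zsemi> (fmap F a b \<odot> \<i> \<one>) = fmap F a b \<Zsemi> \<inverse> (\<r> ?Fab)"
    by (rule C.iso_cancel_right[of "\<r> ?Fab"]) (simp_all add: C.cmp_assoc_arr C.runit_nat_arr[of "fmap F a b", simplified])
  finally show ?thesis by (simp add: postcmp_def C.cmp_assoc_arr)
qed

lemma V_functor_precmp:
  assumes ob: "a \<in> vobj C" "b \<in> vobj C" "c \<in> vobj C" and g: "g \<in> uhom V C a b"
  shows "precmp V C a b c g \<Zsemi> fmap F a c = fmap F b c \<Zsemi> precmp V D (fobj F a) (fobj F b) (fobj F c) (g \<Zsemi> fmap F a b)"
proof -
  note [simp] = ob V_functor_obj V_functor_typ and u [simp] = g[unfolded C.uhom_iff]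
  let ?bc = "vhom C b c" and ?Fbc = "vhom D (fobj F b) (fobj F c)"
  have "precmp V C a b c g \<Zsemi> fmap F a c = \<inverse> (\<l> ?bc) \<Zsemi> ((g \<odot> \<i> ?bc) \<Zsemi> (vcmp C a b c \<Zsemi> fmap F a c))"
    by (simp add: precmp_def C.cmp_assoc_arr)
  also have "\<dots> = \<inverse> (\<l> ?bc) \<Zsemi> (((g \<Zsemi> fmap F a b) \<odot> fmap F b c) \<Zsemi> vcmp D (fobj F a) (fobj F b) (fobj F c))"
    by (simp add: V_functor_vcmp C.cmp_ten_assoc)
  also have "(g \<Zsemi> fmap F a b) \<odot> fmap F b c = (\<i> \<one> \<odot> fmap F b c) \<Zsemi> ((g \<Zsemi> fmap F a b) \<odot> \<i> ?Fbc)"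
    by (simp add: C.cmp_ten)
  also have "\<inverse> (\<l> ?bc) \<Zsemi> ((\<i> \<one> \<odot> fmap F b c) \<Zsemi> ((g \<Zsemi> fmap F a b) \<odot> \<i> ?Fbc) \<Zsemi> vcmp D (fobj F a) (fobj F b) (fobj F c))
     = (\<inverse> (\<l> ?bc) \<Zsemi> (\<i> \<one> \<odot> fmap F b c)) \<Zsemi> (((g \<Zsemi> fmap F a b) \<odot> \<i> ?Fbc) \<Zsemi> vcmp D (fobj F a) (fobj F b) (fobj F c))"
    by (simp add: C.cmp_assoc_arr del: C.cmp_ten)
  also have "\<inverse> (\<l> ?bc) \<Zsemi> (\<i> \<one> \<odot> fmap F b c) = fmap F b c \<Zsemi> \<inverse> (\<l> ?Fbc)"
    using C.lunit_inv_nat_arr[of "fmap F b c"] by simp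
  finally show ?thesis by (simp add: precmp_def C.cmp_assoc_arr)
qed

lemma V_functor_ucmp:
  assumes ob: "a \<in> vobj C" "b \<in> vobj C" "c \<in> vobj C" and f: "f \<in> uhom V C a b" and g: "g \<in> uhom V C b c"
  shows "ucmp V C a b c f g \<Zsemi> fmap F a c = ucmp V D (fobj F a) (fobj F b) (fobj F c) (f \<Zsemi> fmap F a b) (g \<Zsemi> fmap F b c)"
proof -
  note [simp] = ob V_functor_obj V_functor_typ V_functor_uhom f g
  have u: "f \<in> arr V" "src V f = \<one>" "trg V f = vhom C a b" "g \<in> arr V" "src V g = \<one>" "trg V g = vhom C b c"
    using f g by (simp_all add: C.uhom_iff)
  have "ucmp V C a b c f g \<Zsemi> fmap F a c = f \<Zsemi> (postcmp V C a b c g \<Zsemi> fmap F a c)"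
    using u by (simp add: C.global_post[symmetric] C.cmp_assoc_arr)
  also have "\<dots> = (f \<Zsemi> fmap F a b) \<Zsemi> postcmp V D (fobj F a) (fobj F b) (fobj F c) (g \<Zsemi> fmap F b c)"
    using u by (simp add: V_functor_postcmp C.cmp_assoc_arr)
  finally show ?thesis by (simp add: D.global_post)
qed

end

section \<open>Monoidal equivalences from essentially surjective embeddings\<close>

text \<open>A fully faithful monoidal functor with chosen isomorphisms
  \<open>t X : X \<rightarrow> F (G X)\<close> and inverses \<open>s X\<close>. The normalisation on
  objects \<open>F a\<close> makes the inverse functor strict on the unit object and allows one of
  the two natural isomorphisms to consist of identities.\<close>

locale monoidal_embedding = C: strict_enriched V C + D: tensor_enriched V D
  for V :: "('o, 'm, 'z) bcm_scheme" (structure) and C :: "('a, 'o, 'm, 'y) vmoncat_scheme"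
    and D :: "('b, 'o, 'm, 'x) vmoncat_scheme" +
  fixes F :: "('a, 'b, 'm, 'w) vmonfun_scheme" and G :: "'b \<Rightarrow> 'a" and t s :: "'b \<Rightarrow> 'm"
  assumes F_monoidal: "V_monoidal_functor V C D F"
    and F_iso [simp]: "\<lbrakk>a \<in> vobj C; b \<in> vobj C\<rbrakk> \<Longrightarrow> C.iso (fmap F a b)"
    and massoc_in [simp]: "\<lbrakk>X \<in> vobj D; Y \<in> vobj D; Z \<in> vobj D\<rbrakk>
      \<Longrightarrow> massoc D X Y Z \<in> uhom V D (mten D (mten D X Y) Z) (mten D X (mten D Y Z))"
    and mlunit_in [simp]: "X \<in> vobj D \<Longrightarrow> mlunit D X \<in> uhom V D (mten D (munit D) X) X"
    and mrunit_in [simp]: "X \<in> vobj D \<Longrightarrow> mrunit D X \<in> uhom V D (mten D X (munit D)) X"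
    and massoc_natural: "\<lbrakk>X \<in> vobj D; Y \<in> vobj D; Z \<in> vobj D; X' \<in> vobj D; Y' \<in> vobj D; Z' \<in> vobj D;
        f \<in> uhom V D X X'; g \<in> uhom V D Y Y'; h \<in> uhom V D Z Z'\<rbrakk>
      \<Longrightarrow> ucmp V D (mten D (mten D X Y) Z) (mten D (mten D X' Y') Z') (mten D X' (mten D Y' Z'))
          (uten V D (mten D X Y) (mten D X' Y') Z Z' (uten V D X X' Y Y' f g) h) (massoc D X' Y' Z')
        = ucmp V D (mten D (mten D X Y) Z) (mten D X (mten D Y Z)) (mten D X' (mten D Y' Z'))
          (massoc D X Y Z) (uten V D X X' (mten D Y Z) (mten D Y' Z') f (uten V D Y Y' Z Z' g h))"
    and mlunit_natural: "\<lbrakk>X \<in> vobj D; X' \<in> vobj D; f \<in> uhom V D X X'\<rbrakk>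
      \<Longrightarrow> ucmp V D (mten D (munit D) X) (mten D (munit D) X') X'
          (uten V D (munit D) (munit D) X X' (vid D (munit D)) f) (mlunit D X')
        = ucmp V D (mten D (munit D) X) X X' (mlunit D X) f"
    and mrunit_natural: "\<lbrakk>X \<in> vobj D; X' \<in> vobj D; f \<in> uhom V D X X'\<rbrakk>
      \<Longrightarrow> ucmp V D (mten D X (munit D)) (mten D X' (munit D)) X'
          (uten V D X X' (munit D) (munit D) f (vid D (munit D))) (mrunit D X')
        = ucmp V D (mten D X (munit D)) X X' (mrunit D X) f"
    and G_in [simp]: "X \<in> vobj D \<Longrightarrow> G X \<in> vobj C"
    and t_in [simp]: "X \<in> vobj D \<Longrightarrow> t X \<in> uhom V D X (fobj F (G X))"
    and s_in [simp]: "X \<in> vobj D \<Longrightarrow> s X \<in> uhom V D (fobj F (G X)) X"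
    and t_s: "X \<in> vobj D \<Longrightarrow> ucmp V D X (fobj F (G X)) X (t X) (s X) = vid D X"
    and s_t: "X \<in> vobj D \<Longrightarrow> ucmp V D (fobj F (G X)) X (fobj F (G X)) (s X) (t X) = vid D (fobj F (G X))"
    and G_F [simp]: "a \<in> vobj C \<Longrightarrow> G (fobj F a) = a"
    and t_F [simp]: "a \<in> vobj C \<Longrightarrow> t (fobj F a) = vid D (fobj F a)"
begin

notation D.oc (infixr "\<bullet>" 70)
notation D.ot (infixr "\<star>" 75)

abbreviation "\<phi> \<equiv> fobj F"

lemma F_functor: "V_functor V C D F"
  using F_monoidal by (simp add: V_monoidal_functor_def)

lemmas F_lems = C.enriched_category_axioms D.enriched_category_axioms F_functor
lemmas F_obj [simp] = V_functor_obj[OF F_lems]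
lemmas F_typ [simp] = V_functor_typ[OF F_lems]
lemmas F_uhom [simp] = V_functor_uhom[OF F_lems]
lemmas F_ucmp = V_functor_ucmp[OF F_lems]
lemmas F_vid [simp] = V_functor_vid[OF F_lems]
lemmas F_vcmp = V_functor_vcmp[OF F_lems]
lemmas F_post = V_functor_postcmp[OF F_lems]
lemmas F_pre = V_functor_precmp[OF F_lems]

lemma F_unit [simp]: "\<phi> (munit C) = munit D"
  using F_monoidal by (simp add: V_monoidal_functor_def)

lemma nu_uisos: "\<lbrakk>a \<in> vobj C; b \<in> vobj C\<rbrakk> \<Longrightarrow> nu F a b \<in> uisos V D (\<phi> (mten C a b)) (mten D (\<phi> a) (\<phi> b))"
  using F_monoidal by (simp add: V_monoidal_functor_def)

lemma nu_in [simp]: "\<lbrakk>a \<in> vobj C; b \<in> vobj C\<rbrakk> \<Longrightarrow> nu F a b \<in> uhom V D (\<phi> (mten C a b)) (mten D (\<phi> a) (\<phi> b))"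
  using nu_uisos by (simp add: uisos_def)

section \<open>Calculus in the underlying category of the target\<close>

definition ni :: "'a \<Rightarrow> 'a \<Rightarrow> 'm" where
  "ni a b = (SOME g. g \<in> uhom V D (mten D (\<phi> a) (\<phi> b)) (\<phi> (mten C a b))
    \<and> ucmp V D (\<phi> (mten C a b)) (mten D (\<phi> a) (\<phi> b)) (\<phi> (mten C a b)) (nu F a b) g = vid D (\<phi> (mten C a b))
    \<and> ucmp V D (mten D (\<phi> a) (\<phi> b)) (\<phi> (mten C a b)) (mten D (\<phi> a) (\<phi> b)) g (nu F a b) = vid D (mten D (\<phi> a) (\<phi> b)))"

text \<open>In the triples that follow, \<open>N\<close> and \<open>N'\<close> are mutually inverse,
  as are \<open>S\<close> and \<open>S'\<close>; diagram chases become rewriting with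
  \<open>cancel\<close> and its associated form.\<close>

definition Fo :: "'a \<Rightarrow> 'm \<Rightarrow> 'a \<Rightarrow> 'b \<times> 'm \<times> 'b" where "Fo a f b = (\<phi> a, f \<Zsemi> fmap F a b, \<phi> b)"
definition N :: "'a \<Rightarrow> 'a \<Rightarrow> 'b \<times> 'm \<times> 'b" where "N a b = (\<phi> (mten C a b), nu F a b, mten D (\<phi> a) (\<phi> b))"
definition N' :: "'a \<Rightarrow> 'a \<Rightarrow> 'b \<times> 'm \<times> 'b" where "N' a b = (mten D (\<phi> a) (\<phi> b), ni a b, \<phi> (mten C a b))"
definition S :: "'b \<Rightarrow> 'b \<times> 'm \<times> 'b" where "S X = (\<phi> (G X), s X, X)"
definition S' :: "'b \<Rightarrow> 'b \<times> 'm \<times> 'b" where "S' X = (X, t X, \<phi> (G X))"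
definition A :: "'b \<Rightarrow> 'b \<Rightarrow> 'b \<Rightarrow> 'b \<times> 'm \<times> 'b" where
  "A X Y Z = (mten D (mten D X Y) Z, massoc D X Y Z, mten D X (mten D Y Z))"
definition L :: "'b \<Rightarrow> 'b \<times> 'm \<times> 'b" where "L X = (mten D (munit D) X, mlunit D X, X)"
definition R :: "'b \<Rightarrow> 'b \<times> 'm \<times> 'b" where "R X = (mten D X (munit D), mrunit D X, X)"

lemmas tri_defs = Fo_def N_def N'_def S_def S'_def A_def L_def R_def

lemma ni: "\<lbrakk>a \<in> vobj C; b \<in> vobj C\<rbrakk> \<Longrightarrow> ni a b \<in> uhom V D (mten D (\<phi> a) (\<phi> b)) (\<phi> (mten C a b))
    \<and> ucmp V D (\<phi> (mten C a b)) (mten D (\<phi> a) (\<phi> b)) (\<phi> (mten C a b)) (nu F a b) (ni a b) = vid D (\<phi> (mten C a b))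
    \<and> ucmp V D (mten D (\<phi> a) (\<phi> b)) (\<phi> (mten C a b)) (mten D (\<phi> a) (\<phi> b)) (ni a b) (nu F a b) = vid D (mten D (\<phi> a) (\<phi> b))"
  unfolding ni_def by (rule someI_ex) (use nu_uisos[of a b] in \<open>auto simp: uisos_def\<close>)

lemma tri_ends [simp]:
  "fst (Fo a f b) = \<phi> a" "snd (snd (Fo a f b)) = \<phi> b"
  "fst (N a b) = \<phi> (mten C a b)" "snd (snd (N a b)) = mten D (\<phi> a) (\<phi> b)"
  "fst (N' a b) = mten D (\<phi> a) (\<phi> b)" "snd (snd (N' a b)) = \<phi> (mten C a b)"
  "fst (S X) = \<phi> (G X)" "snd (snd (S X)) = X" "fst (S' X) = X" "snd (snd (S' X)) = \<phi> (G X)"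
  "fst (A X Y Z) = mten D (mten D X Y) Z" "snd (snd (A X Y Z)) = mten D X (mten D Y Z)"
  "fst (L X) = mten D (munit D) X" "snd (snd (L X)) = X" "fst (R X) = mten D X (munit D)" "snd (snd (R X)) = X"
  by (simp_all add: tri_defs)

lemma tri_uarr [simp]:
  "\<lbrakk>a \<in> vobj C; b \<in> vobj C; f \<in> uhom V C a b\<rbrakk> \<Longrightarrow> D.uarr (Fo a f b)"
  "\<lbrakk>a \<in> vobj C; b \<in> vobj C\<rbrakk> \<Longrightarrow> D.uarr (N a b)" "\<lbrakk>a \<in> vobj C; b \<in> vobj C\<rbrakk> \<Longrightarrow> D.uarr (N' a b)"
  "X \<in> vobj D \<Longrightarrow> D.uarr (S X)" "X \<in> vobj D \<Longrightarrow> D.uarr (S' X)"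
  "\<lbrakk>X \<in> vobj D; Y \<in> vobj D; Z \<in> vobj D\<rbrakk> \<Longrightarrow> D.uarr (A X Y Z)"
  "X \<in> vobj D \<Longrightarrow> D.uarr (L X)" "X \<in> vobj D \<Longrightarrow> D.uarr (R X)"
  using ni by (simp_all add: tri_defs)

lemma cancel [simp]:
  "\<lbrakk>a \<in> vobj C; b \<in> vobj C\<rbrakk> \<Longrightarrow> N a b \<bullet> N' a b = D.od (\<phi> (mten C a b))"
  "\<lbrakk>a \<in> vobj C; b \<in> vobj C\<rbrakk> \<Longrightarrow> N' a b \<bullet> N a b = D.od (mten D (\<phi> a) (\<phi> b))"
  "X \<in> vobj D \<Longrightarrow> S' X \<bullet> S X = D.od X" "X \<in> vobj D \<Longrightarrow> S X \<bullet> S' X = D.od (\<phi> (G X))"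
  using ni by (simp_all add: tri_defs D.oc_def D.od_def s_t t_s)

lemma cancel' [simp]:
  "\<lbrakk>a \<in> vobj C; b \<in> vobj C; D.uarr p; fst p = \<phi> (mten C a b)\<rbrakk> \<Longrightarrow> N a b \<bullet> N' a b \<bullet> p = p"
  "\<lbrakk>a \<in> vobj C; b \<in> vobj C; D.uarr p; fst p = mten D (\<phi> a) (\<phi> b)\<rbrakk> \<Longrightarrow> N' a b \<bullet> N a b \<bullet> p = p"
  "\<lbrakk>X \<in> vobj D; D.uarr p; fst p = X\<rbrakk> \<Longrightarrow> S' X \<bullet> S X \<bullet> p = p"
  "\<lbrakk>X \<in> vobj D; D.uarr p; fst p = \<phi> (G X)\<rbrakk> \<Longrightarrow> S X \<bullet> S' X \<bullet> p = p"
  by (simp_all add: D.oc_assoc[symmetric])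

lemma S'_F [simp]: "a \<in> vobj C \<Longrightarrow> S' (\<phi> a) = D.od (\<phi> a)"
  by (simp add: S'_def D.od_def)

lemma S_F [simp]: "a \<in> vobj C \<Longrightarrow> S (\<phi> a) = D.od (\<phi> a)"
  using cancel(3)[of "\<phi> a"] by simp

lemma s_F [simp]: "a \<in> vobj C \<Longrightarrow> s (\<phi> a) = vid D (\<phi> a)"
  using S_F[of a] by (simp add: S_def D.od_def)

lemma Fo_ucmp: "\<lbrakk>a \<in> vobj C; b \<in> vobj C; c \<in> vobj C; f \<in> uhom V C a b; g \<in> uhom V C b c\<rbrakk>
    \<Longrightarrow> Fo a (ucmp V C a b c f g) c = Fo a f b \<bullet> Fo b g c"
  by (simp add: Fo_def D.oc_def F_ucmp)

lemma Fo_vid: "a \<in> vobj C \<Longrightarrow> Fo a (vid C a) a = D.od (\<phi> a)"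
  by (simp add: Fo_def D.od_def)

text \<open>Faithfulness of \<open>F\<close> on underlying arrows, from invertibility of its hom
  maps.\<close>

lemma Fo_inj: "\<lbrakk>Fo a f b = Fo a g b; a \<in> vobj C; b \<in> vobj C; f \<in> uhom V C a b; g \<in> uhom V C a b\<rbrakk> \<Longrightarrow> f = g"
  using C.iso_cancel_right[of "fmap F a b" f g] by (simp add: Fo_def C.uhom_iff)

lemma nu_nat:
  assumes "a \<in> vobj C" "b \<in> vobj C" "c \<in> vobj C" "d \<in> vobj C"
  shows "mtenm C a c b d \<Zsemi> (fmap F (mten C a b) (mten C c d) \<Zsemi> postcmp V D (\<phi> (mten C a b)) (\<phi> (mten C c d)) (mten D (\<phi> c) (\<phi> d)) (nu F c d))
    = (fmap F a c \<odot> fmap F b d) \<Zsemi> (mtenm D (\<phi> a) (\<phi> c) (\<phi> b) (\<phi> d) \<Zsemi> precmp V D (\<phi> (mten C a b)) (mten D (\<phi> a) (\<phi> b)) (mten D (\<phi> c) (\<phi> d)) (nu F a b))"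
proof -
  note u [simp] = D.uhom_iff[THEN iffD1, OF nu_in]
  have "mtenm C a c b d \<Zsemi> fmap F (mten C a b) (mten C c d) \<Zsemi> postcmp V D (\<phi> (mten C a b)) (\<phi> (mten C c d)) (mten D (\<phi> c) (\<phi> d)) (nu F c d)
    = (fmap F a c \<odot> fmap F b d) \<Zsemi> mtenm D (\<phi> a) (\<phi> c) (\<phi> b) (\<phi> d) \<Zsemi> precmp V D (\<phi> (mten C a b)) (mten D (\<phi> a) (\<phi> b)) (mten D (\<phi> c) (\<phi> d)) (nu F a b)"
    using F_monoidal assms by (simp add: V_monoidal_functor_def)
  then show ?thesis using assms by (simp add: C.cmp_assoc_arr)
qed

text \<open>Naturality of \<open>\<nu>\<close> on hom objects, evaluated at the pair of elements
  \<open>f\<close>, \<open>g\<close> and solved for the image of their tensor product.\<close>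

lemma Fo_uten:
  assumes ob [simp]: "a \<in> vobj C" "b \<in> vobj C" "c \<in> vobj C" "d \<in> vobj C" and f: "f \<in> uhom V C a b" and g: "g \<in> uhom V C c d"
  shows "Fo (mten C a c) (uten V C a b c d f g) (mten C b d) = N a c \<bullet> (Fo a f b \<star> Fo c g d) \<bullet> N' b d"
proof -
  note u [simp] = f[unfolded C.uhom_iff] g[unfolded C.uhom_iff] and nu = D.uhom_iff[THEN iffD1, OF nu_in]
  let ?u = "uten V C a b c d f g" and ?post = "postcmp V D (\<phi> (mten C a c)) (\<phi> (mten C b d)) (mten D (\<phi> b) (\<phi> d)) (nu F b d)"
    and ?pre = "precmp V D (\<phi> (mten C a c)) (mten D (\<phi> a) (\<phi> c)) (mten D (\<phi> b) (\<phi> d)) (nu F a c)"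
  have [simp]: "?post \<in> arr V" "src V ?post = vhom D (\<phi> (mten C a c)) (\<phi> (mten C b d))" "trg V ?post = vhom D (\<phi> (mten C a c)) (mten D (\<phi> b) (\<phi> d))"
    "?pre \<in> arr V" "src V ?pre = vhom D (mten D (\<phi> a) (\<phi> c)) (mten D (\<phi> b) (\<phi> d))" "trg V ?pre = vhom D (\<phi> (mten C a c)) (mten D (\<phi> b) (\<phi> d))"
    by (simp_all add: nu)
  have "(?u \<Zsemi> fmap F (mten C a c) (mten C b d)) \<Zsemi> ?post = (\<inverse> (\<l> \<one>) \<Zsemi> (f \<odot> g)) \<Zsemi> (mtenm C a b c d \<Zsemi> (fmap F (mten C a c) (mten C b d) \<Zsemi> ?post))"
    by (simp add: uten_def C.cmp_assoc_arr)
  also have "\<dots> = uten V D (\<phi> a) (\<phi> b) (\<phi> c) (\<phi> d) (f \<Zsemi> fmap F a b) (g \<Zsemi> fmap F c d) \<Zsemi> ?pre"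
    by (simp add: nu_nat uten_def C.cmp_assoc_arr C.cmp_ten C.cmp_ten_assoc)
  finally have "Fo (mten C a c) ?u (mten C b d) \<bullet> N b d = N a c \<bullet> (Fo a f b \<star> Fo c g d)"
    using f g by (simp add: D.global_post D.global_pre Fo_def N_def D.oc_def D.ot_def)
  then have "(Fo (mten C a c) ?u (mten C b d) \<bullet> N b d) \<bullet> N' b d = (N a c \<bullet> (Fo a f b \<star> Fo c g d)) \<bullet> N' b d" by simp
  then show ?thesis using f g by (simp add: D.oc_assoc)
qed

text \<open>The associativity law of \<open>\<nu>\<close>; the associator of the strict category
  \<open>C\<close> is an identity and disappears under \<open>F\<close>.\<close>

lemma N_assoc:
  assumes "a \<in> vobj C" "b \<in> vobj C" "c \<in> vobj C"
  shows "N (mten C a b) c \<bullet> (N a b \<star> D.od (\<phi> c)) \<bullet> A (\<phi> a) (\<phi> b) (\<phi> c) = N a (mten C b c) \<bullet> (D.od (\<phi> a) \<star> N b c)"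
proof -
  have "ucmp V D (\<phi> (mten C (mten C a b) c)) (mten D (mten D (\<phi> a) (\<phi> b)) (\<phi> c)) (mten D (\<phi> a) (mten D (\<phi> b) (\<phi> c)))
      (ucmp V D (\<phi> (mten C (mten C a b) c)) (mten D (\<phi> (mten C a b)) (\<phi> c)) (mten D (mten D (\<phi> a) (\<phi> b)) (\<phi> c))
        (nu F (mten C a b) c)
        (uten V D (\<phi> (mten C a b)) (mten D (\<phi> a) (\<phi> b)) (\<phi> c) (\<phi> c) (nu F a b) (vid D (\<phi> c))))
      (massoc D (\<phi> a) (\<phi> b) (\<phi> c))
    = ucmp V D (\<phi> (mten C (mten C a b) c)) (\<phi> (mten C a (mten C b c))) (mten D (\<phi> a) (mten D (\<phi> b) (\<phi> c)))
        (massoc C a b c \<Zsemi> fmap F (mten C (mten C a b) c) (mten C a (mten C b c)))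
        (ucmp V D (\<phi> (mten C a (mten C b c))) (mten D (\<phi> a) (\<phi> (mten C b c))) (mten D (\<phi> a) (mten D (\<phi> b) (\<phi> c)))
          (nu F a (mten C b c))
          (uten V D (\<phi> a) (\<phi> a) (\<phi> (mten C b c)) (mten D (\<phi> b) (\<phi> c)) (vid D (\<phi> a)) (nu F b c)))"
    using F_monoidal assms unfolding V_monoidal_functor_def Let_def by blast
  then have "(N (mten C a b) c \<bullet> (N a b \<star> D.od (\<phi> c))) \<bullet> A (\<phi> a) (\<phi> b) (\<phi> c) = D.od (\<phi> (mten C a (mten C b c))) \<bullet> N a (mten C b c) \<bullet> (D.od (\<phi> a) \<star> N b c)"
    using assms by (simp add: D.oc_def D.ot_def D.od_def N_def A_def)
  then show ?thesis using assms by (simp add: D.oc_assoc)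
qed

text \<open>Inverts \<open>N_assoc\<close>: inserting the composite of the \<open>N\<close> between
  the two strings of \<open>N'\<close> cancels one or the other.\<close>

lemma N'_assoc:
  assumes ob [simp]: "a \<in> vobj C" "b \<in> vobj C" "c \<in> vobj C"
  shows "A (\<phi> a) (\<phi> b) (\<phi> c) \<bullet> (D.od (\<phi> a) \<star> N' b c) \<bullet> N' a (mten C b c) = (N' a b \<star> D.od (\<phi> c)) \<bullet> N' (mten C a b) c"
proof -
  let ?L = "(N' a b \<star> D.od (\<phi> c)) \<bullet> N' (mten C a b) c" and ?r = "(D.od (\<phi> a) \<star> N' b c) \<bullet> N' a (mten C b c)"
  have [simp]: "(N' a b \<star> D.od (\<phi> c)) \<bullet> (N a b \<star> D.od (\<phi> c)) \<bullet> p = p"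
    if "D.uarr p" "fst p = mten D (mten D (\<phi> a) (\<phi> b)) (\<phi> c)" for p
    using that by (simp add: D.oc_assoc[symmetric] D.oc_ot)
  have [simp]: "(D.od (\<phi> a) \<star> N b c) \<bullet> (D.od (\<phi> a) \<star> N' b c) \<bullet> p = p"
    if "D.uarr p" "fst p = mten D (\<phi> a) (\<phi> (mten C b c))" for p
    using that by (simp add: D.oc_assoc[symmetric] D.oc_ot)
  have "A (\<phi> a) (\<phi> b) (\<phi> c) \<bullet> ?r = ?L \<bullet> (N (mten C a b) c \<bullet> (N a b \<star> D.od (\<phi> c)) \<bullet> A (\<phi> a) (\<phi> b) (\<phi> c)) \<bullet> ?r"
    by (simp add: D.oc_assoc)
  also have "\<dots> = ?L" by (simp add: N_assoc D.oc_assoc)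
  finally show ?thesis .
qed

text \<open>As \<open>C\<close> is strict, the unit law of \<open>\<nu>\<close> says that
  \<open>\<nu>\<close> composed with the unitor of \<open>D\<close> is the identity; cancelling
  \<open>N\<close> identifies its inverse with the unitor.\<close>

lemma N'_unit_right: "a \<in> vobj C \<Longrightarrow> N' a (munit C) = R (\<phi> a)"
  and N'_unit_left: "a \<in> vobj C \<Longrightarrow> N' (munit C) a = L (\<phi> a)"
proof -
  assume ob [simp]: "a \<in> vobj C"
  have "ucmp V D (\<phi> (mten C a (munit C))) (mten D (\<phi> a) (munit D)) (\<phi> a) (nu F a (munit C)) (mrunit D (\<phi> a))
      = mrunit C a \<Zsemi> fmap F (mten C a (munit C)) a"
    using F_monoidal ob unfolding V_monoidal_functor_def by blast
  then have "N a (munit C) \<bullet> R (\<phi> a) = D.od (\<phi> a)" by (simp add: N_def R_def D.oc_def D.od_def)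
  then have "N' a (munit C) \<bullet> N a (munit C) \<bullet> R (\<phi> a) = N' a (munit C) \<bullet> D.od (\<phi> a)" by simp
  then show "N' a (munit C) = R (\<phi> a)" by simp
  have "ucmp V D (\<phi> (mten C (munit C) a)) (mten D (munit D) (\<phi> a)) (\<phi> a) (nu F (munit C) a) (mlunit D (\<phi> a))
      = mlunit C a \<Zsemi> fmap F (mten C (munit C) a) a"
    using F_monoidal ob unfolding V_monoidal_functor_def by blast
  then have "N (munit C) a \<bullet> L (\<phi> a) = D.od (\<phi> a)" by (simp add: N_def L_def D.oc_def D.od_def)
  then have "N' (munit C) a \<bullet> N (munit C) a \<bullet> L (\<phi> a) = N' (munit C) a \<bullet> D.od (\<phi> a)" by simp
  then show "N' (munit C) a = L (\<phi> a)" by simp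
qed

lemma A_nat:
  assumes "D.uarr p" "D.uarr q" "D.uarr r"
  shows "((p \<star> q) \<star> r) \<bullet> A (snd (snd p)) (snd (snd q)) (snd (snd r)) = A (fst p) (fst q) (fst r) \<bullet> (p \<star> q \<star> r)"
  using assms massoc_natural by (simp add: D.uarr_def D.oc_def D.ot_def A_def)

lemma L_nat: "D.uarr p \<Longrightarrow> (D.od (munit D) \<star> p) \<bullet> L (snd (snd p)) = L (fst p) \<bullet> p"
  using mlunit_natural by (simp add: D.uarr_def D.oc_def D.ot_def D.od_def L_def)

lemma R_nat: "D.uarr p \<Longrightarrow> (p \<star> D.od (munit D)) \<bullet> R (snd (snd p)) = R (fst p) \<bullet> p"
  using mrunit_natural by (simp add: D.uarr_def D.oc_def D.ot_def D.od_def R_def)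

section \<open>The inverse functor\<close>

text \<open>Conjugation by the chosen isomorphisms, on hom objects. It is \<open>F\<close> after the
  inverse functor.\<close>

definition cj :: "'b \<Rightarrow> 'b \<Rightarrow> 'm" where
  "cj X Y = precmp V D (\<phi> (G X)) X Y (s X) \<Zsemi> postcmp V D (\<phi> (G X)) Y (\<phi> (G Y)) (t Y)"

text \<open>The image under \<open>F\<close> of the structure isomorphism of the inverse functor:
  \<open>F (G (XY)) \<rightarrow> XY \<rightarrow> F (G X) F (G Y) \<rightarrow> F (G X G
  Y)\<close>.\<close>

definition P :: "'b \<Rightarrow> 'b \<Rightarrow> 'b \<times> 'm \<times> 'b" where
  "P X Y = S (mten D X Y) \<bullet> (S' X \<star> S' Y) \<bullet> N' (G X) (G Y)"

text \<open>Hom maps and structure isomorphisms are found in \<open>D\<close> first, as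
  \<open>cj\<close> and \<open>P\<close>, and then pulled back through the invertible hom maps of
  \<open>F\<close>.\<close>

definition Gf :: "('b, 'a, 'm) vmonfun" where
  "Gf = \<lparr>fobj = G, fmap = (\<lambda>X Y. cj X Y \<Zsemi> \<inverse> (fmap F (G X) (G Y))),
     nu = (\<lambda>X Y. fst (snd (P X Y)) \<Zsemi> \<inverse> (fmap F (G (mten D X Y)) (mten C (G X) (G Y))))\<rparr>"

lemma Gf_obj [simp]: "fobj Gf X = G X" by (simp add: Gf_def)

lemmas uhom_typ [simp] = t_in[unfolded D.uhom_iff] s_in[unfolded D.uhom_iff]

lemma cj_typ [simp]:
  assumes "X \<in> vobj D" "Y \<in> vobj D"
  shows "cj X Y \<in> arr V" "src V (cj X Y) = vhom D X Y" "trg V (cj X Y) = vhom D (\<phi> (G X)) (\<phi> (G Y))"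
  using assms by (simp_all add: cj_def)

lemma Gf_typ [simp]:
  assumes "X \<in> vobj D" "Y \<in> vobj D"
  shows "fmap Gf X Y \<in> arr V" "src V (fmap Gf X Y) = vhom D X Y" "trg V (fmap Gf X Y) = vhom C (G X) (G Y)"
  using assms by (simp_all add: Gf_def)

lemma Gf_F: "\<lbrakk>X \<in> vobj D; Y \<in> vobj D\<rbrakk> \<Longrightarrow> fmap Gf X Y \<Zsemi> fmap F (G X) (G Y) = cj X Y"
  by (simp add: Gf_def C.cmp_assoc_arr)

lemma cj_vid: "X \<in> vobj D \<Longrightarrow> vid D X \<Zsemi> cj X X = vid D (\<phi> (G X))"
  using D.global_pre[of "\<phi> (G X)" X X "s X" "vid D X"] D.global_post[of "\<phi> (G X)" X "\<phi> (G X)" "s X" "t X"]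
  by (simp add: cj_def C.cmp_assoc_arr[symmetric] D.ucmp_vid_right D.uhom_iff s_t)

text \<open>In the composite of two conjugates \<open>t Y\<close> and \<open>s Y\<close> meet in the
  middle and cancel.\<close>

lemma cj_vcmp:
  assumes ob [simp]: "X \<in> vobj D" "Y \<in> vobj D" "Z \<in> vobj D"
  shows "vcmp D X Y Z \<Zsemi> cj X Z = (cj X Y \<odot> cj Y Z) \<Zsemi> vcmp D (\<phi> (G X)) (\<phi> (G Y)) (\<phi> (G Z))"
proof -
  let ?X = "\<phi> (G X)" and ?Y = "\<phi> (G Y)" and ?Z = "\<phi> (G Z)"
  let ?p = "precmp V D ?X X Y (s X)" and ?q = "postcmp V D ?X Y ?Y (t Y)" and ?p' = "precmp V D ?Y Y Z (s Y)" and ?q' = "postcmp V D ?Y Z ?Z (t Z)"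
  have "(cj X Y \<odot> cj Y Z) \<Zsemi> vcmp D ?X ?Y ?Z = ((?p \<odot> ?p') \<Zsemi> (?q \<odot> \<i> (vhom D ?Y Z))) \<Zsemi> ((\<i> (vhom D ?X ?Y) \<odot> ?q') \<Zsemi> vcmp D ?X ?Y ?Z)"
    by (simp add: cj_def C.cmp_ten_assoc C.cmp_assoc_arr C.cmp_ten)
  also have "(\<i> (vhom D ?X ?Y) \<odot> ?q') \<Zsemi> vcmp D ?X ?Y ?Z = vcmp D ?X ?Y Z \<Zsemi> postcmp V D ?X Z ?Z (t Z)"
    by (simp add: D.vcmp_post)
  also have "((?p \<odot> ?p') \<Zsemi> (?q \<odot> \<i> (vhom D ?Y Z))) \<Zsemi> (vcmp D ?X ?Y Z \<Zsemi> postcmp V D ?X Z ?Z (t Z))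
     = (?p \<odot> ?p') \<Zsemi> (((?q \<odot> \<i> (vhom D ?Y Z)) \<Zsemi> vcmp D ?X ?Y Z) \<Zsemi> postcmp V D ?X Z ?Z (t Z))"
    by (simp add: C.cmp_assoc_arr del: C.cmp_ten)
  \<comment> \<open>Passes \<open>t Y\<close> from the first factor to the second, where
    \<open>s Y\<close> is waiting.\<close>
  also have "(?q \<odot> \<i> (vhom D ?Y Z)) \<Zsemi> vcmp D ?X ?Y Z = (\<i> (vhom D ?X Y) \<odot> precmp V D Y ?Y Z (t Y)) \<Zsemi> vcmp D ?X Y Z"
    by (simp add: D.post_vcmp)
  also have "(?p \<odot> ?p') \<Zsemi> (((\<i> (vhom D ?X Y) \<odot> precmp V D Y ?Y Z (t Y)) \<Zsemi> vcmp D ?X Y Z) \<Zsemi> postcmp V D ?X Z ?Z (t Z))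
     = (?p \<odot> (?p' \<Zsemi> precmp V D Y ?Y Z (t Y))) \<Zsemi> (vcmp D ?X Y Z \<Zsemi> postcmp V D ?X Z ?Z (t Z))"
    by (simp add: C.cmp_ten_assoc C.cmp_assoc_arr)
  also have "?p' \<Zsemi> precmp V D Y ?Y Z (t Y) = \<i> (vhom D Y Z)"
    by (simp add: D.pre_pre t_s)
  also have "(?p \<odot> \<i> (vhom D Y Z)) \<Zsemi> (vcmp D ?X Y Z \<Zsemi> postcmp V D ?X Z ?Z (t Z)) = ((?p \<odot> \<i> (vhom D Y Z)) \<Zsemi> vcmp D ?X Y Z) \<Zsemi> postcmp V D ?X Z ?Z (t Z)"
    by (simp add: C.cmp_assoc_arr)
  also have "(?p \<odot> \<i> (vhom D Y Z)) \<Zsemi> vcmp D ?X Y Z = vcmp D X Y Z \<Zsemi> precmp V D ?X X Z (s X)"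
    by (simp add: D.vcmp_pre)
  finally show ?thesis by (simp add: cj_def C.cmp_assoc_arr)
qed

lemma Gf_functor: "V_functor V D C Gf"
  unfolding V_functor_def
proof (intro conjI ballI)
  fix X assume [simp]: "X \<in> vobj D"
  have "(vid D X \<Zsemi> fmap Gf X X) \<Zsemi> fmap F (G X) (G X) = vid C (G X) \<Zsemi> fmap F (G X) (G X)"
    by (simp add: C.cmp_assoc_arr Gf_F cj_vid)
  then show "vid D X \<Zsemi> fmap Gf X X = vid C (fobj Gf X)"
    unfolding Gf_obj by (rule C.iso_cancel_right[rotated -1]) simp_all
next
  fix X Y Z assume [simp]: "X \<in> vobj D" "Y \<in> vobj D" "Z \<in> vobj D"
  have "(vcmp D X Y Z \<Zsemi> fmap Gf X Z) \<Zsemi> fmap F (G X) (G Z) = ((fmap Gf X Y \<odot> fmap Gf Y Z) \<Zsemi> vcmp C (G X) (G Y) (G Z)) \<Zsemi> fmap F (G X) (G Z)"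
    by (simp add: C.cmp_assoc_arr Gf_F cj_vcmp F_vcmp C.cmp_ten_assoc)
  then show "vcmp D X Y Z \<Zsemi> fmap Gf X Z = (fmap Gf X Y \<odot> fmap Gf Y Z) \<Zsemi> vcmp C (fobj Gf X) (fobj Gf Y) (fobj Gf Z)"
    unfolding Gf_obj by (rule C.iso_cancel_right[rotated -1]) simp_all
qed (simp_all add: hom_iff)

lemma P_ends [simp]: "fst (P X Y) = \<phi> (G (mten D X Y))" "snd (snd (P X Y)) = \<phi> (mten C (G X) (G Y))"
  by (simp_all add: P_def)

lemma P_uarr [simp]: "\<lbrakk>X \<in> vobj D; Y \<in> vobj D\<rbrakk> \<Longrightarrow> D.uarr (P X Y)"
  by (simp add: P_def)

text \<open>Fullness: every underlying arrow between images under \<open>F\<close> is the image of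
  its pullback.\<close>

lemma Fo_lift:
  assumes "D.uarr p" "fst p = \<phi> a" "snd (snd p) = \<phi> b" "a \<in> vobj C" "b \<in> vobj C"
  shows "fst (snd p) \<Zsemi> \<inverse> (fmap F a b) \<in> uhom V C a b" "Fo a (fst (snd p) \<Zsemi> \<inverse> (fmap F a b)) b = p"
  using assms by (auto simp: D.uarr_def C.uhom_iff D.uhom_iff Fo_def C.cmp_assoc_arr prod_eq_iff)

lemma nu_Gf [simp]:
  assumes "X \<in> vobj D" "Y \<in> vobj D"
  shows "nu Gf X Y \<in> uhom V C (G (mten D X Y)) (mten C (G X) (G Y))"
    "Fo (G (mten D X Y)) (nu Gf X Y) (mten C (G X) (G Y)) = P X Y"
  using Fo_lift[of "P X Y" "G (mten D X Y)" "mten C (G X) (G Y)"] assms by (simp_all add: Gf_def)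

text \<open>\<open>F\<close> reflects isomorphisms: lift the inverse by fullness and check both laws
  by faithfulness.\<close>

lemma Fo_uisos:
  assumes ob: "a \<in> vobj C" "b \<in> vobj C" and f: "f \<in> uhom V C a b" and q: "D.uarr q" "fst q = \<phi> b" "snd (snd q) = \<phi> a"
    and 1: "Fo a f b \<bullet> q = D.od (\<phi> a)" and 2: "q \<bullet> Fo a f b = D.od (\<phi> b)"
  shows "f \<in> uisos V C a b"
proof -
  let ?g = "fst (snd q) \<Zsemi> \<inverse> (fmap F b a)"
  note g = Fo_lift[OF q ob(2,1)]
  have "ucmp V C a b a f ?g = vid C a"
    by (rule Fo_inj[of a _ a]) (simp_all add: ob f g Fo_ucmp 1 Fo_vid C.uhom_iff[of "vid C a"])
  moreover have "ucmp V C b a b ?g f = vid C b"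
    by (rule Fo_inj[of b _ b]) (simp_all add: ob f g Fo_ucmp 2 Fo_vid C.uhom_iff[of "vid C b"])
  ultimately show ?thesis using f g(1) by (auto simp: uisos_def)
qed

lemma S_ten_cancel [simp]:
  "\<lbrakk>X \<in> vobj D; Y \<in> vobj D; D.uarr p; fst p = mten D X Y\<rbrakk> \<Longrightarrow> (S' X \<star> S' Y) \<bullet> (S X \<star> S Y) \<bullet> p = p"
  "\<lbrakk>X \<in> vobj D; Y \<in> vobj D; D.uarr p; fst p = mten D (\<phi> (G X)) (\<phi> (G Y))\<rbrakk> \<Longrightarrow> (S X \<star> S Y) \<bullet> (S' X \<star> S' Y) \<bullet> p = p"
  by (simp_all add: D.oc_assoc[symmetric] D.oc_ot)

lemma P_N: "\<lbrakk>X \<in> vobj D; Y \<in> vobj D\<rbrakk> \<Longrightarrow> P X Y \<bullet> N (G X) (G Y) = S (mten D X Y) \<bullet> (S' X \<star> S' Y)"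
  by (simp add: P_def D.oc_assoc)

lemma nu_Gf_uisos: "\<lbrakk>X \<in> vobj D; Y \<in> vobj D\<rbrakk> \<Longrightarrow> nu Gf X Y \<in> uisos V C (G (mten D X Y)) (mten C (G X) (G Y))"
  by (rule Fo_uisos[where q = "N (G X) (G Y) \<bullet> (S X \<star> S Y) \<bullet> S' (mten D X Y)"]) (simp_all add: P_def D.oc_assoc)

text \<open>The structure map at the unit contains \<open>N'\<close>, which is the unitor of
  \<open>D\<close>; naturality of the unitor moves it to \<open>X\<close>, leaving its
  conjugate.\<close>

lemma nu_Gf_unit_right:
  assumes [simp]: "X \<in> vobj D"
  shows "nu Gf X (munit D) = mrunit D X \<Zsemi> fmap Gf (mten D X (munit D)) X"
proof -
  note m = D.uhom_iff[THEN iffD1, OF mrunit_in]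
  have G1: "G (munit D) = munit C" using G_F[of "munit C"] by simp
  have S1: "S' (munit D) = D.od (munit D)" using S'_F[of "munit C"] by simp
  have "P X (munit D) = S (mten D X (munit D)) \<bullet> R X \<bullet> S' X"
    using R_nat[of "S' X"] by (simp add: P_def G1 S1 N'_unit_right)
  moreover have "\<dots> = (S (mten D X (munit D)) \<bullet> R X) \<bullet> S' X" by (simp add: D.oc_assoc)
  moreover have "mrunit D X \<Zsemi> cj (mten D X (munit D)) X = fst (snd ((S (mten D X (munit D)) \<bullet> R X) \<bullet> S' X))"
    using m by (simp add: cj_def C.cmp_assoc_arr[symmetric] D.global_pre D.global_post S_def R_def S'_def D.oc_def)
  ultimately have "fst (snd (P X (munit D))) = mrunit D X \<Zsemi> cj (mten D X (munit D)) X" by simp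
  then show ?thesis by (simp add: Gf_def G1 m C.cmp_assoc_arr)
qed

lemma nu_Gf_unit_left:
  assumes [simp]: "X \<in> vobj D"
  shows "nu Gf (munit D) X = mlunit D X \<Zsemi> fmap Gf (mten D (munit D) X) X"
proof -
  note m = D.uhom_iff[THEN iffD1, OF mlunit_in]
  have G1: "G (munit D) = munit C" using G_F[of "munit C"] by simp
  have S1: "S' (munit D) = D.od (munit D)" using S'_F[of "munit C"] by simp
  have "P (munit D) X = S (mten D (munit D) X) \<bullet> L X \<bullet> S' X"
    using L_nat[of "S' X"] by (simp add: P_def G1 S1 N'_unit_left)
  moreover have "\<dots> = (S (mten D (munit D) X) \<bullet> L X) \<bullet> S' X" by (simp add: D.oc_assoc)
  moreover have "mlunit D X \<Zsemi> cj (mten D (munit D) X) X = fst (snd ((S (mten D (munit D) X) \<bullet> L X) \<bullet> S' X))"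
    using m by (simp add: cj_def C.cmp_assoc_arr[symmetric] D.global_pre D.global_post S_def L_def S'_def D.oc_def)
  ultimately have "fst (snd (P (munit D) X)) = mlunit D X \<Zsemi> cj (mten D (munit D) X) X" by simp
  then show ?thesis by (simp add: Gf_def G1 m C.cmp_assoc_arr)
qed

text \<open>On underlying arrows, \<open>F\<close> after the inverse functor is conjugation written
  with \<open>S\<close> and \<open>S'\<close>.\<close>

lemma Fo_Gf:
  assumes [simp]: "X \<in> vobj D" "Y \<in> vobj D" and f: "f \<in> uhom V D X Y"
  shows "Fo (G X) (f \<Zsemi> fmap Gf X Y) (G Y) = S X \<bullet> (X, f, Y) \<bullet> S' Y"
proof -
  note u [simp] = f[unfolded D.uhom_iff]
  have "Fo (G X) (f \<Zsemi> fmap Gf X Y) (G Y) = (S X \<bullet> (X, f, Y)) \<bullet> S' Y"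
    using f by (simp add: Fo_def Gf_F C.cmp_assoc_arr)
      (simp add: cj_def C.cmp_assoc_arr[symmetric] D.global_pre D.global_post S_def S'_def D.oc_def)
  then show ?thesis using f by (simp add: D.oc_assoc)
qed

lemma Gf_uhom [simp]: "\<lbrakk>X \<in> vobj D; Y \<in> vobj D; f \<in> uhom V D X Y\<rbrakk> \<Longrightarrow> f \<Zsemi> fmap Gf X Y \<in> uhom V C (G X) (G Y)"
  by (simp add: C.uhom_iff D.uhom_iff)

text \<open>Tested after the faithful \<open>F\<close>. All inner copies of the chosen isomorphisms
  cancel, and the sides then differ by naturality of the associator and by
  \<open>N'_assoc\<close>.\<close>

lemma nu_Gf_assoc:
  assumes [simp]: "X \<in> vobj D" "Y \<in> vobj D" "Z \<in> vobj D"
  shows "ucmp V C (G (mten D (mten D X Y) Z)) (mten C (G (mten D X Y)) (G Z)) (mten C (G X) (mten C (G Y) (G Z)))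
      (nu Gf (mten D X Y) Z)
      (uten V C (G (mten D X Y)) (mten C (G X) (G Y)) (G Z) (G Z) (nu Gf X Y) (vid C (G Z)))
    = ucmp V C (G (mten D (mten D X Y) Z)) (G (mten D X (mten D Y Z))) (mten C (G X) (mten C (G Y) (G Z)))
      (massoc D X Y Z \<Zsemi> fmap Gf (mten D (mten D X Y) Z) (mten D X (mten D Y Z)))
      (ucmp V C (G (mten D X (mten D Y Z))) (mten C (G X) (G (mten D Y Z))) (mten C (G X) (mten C (G Y) (G Z)))
        (nu Gf X (mten D Y Z))
        (uten V C (G X) (G X) (G (mten D Y Z)) (mten C (G Y) (G Z)) (vid C (G X)) (nu Gf Y Z)))" (is "?l = ?r")
proof -
  have vid: "vid C (G Z) \<in> uhom V C (G Z) (G Z)" "vid C (G X) \<in> uhom V C (G X) (G X)" by (simp_all add: C.uhom_iff)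
  have ul: "uten V C (G (mten D X Y)) (mten C (G X) (G Y)) (G Z) (G Z) (nu Gf X Y) (vid C (G Z))
      \<in> uhom V C (mten C (G (mten D X Y)) (G Z)) (mten C (G X) (mten C (G Y) (G Z)))"
    using C.uten_uhom[of "G (mten D X Y)" "mten C (G X) (G Y)" "G Z" "G Z" "nu Gf X Y" "vid C (G Z)"] vid by simp
  have ur: "uten V C (G X) (G X) (G (mten D Y Z)) (mten C (G Y) (G Z)) (vid C (G X)) (nu Gf Y Z)
      \<in> uhom V C (mten C (G X) (G (mten D Y Z))) (mten C (G X) (mten C (G Y) (G Z)))"
    using vid by simp
  let ?XYZ = "mten D (mten D X Y) Z" and ?g = "mten C (G X) (mten C (G Y) (G Z))"
  have "Fo (G ?XYZ) ?l ?g = P (mten D X Y) Z \<bullet> N (G (mten D X Y)) (G Z) \<bullet> (P X Y \<star> D.od (\<phi> (G Z))) \<bullet> N' (mten C (G X) (G Y)) (G Z)"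
    using ul Fo_uten[of "G (mten D X Y)" "mten C (G X) (G Y)" "G Z" "G Z" "nu Gf X Y" "vid C (G Z)"] vid
    by (simp add: Fo_ucmp Fo_vid)
  also have "\<dots> = (P (mten D X Y) Z \<bullet> N (G (mten D X Y)) (G Z)) \<bullet> (P X Y \<star> D.od (\<phi> (G Z))) \<bullet> N' (mten C (G X) (G Y)) (G Z)"
    by (simp add: D.oc_assoc)
  also have "\<dots> = S ?XYZ \<bullet> ((S' (mten D X Y) \<star> S' Z) \<bullet> (P X Y \<star> D.od (\<phi> (G Z)))) \<bullet> N' (mten C (G X) (G Y)) (G Z)"
    by (simp add: P_N D.oc_assoc)
  also have "(S' (mten D X Y) \<star> S' Z) \<bullet> (P X Y \<star> D.od (\<phi> (G Z))) = (((S' X \<star> S' Y) \<bullet> N' (G X) (G Y)) \<star> (S' Z \<bullet> D.od (\<phi> (G Z))))"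
    by (subst D.oc_ot) (simp_all add: P_def)
  also have "\<dots> = ((S' X \<star> S' Y) \<star> S' Z) \<bullet> (N' (G X) (G Y) \<star> D.od (\<phi> (G Z)))"
    by (subst D.oc_ot) simp_all
  finally have l: "Fo (G ?XYZ) ?l ?g = S ?XYZ \<bullet> ((S' X \<star> S' Y) \<star> S' Z) \<bullet> (N' (G X) (G Y) \<star> D.od (\<phi> (G Z))) \<bullet> N' (mten C (G X) (G Y)) (G Z)"
    by (simp add: D.oc_assoc)
  let ?X = "mten D X (mten D Y Z)"
  have "Fo (G ?XYZ) ?r ?g = (S ?XYZ \<bullet> A X Y Z \<bullet> S' ?X) \<bullet> P X (mten D Y Z) \<bullet> N (G X) (G (mten D Y Z)) \<bullet> (D.od (\<phi> (G X)) \<star> P Y Z) \<bullet> N' (G X) (mten C (G Y) (G Z))"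
    using ur vid by (simp add: Fo_ucmp Fo_vid Fo_Gf Fo_uten A_def)
  also have "\<dots> = S ?XYZ \<bullet> A X Y Z \<bullet> S' ?X \<bullet> (P X (mten D Y Z) \<bullet> N (G X) (G (mten D Y Z))) \<bullet> (D.od (\<phi> (G X)) \<star> P Y Z) \<bullet> N' (G X) (mten C (G Y) (G Z))"
    by (simp add: D.oc_assoc)
  also have "\<dots> = S ?XYZ \<bullet> A X Y Z \<bullet> ((S' X \<star> S' (mten D Y Z)) \<bullet> (D.od (\<phi> (G X)) \<star> P Y Z)) \<bullet> N' (G X) (mten C (G Y) (G Z))"
    by (simp add: P_N D.oc_assoc)
  also have "(S' X \<star> S' (mten D Y Z)) \<bullet> (D.od (\<phi> (G X)) \<star> P Y Z) = (S' X \<bullet> D.od (\<phi> (G X))) \<star> ((S' Y \<star> S' Z) \<bullet> N' (G Y) (G Z))"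
    by (subst D.oc_ot) (simp_all add: P_def)
  also have "\<dots> = (S' X \<star> S' Y \<star> S' Z) \<bullet> (D.od (\<phi> (G X)) \<star> N' (G Y) (G Z))"
    by (subst D.oc_ot) simp_all
  also have "S ?XYZ \<bullet> A X Y Z \<bullet> ((S' X \<star> S' Y \<star> S' Z) \<bullet> (D.od (\<phi> (G X)) \<star> N' (G Y) (G Z))) \<bullet> N' (G X) (mten C (G Y) (G Z))
     = S ?XYZ \<bullet> (A X Y Z \<bullet> (S' X \<star> S' Y \<star> S' Z)) \<bullet> (D.od (\<phi> (G X)) \<star> N' (G Y) (G Z)) \<bullet> N' (G X) (mten C (G Y) (G Z))"
    by (simp add: D.oc_assoc)
  \<comment> \<open>The associator leaves \<open>X, Y, Z\<close> for the images, where
    \<open>N'_assoc\<close> can absorb it.\<close>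
  also have "A X Y Z \<bullet> (S' X \<star> S' Y \<star> S' Z) = ((S' X \<star> S' Y) \<star> S' Z) \<bullet> A (\<phi> (G X)) (\<phi> (G Y)) (\<phi> (G Z))"
    using A_nat[of "S' X" "S' Y" "S' Z"] by simp
  finally have r: "Fo (G ?XYZ) ?r ?g = S ?XYZ \<bullet> ((S' X \<star> S' Y) \<star> S' Z) \<bullet> A (\<phi> (G X)) (\<phi> (G Y)) (\<phi> (G Z)) \<bullet> (D.od (\<phi> (G X)) \<star> N' (G Y) (G Z)) \<bullet> N' (G X) (mten C (G Y) (G Z))"
    by (simp add: D.oc_assoc)
  show ?thesis
  proof (rule Fo_inj)
    show "Fo (G ?XYZ) ?l ?g = Fo (G ?XYZ) ?r ?g" unfolding l r by (simp add: N'_assoc)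
  qed (use ul ur in simp_all)
qed

text \<open>An equation between arrows out of hom objects, so triples of underlying arrows do not
  express it and pre- and postcomposition maps are used instead. The sides are compared after
  \<open>F\<close> and after postcomposition with \<open>\<nu>\<close>, two invertible maps.\<close>

lemma nu_Gf_nat:
  assumes ob [simp]: "X \<in> vobj D" "Y \<in> vobj D" "X' \<in> vobj D" "Y' \<in> vobj D"
  shows "mtenm D X X' Y Y' \<Zsemi> fmap Gf (mten D X Y) (mten D X' Y') \<Zsemi>
      postcmp V C (G (mten D X Y)) (G (mten D X' Y')) (mten C (G X') (G Y')) (nu Gf X' Y')
    = (fmap Gf X X' \<odot> fmap Gf Y Y') \<Zsemi> mtenm C (G X) (G X') (G Y) (G Y') \<Zsemi>
      precmp V C (G (mten D X Y)) (mten C (G X) (G Y)) (mten C (G X') (G Y')) (nu Gf X Y)" (is "?l = ?r")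
proof -
  let ?XY = "mten D X Y" and ?XY' = "mten D X' Y'"
  let ?g = "mten C (G X) (G Y)" and ?g' = "mten C (G X') (G Y')"
  let ?f = "mten D (\<phi> (G X)) (\<phi> (G Y))" and ?f' = "mten D (\<phi> (G X')) (\<phi> (G Y'))"
  let ?st = "ucmp V D (\<phi> (G ?XY)) ?XY ?f (s ?XY) (uten V D X (\<phi> (G X)) Y (\<phi> (G Y)) (t X) (t Y))"
  let ?tt = "uten V D X' (\<phi> (G X')) Y' (\<phi> (G Y')) (t X') (t Y')"
  let ?ss = "uten V D (\<phi> (G X)) X (\<phi> (G Y)) Y (s X) (s Y)"
  let ?n = "nu Gf X Y \<Zsemi> fmap F (G ?XY) ?g" and ?n' = "nu Gf X' Y' \<Zsemi> fmap F (G ?XY') ?g'"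
  note n = nu_Gf(1)[OF ob(1,2)] nu_Gf(1)[OF ob(3,4)]
  note un [simp] = n[unfolded C.uhom_iff]
  have uN [simp]: "?n \<in> uhom V D (\<phi> (G ?XY)) (\<phi> ?g)" "?n' \<in> uhom V D (\<phi> (G ?XY')) (\<phi> ?g')" using n by simp_all
  \<comment> \<open>\<open>P_N\<close> in this language: the image of the structure map followed by
    \<open>\<nu>\<close> is \<open>s\<close> followed by \<open>t \<otimes> t\<close>.\<close>
  have nn: "ucmp V D (\<phi> (G ?XY)) (\<phi> ?g) ?f ?n (nu F (G X) (G Y)) = ?st"
    using P_N[of X Y] nu_Gf(2)[of X Y] by (auto simp: P_def N_def S_def S'_def D.oc_def D.ot_def Fo_def prod_eq_iff)
  have nn': "ucmp V D (\<phi> (G ?XY')) (\<phi> ?g') ?f' ?n' (nu F (G X') (G Y')) = ucmp V D (\<phi> (G ?XY')) ?XY' ?f' (s ?XY') ?tt"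
    using P_N[of X' Y'] nu_Gf(2)[of X' Y'] by (auto simp: P_def N_def S_def S'_def D.oc_def D.ot_def Fo_def prod_eq_iff)
  let ?q = "postcmp V D (\<phi> (G ?XY)) (\<phi> ?g') ?f' (nu F (G X') (G Y'))"
  note uF [simp] = D.uhom_iff[THEN iffD1, OF nu_in] D.uhom_iff[THEN iffD1, OF uN(1)] D.uhom_iff[THEN iffD1, OF uN(2)]
  let ?m = "mtenm D X X' Y Y'" and ?pre = "precmp V D (\<phi> (G ?XY)) ?XY ?XY' (s ?XY)"
    and ?post = "postcmp V D (\<phi> (G ?XY)) ?XY' ?f' ?tt"
  have [simp]: "?tt \<in> arr V" "src V ?tt = \<one>" "trg V ?tt = vhom D ?XY' ?f'" "?ss \<in> arr V" "src V ?ss = \<one>" "trg V ?ss = vhom D ?f ?XY"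
    "?st \<in> arr V" "src V ?st = \<one>" "trg V ?st = vhom D (\<phi> (G ?XY)) ?f"
    by simp_all
  have "(?l \<Zsemi> fmap F (G ?XY) ?g') \<Zsemi> ?q
     = ?m \<Zsemi> (fmap Gf ?XY ?XY' \<Zsemi> ((postcmp V C (G ?XY) (G ?XY') ?g' (nu Gf X' Y') \<Zsemi> fmap F (G ?XY) ?g') \<Zsemi> ?q))"
    by (simp add: C.cmp_assoc_arr)
  also have "postcmp V C (G ?XY) (G ?XY') ?g' (nu Gf X' Y') \<Zsemi> fmap F (G ?XY) ?g'
     = fmap F (G ?XY) (G ?XY') \<Zsemi> postcmp V D (\<phi> (G ?XY)) (\<phi> (G ?XY')) (\<phi> ?g') ?n'"
    using n by (simp add: F_post)
  also have "(fmap F (G ?XY) (G ?XY') \<Zsemi> postcmp V D (\<phi> (G ?XY)) (\<phi> (G ?XY')) (\<phi> ?g') ?n') \<Zsemi> ?q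
     = fmap F (G ?XY) (G ?XY') \<Zsemi> postcmp V D (\<phi> (G ?XY)) (\<phi> (G ?XY')) ?f' (ucmp V D (\<phi> (G ?XY')) ?XY' ?f' (s ?XY') ?tt)"
    unfolding nn'[symmetric] using uN by (simp add: D.post_post[symmetric] C.cmp_assoc_arr del: uF(2,3))
  also have "fmap Gf ?XY ?XY' \<Zsemi> \<dots> = cj ?XY ?XY' \<Zsemi> postcmp V D (\<phi> (G ?XY)) (\<phi> (G ?XY')) ?f' (ucmp V D (\<phi> (G ?XY')) ?XY' ?f' (s ?XY') ?tt)"
    by (simp add: C.cmp_assoc_arr[symmetric] Gf_F)
  also have "\<dots> = ?pre \<Zsemi> (postcmp V D (\<phi> (G ?XY)) ?XY' (\<phi> (G ?XY')) (t ?XY') \<Zsemi> (postcmp V D (\<phi> (G ?XY)) (\<phi> (G ?XY')) ?XY' (s ?XY') \<Zsemi> ?post))"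
    by (simp add: cj_def C.cmp_assoc_arr D.post_post)
  \<comment> \<open>The isomorphism \<open>t\<close> at the product is followed by its inverse
    \<open>s\<close>.\<close>
  also have "\<dots> = ?pre \<Zsemi> ?post"
    by (simp add: D.post_post D.ucmp_assoc[symmetric] t_s D.ucmp_vid_left)
  finally have l: "(?l \<Zsemi> fmap F (G ?XY) ?g') \<Zsemi> ?q = ?m \<Zsemi> (?pre \<Zsemi> ?post)" .
  let ?mC = "mtenm C (G X) (G X') (G Y) (G Y')" and ?mD = "mtenm D (\<phi> (G X)) (\<phi> (G X')) (\<phi> (G Y)) (\<phi> (G Y'))"
  let ?pn = "precmp V D (\<phi> (G ?XY)) (\<phi> ?g) ?f' ?n"
  have "(?r \<Zsemi> fmap F (G ?XY) ?g') \<Zsemi> ?q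
     = (fmap Gf X X' \<odot> fmap Gf Y Y') \<Zsemi> (?mC \<Zsemi> ((precmp V C (G ?XY) ?g ?g' (nu Gf X Y) \<Zsemi> fmap F (G ?XY) ?g') \<Zsemi> ?q))"
    by (simp add: C.cmp_assoc_arr)
  also have "precmp V C (G ?XY) ?g ?g' (nu Gf X Y) \<Zsemi> fmap F (G ?XY) ?g' = fmap F ?g ?g' \<Zsemi> precmp V D (\<phi> (G ?XY)) (\<phi> ?g) (\<phi> ?g') ?n"
    using n by (simp add: F_pre)
  also have "(fmap F ?g ?g' \<Zsemi> precmp V D (\<phi> (G ?XY)) (\<phi> ?g) (\<phi> ?g') ?n) \<Zsemi> ?q = fmap F ?g ?g' \<Zsemi> (postcmp V D (\<phi> ?g) (\<phi> ?g') ?f' (nu F (G X') (G Y')) \<Zsemi> ?pn)"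
    using uN by (simp add: C.cmp_assoc_arr D.pre_post del: uF(2,3))
  also have "?mC \<Zsemi> (fmap F ?g ?g' \<Zsemi> (postcmp V D (\<phi> ?g) (\<phi> ?g') ?f' (nu F (G X') (G Y')) \<Zsemi> ?pn))
     = (?mC \<Zsemi> (fmap F ?g ?g' \<Zsemi> postcmp V D (\<phi> ?g) (\<phi> ?g') ?f' (nu F (G X') (G Y')))) \<Zsemi> ?pn"
    by (simp add: C.cmp_assoc_arr)
  also have "?mC \<Zsemi> (fmap F ?g ?g' \<Zsemi> postcmp V D (\<phi> ?g) (\<phi> ?g') ?f' (nu F (G X') (G Y')))
     = (fmap F (G X) (G X') \<odot> fmap F (G Y) (G Y')) \<Zsemi> (?mD \<Zsemi> precmp V D (\<phi> ?g) ?f ?f' (nu F (G X) (G Y)))"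
    by (rule nu_nat) simp_all
  also have "((fmap F (G X) (G X') \<odot> fmap F (G Y) (G Y')) \<Zsemi> (?mD \<Zsemi> precmp V D (\<phi> ?g) ?f ?f' (nu F (G X) (G Y)))) \<Zsemi> ?pn
     = (fmap F (G X) (G X') \<odot> fmap F (G Y) (G Y')) \<Zsemi> (?mD \<Zsemi> precmp V D (\<phi> (G ?XY)) ?f ?f' ?st)"
    unfolding nn[symmetric] using uN by (simp add: D.pre_pre[symmetric] C.cmp_assoc_arr del: uF(2,3))
  also have "(fmap Gf X X' \<odot> fmap Gf Y Y') \<Zsemi> \<dots> = (cj X X' \<odot> cj Y Y') \<Zsemi> (?mD \<Zsemi> precmp V D (\<phi> (G ?XY)) ?f ?f' ?st)"
    by (simp add: C.cmp_ten_assoc Gf_F)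
  also have "\<dots> = (precmp V D (\<phi> (G X)) X X' (s X) \<odot> precmp V D (\<phi> (G Y)) Y Y' (s Y)) \<Zsemi>
     (((postcmp V D (\<phi> (G X)) X' (\<phi> (G X')) (t X') \<odot> postcmp V D (\<phi> (G Y)) Y' (\<phi> (G Y')) (t Y')) \<Zsemi> ?mD) \<Zsemi> precmp V D (\<phi> (G ?XY)) ?f ?f' ?st)"
    by (simp add: cj_def C.cmp_ten_assoc C.cmp_assoc_arr)
  also have "(postcmp V D (\<phi> (G X)) X' (\<phi> (G X')) (t X') \<odot> postcmp V D (\<phi> (G Y)) Y' (\<phi> (G Y')) (t Y')) \<Zsemi> ?mD
     = mtenm D (\<phi> (G X)) X' (\<phi> (G Y)) Y' \<Zsemi> postcmp V D ?f ?XY' ?f' ?tt"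
    by (rule D.mtenm_post) simp_all
  also have "(precmp V D (\<phi> (G X)) X X' (s X) \<odot> precmp V D (\<phi> (G Y)) Y Y' (s Y)) \<Zsemi> ((mtenm D (\<phi> (G X)) X' (\<phi> (G Y)) Y' \<Zsemi> postcmp V D ?f ?XY' ?f' ?tt) \<Zsemi> precmp V D (\<phi> (G ?XY)) ?f ?f' ?st)
     = ((precmp V D (\<phi> (G X)) X X' (s X) \<odot> precmp V D (\<phi> (G Y)) Y Y' (s Y)) \<Zsemi> mtenm D (\<phi> (G X)) X' (\<phi> (G Y)) Y') \<Zsemi> (postcmp V D ?f ?XY' ?f' ?tt \<Zsemi> precmp V D (\<phi> (G ?XY)) ?f ?f' ?st)"
    by (simp add: C.cmp_assoc_arr)
  also have "(precmp V D (\<phi> (G X)) X X' (s X) \<odot> precmp V D (\<phi> (G Y)) Y Y' (s Y)) \<Zsemi> mtenm D (\<phi> (G X)) X' (\<phi> (G Y)) Y' = ?m \<Zsemi> precmp V D ?f ?XY ?XY' ?ss"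
    by (rule D.mtenm_pre) simp_all
  also have "postcmp V D ?f ?XY' ?f' ?tt \<Zsemi> precmp V D (\<phi> (G ?XY)) ?f ?f' ?st = precmp V D (\<phi> (G ?XY)) ?f ?XY' ?st \<Zsemi> ?post"
    by (rule D.pre_post[symmetric]) (simp_all add: D.uhom_iff)
  also have "(?m \<Zsemi> precmp V D ?f ?XY ?XY' ?ss) \<Zsemi> (precmp V D (\<phi> (G ?XY)) ?f ?XY' ?st \<Zsemi> ?post)
     = ?m \<Zsemi> ((precmp V D ?f ?XY ?XY' ?ss \<Zsemi> precmp V D (\<phi> (G ?XY)) ?f ?XY' ?st) \<Zsemi> ?post)"
    by (simp add: C.cmp_assoc_arr)
  also have "precmp V D ?f ?XY ?XY' ?ss \<Zsemi> precmp V D (\<phi> (G ?XY)) ?f ?XY' ?st = precmp V D (\<phi> (G ?XY)) ?XY ?XY' (ucmp V D (\<phi> (G ?XY)) ?f ?XY ?st ?ss)"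
    by (rule D.pre_pre) (simp_all add: D.uhom_iff)
  \<comment> \<open>By \<open>?st\<close>, the arrow \<open>s\<close> at the product is followed by
    \<open>t \<otimes> t\<close>, which \<open>s \<otimes> s\<close> undoes.\<close>
  also have "ucmp V D (\<phi> (G ?XY)) ?f ?XY ?st ?ss = s ?XY"
  proof -
    have "(S ?XY \<bullet> (S' X \<star> S' Y)) \<bullet> (S X \<star> S Y) = S ?XY"
      by (simp add: D.oc_assoc D.oc_ot)
    then show ?thesis by (simp add: S_def S'_def D.oc_def D.ot_def)
  qed
  finally have "(?l \<Zsemi> fmap F (G ?XY) ?g') \<Zsemi> ?q = (?r \<Zsemi> fmap F (G ?XY) ?g') \<Zsemi> ?q"
    unfolding l ..
  moreover have "C.iso ?q"
  proof (rule C.isoI(1))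
    let ?q' = "postcmp V D (\<phi> (G ?XY)) ?f' (\<phi> ?g') (ni (G X') (G Y'))"
    note ni' = ni[of "G X'" "G Y'"]
    have [simp]: "ni (G X') (G Y') \<in> uhom V D ?f' (\<phi> ?g')" using ni' by simp
    note [simp] = D.uhom_iff[THEN iffD1, OF this]
    show "?q \<in> arr V" "?q' \<in> arr V" "src V ?q' = trg V ?q" "trg V ?q' = src V ?q" by simp_all
    show "?q \<Zsemi> ?q' = \<i> (src V ?q)" "?q' \<Zsemi> ?q = \<i> (trg V ?q)" using ni' by (simp_all add: D.post_post)
  qed
  ultimately have "?l \<Zsemi> fmap F (G ?XY) ?g' = ?r \<Zsemi> fmap F (G ?XY) ?g'"
    by (rule C.iso_cancel_right[rotated -1]) simp_all
  then show ?thesis by (rule C.iso_cancel_right[rotated -1]) simp_all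
qed

lemma G_unit [simp]: "G (munit D) = munit C"
  using G_F[of "munit C"] by simp

lemma Gf_monoidal: "V_monoidal_functor V D C Gf"
  unfolding V_monoidal_functor_def Let_def Gf_obj
proof (intro conjI ballI)
  fix X assume [simp]: "X \<in> vobj D"
  note [simp] = nu_Gf(1)[of X "munit D", unfolded C.uhom_iff, simplified] nu_Gf(1)[of "munit D" X, unfolded C.uhom_iff, simplified]
  show "ucmp V C (G (mten D X (munit D))) (mten C (G X) (munit C)) (G X) (nu Gf X (munit D)) (mrunit C (G X)) = mrunit D X \<Zsemi> fmap Gf (mten D X (munit D)) X"
    by (simp add: C.ucmp_vid_right nu_Gf_unit_right[symmetric])
  show "ucmp V C (G (mten D (munit D) X)) (mten C (munit C) (G X)) (G X) (nu Gf (munit D) X) (mlunit C (G X)) = mlunit D X \<Zsemi> fmap Gf (mten D (munit D) X) X"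
    by (simp add: C.ucmp_vid_right nu_Gf_unit_left[symmetric])
next
  fix X Y Z assume [simp]: "X \<in> vobj D" "Y \<in> vobj D" "Z \<in> vobj D"
  have v: "vid C (G Z) \<in> uhom V C (G Z) (G Z)" by (simp add: C.uhom_iff)
  have "ucmp V C (G (mten D (mten D X Y) Z)) (mten C (G (mten D X Y)) (G Z)) (mten C (mten C (G X) (G Y)) (G Z)) (nu Gf (mten D X Y) Z)
      (uten V C (G (mten D X Y)) (mten C (G X) (G Y)) (G Z) (G Z) (nu Gf X Y) (vid C (G Z))) \<in> uhom V C (G (mten D (mten D X Y) Z)) (mten C (mten C (G X) (G Y)) (G Z))"
    by (rule C.ucmp_uhom[OF _ _ _ _ C.uten_uhom]) (simp_all add: v)
  then show "ucmp V C (G (mten D (mten D X Y) Z)) (mten C (mten C (G X) (G Y)) (G Z)) (mten C (G X) (mten C (G Y) (G Z)))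
       (ucmp V C (G (mten D (mten D X Y) Z)) (mten C (G (mten D X Y)) (G Z)) (mten C (mten C (G X) (G Y)) (G Z)) (nu Gf (mten D X Y) Z)
         (uten V C (G (mten D X Y)) (mten C (G X) (G Y)) (G Z) (G Z) (nu Gf X Y) (vid C (G Z))))
       (massoc C (G X) (G Y) (G Z)) =
      ucmp V C (G (mten D (mten D X Y) Z)) (G (mten D X (mten D Y Z))) (mten C (G X) (mten C (G Y) (G Z)))
       (massoc D X Y Z \<Zsemi> fmap Gf (mten D (mten D X Y) Z) (mten D X (mten D Y Z)))
       (ucmp V C (G (mten D X (mten D Y Z))) (mten C (G X) (G (mten D Y Z))) (mten C (G X) (mten C (G Y) (G Z))) (nu Gf X (mten D Y Z))
         (uten V C (G X) (G X) (G (mten D Y Z)) (mten C (G Y) (G Z)) (vid C (G X)) (nu Gf Y Z)))"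
    using nu_Gf_assoc[of X Y Z] by (simp add: C.ucmp_vid_right C.uhom_iff)
qed (simp_all add: Gf_functor nu_Gf_uisos nu_Gf_nat)

section \<open>The two monoidal natural isomorphisms\<close>

lemma vid_uisos: "a \<in> vobj C \<Longrightarrow> vid C a \<in> uisos V C a a"
  by (auto simp: uisos_def C.uhom_iff C.ucmp_vid_right intro: exI[of _ "vid C a"])

text \<open>Thanks to the normalisation, conjugation between images of \<open>F\<close> is trivial,
  so identities form the required isomorphism; compatibility with \<open>\<nu>\<close> is checked by
  faithfulness of \<open>F\<close>.\<close>

lemma F_Gf: "monoidal_V_natural_iso V C C (vmonfun_cmp V C D C F Gf) (vmonfun_id V C) (vid C)"
  unfolding monoidal_V_natural_iso_def V_natural_iso_def
proof (intro conjI ballI)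
  fix a b assume [simp]: "a \<in> vobj C" "b \<in> vobj C"
  have "(fmap F a b \<Zsemi> fmap Gf (\<phi> a) (\<phi> b)) \<Zsemi> fmap F a b = \<i> (vhom C a b) \<Zsemi> fmap F a b"
    using Gf_F[of "\<phi> a" "\<phi> b"] by (simp add: C.cmp_assoc_arr cj_def)
  then have F: "fmap F a b \<Zsemi> fmap Gf (\<phi> a) (\<phi> b) = \<i> (vhom C a b)"
    by (rule C.iso_cancel_right[rotated -1]) simp_all
  show "fmap (vmonfun_cmp V C D C F Gf) a b \<Zsemi> postcmp V C (fobj (vmonfun_cmp V C D C F Gf) a) (fobj (vmonfun_cmp V C D C F Gf) b) (fobj (vmonfun_id V C) b) (vid C b)
      = fmap (vmonfun_id V C) a b \<Zsemi> precmp V C (fobj (vmonfun_cmp V C D C F Gf) a) (fobj (vmonfun_id V C) a) (fobj (vmonfun_id V C) b) (vid C a)"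
    by (simp add: vmonfun_cmp_def vmonfun_id_def F)
  let ?ab = "mten C a b" and ?f = "mten D (\<phi> a) (\<phi> b)"
  let ?n = "nu F a b \<Zsemi> fmap Gf (\<phi> ?ab) ?f" and ?m = "nu Gf (\<phi> a) (\<phi> b)"
  have n: "?n \<in> uhom V C ?ab (G ?f)" using Gf_uhom[of "\<phi> ?ab" ?f "nu F a b"] by simp
  have m: "?m \<in> uhom V C (G ?f) ?ab" using nu_Gf(1)[of "\<phi> a" "\<phi> b"] by simp
  have "ucmp V C ?ab (G ?f) ?ab ?n ?m = vid C ?ab"
  proof (rule Fo_inj)
    have "Fo ?ab ?n (G ?f) = N a b \<bullet> S' ?f" using Fo_Gf[of "\<phi> ?ab" ?f "nu F a b"] by (simp add: N_def[symmetric])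
    moreover have "Fo (G ?f) ?m ?ab = S ?f \<bullet> N' a b" using nu_Gf(2)[of "\<phi> a" "\<phi> b"] by (simp add: P_def)
    ultimately show "Fo ?ab (ucmp V C ?ab (G ?f) ?ab ?n ?m) ?ab = Fo ?ab (vid C ?ab) ?ab"
      using n m by (simp add: Fo_ucmp Fo_vid D.oc_assoc)
  qed (use n m in \<open>simp_all add: C.uhom_iff[of "vid C ?ab"]\<close>)
  then show "ucmp V C (fobj (vmonfun_cmp V C D C F Gf) ?ab) (fobj (vmonfun_id V C) ?ab) (mten C (fobj (vmonfun_id V C) a) (fobj (vmonfun_id V C) b)) (vid C ?ab) (nu (vmonfun_id V C) a b)
      = ucmp V C (fobj (vmonfun_cmp V C D C F Gf) ?ab) (mten C (fobj (vmonfun_cmp V C D C F Gf) a) (fobj (vmonfun_cmp V C D C F Gf) b)) (mten C (fobj (vmonfun_id V C) a) (fobj (vmonfun_id V C) b))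
         (nu (vmonfun_cmp V C D C F Gf) a b)
         (uten V C (fobj (vmonfun_cmp V C D C F Gf) a) (fobj (vmonfun_id V C) a) (fobj (vmonfun_cmp V C D C F Gf) b) (fobj (vmonfun_id V C) b) (vid C a) (vid C b))"
    by (simp add: vmonfun_cmp_def vmonfun_id_def C.uten_vid C.ucmp_vid_right)
qed (simp_all add: vmonfun_cmp_def vmonfun_id_def vid_uisos)

lemma s_uisos: "X \<in> vobj D \<Longrightarrow> s X \<in> uisos V D (\<phi> (G X)) X"
  using t_s s_t by (auto simp: uisos_def intro!: bexI[of _ "t X"])

text \<open>The isomorphisms \<open>s\<close> themselves are natural, as conjugation was defined
  from them, and \<open>P_N\<close> makes them monoidal.\<close>

lemma Gf_F_iso: "monoidal_V_natural_iso V D D (vmonfun_cmp V D C D Gf F) (vmonfun_id V D) s"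
  unfolding monoidal_V_natural_iso_def V_natural_iso_def
proof (intro conjI ballI)
  fix X Y assume [simp]: "X \<in> vobj D" "Y \<in> vobj D"
  show "fmap (vmonfun_cmp V D C D Gf F) X Y \<Zsemi> postcmp V D (fobj (vmonfun_cmp V D C D Gf F) X) (fobj (vmonfun_cmp V D C D Gf F) Y) (fobj (vmonfun_id V D) Y) (s Y)
      = fmap (vmonfun_id V D) X Y \<Zsemi> precmp V D (fobj (vmonfun_cmp V D C D Gf F) X) (fobj (vmonfun_id V D) X) (fobj (vmonfun_id V D) Y) (s X)"
    by (simp add: vmonfun_cmp_def vmonfun_id_def Gf_F cj_def C.cmp_assoc_arr D.post_post t_s)
  have "Fo (G (mten D X Y)) (nu Gf X Y) (mten C (G X) (G Y)) \<bullet> N (G X) (G Y) \<bullet> (S X \<star> S Y) = (P X Y \<bullet> N (G X) (G Y)) \<bullet> (S X \<star> S Y)"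
    by (simp add: D.oc_assoc)
  also have "\<dots> = S (mten D X Y)"
    by (simp add: P_N D.oc_assoc D.oc_ot)
  finally have "(Fo (G (mten D X Y)) (nu Gf X Y) (mten C (G X) (G Y)) \<bullet> N (G X) (G Y)) \<bullet> (S X \<star> S Y) = S (mten D X Y)"
    by (simp add: D.oc_assoc)
  then show "ucmp V D (fobj (vmonfun_cmp V D C D Gf F) (mten D X Y)) (fobj (vmonfun_id V D) (mten D X Y)) (mten D (fobj (vmonfun_id V D) X) (fobj (vmonfun_id V D) Y)) (s (mten D X Y)) (nu (vmonfun_id V D) X Y)
      = ucmp V D (fobj (vmonfun_cmp V D C D Gf F) (mten D X Y)) (mten D (fobj (vmonfun_cmp V D C D Gf F) X) (fobj (vmonfun_cmp V D C D Gf F) Y)) (mten D (fobj (vmonfun_id V D) X) (fobj (vmonfun_id V D) Y))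
         (nu (vmonfun_cmp V D C D Gf F) X Y)
         (uten V D (fobj (vmonfun_cmp V D C D Gf F) X) (fobj (vmonfun_id V D) X) (fobj (vmonfun_cmp V D C D Gf F) Y) (fobj (vmonfun_id V D) Y) (s X) (s Y))"
    by (simp add: vmonfun_cmp_def vmonfun_id_def D.ucmp_vid_right Fo_def N_def S_def D.oc_def D.ot_def)
next
  show "s (munit D) = vid D (munit D)" using s_F[of "munit C"] by simp
qed (simp_all add: vmonfun_cmp_def vmonfun_id_def s_uisos)

theorem F_equivalence: "V_monoidal_equivalence V C D F"
  unfolding V_monoidal_equivalence_def using F_monoidal Gf_monoidal F_Gf Gf_F_iso by blast

end

section \<open>Comparison of the three conditions\<close>

context enriched_category
begin

text \<open>Two out of three for isomorphisms; it strips the unitor from the comparison arrow of the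
  embedding in \<open>Emb_mu_uisos_iff\<close>.\<close>

lemma uisos_cancel:
  assumes ob: "a \<in> vobj C" "b \<in> vobj C" "c \<in> vobj C" and f: "f \<in> uisos V C a b" and g: "g \<in> uhom V C b c"
  shows "ucmp V C a b c f g \<in> uisos V C a c \<longleftrightarrow> g \<in> uisos V C b c"
proof -
  obtain f' where f': "f \<in> uhom V C a b" "f' \<in> uhom V C b a" "ucmp V C a b a f f' = vid C a" "ucmp V C b a b f' f = vid C b"
    using f by (auto simp: uisos_def)
  note [simp] = ob g f' uhom_iff[THEN iffD1, OF g] uhom_iff[THEN iffD1, OF f'(1)] uhom_iff[THEN iffD1, OF f'(2)]
  have gf: "ucmp V C b a c f' (ucmp V C a b c f g) = g"
    by (simp add: ucmp_assoc[symmetric] ucmp_vid_left)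
  show ?thesis
  proof
    assume "ucmp V C a b c f g \<in> uisos V C a c"
    then obtain h where h: "h \<in> uhom V C c a" "ucmp V C a c a (ucmp V C a b c f g) h = vid C a" "ucmp V C c a c h (ucmp V C a b c f g) = vid C c"
      by (auto simp: uisos_def)
    note [simp] = h(1)
    have "ucmp V C b c b g (ucmp V C c a b h f) = ucmp V C b a b f' (ucmp V C a a b (ucmp V C a c a (ucmp V C a b c f g) h) f)"
      by (subst gf[symmetric]) (simp add: ucmp_assoc)
    then have "ucmp V C b c b g (ucmp V C c a b h f) = vid C b" by (simp add: h ucmp_vid_left)
    moreover have "ucmp V C c b c (ucmp V C c a b h f) g = vid C c" using h(3) by (simp add: ucmp_assoc)
    ultimately show "g \<in> uisos V C b c" by (auto simp: uisos_def intro!: bexI[of _ "ucmp V C c a b h f"])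
  next
    assume "g \<in> uisos V C b c"
    then obtain h where h: "h \<in> uhom V C c b" "ucmp V C b c b g h = vid C b" "ucmp V C c b c h g = vid C c"
      by (auto simp: uisos_def)
    note [simp] = h(1) uhom_iff[THEN iffD1, OF h(1)]
    have "ucmp V C a c a (ucmp V C a b c f g) (ucmp V C c b a h f') = ucmp V C a b a f (ucmp V C b b a (ucmp V C b c b g h) f')"
      by (simp add: ucmp_assoc)
    then have 1: "ucmp V C a c a (ucmp V C a b c f g) (ucmp V C c b a h f') = vid C a" by (simp add: h ucmp_vid_left)
    have "ucmp V C c a c (ucmp V C c b a h f') (ucmp V C a b c f g) = ucmp V C c b c h (ucmp V C b b c (ucmp V C b a b f' f) g)"
      by (simp add: ucmp_assoc gf ucmp_vid_left)
    then have "ucmp V C c a c (ucmp V C c b a h f') (ucmp V C a b c f g) = vid C c" by (simp add: h ucmp_vid_left)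
    with 1 show "ucmp V C a b c f g \<in> uisos V C a c"
      by (auto simp: uisos_def intro!: bexI[of _ "ucmp V C c b a h f'"])
  qed
qed

end

context strict_enriched
begin

lemma ku_ucmp_vid_iff:
  assumes f: "ku f a u b v" and g: "ku g b v a u"
  shows "ucmp V K (a, u) (b, v) (a, u) f g = vid K (a, u)
    \<longleftrightarrow> start [u] |>0: FL f a u b v |>Suc 0: FL g b v a u |>0: M a b a = start [u] |>0: J a"
proof -
  note ob = kuD(1-4)[OF f]
  have at: "at (start [u]) 0 [u]" using ob by (simp add: at_iff)
  have v: "ku (vid K (a, u)) a u a u" using ob by (intro ku_vid)
  have "ucmp V K (a, u) (b, v) (a, u) f g = vid K (a, u)
    \<longleftrightarrow> start [u] |>0: FL (ucmp V K (a, u) (b, v) (a, u) f g) a u a u = start [u] |>0: FL (vid K (a, u)) a u a u"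
    using ku_ext[OF ku_ucmp[OF f g] v] by metis
  then show ?thesis
    unfolding box_fl_ucmp[OF at f g] box_fl_vid[OF at ob(1,3)] .
qed

lemma ku_ucmp_vidD:
  assumes "ucmp V K (a, u) (b, v) (a, u) f g = vid K (a, u)" and f: "ku f a u b v" and g: "ku g b v a u" and at: "at p n [u]"
  shows "p |>n: FL f a u b v |>Suc n: FL g b v a u |>n: M a b a = p |>n: J a"
  using box_fl_ucmp[OF at f g] box_fl_vid[OF at kuD(1,3)[OF f]] unfolding assms(1) by simp

lemma ku_uisosI:
  assumes f: "ku f a u b v" and g: "ku g b v a u"
    and "start [u] |>0: FL f a u b v |>Suc 0: FL g b v a u |>0: M a b a = start [u] |>0: J a"
    and "start [v] |>0: FL g b v a u |>Suc 0: FL f a u b v |>0: M b a b = start [v] |>0: J b"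
  shows "f \<in> uisos V K (a, u) (b, v)"
proof -
  have "f \<in> uhom V K (a, u) (b, v)" "g \<in> uhom V K (b, v) (a, u)"
    using f g kuD(1-4)[OF f] by (simp_all add: ku_iff[symmetric])
  moreover have "ucmp V K (a, u) (b, v) (a, u) f g = vid K (a, u)" "ucmp V K (b, v) (a, u) (b, v) g f = vid K (b, v)"
    using ku_ucmp_vid_iff[OF f g] ku_ucmp_vid_iff[OF g f] assms(3,4) by blast+
  ultimately show ?thesis unfolding uisos_def by blast
qed

text \<open>The inverse is the name of the inverse unitor of \<open>V\<close> with an identity of
  \<open>C\<close> attached. The comparison arrow of the embedding starts at
  \<open>(c, \<one> \<otimes> v)\<close>, so it contains this isomorphism.\<close>

lemma mlunit_uisos:
  assumes ob [simp]: "a \<in> vobj C" "u \<in> obj V"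
  shows "mlunit K (a, u) \<in> uisos V K (a, \<one> \<otimes> u) (a, u)"
proof (rule ku_uisosI[OF ku_mlunit[OF ob]])
  let ?f = "\<inverse> (\<l> u) \<Zsemi> (\<inverse> (\<l> (\<one> \<otimes> u)) \<Zsemi> (vid C a \<odot> \<i> (\<one> \<otimes> u)))"
  let ?g = "name V u ?f" and ?m = "mlunit K (a, u)"
  show g: "ku ?g a u a (\<one> \<otimes> u)" by (rule fl_name(1)) simp_all
  have fl: "fl ?g a u a (\<one> \<otimes> u) = ?f" by (rule fl_name(2)) simp_all
  have G: "p |>n: FL ?g a u a (\<one> \<otimes> u) = p |>n: J a |>Suc n: U |>Suc n: PK \<one> u" if at: "at p n [u]" for p n
  proof -
    obtain A D where c: "cods p = Some (A @ [u] @ D)" "n = length A" using at by (rule at_cods)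
    show ?thesis unfolding fl using c by (simp add: box_norm box_vid)
  qed
  let ?s = "start [\<one> \<otimes> u]" let ?p = "?s |>0: Box [\<one> \<otimes> u] (\<i> (\<one> \<otimes> u)) [\<one>, u]"
  have s: "?s = ?p |>0: PK \<one> u" by (simp add: box_norm)
  have m: "?s |>0: FL ?m a (\<one> \<otimes> u) a u = ?p |>0: U' |>0: J a"
    by (subst s, rule box_fl_mlunit) (simp_all add: at_iff)
  have "?p |>0: U' |>0: J a |>Suc 0: FL ?g a u a (\<one> \<otimes> u) |>0: M a a a = ?p |>0: U' |>0: FL ?g a u a (\<one> \<otimes> u) |>0: J a |>0: M a a a"
    using g by (simp add: box_interchange)
  also have "\<dots> = ?p |>0: U' |>0: FL ?g a u a (\<one> \<otimes> u)"
    by (rule J_M_left) (use g in \<open>simp_all add: at_iff\<close>)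
  also have "\<dots> = ?p |>0: U' |>0: J a |>Suc 0: U |>Suc 0: PK \<one> u"
    by (rule G) (simp add: at_iff)
  also have "?p |>0: U' |>0: J a |>Suc 0: U = ?p |>0: U' |>0: U |>0: J a"
    using box_interchange[of 0 "J a" 0 "?p |>0: U'" U] by simp
  also have "?p |>0: U' |>0: U = ?p"
    by (rule box_unit_cancel') (simp add: at_iff)
  also have "?p |>0: J a |>Suc 0: PK \<one> u = ?p |>0: PK \<one> u |>0: J a"
    using box_interchange[of 0 "J a" 0 ?p "PK \<one> u"] by simp
  also have "?p |>0: PK \<one> u = ?s" using s by simp
  finally show "?s |>0: FL ?m a (\<one> \<otimes> u) a u |>Suc 0: FL ?g a u a (\<one> \<otimes> u) |>0: M a a a = ?s |>0: J a"
    unfolding m .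
  have "start [u] |>0: FL ?g a u a (\<one> \<otimes> u) = start [u] |>0: J a |>Suc 0: U |>Suc 0: PK \<one> u"
    by (rule G) (simp add: at_iff)
  moreover have "start [u] |>0: J a |>Suc 0: U |>Suc 0: PK \<one> u |>Suc 0: FL ?m a (\<one> \<otimes> u) a u = start [u] |>0: J a |>Suc 0: U |>Suc 0: U' |>Suc 0: J a"
    by (rule box_fl_mlunit) (simp_all add: at_iff)
  ultimately show "start [u] |>0: FL ?g a u a (\<one> \<otimes> u) |>Suc 0: FL ?m a (\<one> \<otimes> u) a u |>0: M a a a = start [u] |>0: J a"
    by (simp add: box_unit_cancel J_M_right at_iff)
qed

context
  fixes W :: "('a, 'o, 'm) tensoring"
  assumes W: "is_tensoring V C W"
begin

lemmas W_simps [simp] = eta_typ[OF W] tobj_obj[OF W] tiso_typ[OF W] tmate_typ[OF W]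
lemmas splitsD_W = splitsD[OF W]
lemmas splitsI_W = splitsI[OF W]

context
  fixes c v assumes cv [simp]: "c \<in> vobj C" "v \<in> obj V"
begin

abbreviation (input) "ctv \<equiv> tobj W c v"
abbreviation (input) "Hc \<equiv> Box [v] (eta W c v) [vhom C c ctv]"

text \<open>The second inverse law is an equation of endomorphisms of \<open>c \<lhd> v\<close>. By
  the universal property it may be checked after \<open>\<eta>\<close>, where associativity and the
  given law settle it.\<close>

lemma splits_if_section:
  assumes th: "\<theta> \<in> arr V" "src V \<theta> = \<one>" "trg V \<theta> = vhom C ctv c \<otimes> v"
    and sec: "start [v] |>0: Hc |>Suc 0: Box [] \<theta> [vhom C ctv c, v] |>0: M c ctv c = start [v] |>0: J c"
  shows "splits W c v \<theta>"
proof (rule splitsI_W[OF cv th _ sec])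
  let ?Th = "Box [] \<theta> [vhom C ctv c, v]" and ?f = "\<theta> \<Zsemi> tact W ctv c v"
  note [simp] = th
  have box_f: "p |>n: Box [] ?f [vhom C ctv ctv] = p |>n: ?Th |>Suc n: Hc |>n: M ctv c ctv" if "at p n []" for p n
    using box_split_right[OF W cv th that] by simp
  have "?f = vid C ctv"
  proof (rule tensor_ext[OF W cv, where ws = "[]" and b = ctv])
    let ?s = "start [v]"
    have "?s |>0: Hc |>Suc 0: Box [] ?f [vhom C ctv ctv] = ?s |>0: Hc |>Suc 0: ?Th |>Suc (Suc 0): Hc |>Suc 0: M ctv c ctv"
      by (rule box_f) (simp add: at_iff)
    then have "?s |>0: Hc |>Suc 0: Box [] ?f [vhom C ctv ctv] |>0: M c ctv ctv = ?s |>0: Hc |>Suc 0: ?Th |>Suc (Suc 0): Hc |>Suc 0: M ctv c ctv |>0: M c ctv ctv" by simp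
    also have "\<dots> = ?s |>0: Hc |>Suc 0: ?Th |>Suc (Suc 0): Hc |>0: M c ctv c |>0: M c c ctv"
      by (rule M_assoc[symmetric]) (simp_all add: at_iff)
    also have "?s |>0: Hc |>Suc 0: ?Th |>Suc (Suc 0): Hc |>0: M c ctv c = ?s |>0: Hc |>Suc 0: ?Th |>0: M c ctv c |>Suc 0: Hc"
      by (simp add: box_interchange)
    also have "\<dots> = ?s |>0: Hc |>0: J c" unfolding sec using box_interchange[of 0 "J c" 0 ?s Hc] by simp
    also have "\<dots> |>0: M c c ctv = ?s |>0: Hc" by (rule J_M_left) (simp_all add: at_iff)
    also have "\<dots> = ?s |>0: Hc |>Suc 0: J ctv |>0: M c ctv ctv" by (rule J_M_right[symmetric]) (simp_all add: at_iff)
    finally show "?s |>0: Hc |>Suc 0: Box [] ?f [vhom C ctv ctv] |>0: M c ctv ctv = ?s |>0: Hc |>Suc 0: J ctv |>0: M c ctv ctv" .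
  qed simp_all
  then show "start [] |>0: ?Th |>Suc 0: Hc |>0: M ctv c ctv = start [] |>0: J ctv"
    using box_f[of "start []" 0] by (simp add: at_iff)
qed

text \<open>An isomorphism \<open>h\<close> from \<open>(c, v)\<close> to \<open>(b, \<one>)\<close>
  amounts to an arrow \<open>v \<rightarrow> C(c, b)\<close>, which factors through
  \<open>\<eta>\<close> and a mate \<open>c \<lhd> v \<rightarrow> b\<close>. Precomposing the
  inverse \<open>g\<close> with that mate gives \<open>\<theta>\<close>, and \<open>h g = id\<close>
  becomes the section law.\<close>

lemma splits_if_uisos:
  assumes b [simp]: "b \<in> vobj C" and h: "h \<in> uisos V K (c, v) (b, \<one>)"
  shows "\<exists>\<theta>. splits W c v \<theta>"
proof -
  obtain g where "h \<in> uhom V K (c, v) (b, \<one>)" "g \<in> uhom V K (b, \<one>) (c, v)" and hg: "ucmp V K (c, v) (b, \<one>) (c, v) h g = vid K (c, v)"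
    using h unfolding uisos_def by blast
  then have k [simp]: "ku h c v b \<one>" "ku g b \<one> c v" by (simp_all add: ku_iff)
  \<comment> \<open>\<open>h\<close> with its trailing unit removed, and \<open>g\<close> read as an
    element of \<open>C(b, c) \<otimes> v\<close>.\<close>
  let ?p = "fl h c v b \<one> \<Zsemi> \<r> (vhom C c b)" and ?q = "fl g b \<one> c v"
  note ty [simp] = fl_typ(1-3)[OF k(1)] fl_typ(1-3)[OF k(2)]
  let ?P = "Box [v] ?p [vhom C c b]" and ?Q = "Box [] ?q [vhom C b c, v]"
  have P: "p |>n: FL h c v b \<one> = p |>n: ?P |>Suc n: U" if at: "at p n [v]" for p n
  proof -
    obtain A D where c: "cods p = Some (A @ [v] @ D)" "n = length A" using at by (rule at_cods)
    have "p |>n: ?P = p |>n: FL h c v b \<one> |>n: Box [vhom C c b, \<one>] (\<r> (vhom C c b)) [vhom C c b]"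
      by (subst box_cmp) simp_all
    also have "\<dots> = p |>n: FL h c v b \<one> |>Suc n: U'"
    proof -
      have "q |>n: Box [vhom C c b, \<one>] (\<r> (vhom C c b)) [vhom C c b] = q |>Suc n: U'" if "cods q = Some (A @ [vhom C c b, \<one>] @ D)" for q
        using that c by (simp add: box_norm)
      then show ?thesis using c by simp
    qed
    finally have "p |>n: ?P |>Suc n: U = p |>n: FL h c v b \<one> |>Suc n: U' |>Suc n: U" by simp
    also have "\<dots> = p |>n: FL h c v b \<one>" by (rule box_unit_cancel') (use c in \<open>simp add: at_iff\<close>)
    finally show ?thesis ..
  qed
  have "start [v] |>0: FL h c v b \<one> |>Suc 0: FL g b \<one> c v |>0: M c b c = start [v] |>0: J c"
    by (rule ku_ucmp_vidD[OF hg k]) (simp add: at_iff)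
  moreover have "start [v] |>0: FL h c v b \<one> = start [v] |>0: ?P |>Suc 0: U"
    by (rule P) (simp add: at_iff)
  moreover have "FL g b \<one> c v = Box [\<one>] ?q [vhom C b c, v]" by simp
  ultimately have sec: "start [v] |>0: ?P |>Suc 0: ?Q |>0: M c b c = start [v] |>0: J c"
    by (simp add: box_split_nil[of ?q] box_unit_cancel at_iff)
  let ?m = "tmate V W c v b ?p"
  \<comment> \<open>The element \<open>g\<close> carried from \<open>C(b, c)\<close> to
    \<open>C(c \<lhd> v, c)\<close> along the mate of \<open>?p\<close>.\<close>
  let ?th = "?q \<Zsemi> (precmp V C ctv b c ?m \<odot> \<i> v)"
  have th: "?th \<in> arr V" "src V ?th = \<one>" "trg V ?th = vhom C ctv c \<otimes> v" by simp_all
  have "splits W c v ?th"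
  proof (rule splits_if_section[OF th])
    let ?s = "start [v]" and ?Mm = "Box [] ?m [vhom C ctv b]"
    have Th: "?s |>0: Hc |>Suc 0: Box [] ?th [vhom C ctv c, v] = ?s |>0: Hc |>Suc 0: ?Q |>Suc 0: ?Mm |>Suc 0: M ctv b c"
      by (subst box_cmp[symmetric, where ys = "[vhom C b c, v]"]) (simp_all add: box_ten_native box_precmp at_iff box_id)
    have sw: "?s |>0: Hc |>Suc 0: ?Q |>Suc 0: ?Mm = ?s |>0: Hc |>Suc 0: ?Mm |>Suc (Suc 0): ?Q"
      using box_interchange[of "Suc 0" ?Mm "Suc 0" "?s |>0: Hc" ?Q] by simp
    have "?s |>0: Hc |>Suc 0: ?Mm |>Suc (Suc 0): ?Q |>Suc 0: M ctv b c |>0: M c ctv c = ?s |>0: Hc |>Suc 0: ?Mm |>Suc (Suc 0): ?Q |>0: M c ctv b |>0: M c b c"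
      by (rule M_assoc[symmetric]) (simp_all add: at_iff)
    also have "?s |>0: Hc |>Suc 0: ?Mm |>Suc (Suc 0): ?Q |>0: M c ctv b = ?s |>0: Hc |>Suc 0: ?Mm |>0: M c ctv b |>Suc 0: ?Q"
      by (simp add: box_interchange)
    also have "?s |>0: Hc |>Suc 0: ?Mm |>0: M c ctv b = ?s |>0: ?P"
      by (rule box_tmate[OF W]) (simp_all add: at_iff)
    finally show "?s |>0: Hc |>Suc 0: Box [] ?th [vhom C ctv c, v] |>0: M c ctv c = ?s |>0: J c"
      unfolding Th sw using sec by simp
  qed
  then show ?thesis ..
qed

text \<open>The unit \<open>\<eta>\<close> as an underlying arrow from \<open>(c, v)\<close> to the
  embedded object \<open>(c \<lhd> v, \<one>)\<close>; the inverse unitor supplies the required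
  second component.\<close>

definition tk :: "'m" where "tk = name V v (eta W c v \<Zsemi> \<inverse> (\<r> (vhom C c ctv)))"

lemma ku_tk: "ku tk c v ctv \<one>"
  by (simp add: tk_def ku_def)

lemma box_fl_tk:
  assumes "at p n [v]"
  shows "p |>n: FL tk c v ctv \<one> = p |>n: Hc |>Suc n: U"
proof -
  obtain A D where c: "cods p = Some (A @ [v] @ D)" "n = length A" using assms by (rule at_cods)
  have fl: "fl tk c v ctv \<one> = eta W c v \<Zsemi> \<inverse> (\<r> (vhom C c ctv))"
    unfolding tk_def by (rule fl_name(2)) simp_all
  have "p |>n: FL tk c v ctv \<one> = p |>n: Hc |>n: Box [vhom C c ctv] (\<inverse> (\<r> (vhom C c ctv))) [vhom C c ctv, \<one>]"
    unfolding fl by (subst box_cmp) simp_all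
  then show ?thesis using c by (simp add: box_norm)
qed

text \<open>The name of \<open>\<theta>\<close> is the inverse; evaluated on states, the two laws
  are those of \<open>splits\<close>, up to a unit strand.\<close>

lemma tk_uisos:
  assumes "splits W c v \<theta>"
  shows "tk \<in> uisos V K (c, v) (ctv, \<one>)"
proof (rule ku_uisosI[OF ku_tk])
  note th [simp] = splitsD_W(1-3)[OF cv assms]
  let ?g = "name V \<one> \<theta>" and ?Th = "Box [] \<theta> [vhom C ctv c, v]"
  show g: "ku ?g ctv \<one> c v" by (rule fl_name(1)) simp_all
  have fl: "fl ?g ctv \<one> c v = \<theta>" by (rule fl_name(2)) simp_all
  have G: "p |>n: FL ?g ctv \<one> c v = p |>n: U' |>n: ?Th" for p n
    unfolding fl by (rule box_split_nil) simp_all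
  have F: "start [v] |>0: FL tk c v ctv \<one> = start [v] |>0: Hc |>Suc 0: U"
    by (rule box_fl_tk) (simp add: at_iff)
  have "start [v] |>0: Hc |>Suc 0: ?Th |>0: M c ctv c = start [v] |>0: J c"
    by (rule splitsD_W(5)[OF cv assms]) (simp add: at_iff)
  then show "start [v] |>0: FL tk c v ctv \<one> |>Suc 0: FL ?g ctv \<one> c v |>0: M c ctv c = start [v] |>0: J c"
    unfolding F G by (simp add: box_unit_cancel at_iff)
  let ?s = "start [\<one>]"
  have F': "?s |>0: U' |>0: ?Th |>Suc 0: FL tk c v ctv \<one> = ?s |>0: U' |>0: ?Th |>Suc 0: Hc |>Suc (Suc 0): U"
    by (rule box_fl_tk) (simp add: at_iff)
  have "?s |>0: U' |>0: ?Th |>Suc 0: Hc |>Suc (Suc 0): U |>0: M ctv c ctv = ?s |>0: U' |>0: ?Th |>Suc 0: Hc |>0: M ctv c ctv |>Suc 0: U"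
    by (simp add: box_interchange)
  also have "?s |>0: U' |>0: ?Th |>Suc 0: Hc |>0: M ctv c ctv = ?s |>0: U' |>0: J ctv"
    by (rule splitsD_W(4)[OF cv assms]) (simp add: at_iff)
  also have "\<dots> |>Suc 0: U = ?s |>0: U' |>0: U |>0: J ctv"
    using box_interchange[of 0 "J ctv" 0 "?s |>0: U'" U] by simp
  also have "?s |>0: U' |>0: U = ?s" by (rule box_unit_cancel') (simp add: at_iff)
  finally show "?s |>0: FL ?g ctv \<one> c v |>Suc 0: FL tk c v ctv \<one> |>0: M ctv c ctv = ?s |>0: J ctv"
    unfolding G F' .
qed

text \<open>In the completion \<open>(c, \<one>) \<lhd> v\<close> is
  \<open>(c, \<one> \<otimes> v)\<close>, so the comparison arrow is \<open>tk\<close> preceded by a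
  left unitor.\<close>

lemma Emb_mu: "tensored_mu V C W (completion_tensoring V C) Emb c v = ucmp V K (c, \<one> \<otimes> v) (c, v) (ctv, \<one>) (mlunit K (c, v)) tk"
proof (rule ku_ext)
  let ?h = "vhom C c ctv" let ?e = "eta W c v \<Zsemi> \<inverse> (\<r> ?h)"
  \<comment> \<open>Naturality of \<open>mate\<close> and of \<open>\<l>\<close> show that
    \<open>\<eta>\<close> followed by the embedding is a curried arrow, which
    \<open>self_tmate\<close> then uncurries.\<close>
  have "mate V \<one> v (\<l> v \<Zsemi> ?e) = mate V \<one> v ((\<i> \<one> \<odot> eta W c v) \<Zsemi> (\<l> ?h \<Zsemi> \<inverse> (\<r> ?h)))"
    using lunit_nat_arr[of "eta W c v"] by (simp add: cmp_assoc_arr[symmetric])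
  also have "\<dots> = eta W c v \<Zsemi> fmap Emb c ctv"
    using mate_nat[of \<one> "\<l> ?h \<Zsemi> \<inverse> (\<r> ?h)" ?h "?h \<otimes> \<one>" "eta W c v" v] by (simp add: completion_embedding_def hom_iff)
  finally have mu: "tensored_mu V C W (completion_tensoring V C) Emb c v = name V (\<one> \<otimes> v) (\<l> v \<Zsemi> ?e)" (is "?mu = ?n")
    using self_tmate[of \<one> v "?h \<otimes> \<one>" "\<l> v \<Zsemi> ?e"] by (simp add: tensored_mu_def tmate_def completion_tensoring_def)
  show "ku ?mu c (\<one> \<otimes> v) ctv \<one>" unfolding mu by (rule fl_name(1)) simp_all
  have fl: "fl ?n c (\<one> \<otimes> v) ctv \<one> = \<l> v \<Zsemi> ?e" by (rule fl_name(2)) simp_all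
  have m: "ku (mlunit K (c, v)) c (\<one> \<otimes> v) c v" by (rule ku_mlunit) simp_all
  show "ku (ucmp V K (c, \<one> \<otimes> v) (c, v) (ctv, \<one>) (mlunit K (c, v)) tk) c (\<one> \<otimes> v) ctv \<one>" by (rule ku_ucmp[OF m ku_tk])
  let ?s = "start [\<one> \<otimes> v]" let ?p = "?s |>0: Box [\<one> \<otimes> v] (\<i> (\<one> \<otimes> v)) [\<one>, v]"
  have s: "?s = ?p |>0: PK \<one> v" by (simp add: box_norm)
  have "?s |>0: FL (ucmp V K (c, \<one> \<otimes> v) (c, v) (ctv, \<one>) (mlunit K (c, v)) tk) c (\<one> \<otimes> v) ctv \<one>
     = ?p |>0: PK \<one> v |>0: FL (mlunit K (c, v)) c (\<one> \<otimes> v) c v |>Suc 0: FL tk c v ctv \<one> |>0: M c c ctv"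
    unfolding s[symmetric] by (rule box_fl_ucmp[OF _ m ku_tk]) (simp add: at_iff)
  also have "?p |>0: PK \<one> v |>0: FL (mlunit K (c, v)) c (\<one> \<otimes> v) c v = ?p |>0: U' |>0: J c"
    by (rule box_fl_mlunit) (simp_all add: at_iff)
  also have "?p |>0: U' |>0: J c |>Suc 0: FL tk c v ctv \<one> = ?p |>0: U' |>0: J c |>Suc 0: Hc |>Suc (Suc 0): U"
    by (rule box_fl_tk) (simp add: at_iff)
  also have "\<dots> |>0: M c c ctv = ?p |>0: U' |>0: Hc |>0: J c |>0: M c c ctv |>Suc 0: U"
    by (simp add: box_interchange)
  also have "?p |>0: U' |>0: Hc |>0: J c |>0: M c c ctv = ?p |>0: U' |>0: Hc"
    by (rule J_M_left) (simp_all add: at_iff)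
  finally have r: "?s |>0: FL (ucmp V K (c, \<one> \<otimes> v) (c, v) (ctv, \<one>) (mlunit K (c, v)) tk) c (\<one> \<otimes> v) ctv \<one> = ?p |>0: U' |>0: Hc |>Suc 0: U" .
  have "?s |>0: Box [\<one> \<otimes> v] (\<l> v \<Zsemi> ?e) [?h, \<one>] = ?p |>0: PK \<one> v |>0: Box [\<one> \<otimes> v] (\<l> v) [v] |>0: Hc |>0: Box [?h] (\<inverse> (\<r> ?h)) [?h, \<one>]"
    unfolding s[symmetric] by (simp add: box_cmp cmp_assoc_arr)
  also have "\<dots> = ?p |>0: U' |>0: Hc |>Suc 0: U" by (simp add: box_norm)
  finally show "?s |>0: FL ?mu c (\<one> \<otimes> v) ctv \<one> = ?s |>0: FL (ucmp V K (c, \<one> \<otimes> v) (c, v) (ctv, \<one>) (mlunit K (c, v)) tk) c (\<one> \<otimes> v) ctv \<one>"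
    unfolding r mu fl .
qed

text \<open>The unitor is cancelled by \<open>uisos_cancel\<close>. If \<open>tk\<close> is
  invertible, \<open>splits_if_uisos\<close> applies to it with \<open>b\<close> equal to
  \<open>c \<lhd> v\<close>.\<close>

lemma Emb_mu_uisos_iff:
  "tensored_mu V C W (completion_tensoring V C) Emb c v \<in> uisos V K (c, \<one> \<otimes> v) (ctv, \<one>) \<longleftrightarrow> (\<exists>\<theta>. splits W c v \<theta>)"
proof -
  have "tk \<in> uhom V K (c, v) (ctv, \<one>)" using ku_tk by (simp add: ku_iff)
  then have "tensored_mu V C W (completion_tensoring V C) Emb c v \<in> uisos V K (c, \<one> \<otimes> v) (ctv, \<one>) \<longleftrightarrow> tk \<in> uisos V K (c, v) (ctv, \<one>)"
    unfolding Emb_mu by (intro K.uisos_cancel mlunit_uisos) simp_all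
  also have "\<dots> \<longleftrightarrow> (\<exists>\<theta>. splits W c v \<theta>)"
    using tk_uisos splits_if_uisos[of ctv tk] by auto
  finally show ?thesis .
qed

end

lemma Emb_tensored_iff:
  "tensored_functor V C W K (completion_tensoring V C) Emb \<longleftrightarrow> (\<forall>c \<in> vobj C. \<forall>v \<in> obj V. \<exists>\<theta>. splits W c v \<theta>)"
proof -
  have "tobj (completion_tensoring V C) (fobj Emb c) v = (c, \<one> \<otimes> v)" for c v
    by (simp add: tobj_def completion_tensoring_def)
  then show ?thesis
    unfolding tensored_functor_def using Emb_functor Emb_mu_uisos_iff by simp
qed

end

text \<open>The component at \<open>(c, v)\<close> of the second natural isomorphism is an
  isomorphism from an embedded object; its inverse is the input of
  \<open>splits_if_uisos\<close>.\<close>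

lemma equivalence_imp_splits:
  assumes W: "is_tensoring V C W" and eq: "V_monoidal_equivalence V C K Emb" and cv [simp]: "c \<in> vobj C" "v \<in> obj V"
  shows "\<exists>\<theta>. splits W c v \<theta>"
proof -
  obtain G :: "('a \<times> 'o, 'a, 'm) vmonfun" and \<tau> where G: "V_monoidal_functor V K C G"
    and \<tau>: "monoidal_V_natural_iso V K K (vmonfun_cmp V K C K G Emb) (vmonfun_id V K) \<tau>"
    using eq unfolding V_monoidal_equivalence_def by blast
  let ?b = "fobj G (c, v)"
  have b [simp]: "?b \<in> vobj C" using G by (simp add: V_monoidal_functor_def V_functor_def)
  have "\<tau> (c, v) \<in> uisos V K (?b, \<one>) (c, v)"
    using \<tau> by (simp add: monoidal_V_natural_iso_def V_natural_iso_def vmonfun_cmp_def vmonfun_id_def)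
  then obtain h where h: "h \<in> uisos V K (c, v) (?b, \<one>)"
    unfolding uisos_def by blast
  show ?thesis by (rule splits_if_uisos[OF W cv b h])
qed

text \<open>Provides the data of \<open>monoidal_embedding\<close> with \<open>tk\<close> as chosen
  isomorphism; the coherence obligations are the naturality lemmas for the completion.\<close>

lemma splits_imp_equivalence:
  fixes W :: "('a, 'o, 'm) tensoring"
  assumes W: "is_tensoring V C W" and spl: "\<And>c v. \<lbrakk>c \<in> vobj C; v \<in> obj V\<rbrakk> \<Longrightarrow> \<exists>\<theta>. splits W c v \<theta>"
  shows "V_monoidal_equivalence V C K Emb"
proof -
  \<comment> \<open>The case distinction ensures \<open>G (a, \<one>) = a\<close> and an identity
    there, where \<open>a \<lhd> \<one>\<close> would be merely isomorphic to
    \<open>a\<close>.\<close>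
  define G where "G X = (if snd X = \<one> then fst X else tobj W (fst X) (snd X))" for X
  define t where "t X = (if snd X = \<one> then vid K X else tk W (fst X) (snd X))" for X
  have t: "t X \<in> uisos V K X (G X, \<one>)" if X: "X \<in> vobj K" for X
  proof -
    obtain a u where Xau: "X = (a, u)" "a \<in> vobj C" "u \<in> obj V" using X by auto
    have "vid K (a, \<one>) \<in> uisos V K (a, \<one>) (a, \<one>)"
      using K.ucmp_vid_left[of "(a, \<one>)" "(a, \<one>)" "vid K (a, \<one>)"] Xau K.uhom_iff[of "vid K (a, \<one>)" "(a, \<one>)" "(a, \<one>)"]
      unfolding uisos_def by auto
    moreover obtain \<theta> where "splits W a u \<theta>" using spl Xau by blast
    then have "tk W a u \<in> uisos V K (a, u) (tobj W a u, \<one>)" by (rule tk_uisos[OF W Xau(2,3)])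
    ultimately show ?thesis
      using Xau by (auto simp: G_def t_def simp del: completion_simps(5))
  qed
  define s where "s X = (SOME s. s \<in> uhom V K (G X, \<one>) X \<and> ucmp V K X (G X, \<one>) X (t X) s = vid K X
    \<and> ucmp V K (G X, \<one>) X (G X, \<one>) s (t X) = vid K (G X, \<one>))" for X
  have s: "s X \<in> uhom V K (G X, \<one>) X \<and> ucmp V K X (G X, \<one>) X (t X) (s X) = vid K X
    \<and> ucmp V K (G X, \<one>) X (G X, \<one>) (s X) (t X) = vid K (G X, \<one>)" if "X \<in> vobj K" for X
    unfolding s_def by (rule someI_ex) (use t[OF that] in \<open>auto simp: uisos_def simp del: completion_simps(5)\<close>)
  interpret E: monoidal_embedding V C K Emb G t s
  proof (unfold_locales, goal_cases)
    case 1 show ?case by (rule Emb_monoidal)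
  next
    case (2 a b) then show ?case by (rule Emb_iso)
  next
    case (3 X Y Z) then show ?case using ku_massoc by (cases X; cases Y; cases Z) (simp add: ku_iff)
  next
    case (4 X) then show ?case using ku_mlunit by (cases X) (simp add: ku_iff)
  next
    case (5 X) then show ?case using ku_mrunit by (cases X) (simp add: ku_iff)
  next
    case (6 X Y Z X' Y' Z' f g h)
    obtain a u b v c w where X: "X = (a, u)" "Y = (b, v)" "Z = (c, w)" by (cases X; cases Y; cases Z)
    obtain a' u' b' v' c' w' where X': "X' = (a', u')" "Y' = (b', v')" "Z' = (c', w')" by (cases X'; cases Y'; cases Z')
    show ?case using 6 unfolding X X' by (intro massoc_nat) (simp_all add: ku_iff)
  next
    case (7 X X' f)
    obtain a u a' u' where X: "X = (a, u)" "X' = (a', u')" by (cases X; cases X')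
    show ?case using 7 unfolding X by (intro mlunit_nat) (simp add: ku_iff)
  next
    case (8 X X' f)
    obtain a u a' u' where X: "X = (a, u)" "X' = (a', u')" by (cases X; cases X')
    show ?case using 8 unfolding X by (intro mrunit_nat) (simp add: ku_iff)
  next
    case (9 X) then show ?case using W by (cases X) (auto simp: G_def tobj_obj[OF W])
  next
    case (10 X) then show ?case using t[of X] unfolding Emb_obj uisos_def by blast
  next
    case (11 X) then show ?case using s[of X] unfolding Emb_obj by blast
  next
    case (12 X) then show ?case using s[of X] unfolding Emb_obj by blast
  next
    case (13 X) then show ?case using s[of X] unfolding Emb_obj by blast
  next
    case (14 a) show ?case by (simp add: G_def)
  next
    case (15 a) show ?case by (simp add: t_def)
  qed
  show ?thesis by (rule E.F_equivalence)
qed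

lemma Emb_equivalence_iff:
  assumes "is_tensoring V C W"
  shows "V_monoidal_equivalence V C K Emb \<longleftrightarrow> (\<forall>c \<in> vobj C. \<forall>v \<in> obj V. \<exists>\<theta>. splits W c v \<theta>)"
  using equivalence_imp_splits[OF assms] splits_imp_equivalence[OF assms] by blast

end

theorem corollary1p7:
  fixes V :: "('o, 'm) bcm"
    and C :: "('a, 'o, 'm) vmoncat"
    and T :: "('a, 'o, 'm) tensoring"
  assumes "braided_closed_monoidal_category V"
    and "strict_V_monoidal_category V C"
    and "closed_V_monoidal V C"
    and "is_tensoring V C T"
  shows "((\<forall>a \<in> vobj C. tensored_functor V C T (self V) (self_tensoring V) (representable V C a))
           \<longleftrightarrow> tensored_functor V C T (completion V C) (completion_tensoring V C)
                 (completion_embedding V C))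
       \<and> (tensored_functor V C T (completion V C) (completion_tensoring V C)
             (completion_embedding V C)
           \<longleftrightarrow> V_monoidal_equivalence V C (completion V C) (completion_embedding V C))"
proof -
  interpret strict_V_monoidal_category V C by (rule assms(2))
  interpret strict_enriched V C
    using assms(1,2) V_category_axioms by (intro strict_enriched.intro enriched_category.intro)
  show ?thesis
    unfolding Emb_tensored_iff[OF assms(4)] Emb_equivalence_iff[OF assms(4)] representables_tensored_iff[OF assms(4)] by blast
qed

end
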